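(* Consider the first Painlevé equation (P$_{\rm I}$): $dx/dz=6y^2+z$, $dy/dz=x$, and Painlevé's coordinates $(u,w)$ defined by $$x=uw^3-2w^{-3}-\tfrac12zw-\tfrac12w^2,\qquad y=w^{-2}.$$ For $z\in\mathbb{C}$ let $M(z)=\{(U,V,W)\in\mathbb{C}^3: V^2=UW^4+2zW^3+4W\}$. (i) The space $\mathbb{C}^2_{(u,w)}$ divided by the $\mathbb{Z}_2$-action $$(u,w)\mapsto(-u+zw^{-2}+4w^{-6},\,-w)$$ (induced from the orbifold structure of $\mathbb{C}P^3(3,2,4,5)$) gives the algebraic surface $M(z)$. The space of initial conditions $E(z)$ for (P$_{\rm I}$) is given by $\mathbb{C}^2_{(x,y)}\cup M(z)$ glued by $$x=VW^{-2}-\tfrac12W,\quad y=W^{-1}\qquad\Longleftrightarrow\qquad V=xy^{-2}+\tfrac12y^{-3},\quad W=y^{-1}.$$ (ii) $M(z)$ and $E(z)$ have holomorphic symplectic forms, given on $M(z)$ by $-W^{-4}\,dV\wedge dW=\frac{1}{4UW^3+6zW^2+4}\,dV\wedge dU$ and on $\mathbb{C}^2_{(x,y)}$ by $dx\wedge dy$, and (P$_{\rm I}$) is a Hamiltonian system with respect to this form. Painlevé's coordinates $(u,w)$ are Darboux coordinates (up to a constant factor) of the symplectic form on $M(z)$. (iii) Consider an ODE $dx/dz=f(x,y,z)$, $dy/dz=g(x,y,z)$, where $f$ and $g$ are polynomials in $x$ and $y$ (with coefficients depending on $z$). If it is also expressed as a polynomial ODE (polynomial in $u,w$) in Painlevé's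 coordinates, then it is (P$_{\rm I}$).
   Context: A manifold $E(z)$ parameterized by $z\in\mathbb{C}$ is called the space of initial conditions of a polynomial system (with independent variable $z$) if every solution of the system gives a global holomorphic section of the fiber bundle $\mathcal{P}=\{(x,z): x\in E(z),\ z\in\mathbb{C}\}$ over $\mathbb{C}$. The $\mathbb{Z}_2$-action in (i) is defined where $w\neq0$ and expresses that $(u,w)$ and its image correspond to the same $(x,y)$; points with $w=0$ are identified only with themselves. The identification of the quotient with $M(z)$ is by means of the invariants $$U=u(uw^6-zw^4-4)+\tfrac14w^2z^2,\quad V=w^7\bigl(u-\tfrac12zw^{-2}-2w^{-6}\bigr),\quad W=w^2 .$$ The gluing of $\mathbb{C}^2_{(x,y)}$ and $M(z)$ is over $\{y\ne0\}$ and $\{W\neq0\}$. "Darboux coordinates up to a constant factor" means that under the map $(u,w)\mapsto(U,V,W)$ the form pulls back to a nonzero constant multiple of $du\wedge dw$. The action arises from $\mathbb{C}P^3(3,2,4,5)$ as follows: the chart $X_2=xy^{-3/2}$, $Z_2=zy^{-2}$, $\varepsilon_2=y^{-5/2}$ is divided by $(X_2,Z_2,\varepsilon_2)\mapsto(-X_2,Z_2,-\varepsilon_2)$, and $(u,z,w)$ is a chart of the weighted blow-up of this chart at $(X_2,Z_2,\varepsilon_2)=(-2,0,0)$ with weights $6,4,5$, namely $X_2+2=uw^6-\frac12zw^4-\frac12w^5$, $Z_2=zw^4$, $\varepsilon_2=w^5$. *)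

theory Defs
  imports "HOL-Analysis.Analysis" "HOL-Computational_Algebra.Polynomial"
begin

section \<open>Holomorphic maps of several variables\<close>

definition complex_diff_at :: "(complex^'n \<Rightarrow> complex) \<Rightarrow> complex^'n \<Rightarrow> bool" where
  "complex_diff_at f p \<longleftrightarrow>
     (\<exists>f'. (f has_derivative f') (at p) \<and> (\<forall>c v. f' (c *s v) = c * f' v))"

text \<open>The set \<open>S\<close> need not be open: as usual on analytic subsets, holomorphic means locally
  the restriction of a holomorphic function of the ambient space.\<close>

definition hol_fun :: "(complex^'n) set \<Rightarrow> (complex^'n \<Rightarrow> complex) \<Rightarrow> bool" where
  "hol_fun S f \<longleftrightarrow>
     (\<forall>p\<in>S. \<exists>N F. open N \<and> p \<in> N \<and> (\<forall>q\<in>N. complex_diff_at F q) \<and> (\<forall>q\<in>N \<inter> S. F q = f q))"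

definition hol_map :: "(complex^'n) set \<Rightarrow> (complex^'n \<Rightarrow> complex^'m) \<Rightarrow> bool" where
  "hol_map S f \<longleftrightarrow> (\<forall>i. hol_fun S (\<lambda>p. f p $ i))"

definition locally_biholomorphic ::
  "(complex^'n \<Rightarrow> complex^'m) \<Rightarrow> (complex^'n) set \<Rightarrow> (complex^'m) set \<Rightarrow> bool" where
  "locally_biholomorphic f S T \<longleftrightarrow>
     (\<forall>p\<in>S. \<exists>N. openin (top_of_set S) N \<and> p \<in> N \<and> inj_on f N \<and> openin (top_of_set T) (f ` N) \<and>
        hol_map N f \<and> hol_map (f ` N) (inv_into N f))"


section \<open>Complex manifolds\<close>

text \<open>A chart is a domain together with a coordinate map; the values of the map outside the
  domain are irrelevant.\<close>

type_synonym ('a, 'n) chart = "'a set \<times> ('a \<Rightarrow> complex^'n)"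

definition complex_atlas :: "'a topology \<Rightarrow> ('a, 'n::finite) chart set \<Rightarrow> bool" where
  "complex_atlas X A \<longleftrightarrow>
     (\<Union>(D,\<phi>)\<in>A. D) = topspace X \<and>
     (\<forall>(D,\<phi>)\<in>A. openin X D \<and> open (\<phi> ` D) \<and>
        homeomorphic_map (subtopology X D) (top_of_set (\<phi> ` D)) \<phi>) \<and>
     (\<forall>(D,\<phi>)\<in>A. \<forall>(D',\<psi>)\<in>A. hol_map (\<phi> ` (D \<inter> D')) (\<psi> \<circ> inv_into D \<phi>))"

definition complex_manifold :: "'a topology \<Rightarrow> ('a, 'n::finite) chart set \<Rightarrow> bool" where
  "complex_manifold X A \<longleftrightarrow> Hausdorff_space X \<and> second_countable X \<and> complex_atlas X A"

text \<open>All holomorphic charts of a subset of \<open>\<complex>\<^sup>k\<close>. They form an atlas of dimension \<open>n\<close>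
  exactly when the subset is an \<open>n\<close>-dimensional complex submanifold.\<close>

definition submanifold_charts :: "(complex^'k) set \<Rightarrow> (complex^'k, 'n::finite) chart set" where
  "submanifold_charts S =
     {(D,\<phi>). openin (top_of_set S) D \<and> inj_on \<phi> D \<and> open (\<phi> ` D) \<and>
        hol_map D \<phi> \<and> hol_map (\<phi> ` D) (inv_into D \<phi>)}"


section \<open>Gluing two pieces\<close>

definition glue_rel :: "'a set \<Rightarrow> 'b set \<Rightarrow> ('a \<times> 'b) set \<Rightarrow> ('a + 'b) rel" where
  "glue_rel S T G = Id_on (S <+> T) \<union> {(Inl a, Inr b) |a b. (a,b) \<in> G} \<union>
     {(Inr b, Inl a) |a b. (a,b) \<in> G}"

text \<open>The space covered by \<open>j ` S\<close> and \<open>k ` T\<close>, with the final topology and with the charts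
  of \<open>S\<close> and \<open>T\<close> transported by the injections \<open>j\<close> and \<open>k\<close>.\<close>

definition glued_topology ::
  "('a::topological_space \<Rightarrow> 'c) \<Rightarrow> 'a set \<Rightarrow> ('b::topological_space \<Rightarrow> 'c) \<Rightarrow> 'b set \<Rightarrow> 'c topology" where
  "glued_topology j S k T = topology (\<lambda>O'. O' \<subseteq> j ` S \<union> k ` T \<and>
     openin (top_of_set S) {a \<in> S. j a \<in> O'} \<and> openin (top_of_set T) {b \<in> T. k b \<in> O'})"

lemma openin_glued_topology:
  "openin (glued_topology j S k T) O' \<longleftrightarrow> O' \<subseteq> j ` S \<union> k ` T \<and>
     openin (top_of_set S) {a \<in> S. j a \<in> O'} \<and> openin (top_of_set T) {b \<in> T. k b \<in> O'}"
proof -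
  have "istopology (\<lambda>O'. O' \<subseteq> j ` S \<union> k ` T \<and>
     openin (top_of_set S) {a \<in> S. j a \<in> O'} \<and> openin (top_of_set T) {b \<in> T. k b \<in> O'})"
    unfolding istopology_def
  proof (intro conjI allI impI; (elim conjE)?)
    fix A B
    assume "openin (top_of_set S) {a \<in> S. j a \<in> A}" "openin (top_of_set S) {a \<in> S. j a \<in> B}"
    moreover have "{a \<in> S. j a \<in> A \<inter> B} = {a \<in> S. j a \<in> A} \<inter> {a \<in> S. j a \<in> B}" by auto
    ultimately show "openin (top_of_set S) {a \<in> S. j a \<in> A \<inter> B}" by auto
  next
    fix A B
    assume "openin (top_of_set T) {a \<in> T. k a \<in> A}" "openin (top_of_set T) {a \<in> T. k a \<in> B}"
    moreover have "{a \<in> T. k a \<in> A \<inter> B} = {a \<in> T. k a \<in> A} \<inter> {a \<in> T. k a \<in> B}" by auto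
    ultimately show "openin (top_of_set T) {a \<in> T. k a \<in> A \<inter> B}" by auto
  next
    fix K
    assume *: "\<forall>A\<in>K. A \<subseteq> j ` S \<union> k ` T \<and>
      openin (top_of_set S) {a \<in> S. j a \<in> A} \<and> openin (top_of_set T) {b \<in> T. k b \<in> A}"
    have "{a \<in> S. j a \<in> \<Union>K} = (\<Union>A\<in>K. {a \<in> S. j a \<in> A})" by auto
    then show "openin (top_of_set S) {a \<in> S. j a \<in> \<Union>K}" using * by auto
    have "{a \<in> T. k a \<in> \<Union>K} = (\<Union>A\<in>K. {a \<in> T. k a \<in> A})" by auto
    then show "openin (top_of_set T) {a \<in> T. k a \<in> \<Union>K}" using * by auto
    show "\<Union>K \<subseteq> j ` S \<union> k ` T" using * by blast
  qed auto
  then show ?thesis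
    unfolding glued_topology_def by simp
qed

definition glued_charts ::
  "(complex^'k \<Rightarrow> 'c) \<Rightarrow> (complex^'k) set \<Rightarrow> (complex^'l \<Rightarrow> 'c) \<Rightarrow> (complex^'l) set \<Rightarrow>
     ('c, 'n::finite) chart set" where
  "glued_charts j S k T =
     {(j ` D, \<phi> \<circ> inv_into S j) |D \<phi>. (D,\<phi>) \<in> submanifold_charts S} \<union>
     {(k ` D, \<phi> \<circ> inv_into T k) |D \<phi>. (D,\<phi>) \<in> submanifold_charts T}"


section \<open>Holomorphic symplectic forms\<close>

text \<open>A 2-form on a manifold with atlas \<open>A\<close> is given by its coordinate expression in every chart
  \<open>c\<close>: \<open>\<omega> c p\<close> is a bilinear form on the coordinate tangent space \<open>\<complex>\<^sup>n\<close> at \<open>p\<close>.\<close>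

type_synonym ('a, 'n) two_form =
  "('a, 'n) chart \<Rightarrow> 'a \<Rightarrow> complex^'n \<Rightarrow> complex^'n \<Rightarrow> complex"

definition alternating_bilinear :: "(complex^'n \<Rightarrow> complex^'n \<Rightarrow> complex) \<Rightarrow> bool" where
  "alternating_bilinear B \<longleftrightarrow>
     (\<forall>u v w. B (u + v) w = B u w + B v w) \<and> (\<forall>c v w. B (c *s v) w = c * B v w) \<and>
     (\<forall>v w. B w v = - B v w)"

definition holomorphic_two_form ::
  "('a, 'n::finite) chart set \<Rightarrow> ('a, 'n) two_form \<Rightarrow> bool" where
  "holomorphic_two_form A \<omega> \<longleftrightarrow>
     (\<forall>(D,\<phi>)\<in>A. (\<forall>p\<in>D. alternating_bilinear (\<omega> (D,\<phi>) p)) \<and>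
        (\<forall>v w. hol_fun (\<phi> ` D) (\<lambda>t. \<omega> (D,\<phi>) (inv_into D \<phi> t) v w))) \<and>
     (\<forall>(D,\<phi>)\<in>A. \<forall>(D',\<psi>)\<in>A. \<forall>p\<in>D \<inter> D'. \<forall>v w.
        (let \<tau>' = frechet_derivative (\<psi> \<circ> inv_into D \<phi>) (at (\<phi> p))
         in \<omega> (D,\<phi>) p v w = \<omega> (D',\<psi>) p (\<tau>' v) (\<tau>' w)))"

definition closed_two_form ::
  "('a, 'n::finite) chart set \<Rightarrow> ('a, 'n) two_form \<Rightarrow> bool" where
  "closed_two_form A \<omega> \<longleftrightarrow>
     (\<forall>(D,\<phi>)\<in>A. \<forall>p\<in>D. \<forall>u v w.
        (let d = (\<lambda>a b c. frechet_derivative (\<lambda>t. \<omega> (D,\<phi>) (inv_into D \<phi> t) b c) (at (\<phi> p)) a)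
         in d u v w + d v w u + d w u v = 0))"

definition nondegenerate_two_form ::
  "('a, 'n::finite) chart set \<Rightarrow> ('a, 'n) two_form \<Rightarrow> bool" where
  "nondegenerate_two_form A \<omega> \<longleftrightarrow>
     (\<forall>(D,\<phi>)\<in>A. \<forall>p\<in>D. \<forall>v. v \<noteq> 0 \<longrightarrow> (\<exists>w. \<omega> (D,\<phi>) p v w \<noteq> 0))"

definition holomorphic_symplectic_form ::
  "('a, 'n::finite) chart set \<Rightarrow> ('a, 'n) two_form \<Rightarrow> bool" where
  "holomorphic_symplectic_form A \<omega> \<longleftrightarrow>
     holomorphic_two_form A \<omega> \<and> closed_two_form A \<omega> \<and> nondegenerate_two_form A \<omega>"

definition wedge :: "'n \<Rightarrow> 'n \<Rightarrow> complex^'n \<Rightarrow> complex^'n \<Rightarrow> complex" where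
  "wedge i j a b = a $ i * b $ j - a $ j * b $ i"

text \<open>On the open subset \<open>j ` S\<close> of the manifold the form \<open>\<omega>\<close> is the transport by \<open>j\<close> of (the
  restriction to \<open>S\<close> of) the form \<open>\<beta>\<close>, which is written in coordinates of the space
  \<open>\<complex>\<^sup>k\<close> containing \<open>S\<close>.\<close>

definition form_given_by ::
  "('a, 'n::finite) chart set \<Rightarrow> ('a, 'n) two_form \<Rightarrow> (complex^'k \<Rightarrow> 'a) \<Rightarrow> (complex^'k) set \<Rightarrow>
     (complex^'k \<Rightarrow> complex^'k \<Rightarrow> complex^'k \<Rightarrow> complex) \<Rightarrow> bool" where
  "form_given_by A \<omega> j S \<beta> \<longleftrightarrow>
     (\<forall>(D,\<psi>)\<in>A. \<forall>p\<in>D \<inter> j ` S. \<forall>v w.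
        (let \<gamma>' = frechet_derivative (inv_into S j \<circ> inv_into D \<psi>) (at (\<psi> p))
         in \<omega> (D,\<psi>) p v w = \<beta> (inv_into S j p) (\<gamma>' v) (\<gamma>' w)))"

text \<open>The pullback of \<open>\<omega>\<close> under a map \<open>f\<close> from an open subset \<open>S\<close> of \<open>\<complex>\<^sup>k\<close> to the manifold
  is the form \<open>\<beta>\<close>.\<close>

definition pullback_equals ::
  "('a, 'n::finite) chart set \<Rightarrow> ('a, 'n) two_form \<Rightarrow> (complex^'k \<Rightarrow> 'a) \<Rightarrow> (complex^'k) set \<Rightarrow>
     (complex^'k \<Rightarrow> complex^'k \<Rightarrow> complex^'k \<Rightarrow> complex) \<Rightarrow> bool" where
  "pullback_equals A \<omega> f S \<beta> \<longleftrightarrow>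
     (\<forall>(D,\<psi>)\<in>A. \<forall>q\<in>S. f q \<in> D \<longrightarrow> (\<forall>v w.
        (let f' = frechet_derivative (\<psi> \<circ> f) (at q)
         in \<beta> q v w = \<omega> (D,\<psi>) (f q) (f' v) (f' w))))"


section \<open>Nonautonomous systems in the plane\<close>

text \<open>\<open>X z p\<close> is the right-hand side of the system \<open>dp/dz = X z p\<close>.\<close>

type_synonym plane_system = "complex \<Rightarrow> complex^2 \<Rightarrow> complex^2"

definition solves :: "plane_system \<Rightarrow> complex set \<Rightarrow> (complex \<Rightarrow> complex^2) \<Rightarrow> bool" where
  "solves X \<Omega> s \<longleftrightarrow>
     (\<forall>z\<in>\<Omega>. \<forall>i. ((\<lambda>z. s z $ i) has_field_derivative X z (s z) $ i) (at z))"

text \<open>The system is Hamiltonian, with a time-dependent Hamiltonian \<open>H\<close>, for the constant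
  symplectic form \<open>\<beta>\<close> on \<open>\<complex>\<^sup>2\<close>: contracting \<open>\<beta>\<close> with \<open>X\<close> gives the differential of \<open>H\<close>
  in the first two variables.\<close>

definition hamiltonian_system ::
  "plane_system \<Rightarrow> (complex^2 \<Rightarrow> complex^2 \<Rightarrow> complex) \<Rightarrow> bool" where
  "hamiltonian_system X \<beta> \<longleftrightarrow>
     (\<exists>H :: complex^3 \<Rightarrow> complex. hol_fun UNIV H \<and>
        (\<forall>z p v. \<beta> (X z p) v = frechet_derivative (\<lambda>p. H (vector [p $ 1, p $ 2, z])) (at p) v))"

text \<open>\<open>Y\<close> is the expression of the system \<open>X\<close> in new coordinates on \<open>S\<close>, where
  \<open>\<Phi> z\<close> maps the new coordinates to the old ones: along every curve \<open>q(z)\<close> that has velocity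
  \<open>Y\<close> at \<open>z\<close>, the curve \<open>\<Phi> z (q z)\<close> has velocity \<open>X\<close> at \<open>z\<close>.\<close>

definition expressed_as ::
  "(complex \<Rightarrow> complex^2 \<Rightarrow> complex^2) \<Rightarrow> (complex^2) set \<Rightarrow> complex set \<Rightarrow>
     plane_system \<Rightarrow> plane_system \<Rightarrow> bool" where
  "expressed_as \<Phi> S \<Omega> X Y \<longleftrightarrow>
     (\<forall>z\<in>\<Omega>. \<forall>q\<in>S. \<forall>i.
        ((\<lambda>t. \<Phi> (z + t) (q + t *s Y z q) $ i) has_field_derivative X z (\<Phi> z q) $ i) (at 0))"

text \<open>Polynomials in two variables: polynomials in the first variable whose coefficients are
  polynomials in the second. A polynomial system with coefficients depending on \<open>z\<close> is a pair
  of such polynomials for every \<open>z\<close>.\<close>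

definition eval2 :: "complex poly poly \<Rightarrow> complex \<Rightarrow> complex \<Rightarrow> complex" where
  "eval2 f x y = poly (poly f [:x:]) y"

definition poly_system ::
  "(complex \<Rightarrow> complex poly poly) \<Rightarrow> (complex \<Rightarrow> complex poly poly) \<Rightarrow> plane_system" where
  "poly_system f g z p = vector [eval2 (f z) (p $ 1) (p $ 2), eval2 (g z) (p $ 1) (p $ 2)]"


section \<open>Spaces of initial conditions\<close>

definition bundle_set :: "(complex \<Rightarrow> 'e topology) \<Rightarrow> ('e \<times> complex) set" where
  "bundle_set E = {(e,z). e \<in> topspace (E z)}"

text \<open>The total space is a complex manifold, the projection to \<open>z\<close> is a holomorphic submersion
  (locally it is the last coordinate of a chart) and it is locally trivial.\<close>

definition fibre_bundle_over_plane ::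
  "(complex \<Rightarrow> 'e topology) \<Rightarrow> ('e \<times> complex) topology \<Rightarrow> ('e \<times> complex, 3) chart set \<Rightarrow> bool" where
  "fibre_bundle_over_plane E P B \<longleftrightarrow>
     topspace P = bundle_set E \<and> complex_manifold P B \<and>
     (\<forall>p\<in>bundle_set E. \<exists>(D,\<phi>)\<in>B. p \<in> D \<and> (\<forall>q\<in>D. \<phi> q $ 3 = snd q)) \<and>
     (\<forall>z0. \<exists>N h. open N \<and> z0 \<in> N \<and>
        homeomorphic_map (prod_topology (top_of_set N) (E z0))
          (subtopology P {p \<in> bundle_set E. snd p \<in> N}) h \<and>
        (\<forall>z\<in>N. \<forall>e\<in>topspace (E z0). snd (h (z,e)) = z))"

definition global_holomorphic_section ::
  "(complex \<Rightarrow> 'e topology) \<Rightarrow> ('e \<times> complex) topology \<Rightarrow> ('e \<times> complex, 3) chart set \<Rightarrow>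
     (complex \<Rightarrow> 'e) \<Rightarrow> bool" where
  "global_holomorphic_section E P B s \<longleftrightarrow>
     (\<forall>z. s z \<in> topspace (E z)) \<and> continuous_map euclidean P (\<lambda>z. (s z, z)) \<and>
     (\<forall>(D,\<phi>)\<in>B. \<forall>i. (\<lambda>z. \<phi> (s z, z) $ i) holomorphic_on {z. (s z, z) \<in> D})"

text \<open>\<open>E z\<close> is a manifold with charts \<open>A z\<close>, the bundle of all \<open>E z\<close> has topology \<open>P\<close> and charts
  \<open>B\<close>, and \<open>j z\<close> embeds the phase space \<open>\<complex>\<^sup>2\<close> of the system into \<open>E z\<close>. Solutions are local:
  they are given on an arbitrary domain of the \<open>z\<close>-plane.\<close>

definition space_of_initial_conditions ::
  "plane_system \<Rightarrow> (complex \<Rightarrow> 'e topology) \<Rightarrow> (complex \<Rightarrow> ('e, 2) chart set) \<Rightarrow>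
     ('e \<times> complex) topology \<Rightarrow> ('e \<times> complex, 3) chart set \<Rightarrow>
     (complex \<Rightarrow> complex^2 \<Rightarrow> 'e) \<Rightarrow> bool" where
  "space_of_initial_conditions X E A P B j \<longleftrightarrow>
     (\<forall>z. complex_manifold (E z) (A z)) \<and>
     fibre_bundle_over_plane E P B \<and>
     (\<forall>\<Omega> s. open \<Omega> \<and> connected \<Omega> \<and> \<Omega> \<noteq> {} \<and> solves X \<Omega> s \<longrightarrow>
        (\<exists>\<sigma>. global_holomorphic_section E P B \<sigma> \<and> (\<forall>z\<in>\<Omega>. \<sigma> z = j z (s z))))"


section \<open>The first Painleve equation\<close>

definition PI_system :: plane_system where
  "PI_system z p = vector [6 * (p $ 2)^2 + z, p $ 1]"

text \<open>Painleve's coordinates \<open>(u, w)\<close>, meaningful for \<open>w \<noteq> 0\<close>.\<close>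

definition painleve_coords :: "complex \<Rightarrow> complex^2 \<Rightarrow> complex^2" where
  "painleve_coords z q = (let u = q $ 1; w = q $ 2 in
     vector [u * w^3 - 2 / w^3 - z * w / 2 - w^2 / 2, 1 / w^2])"

text \<open>The nontrivial element of the group of order two, defined for \<open>w \<noteq> 0\<close>; points with
  \<open>w = 0\<close> are identified only with themselves.\<close>

definition Z2_act :: "complex \<Rightarrow> complex^2 \<Rightarrow> complex^2" where
  "Z2_act z q = (let u = q $ 1; w = q $ 2 in vector [- u + z / w^2 + 4 / w^6, - w])"

definition Z2_rel :: "complex \<Rightarrow> (complex^2) rel" where
  "Z2_rel z = {(p,q). q = p \<or> p $ 2 \<noteq> 0 \<and> q = Z2_act z p}"

definition M :: "complex \<Rightarrow> (complex^3) set" where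
  "M z = {q. let U = q $ 1; V = q $ 2; W = q $ 3 in V^2 = U * W^4 + 2 * z * W^3 + 4 * W}"

text \<open>The second component is \<open>w\<^sup>7 (u - z w\<^sup>-\<^sup>2/2 - 2 w\<^sup>-\<^sup>6)\<close> with the negative powers
  cleared, so that it is also defined at \<open>w = 0\<close>.\<close>

definition invariants :: "complex \<Rightarrow> complex^2 \<Rightarrow> complex^3" where
  "invariants z q = (let u = q $ 1; w = q $ 2 in
     vector [u * (u * w^6 - z * w^4 - 4) + w^2 * z^2 / 4, u * w^7 - z * w^5 / 2 - 2 * w, w^2])"

text \<open>The surface \<open>T\<close> is the quotient of \<open>\<complex>\<^sup>2\<close> by the relation \<open>R\<close>, by means of the map \<open>f\<close>: as a
  set, with the quotient topology, and with the complex structure for which the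
  projection is locally biholomorphic.\<close>

definition quotient_surface ::
  "(complex^2) rel \<Rightarrow> (complex^2 \<Rightarrow> complex^3) \<Rightarrow> (complex^3) set \<Rightarrow> bool" where
  "quotient_surface R f T \<longleftrightarrow>
     equiv UNIV R \<and>
     (\<exists>h. bij_betw h (UNIV // R) T \<and> (\<forall>p. h (R `` {p}) = f p)) \<and>
     quotient_map euclidean (top_of_set T) f \<and>
     locally_biholomorphic f UNIV T \<and>
     complex_manifold (top_of_set T) (submanifold_charts T :: (complex^3, 2) chart set)"

text \<open>The weighted projective space \<open>\<complex>P\<^sup>3(3,2,4,5)\<close> with homogeneous coordinates \<open>(x, y, z, \<epsilon>)\<close>,
  its chart \<open>y \<noteq> 0\<close> with orbifold coordinates \<open>(X\<^sub>2, Z\<^sub>2, \<epsilon>\<^sub>2)\<close>, and the blow-up coordinates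
  \<open>(u, z, w)\<close> centred at \<open>(X\<^sub>2, Z\<^sub>2, \<epsilon>\<^sub>2) = (-2, 0, 0)\<close>.\<close>

definition wps_rel :: "(complex^4) rel" where
  "wps_rel = {(p,q). p \<noteq> 0 \<and> (\<exists>c. c \<noteq> 0 \<and>
     q = vector [c^3 * p $ 1, c^2 * p $ 2, c^4 * p $ 3, c^5 * p $ 4])}"

definition wps :: "(complex^4) set set" where
  "wps = (UNIV - {0}) // wps_rel"

definition wps_affine :: "complex \<Rightarrow> complex^2 \<Rightarrow> (complex^4) set" where
  "wps_affine z p = wps_rel `` {vector [p $ 1, p $ 2, z, 1]}"

definition wps_chart2 :: "complex^3 \<Rightarrow> (complex^4) set" where
  "wps_chart2 r = wps_rel `` {vector [r $ 1, 1, r $ 2, r $ 3]}"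

definition orbifold_act :: "complex^3 \<Rightarrow> complex^3" where
  "orbifold_act r = vector [- (r $ 1), r $ 2, - (r $ 3)]"

definition blow_up :: "complex \<Rightarrow> complex^2 \<Rightarrow> complex^3" where
  "blow_up z q = (let u = q $ 1; w = q $ 2 in
     vector [-2 + u * w^6 - z * w^4 / 2 - w^5 / 2, z * w^4, w^5])"

definition induced_from_orbifold :: bool where
  "induced_from_orbifold \<longleftrightarrow>
     range wps_chart2 \<subseteq> wps \<and>
     (\<forall>r r'. wps_chart2 r = wps_chart2 r' \<longleftrightarrow> r' = r \<or> r' = orbifold_act r) \<and>
     (\<forall>z q. q $ 2 \<noteq> 0 \<longrightarrow>
        wps_chart2 (blow_up z q) = wps_affine z (painleve_coords z q) \<and>
        blow_up z (Z2_act z q) = orbifold_act (blow_up z q))"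

definition gluing :: "complex \<Rightarrow> ((complex^2) \<times> (complex^3)) set" where
  "gluing z = {(p,q). p $ 2 \<noteq> 0 \<and> q \<in> M z \<and> q $ 3 \<noteq> 0 \<and>
     (let x = p $ 1; y = p $ 2; V = q $ 2; W = q $ 3 in x = V / W^2 - W / 2 \<and> y = 1 / W)}"

definition gluing_inverse :: "complex \<Rightarrow> ((complex^2) \<times> (complex^3)) set" where
  "gluing_inverse z = {(p,q). p $ 2 \<noteq> 0 \<and> q \<in> M z \<and> q $ 3 \<noteq> 0 \<and>
     (let x = p $ 1; y = p $ 2; V = q $ 2; W = q $ 3 in V = x / y^2 + 1 / (2 * y^3) \<and> W = 1 / y)}"

type_synonym E_point = "((complex^2) + (complex^3)) set"

definition E_rel :: "complex \<Rightarrow> ((complex^2) + (complex^3)) rel" where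
  "E_rel z = glue_rel UNIV (M z) (gluing z)"

definition E_xy :: "complex \<Rightarrow> complex^2 \<Rightarrow> E_point" where
  "E_xy z p = E_rel z `` {Inl p}"

definition E_M :: "complex \<Rightarrow> complex^3 \<Rightarrow> E_point" where
  "E_M z q = E_rel z `` {Inr q}"

definition E_set :: "complex \<Rightarrow> E_point set" where
  "E_set z = (UNIV <+> M z) // E_rel z"

definition E_top :: "complex \<Rightarrow> E_point topology" where
  "E_top z = glued_topology (E_xy z) UNIV (E_M z) (M z)"

definition E_charts :: "complex \<Rightarrow> (E_point, 2) chart set" where
  "E_charts z = glued_charts (E_xy z) UNIV (E_M z) (M z)"

definition M_charts :: "complex \<Rightarrow> (complex^3, 2) chart set" where
  "M_charts z = submanifold_charts (M z)"

text \<open>The bundle of all \<open>E z\<close> is covered by the images of \<open>\<complex>\<^sup>3\<close>, with coordinates \<open>(x, y, z)\<close>,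
  and of the hypersurface of all \<open>(U, V, W, z)\<close> with \<open>(U, V, W) \<in> M z\<close>.\<close>

definition total_M :: "(complex^4) set" where
  "total_M = {r. vector [r $ 1, r $ 2, r $ 3] \<in> M (r $ 4)}"

definition P_xy :: "complex^3 \<Rightarrow> E_point \<times> complex" where
  "P_xy r = (E_xy (r $ 3) (vector [r $ 1, r $ 2]), r $ 3)"

definition P_M :: "complex^4 \<Rightarrow> E_point \<times> complex" where
  "P_M r = (E_M (r $ 4) (vector [r $ 1, r $ 2, r $ 3]), r $ 4)"

definition P_top :: "(E_point \<times> complex) topology" where
  "P_top = glued_topology P_xy UNIV P_M total_M"

definition P_charts :: "(E_point \<times> complex, 3) chart set" where
  "P_charts = glued_charts P_xy UNIV P_M total_M"

text \<open>The two expressions of the symplectic form on \<open>M z\<close>, in the coordinates \<open>(U, V, W)\<close>: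
  \<open>-W\<^sup>-\<^sup>4 dV \<and> dW\<close> where \<open>W \<noteq> 0\<close>, and \<open>dV \<and> dU / (4 U W\<^sup>3 + 6 z W\<^sup>2 + 4)\<close> where the
  denominator does not vanish.\<close>

definition M_W :: "complex \<Rightarrow> (complex^3) set" where
  "M_W z = {q \<in> M z. q $ 3 \<noteq> 0}"

definition form_VW :: "complex^3 \<Rightarrow> complex^3 \<Rightarrow> complex^3 \<Rightarrow> complex" where
  "form_VW q a b = - wedge 2 3 a b / (q $ 3)^4"

definition denom :: "complex \<Rightarrow> complex^3 \<Rightarrow> complex" where
  "denom z q = 4 * q $ 1 * (q $ 3)^3 + 6 * z * (q $ 3)^2 + 4"

definition M_UV :: "complex \<Rightarrow> (complex^3) set" where
  "M_UV z = {q \<in> M z. denom z q \<noteq> 0}"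

definition form_VU :: "complex \<Rightarrow> complex^3 \<Rightarrow> complex^3 \<Rightarrow> complex^3 \<Rightarrow> complex" where
  "form_VU z q a b = wedge 2 1 a b / denom z q"

end

theory Submission
  imports Defs "HOL-Complex_Analysis.Cauchy_Integral_Formula"
begin

text \<open>The map \<open>(u, w) \<mapsto> (U, V, W)\<close> is a local biholomorphism onto \<open>M z\<close> whose fibres are the orbits of the
  \<open>\<int>\<^sub>2\<close>-action, and it satisfies \<open>dx \<and> dy = - W\<^sup>-\<^sup>4 dV \<and> dW = - 2 du \<and> dw\<close>; so the charts \<open>(u, w)\<close> and \<open>(x, y)\<close> give
  the complex and the symplectic structure of \<open>M z\<close> and \<open>E z\<close>.
  The equation is a polynomial, hence regular, vector field on both pieces, and a smooth proper function on
  the fibres that grows at most exponentially along solutions extends every solution over the whole plane.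
  The difference of the first Painleve equation and another system that is polynomial in \<open>(x, y)\<close> and in \<open>(u, w)\<close> is an autonomous
  vector field for each fixed \<open>z\<close>. Its divergence is a function regular in both coordinates, hence constant,
  and then so is its Hamiltonian.\<close>

subsection \<open>Holomorphic functions of several variables\<close>

text \<open>Regular functions are constant because of a gap. Along \<open>u = v / w\<close> with w
  tending to 0, the functions \<open>x^2 - 4 * y^3 - 2 * z * y\<close>, y and x have poles of order
  1, 2 and 3, and the first has leading coefficient \<open>2 - 4 * v\<close>. Since 1 is not of the
  form \<open>2 * b + 3 * e\<close>, the leading coefficient of a polynomial in (x, y), as a
  polynomial in \<open>2 - 4 * v\<close>, lacks the power just below its pole order N. Regularity in
  (u, w) would make it a multiple of \<open>v^N\<close>, which has no such gap.

  Continuation needs no information on poles: a bound for time and for the point in either piece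
  gives a common radius of existence, and the bound from the proper function is the same for all
  solutions with a given initial value on a given disc. So steps of one fixed length reach every
  radius.

  Differentiability is given pointwise only. The inverse function theorem needs continuous
  derivatives and the symplectic forms need holomorphic Jacobians; Cauchy's formula on complex lines
  supplies both.\<close>

lemma has_derivative_vecI:
  fixes f :: "'a::real_normed_vector \<Rightarrow> 'b::euclidean_space^'n::finite"
  assumes "\<And>i. ((\<lambda>x. f x $ i) has_derivative (\<lambda>h. f' h $ i)) (at x within S)"
  shows "(f has_derivative f') (at x within S)"
  unfolding has_derivative_componentwise_within[of f]
  using assms by (auto simp: Basis_vec_def inner_axis intro: has_derivative_inner_left)

lemma has_derivative_vec_nth:
  "(f has_derivative f') F \<Longrightarrow> ((\<lambda>x. f x $ i) has_derivative (\<lambda>h. f' h $ i)) F"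
  by (rule bounded_linear.has_derivative[OF bounded_linear_vec_nth])

lemma norm_scalar_vec: "norm (c *s (v :: complex^'n)) = norm c * norm v"
  by (simp add: norm_vec_def norm_mult L2_set_right_distrib)

lemma bounded_linear_scalar_left: "bounded_linear (\<lambda>c. c *s (v :: complex^'n))"
  by (rule bounded_linear_intro[where K="norm v"])
     (simp_all add: norm_scalar_vec vec_eq_iff algebra_simps)

lemma complex_diff_at_const: "complex_diff_at (\<lambda>_. c) p"
  unfolding complex_diff_at_def by (rule exI[of _ "\<lambda>_. 0"]) auto

lemma complex_diff_at_nth: "complex_diff_at (\<lambda>p. p $ i) p"
  unfolding complex_diff_at_def
  by (rule exI[of _ "\<lambda>v. v $ i"]) (auto intro: bounded_linear_imp_has_derivative bounded_linear_vec_nth)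

lemma complex_diff_at_add:
  assumes "complex_diff_at f p" "complex_diff_at g p"
  shows "complex_diff_at (\<lambda>p. f p + g p) p"
proof -
  obtain f' g' where "(f has_derivative f') (at p)" "\<forall>c v. f' (c *s v) = c * f' v"
    "(g has_derivative g') (at p)" "\<forall>c v. g' (c *s v) = c * g' v"
    using assms unfolding complex_diff_at_def by auto
  then show ?thesis unfolding complex_diff_at_def
    by (intro exI[of _ "\<lambda>v. f' v + g' v"]) (auto intro: has_derivative_add simp: algebra_simps)
qed

lemma complex_diff_at_mult:
  assumes "complex_diff_at f p" "complex_diff_at g p"
  shows "complex_diff_at (\<lambda>p. f p * g p) p"
proof -
  obtain f' g' where "(f has_derivative f') (at p)" "\<forall>c v. f' (c *s v) = c * f' v"
    "(g has_derivative g') (at p)" "\<forall>c v. g' (c *s v) = c * g' v"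
    using assms unfolding complex_diff_at_def by auto
  then show ?thesis unfolding complex_diff_at_def
    by (intro exI[of _ "\<lambda>v. f p * g' v + f' v * g p"]) (auto intro: has_derivative_mult simp: algebra_simps)
qed

lemma complex_diff_at_compose_field:
  assumes "complex_diff_at f p" "(g has_field_derivative g') (at (f p))"
  shows "complex_diff_at (\<lambda>p. g (f p)) p"
proof -
  obtain f' where f': "(f has_derivative f') (at p)" "\<forall>c v. f' (c *s v) = c * f' v"
    using assms unfolding complex_diff_at_def by auto
  have "((\<lambda>p. g (f p)) has_derivative (\<lambda>v. g' * f' v)) (at p)"
    using has_derivative_compose[OF f'(1) assms(2)[unfolded has_field_derivative_def]] by simp
  then show ?thesis unfolding complex_diff_at_def using f'(2)
    by (intro exI[of _ "\<lambda>v. g' * f' v"]) auto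
qed

lemma complex_diff_at_uminus: "complex_diff_at f p \<Longrightarrow> complex_diff_at (\<lambda>p. - f p) p"
  using complex_diff_at_mult[OF complex_diff_at_const[of "-1" p], of f] by simp

lemma complex_diff_at_diff:
  "complex_diff_at f p \<Longrightarrow> complex_diff_at g p \<Longrightarrow> complex_diff_at (\<lambda>p. f p - g p) p"
  using complex_diff_at_add[OF _ complex_diff_at_uminus[of g p], of f] by simp

lemma complex_diff_at_power: "complex_diff_at f p \<Longrightarrow> complex_diff_at (\<lambda>p. f p ^ n) p"
  by (induction n) (auto intro: complex_diff_at_const complex_diff_at_mult)

lemma complex_diff_at_inverse:
  "complex_diff_at f p \<Longrightarrow> f p \<noteq> 0 \<Longrightarrow> complex_diff_at (\<lambda>p. inverse (f p)) p"
  using complex_diff_at_compose_field[OF _ DERIV_inverse] by blast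

lemma complex_diff_at_divide:
  "complex_diff_at f p \<Longrightarrow> complex_diff_at g p \<Longrightarrow> g p \<noteq> 0 \<Longrightarrow> complex_diff_at (\<lambda>p. f p / g p) p"
  unfolding divide_inverse by (intro complex_diff_at_mult complex_diff_at_inverse)

lemmas complex_diff_at_intros = complex_diff_at_const complex_diff_at_nth complex_diff_at_add
  complex_diff_at_mult complex_diff_at_uminus complex_diff_at_diff complex_diff_at_power
  complex_diff_at_divide

lemma complex_diff_at_derivative:
  assumes "complex_diff_at f p"
  shows "(f has_derivative frechet_derivative f (at p)) (at p)"
    and "frechet_derivative f (at p) (c *s v) = c * frechet_derivative f (at p) v"
proof -
  obtain f' where f': "(f has_derivative f') (at p)" "\<forall>c v. f' (c *s v) = c * f' v"
    using assms unfolding complex_diff_at_def by auto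
  have "f' = frechet_derivative f (at p)"
    using frechet_derivative_at[OF f'(1)] .
  with f' show "(f has_derivative frechet_derivative f (at p)) (at p)"
    "frechet_derivative f (at p) (c *s v) = c * frechet_derivative f (at p) v" by auto
qed

lemma complex_diff_at_cong:
  assumes "complex_diff_at f p" "open N" "p \<in> N" "\<And>q. q \<in> N \<Longrightarrow> f q = g q"
  shows "complex_diff_at g p"
  using assms has_derivative_transform_within_open[of f _ p UNIV N g]
  unfolding complex_diff_at_def by blast

lemma complex_diff_at_isCont: "complex_diff_at f p \<Longrightarrow> isCont f p"
  using complex_diff_at_derivative(1) has_derivative_continuous by blast

lemma complex_diff_at_compose:
  fixes f :: "complex^'n \<Rightarrow> complex^'m"
  assumes "\<And>i. complex_diff_at (\<lambda>p. f p $ i) p" "complex_diff_at g (f p)"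
  shows "complex_diff_at (\<lambda>p. g (f p)) p"
proof -
  let ?f' = "\<lambda>v. \<chi> i. frechet_derivative (\<lambda>p. f p $ i) (at p) v"
  have f': "(f has_derivative ?f') (at p)"
    by (rule has_derivative_vecI) (simp add: complex_diff_at_derivative assms)
  have 1: "((\<lambda>p. g (f p)) has_derivative (\<lambda>v. frechet_derivative g (at (f p)) (?f' v))) (at p)"
    by (rule has_derivative_compose[OF f' complex_diff_at_derivative(1)[OF assms(2)]])
  have 2: "?f' (c *s v) = c *s ?f' v" for c v
    by (simp add: vec_eq_iff complex_diff_at_derivative assms)
  show ?thesis unfolding complex_diff_at_def
    using 1 by (intro exI conjI allI) (auto simp: 2 complex_diff_at_derivative[OF assms(2)])
qed

lemma complex_diff_at_along_curve:
  fixes c :: "complex \<Rightarrow> complex^'n"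
  assumes "\<And>i. (\<lambda>z. c z $ i) field_differentiable at z" "complex_diff_at g (c z)"
  shows "(\<lambda>z. g (c z)) field_differentiable at z"
proof -
  obtain d where d: "\<And>i. ((\<lambda>z. c z $ i) has_field_derivative d i) (at z)"
    using assms(1) unfolding field_differentiable_def by metis
  have c': "(c has_derivative (\<lambda>h. h *s (\<chi> i. d i))) (at z)"
    by (rule has_derivative_vecI) (use d in \<open>simp add: has_field_derivative_def mult.commute[of "d _"] mult_commute_abs\<close>)
  have "((\<lambda>z. g (c z)) has_derivative (\<lambda>h. frechet_derivative g (at (c z)) (h *s (\<chi> i. d i)))) (at z)"
    by (rule has_derivative_compose[OF c' complex_diff_at_derivative(1)[OF assms(2)]])
  then have "((\<lambda>z. g (c z)) has_derivative (\<lambda>h. frechet_derivative g (at (c z)) (\<chi> i. d i) * h)) (at z)"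
    by (simp add: complex_diff_at_derivative(2)[OF assms(2)] mult.commute)
  then show ?thesis
    unfolding field_differentiable_def has_field_derivative_def by blast
qed

lemma hol_fun_open:
  assumes "open S"
  shows "hol_fun S f \<longleftrightarrow> (\<forall>p\<in>S. complex_diff_at f p)"
proof
  assume L: "hol_fun S f"
  show "\<forall>p\<in>S. complex_diff_at f p"
  proof
    fix p assume "p \<in> S"
    with L obtain N F where "open N" "p \<in> N" "\<forall>q\<in>N. complex_diff_at F q" "\<forall>q\<in>N \<inter> S. F q = f q"
      unfolding hol_fun_def by metis
    then show "complex_diff_at f p"
      using complex_diff_at_cong[of F p "N \<inter> S" f] assms \<open>p \<in> S\<close> by auto
  qed
next
  assume "\<forall>p\<in>S. complex_diff_at f p"
  then show "hol_fun S f" unfolding hol_fun_def using assms by blast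
qed

lemma hol_funI:
  assumes "\<And>p. p \<in> S \<Longrightarrow> \<exists>N F. open N \<and> p \<in> N \<and> (\<forall>q\<in>N. complex_diff_at F q) \<and> (\<forall>q\<in>N \<inter> S. F q = f q)"
  shows "hol_fun S f"
  using assms unfolding hol_fun_def by blast

lemma hol_funE:
  assumes "hol_fun S f" "p \<in> S"
  obtains N F where "open N" "p \<in> N" "\<And>q. q \<in> N \<Longrightarrow> complex_diff_at F q" "\<And>q. q \<in> N \<Longrightarrow> q \<in> S \<Longrightarrow> F q = f q"
proof -
  obtain N F where "open N" "p \<in> N" "\<forall>q\<in>N. complex_diff_at F q" "\<forall>q\<in>N \<inter> S. F q = f q"
    using bspec[OF assms(1)[unfolded hol_fun_def] assms(2)] by blast
  then show ?thesis by (intro that[of N F]) auto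
qed

lemma hol_fun_subset:
  assumes "hol_fun S f" "T \<subseteq> S" shows "hol_fun T f"
proof (rule hol_funI)
  fix p assume "p \<in> T"
  then have "p \<in> S" using assms by blast
  from hol_funE[OF assms(1) this] obtain N F where
    "open N" "p \<in> N" "\<And>q. q \<in> N \<Longrightarrow> complex_diff_at F q" "\<And>q. q \<in> N \<Longrightarrow> q \<in> S \<Longrightarrow> F q = f q" by metis
  then show "\<exists>N F. open N \<and> p \<in> N \<and> (\<forall>q\<in>N. complex_diff_at F q) \<and> (\<forall>q\<in>N \<inter> T. F q = f q)"
    using assms(2) by (intro exI[of _ N] exI[of _ F]) auto
qed

lemma hol_map_subset: "hol_map S f \<Longrightarrow> T \<subseteq> S \<Longrightarrow> hol_map T f"
  unfolding hol_map_def using hol_fun_subset by blast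

lemma hol_fun_cong:
  assumes "hol_fun S f" "\<And>p. p \<in> S \<Longrightarrow> f p = g p" shows "hol_fun S g"
proof (rule hol_funI)
  fix p assume "p \<in> S"
  from hol_funE[OF assms(1) this] obtain N F where
    "open N" "p \<in> N" "\<And>q. q \<in> N \<Longrightarrow> complex_diff_at F q" "\<And>q. q \<in> N \<Longrightarrow> q \<in> S \<Longrightarrow> F q = f q" by metis
  then show "\<exists>N F. open N \<and> p \<in> N \<and> (\<forall>q\<in>N. complex_diff_at F q) \<and> (\<forall>q\<in>N \<inter> S. F q = g q)"
    using assms(2) by (intro exI[of _ N] exI[of _ F]) auto
qed

lemma hol_map_cong: "hol_map S f \<Longrightarrow> (\<And>p. p \<in> S \<Longrightarrow> f p = g p) \<Longrightarrow> hol_map S g"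
  unfolding hol_map_def using hol_fun_cong[of S "\<lambda>p. f p $ i" "\<lambda>p. g p $ i" for i] by simp

lemma hol_fun_of_complex_diff:
  assumes "open N" "S \<subseteq> N" "\<And>p. p \<in> N \<Longrightarrow> complex_diff_at f p" shows "hol_fun S f"
  using assms by (intro hol_funI exI[of _ N] exI[of _ f]) auto

lemma hol_fun_continuous_on:
  assumes "hol_fun S f" shows "continuous_on S f"
proof -
  have "continuous (at p within S) f" if "p \<in> S" for p
  proof -
    from hol_funE[OF assms that] obtain N F where
      N: "open N" "p \<in> N" "\<And>q. q \<in> N \<Longrightarrow> complex_diff_at F q" "\<And>q. q \<in> N \<Longrightarrow> q \<in> S \<Longrightarrow> F q = f q" by metis
    have "continuous (at p within S) F"
      using complex_diff_at_isCont[OF N(3)[OF N(2)]] by (rule continuous_at_imp_continuous_at_within)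
    then show ?thesis
      by (rule continuous_transform_within_openin[of p S F "N \<inter> S" f])
         (use N that in \<open>auto simp: openin_open\<close>)
  qed
  then show ?thesis by (simp add: continuous_on_eq_continuous_within)
qed

lemma hol_map_continuous_on: "hol_map S f \<Longrightarrow> continuous_on S f"
  using continuous_on_vec_lambda[of S "\<lambda>i p. f p $ i"] by (simp add: hol_map_def hol_fun_continuous_on)

lemma hol_fun_compose:
  fixes f :: "complex^'n \<Rightarrow> complex^'m"
  assumes f: "hol_map S f" and g: "hol_fun T g" and "f ` S \<subseteq> T"
  shows "hol_fun S (\<lambda>p. g (f p))"
  unfolding hol_fun_def
proof
  fix p assume "p \<in> S"
  have "\<forall>i. \<exists>N F. open N \<and> p \<in> N \<and> (\<forall>q\<in>N. complex_diff_at F q) \<and> (\<forall>q\<in>N \<inter> S. F q = f q $ i)"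
    using f \<open>p \<in> S\<close> unfolding hol_map_def hol_fun_def by simp
  then obtain N F where N: "\<And>i. open (N i)" "\<And>i. p \<in> N i" "\<And>i q. q \<in> N i \<Longrightarrow> complex_diff_at (F i) q"
     "\<And>i q. q \<in> N i \<inter> S \<Longrightarrow> F i q = f q $ i" by metis
  have "f p \<in> T" using assms(3) \<open>p \<in> S\<close> by blast
  from hol_funE[OF g this] obtain M G where
    M: "open M" "f p \<in> M" "\<And>q. q \<in> M \<Longrightarrow> complex_diff_at G q" "\<And>q. q \<in> M \<Longrightarrow> q \<in> T \<Longrightarrow> G q = g q" by metis
  define N' where "N' = (\<Inter>i. N i)"
  define F' where "F' q = (\<chi> i. F i q)" for q
  have oN: "open N'" unfolding N'_def using N(1) by auto
  have N': "q \<in> N' \<Longrightarrow> q \<in> N i" for q i by (simp add: N'_def)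
  have pN: "p \<in> N'" using N(2) by (simp add: N'_def)
  have cF: "continuous_on N' F'"
    unfolding F'_def
    by (intro continuous_on_vec_lambda continuous_at_imp_continuous_on ballI complex_diff_at_isCont)
       (use N(3) N' in blast)
  have Fp: "F' q = f q" if "q \<in> N'" "q \<in> S" for q
    using N(4) N' that unfolding F'_def by (simp add: vec_eq_iff)
  \<comment> \<open>\<open>F'\<close> agrees with f only on S, so off S its values need not lie
    where \<open>G\<close> is holomorphic; \<open>Q\<close> removes the points where they do
    not.\<close>
  define Q where "Q = N' \<inter> F' -` M"
  have "open Q" unfolding Q_def
    by (rule continuous_open_preimage[OF cF oN M(1)])
  moreover have "p \<in> Q" unfolding Q_def
    using pN M(2) Fp[OF pN \<open>p \<in> S\<close>] by simp
  moreover have "complex_diff_at (\<lambda>q. G (F' q)) q" if "q \<in> Q" for q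
  proof (rule complex_diff_at_compose)
    show "complex_diff_at (\<lambda>p. F' p $ i) q" for i
      using N(3)[of q i] N'[of q i] that by (simp add: F'_def Q_def)
    show "complex_diff_at G (F' q)" using M(3) that by (simp add: Q_def)
  qed
  moreover have "G (F' q) = g (f q)" if "q \<in> Q \<inter> S" for q
    using that Fp[of q] M(4)[of "f q"] assms(3) unfolding Q_def by auto
  ultimately show "\<exists>N F. open N \<and> p \<in> N \<and> (\<forall>q\<in>N. complex_diff_at F q) \<and> (\<forall>q\<in>N \<inter> S. F q = g (f q))"
    by (intro exI[of _ Q] exI[of _ "\<lambda>q. G (F' q)"]) blast
qed

lemma hol_map_compose:
  assumes f: "hol_map S f" and g: "hol_map T g" and "f ` S \<subseteq> T"
  shows "hol_map S (\<lambda>p. g (f p))"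
  using assms hol_fun_compose unfolding hol_map_def[of _ g] hol_map_def[of _ "\<lambda>p. g (f p)"] by blast

lemma hol_map_id: "hol_map S (\<lambda>p. p)"
  unfolding hol_map_def by (auto intro!: hol_fun_of_complex_diff[of UNIV] complex_diff_at_nth)

lemma hol_map_derivative:
  fixes f :: "complex^'n \<Rightarrow> complex^'m"
  assumes "hol_map S f" "open S" "p \<in> S"
  shows "(f has_derivative frechet_derivative f (at p)) (at p)"
    and "frechet_derivative f (at p) (c *s v) = c *s frechet_derivative f (at p) v"
    and "frechet_derivative f (at p) v $ i = frechet_derivative (\<lambda>p. f p $ i) (at p) v"
proof -
  have d: "complex_diff_at (\<lambda>p. f p $ i) p" for i
    using assms by (auto simp: hol_map_def hol_fun_open)
  let ?f' = "\<lambda>v. \<chi> i. frechet_derivative (\<lambda>p. f p $ i) (at p) v"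
  have f': "(f has_derivative ?f') (at p)"
    by (rule has_derivative_vecI) (simp add: complex_diff_at_derivative d)
  have e: "frechet_derivative f (at p) = ?f'" using frechet_derivative_at[OF f'] by simp
  show "(f has_derivative frechet_derivative f (at p)) (at p)" using f' e by simp
  show "frechet_derivative f (at p) (c *s v) = c *s frechet_derivative f (at p) v"
    by (simp add: e vec_eq_iff complex_diff_at_derivative(2)[OF d])
  show "frechet_derivative f (at p) v $ i = frechet_derivative (\<lambda>p. f p $ i) (at p) v"
    by (simp add: e)
qed

section \<open>Derivatives of holomorphic functions through Cauchy's formula\<close>

lemma ball_subset_double:
  assumes "q \<in> ball p \<rho>" shows "ball q \<rho> \<subseteq> ball p (2 * \<rho>)"
proof
  fix x assume "x \<in> ball q \<rho>"
  then show "x \<in> ball p (2 * \<rho>)" using assms dist_triangle[of p x q] by simp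
qed

lemma open_double_ball:
  fixes p :: "'a::metric_space"
  assumes "open S" "p \<in> S"
  obtains \<rho> where "0 < \<rho>" "ball p (2 * \<rho>) \<subseteq> S"
proof -
  obtain e where "0 < e" "ball p e \<subseteq> S" using assms open_contains_ball_eq by blast
  then show ?thesis by (intro that[of "e / 2"]) auto
qed

text \<open>On the complex line through p in direction v, f is a function of one variable, and its
  derivative at 0 is Cauchy's integral over a circle; with du = 2 pi i E dt this leaves f / E. The
  derivative is thus expressed by values of f alone, so continuity and differentiability in p can be
  obtained under the integral sign.\<close>

lemma complex_diff_at_Cauchy:
  fixes f :: "complex^'n \<Rightarrow> complex"
  assumes f: "\<And>q. q \<in> ball p \<rho> \<Longrightarrow> complex_diff_at f q" and r: "0 < r" "r * norm v < \<rho>"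
  defines "E \<equiv> \<lambda>t::real. of_real r * exp (2 * of_real pi * \<i> * of_real t)"
  shows "((\<lambda>t. f (p + E t *s v) / E t) has_integral frechet_derivative f (at p) v) {0..1}"
proof -
  \<comment> \<open>The circle of radius r has to lie inside an open disc of holomorphy. For
    \<open>v = 0\<close> the line is a single point and every larger radius will do.\<close>
  have "\<exists>R. r < R \<and> R * norm v < \<rho>"
  proof (cases "v = 0")
    case False
    then show ?thesis using r by (intro exI[of _ "(r + \<rho> / norm v) / 2"]) (auto simp: field_simps)
  qed (use r in \<open>auto intro: exI[of _ "r + 1"]\<close>)
  then obtain R where R: "r < R" "R * norm v < \<rho>" by blast
  have inb: "p + z *s v \<in> ball p \<rho>" if "z \<in> ball 0 R" for z
  proof -
    have "norm (z *s v) \<le> R * norm v"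
      using that by (auto simp: norm_scalar_vec intro!: mult_right_mono)
    then show ?thesis using R by (simp add: dist_norm)
  qed
  let ?h = "\<lambda>z. f (p + z *s v)"
  have hd: "(?h has_field_derivative frechet_derivative f (at (p + z *s v)) v) (at z)"
    if "z \<in> ball 0 R" for z
  proof -
    have "((\<lambda>z. p + z *s v) has_derivative (\<lambda>h. h *s v)) (at z)"
      using has_derivative_add[OF has_derivative_const[of p]
          bounded_linear_imp_has_derivative[OF bounded_linear_scalar_left[of v]]] by simp
    from has_derivative_compose[OF this complex_diff_at_derivative(1)[OF f[OF inb[OF that]]]]
    have "(?h has_derivative (\<lambda>h. frechet_derivative f (at (p + z *s v)) (h *s v))) (at z)" .
    then show ?thesis
      unfolding has_field_derivative_def
      by (simp add: complex_diff_at_derivative(2)[OF f[OF inb[OF that]]] mult_commute_abs)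
  qed
  have hol: "?h holomorphic_on ball 0 R"
    unfolding holomorphic_on_open[OF open_ball] using hd by blast
  have "((\<lambda>u. ?h u / (u - 0) ^ Suc 1) has_contour_integral (2 * pi * \<i>) / fact 1 * (deriv ^^ 1) ?h 0) (circlepath 0 r)"
    by (rule Cauchy_has_contour_integral_higher_derivative_circlepath)
      (use hol R r in \<open>auto intro!: holomorphic_on_imp_continuous_on intro: holomorphic_on_subset\<close>)
  moreover have "deriv ?h 0 = frechet_derivative f (at p) v"
    using hd[of 0] R r DERIV_imp_deriv by fastforce
  ultimately have "((\<lambda>u. ?h u / u^2) has_contour_integral 2 * pi * \<i> * frechet_derivative f (at p) v) (circlepath 0 r)"
    by (simp add: power2_eq_square)
  moreover have cp: "circlepath 0 r = E"
    unfolding E_def circlepath by (simp add: mult_ac)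
  moreover have "vector_derivative E (at t) = 2 * pi * \<i> * E t" for t
    using vector_derivative_circlepath[of 0 r t] unfolding cp by (simp add: E_def mult_ac)
  ultimately have "((\<lambda>t. ?h (E t) / E t ^ 2 * (2 * pi * \<i> * E t)) has_integral 2 * pi * \<i> * frechet_derivative f (at p) v) {0..1}"
    by (simp add: has_contour_integral)
  from has_integral_mult_right[OF this, of "1 / (2 * pi * \<i>)"]
  have "((\<lambda>t. 1 / (2 * pi * \<i>) * (?h (E t) / E t ^ 2 * (2 * pi * \<i> * E t))) has_integral frechet_derivative f (at p) v) {0..1}"
    by simp
  moreover have "E t \<noteq> 0" for t using r by (simp add: E_def)
  then have "1 / (2 * pi * \<i>) * (?h (E t) / E t ^ 2 * (2 * pi * \<i> * E t)) = ?h (E t) / E t" for t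
    by (simp add: power2_eq_square field_simps)
  ultimately show ?thesis by simp
qed

context
  fixes f :: "complex^'n \<Rightarrow> complex" and S
  assumes S: "open S" and f: "\<And>q. q \<in> S \<Longrightarrow> complex_diff_at f q"
begin

private abbreviation (input) "df \<equiv> \<lambda>q. frechet_derivative f (at q)"

lemma continuous_on_frechet_derivative_hol: "continuous_on S (\<lambda>q. frechet_derivative f (at q) v)"
proof -
  have "isCont (\<lambda>q. df q v) p" if pS: "p \<in> S" for p
  proof -
    \<comment> \<open>Half of the available radius is reserved for moving the centre: each q in
      \<open>ball p \<rho>\<close> has its own ball of radius \<rho> inside S, so one radius r of
      the Cauchy circle serves all q.\<close>
    obtain \<rho> where \<rho>: "0 < \<rho>" "ball p (2 * \<rho>) \<subseteq> S"
      using open_double_ball[OF S pS] by metis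
    define r where "r = \<rho> / (2 * (norm v + 1))"
    have r: "0 < r" "r * norm v < \<rho>"
      using \<rho> by (auto simp: r_def field_simps add_pos_nonneg intro: add_nonneg_pos)
    define E where "E = (\<lambda>t::real. of_real r * exp (2 * of_real pi * \<i> * of_real t))"
    have E0: "E t \<noteq> 0" for t using r by (simp add: E_def)
    have nE: "norm (E t) = r" for t using r by (simp add: E_def norm_mult norm_exp_eq_Re)
    have inS: "q + E t *s v \<in> S" if "q \<in> ball p \<rho>" for q t
    proof -
      have "dist p (q + E t *s v) \<le> dist p q + norm (E t *s v)"
        by (metis add_diff_cancel_left' dist_commute dist_norm dist_triangle)
      then have "dist p (q + E t *s v) < 2 * \<rho>" using that r by (simp add: norm_scalar_vec nE)
      then show ?thesis using \<rho> by auto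
    qed
    have contE: "continuous_on A E" for A unfolding E_def by (intro continuous_intros)
    have cont: "continuous_on (ball p \<rho> \<times> cbox 0 1) (\<lambda>(q,t). f (q + E t *s v) / E t)"
      unfolding split_beta
    proof (intro continuous_on_divide ballI)
      show "continuous_on (ball p \<rho> \<times> cbox 0 1) (\<lambda>x. f (fst x + E (snd x) *s v))"
      proof (rule continuous_on_compose2[of S f])
        show "continuous_on S f"
          using f complex_diff_at_isCont by (blast intro: continuous_at_imp_continuous_on)
        show "continuous_on (ball p \<rho> \<times> cbox 0 1) (\<lambda>x. fst x + E (snd x) *s v)"
          by (intro continuous_on_add continuous_on_fst continuous_on_id
              bounded_linear.continuous_on[OF bounded_linear_scalar_left]
              continuous_on_compose2[OF contE[of UNIV]] continuous_on_snd) auto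
      qed (use inS in auto)
      show "continuous_on (ball p \<rho> \<times> cbox 0 1) (\<lambda>x. E (snd x))"
        by (intro continuous_on_compose2[OF contE[of UNIV]] continuous_on_snd continuous_on_id) auto
    qed (use E0 in auto)
    have "continuous_on (ball p \<rho>) (\<lambda>q. integral (cbox 0 1) (\<lambda>t. f (q + E t *s v) / E t))"
      by (rule integral_continuous_on_param[OF cont])
    moreover have "integral (cbox 0 1) (\<lambda>t. f (q + E t *s v) / E t) = df q v" if "q \<in> ball p \<rho>" for q
    proof -
      have "ball q \<rho> \<subseteq> ball p (2 * \<rho>)"
        using that by (rule ball_subset_double)
      then have "((\<lambda>t. f (q + E t *s v) / E t) has_integral df q v) {0..1}"
        unfolding E_def using \<rho> r by (intro complex_diff_at_Cauchy[of q \<rho> f r v] f) auto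
      then show ?thesis by (simp add: integral_unique)
    qed
    ultimately have "continuous_on (ball p \<rho>) (\<lambda>q. df q v)"
      by (rule continuous_on_eq)
    then show ?thesis using \<rho> by (simp add: continuous_on_eq_continuous_at)
  qed
  then show ?thesis by (simp add: continuous_at_imp_continuous_on)
qed

text \<open>In finite dimension, norm continuity of the derivative follows from continuity on each
  vector. The Leibniz rule in the next lemma needs it in this form.\<close>

lemma continuous_on_Blinfun_hol: "continuous_on S (\<lambda>q. Blinfun (frechet_derivative f (at q)))"
proof (rule continuous_on_blinfun_componentwise)
  fix i :: "complex^'n"
  show "continuous_on S (\<lambda>q. blinfun_apply (Blinfun (df q)) i)"
    using continuous_on_frechet_derivative_hol[of i]
    by (rule continuous_on_eq)
       (metis bounded_linear_Blinfun_apply complex_diff_at_derivative(1) f has_derivative_bounded_linear)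
qed

text \<open>Differentiation under the integral sign in Cauchy's formula. This makes the Jacobians of
  holomorphic coordinate changes holomorphic, hence also the coefficients of the symplectic
  forms.\<close>

lemma complex_diff_at_frechet_derivative:
  assumes p: "p \<in> S"
  shows "complex_diff_at (\<lambda>q. frechet_derivative f (at q) v) p"
proof -
  obtain \<rho> where \<rho>: "0 < \<rho>" "ball p (2 * \<rho>) \<subseteq> S"
    using open_double_ball[OF S p] by metis
  define r where "r = \<rho> / (2 * (norm v + 1))"
  have r: "0 < r" "r * norm v < \<rho>"
    using \<rho> by (auto simp: r_def field_simps add_pos_nonneg intro: add_nonneg_pos)
  define E where "E = (\<lambda>t::real. of_real r * exp (2 * of_real pi * \<i> * of_real t))"
  have E0: "E t \<noteq> 0" for t using r by (simp add: E_def)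
  have nE: "norm (E t) = r" for t using r by (simp add: E_def norm_mult norm_exp_eq_Re)
  have inS: "q + E t *s v \<in> S" if "q \<in> ball p \<rho>" for q t
  proof -
    have "dist p (q + E t *s v) \<le> dist p q + norm (E t *s v)"
      by (metis add_diff_cancel_left' dist_commute dist_norm dist_triangle)
    then have "dist p (q + E t *s v) < 2 * \<rho>" using that r by (simp add: norm_scalar_vec nE)
    then show ?thesis using \<rho> by auto
  qed
  have contE: "continuous_on A E" for A unfolding E_def by (intro continuous_intros)
  have ball: "ball q \<rho> \<subseteq> S" if "q \<in> ball p \<rho>" for q
    using ball_subset_double[OF that] \<rho>(2) by (rule order.trans)
  have cauchy: "((\<lambda>t. f (q + E t *s v) / E t) has_integral df q v) {0..1}" if "q \<in> ball p \<rho>" for q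
    unfolding E_def using r ball[OF that] by (intro complex_diff_at_Cauchy[of q \<rho> f r v] f) auto
  have bl: "bounded_linear (df q)" if "q \<in> S" for q
    using complex_diff_at_derivative(1)[OF f[OF that]] has_derivative_bounded_linear by blast
  define fx where "fx q t = blinfun_mult_right (1 / E t) o\<^sub>L Blinfun (df (q + E t *s v))" for q t
  have fx: "blinfun_apply (fx q t) h = df (q + E t *s v) h / E t" if "q \<in> ball p \<rho>" for q t h
    using bl[OF inS[OF that]]
    by (simp add: fx_def bounded_linear_Blinfun_apply)
  have cont: "continuous_on (ball p \<rho> \<times> cbox 0 1) (\<lambda>(q,t). fx q t)"
    unfolding split_beta fx_def
  proof (intro continuous_on_const bounded_bilinear.continuous_on[OF bounded_bilinear_blinfun_compose]
      bounded_linear.continuous_on[OF bounded_linear_blinfun_mult_right] continuous_on_divide ballI)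
    show "continuous_on (ball p \<rho> \<times> cbox 0 1) (\<lambda>x. E (snd x))"
      by (intro continuous_on_compose2[OF contE[of UNIV]] continuous_on_snd continuous_on_id) auto
    show "continuous_on (ball p \<rho> \<times> cbox 0 1) (\<lambda>x. Blinfun (df (fst x + E (snd x) *s v)))"
    proof (rule continuous_on_compose2[OF continuous_on_Blinfun_hol])
      show "continuous_on (ball p \<rho> \<times> cbox 0 1) (\<lambda>x. fst x + E (snd x) *s v)"
        by (intro continuous_on_add continuous_on_fst continuous_on_id
            bounded_linear.continuous_on[OF bounded_linear_scalar_left]
            continuous_on_compose2[OF contE[of UNIV]] continuous_on_snd) auto
    qed (use inS in auto)
  qed (use E0 in auto)
  have "((\<lambda>q. integral (cbox 0 1) (\<lambda>t. f (q + E t *s v) / E t)) has_derivative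
      blinfun_apply (integral (cbox 0 1) (fx p))) (at p within ball p \<rho>)"
  proof (rule leibniz_rule[OF _ _ cont])
    fix q t assume q: "q \<in> ball p \<rho>"
    have 1: "((\<lambda>q. q + E t *s v) has_derivative (\<lambda>h. h)) (at q)"
      by (auto intro!: derivative_eq_intros)
    have "((\<lambda>q. f (q + E t *s v) / E t) has_derivative (\<lambda>h. df (q + E t *s v) h / E t)) (at q)"
      by (intro bounded_linear.has_derivative[OF bounded_linear_divide]
           has_derivative_compose[OF 1 complex_diff_at_derivative(1)[OF f[OF inS[OF q]]]])
    moreover have "(\<lambda>h. df (q + E t *s v) h / E t) = blinfun_apply (fx q t)"
      using fx[OF q] by auto
    ultimately show "((\<lambda>q. f (q + E t *s v) / E t) has_derivative blinfun_apply (fx q t)) (at q within ball p \<rho>)"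
      by (simp add: has_derivative_at_withinI)
  next
    fix q assume "q \<in> ball p \<rho>"
    then show "(\<lambda>t. f (q + E t *s v) / E t) integrable_on cbox 0 1"
      using cauchy by (auto simp: integrable_on_def)
  qed (use \<rho> in auto)
  then have "((\<lambda>q. integral (cbox 0 1) (\<lambda>t. f (q + E t *s v) / E t)) has_derivative
      blinfun_apply (integral (cbox 0 1) (fx p))) (at p)"
    using \<rho> by (simp add: at_within_open[of p "ball p \<rho>"])
  then have D: "((\<lambda>q. df q v) has_derivative blinfun_apply (integral (cbox 0 1) (fx p))) (at p)"
    by (rule has_derivative_transform_within_open[of _ _ _ _ "ball p \<rho>"])
       (use \<rho> cauchy in \<open>auto simp: integral_unique\<close>)
  \<comment> \<open>Complex linearity of the second derivative: the integrand is complex linear in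
    h, and evaluation at h commutes with the integral.\<close>
  have "blinfun_apply (integral (cbox 0 1) (fx p)) (c *s h) = c * blinfun_apply (integral (cbox 0 1) (fx p)) h" for c h
  proof -
    have pb: "p \<in> ball p \<rho>" using \<rho> by simp
    have cp: "continuous_on (cbox 0 1) (fx p)"
      using continuous_on_compose2[OF cont, of "cbox 0 1" "\<lambda>t. (p,t)"] \<rho>(1)
      by (simp add: image_subset_iff continuous_on_Pair)
    then have int: "fx p integrable_on cbox 0 1" by (rule integrable_continuous)
    have *: "blinfun_apply (integral (cbox 0 1) (fx p)) h = integral (cbox 0 1) (\<lambda>t. blinfun_apply (fx p t) h)" for h
      using integral_linear[OF int bounded_linear_apply_blinfun[of h]] by (simp add: o_def)
    show ?thesis
      unfolding * fx[OF pb] using \<rho> f[OF inS[OF pb]]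
      by (simp add: complex_diff_at_derivative(2) flip: integral_mult_right)
  qed
  with D show ?thesis unfolding complex_diff_at_def by blast
qed

end

lemma hol_fun_frechet_derivative:
  "open S \<Longrightarrow> hol_fun S f \<Longrightarrow> hol_fun S (\<lambda>q. frechet_derivative f (at q) v)"
  using complex_diff_at_frechet_derivative[of S f] by (simp add: hol_fun_open)

lemma hol_fun_frechet_blinfun:
  fixes f :: "complex^'n \<Rightarrow> complex^'m"
  assumes "open S" "hol_map S f"
  shows "continuous_on S (\<lambda>q. Blinfun (frechet_derivative f (at q)))"
proof (rule continuous_on_blinfun_componentwise)
  fix i :: "complex^'n"
  have "continuous_on S (\<lambda>q. \<chi> j. frechet_derivative (\<lambda>p. f p $ j) (at q) i)"
    by (intro continuous_on_vec_lambda hol_fun_continuous_on hol_fun_frechet_derivative)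
       (use assms in \<open>auto simp: hol_map_def\<close>)
  then show "continuous_on S (\<lambda>q. blinfun_apply (Blinfun (frechet_derivative f (at q))) i)"
  proof (rule continuous_on_eq)
    fix q assume "q \<in> S"
    then show "(\<chi> j. frechet_derivative (\<lambda>p. f p $ j) (at q) i) = blinfun_apply (Blinfun (frechet_derivative f (at q))) i"
      using has_derivative_bounded_linear[OF hol_map_derivative(1)[OF assms(2,1)]]
        hol_map_derivative(3)[OF assms(2,1)]
      by (simp add: bounded_linear_Blinfun_apply vec_eq_iff)
  qed
qed

text \<open>The real inverse function theorem gives a differentiable local inverse, and its
  derivative is the inverse of a complex linear map, hence complex linear. Injectivity of the
  derivative suffices because source and target have equal dimension.\<close>

lemma hol_inverse_function:
  fixes f :: "complex^'n \<Rightarrow> complex^'n"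
  assumes S: "open S" "hol_map S f" "p \<in> S"
    and inj: "\<And>v. frechet_derivative f (at p) v = 0 \<Longrightarrow> v = 0"
  obtains U V g where "open U" "U \<subseteq> S" "p \<in> U" "open V" "homeomorphism U V f g" "hol_map V g"
proof -
  let ?f' = "\<lambda>q. Blinfun (frechet_derivative f (at q))"
  have bl: "bounded_linear (frechet_derivative f (at q))" if "q \<in> S" for q
    using has_derivative_bounded_linear[OF hol_map_derivative(1)[OF S(2,1) that]] .
  have app: "blinfun_apply (?f' q) = frechet_derivative f (at q)" if "q \<in> S" for q
    using bl[OF that] by (simp add: bounded_linear_Blinfun_apply)
  have lin: "linear (frechet_derivative f (at p))" using bl[OF S(3)] by (rule bounded_linear.linear)
  then have "inj (frechet_derivative f (at p))"
    using inj by (simp add: linear_injective_0)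
  then obtain h where h: "linear h" "h \<circ> frechet_derivative f (at p) = id"
    using linear_injective_left_inverse[OF lin] by blast
  have "Blinfun h o\<^sub>L ?f' p = id_blinfun"
    by (rule blinfun_eqI) (use h app[OF S(3)] in
        \<open>simp add: bounded_linear_Blinfun_apply linear_conv_bounded_linear[symmetric] fun_eq_iff\<close>)
  then obtain U V g g' where U: "open U" "U \<subseteq> S" "p \<in> U" "open V" "homeomorphism U V f g"
    and g': "\<And>y. y \<in> V \<Longrightarrow> (g has_derivative g' y) (at y)"
    "\<And>y. y \<in> V \<Longrightarrow> g' y = inv (blinfun_apply (?f' (g y)))"
    "\<And>y. y \<in> V \<Longrightarrow> bij (blinfun_apply (?f' (g y)))"
    using inverse_function_theorem[of S f ?f' p "Blinfun h"] S app
      hol_map_derivative(1)[OF S(2,1)] hol_fun_frechet_blinfun[OF S(1,2)] by metis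
  have gy: "g y \<in> S" if "y \<in> V" for y
    using U that unfolding homeomorphism_def by blast
  have "hol_map V g"
    unfolding hol_map_def hol_fun_open[OF U(4)]
  proof (intro allI ballI)
    fix i y assume y: "y \<in> V"
    let ?d = "frechet_derivative f (at (g y))"
    have "g' y (c *s v) = c *s g' y v" for c v
    proof -
      have "?d (g' y (c *s v)) = ?d (c *s g' y v)"
        using g'(2)[OF y] g'(3)[OF y] app[OF gy[OF y]] hol_map_derivative(2)[OF S(2,1) gy[OF y]]
        by (simp add: bij_is_surj surj_f_inv_f)
      then show ?thesis
        using g'(3)[OF y] app[OF gy[OF y]] by (metis bij_is_inj injD)
    qed
    then show "complex_diff_at (\<lambda>p. g p $ i) y"
      unfolding complex_diff_at_def
      using has_derivative_vec_nth[OF g'(1)[OF y], of i] by (intro exI[of _ "\<lambda>h. g' y h $ i"]) auto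
  qed
  then show ?thesis using that U by blast
qed

text \<open>No chart of T is needed beforehand. The map \<open>\<pi> (F q)\<close> has a local
  inverse g by the inverse function theorem; since \<pi> is injective on T near \<open>F p\<close>,
  the local inverse of F is g after \<pi>, the restriction of a holomorphic map of the ambient
  space. The same injectivity makes the image relatively open in T.\<close>

lemma local_parametrization:
  fixes F :: "complex^'n \<Rightarrow> complex^'k" and \<pi> :: "complex^'k \<Rightarrow> complex^'n"
  assumes F: "hol_map UNIV F" "range F \<subseteq> T" and \<pi>: "hol_map UNIV \<pi>"
    and inj: "\<And>v. frechet_derivative (\<lambda>q. \<pi> (F q)) (at p) v = 0 \<Longrightarrow> v = 0"
    and Q: "open Q" "F p \<in> Q" "inj_on \<pi> (T \<inter> Q)"
  shows "\<exists>N. openin (top_of_set UNIV) N \<and> p \<in> N \<and> inj_on F N \<and> openin (top_of_set T) (F ` N) \<and>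
        hol_map N F \<and> hol_map (F ` N) (inv_into N F)"
proof -
  let ?S = "F -` Q"
  have S: "open ?S"
    by (rule open_vimage[OF Q(1) hol_map_continuous_on[OF F(1)]])
  have h: "hol_map ?S (\<lambda>q. \<pi> (F q))"
    by (rule hol_map_subset[OF hol_map_compose[OF F(1) \<pi>]]) auto
  obtain U V g where U: "open U" "U \<subseteq> ?S" "p \<in> U" "open V" "homeomorphism U V (\<lambda>q. \<pi> (F q)) g" "hol_map V g"
    using hol_inverse_function[OF S h _ inj] Q(2) by (metis vimageI)
  have g: "g (\<pi> (F q)) = q" "\<pi> (F q) \<in> V" if "q \<in> U" for q
    using U(5) that unfolding homeomorphism_def by auto
  have g2: "g y \<in> U" "\<pi> (F (g y)) = y" if "y \<in> V" for y
    using U(5) that unfolding homeomorphism_def by auto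
  have injF: "inj_on F U" by (rule inj_on_inverseI[of _ "\<lambda>t. g (\<pi> t)"]) (use g in auto)
  \<comment> \<open>A point t of T near \<open>F p\<close> is attained: t and
    \<open>F (g (\<pi> t))\<close> have the same projection and both lie where \<pi> is
    injective.\<close>
  have img: "F ` U = T \<inter> (Q \<inter> \<pi> -` V)"
  proof (intro equalityI subsetI)
    fix t assume t: "t \<in> T \<inter> (Q \<inter> \<pi> -` V)"
    then have "g (\<pi> t) \<in> U" "\<pi> (F (g (\<pi> t))) = \<pi> t" using g2 by auto
    moreover then have "F (g (\<pi> t)) \<in> T \<inter> Q" using F(2) U(2) by auto
    ultimately have "F (g (\<pi> t)) = t" using Q(3) t by (auto dest: inj_onD)
    then show "t \<in> F ` U" using \<open>g (\<pi> t) \<in> U\<close> by (metis imageI)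
  qed (use F(2) U(2) g in auto)
  have o: "open (Q \<inter> \<pi> -` V)"
    using open_vimage[OF U(4) hol_map_continuous_on[OF \<pi>]] Q(1) by (simp add: open_Int)
  have "hol_map (F ` U) (\<lambda>t. g (\<pi> t))"
    by (rule hol_map_compose[OF hol_map_subset[OF \<pi>] U(6)]) (use img in auto)
  moreover have "inv_into U F t = g (\<pi> t)" if "t \<in> F ` U" for t
    using that injF g by auto
  ultimately have "hol_map (F ` U) (inv_into U F)"
    using hol_map_cong by metis
  moreover have "openin (top_of_set T) (F ` U)"
    unfolding img using o by (simp add: openin_open_Int)
  ultimately show ?thesis
    using U(1,3) injF hol_map_subset[OF F(1), of U] by (intro exI[of _ U]) auto
qed

lemma vector_4 [simp]:
  "(vector [x,y,z,w] :: ('a::zero)^4) $ 1 = x"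
  "(vector [x,y,z,w] :: ('a::zero)^4) $ 2 = y"
  "(vector [x,y,z,w] :: ('a::zero)^4) $ 3 = z"
  "(vector [x,y,z,w] :: ('a::zero)^4) $ 4 = w"
  unfolding vector_def by simp_all

lemma vector_eta [simp]:
  "vector [v $ 1, v $ 2] = (v :: 'a::zero^2)"
  "vector [v' $ 1, v' $ 2, v' $ 3] = (v' :: 'a::zero^3)"
  "vector [v'' $ 1, v'' $ 2, v'' $ 3, v'' $ 4] = (v'' :: 'a::zero^4)"
  by (simp_all add: vec_eq_iff forall_2 forall_3 forall_4)

lemma vector_eq_iff [simp]:
  "vector [a, b] = (vector [a', b'] :: 'a::zero^2) \<longleftrightarrow> a = a' \<and> b = b'"
  "vector [a, b, c] = (vector [a', b', c'] :: 'a::zero^3) \<longleftrightarrow> a = a' \<and> b = b' \<and> c = c'"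
  "vector [a, b, c, d] = (vector [a', b', c', d'] :: 'a::zero^4) \<longleftrightarrow> a = a' \<and> b = b' \<and> c = c' \<and> d = d'"
  by (auto simp: vec_eq_iff forall_2 forall_3 forall_4)

subsection \<open>Submanifolds\<close>

lemma submanifold_chartsD:
  assumes "(D, \<phi>) \<in> submanifold_charts T"
  shows "openin (top_of_set T) D" "D \<subseteq> T" "inj_on \<phi> D" "open (\<phi> ` D)" "hol_map D \<phi>"
    "hol_map (\<phi> ` D) (inv_into D \<phi>)"
  using assms openin_imp_subset[of "top_of_set T" D] unfolding submanifold_charts_def
  by (auto dest: openin_imp_subset)

lemma submanifold_transition:
  assumes "(D, \<phi>) \<in> submanifold_charts T" "(D', \<psi>) \<in> submanifold_charts T"
  shows "hol_map (\<phi> ` (D \<inter> D')) (\<lambda>t. \<psi> (inv_into D \<phi> t))"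
proof (rule hol_map_compose[of _ "inv_into D \<phi>" D' \<psi>])
  show "hol_map (\<phi> ` (D \<inter> D')) (inv_into D \<phi>)"
    by (rule hol_map_subset[OF submanifold_chartsD(6)[OF assms(1)]]) auto
  show "hol_map D' \<psi>" by (rule submanifold_chartsD[OF assms(2)])
  show "inv_into D \<phi> ` \<phi> ` (D \<inter> D') \<subseteq> D'"
    using submanifold_chartsD(3)[OF assms(1)] by (auto simp: inv_into_f_f)
qed

lemma submanifold_chart_homeo:
  assumes "(D, \<phi>) \<in> submanifold_charts T"
  shows "homeomorphic_maps (top_of_set D) (top_of_set (\<phi> ` D)) \<phi> (inv_into D \<phi>)"
  using submanifold_chartsD(3)[OF assms]
    hol_map_continuous_on[OF submanifold_chartsD(5)[OF assms]]
    hol_map_continuous_on[OF submanifold_chartsD(6)[OF assms]]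
  by (auto simp: homeomorphic_maps_def f_inv_into_f inv_into_f_f inv_into_into)

lemma second_countable_euclidean: "second_countable (euclidean :: 'a::second_countable_topology topology)"
proof -
  obtain B :: "'a set set" where B: "countable B" "\<And>C. C \<in> B \<Longrightarrow> open C"
    "\<And>S. open S \<Longrightarrow> \<exists>U. U \<subseteq> B \<and> S = \<Union>U"
    using univ_second_countable by blast
  have "\<exists>V\<in>B. x \<in> V \<and> V \<subseteq> U" if U: "open U" "x \<in> U" for U x
  proof -
    obtain \<U> where "\<U> \<subseteq> B" "U = \<Union>\<U>" using B(3)[OF U(1)] by blast
    then show ?thesis using U(2) by blast
  qed
  then show ?thesis unfolding second_countable_def using B(1,2) by (intro exI[of _ B]) simp
qed

lemma complex_manifold_submanifold:
  assumes "\<And>t. t \<in> T \<Longrightarrow> \<exists>(D,\<phi>)\<in>(submanifold_charts T :: (complex^'k, 'n::finite) chart set). t \<in> D"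
  shows "complex_manifold (top_of_set T) (submanifold_charts T :: (complex^'k, 'n) chart set)"
  unfolding complex_manifold_def complex_atlas_def
proof (intro conjI)
  show "Hausdorff_space (top_of_set T)"
    by (simp add: Hausdorff_space_subtopology)
  show "second_countable (top_of_set T)"
    by (simp add: second_countable_subtopology second_countable_euclidean)
  show "(\<Union>(D,\<phi>)\<in>(submanifold_charts T :: (complex^'k, 'n) chart set). D) = topspace (top_of_set T)"
    using assms submanifold_chartsD(2) by fastforce
  show "\<forall>(D, \<phi>)\<in>(submanifold_charts T :: (complex^'k, 'n) chart set). openin (top_of_set T) D \<and> open (\<phi> ` D) \<and>
     homeomorphic_map (subtopology (top_of_set T) D) (top_of_set (\<phi> ` D)) \<phi>"
  proof clarify
    fix D \<phi> assume c: "(D, \<phi>) \<in> (submanifold_charts T :: (complex^'k, 'n) chart set)"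
    show "openin (top_of_set T) D \<and> open (\<phi> ` D) \<and>
     homeomorphic_map (subtopology (top_of_set T) D) (top_of_set (\<phi> ` D)) \<phi>"
      using submanifold_chartsD[OF c] submanifold_chart_homeo[OF c]
      by (auto simp: subtopology_subtopology inf_absorb2 homeomorphic_map_maps)
  qed
  show "\<forall>(D, \<phi>)\<in>(submanifold_charts T :: (complex^'k, 'n) chart set). \<forall>(D', \<psi>)\<in>submanifold_charts T.
     hol_map (\<phi> ` (D \<inter> D')) (\<psi> \<circ> inv_into D \<phi>)"
    using submanifold_transition by (auto simp: o_def)
qed

text \<open>A local inverse of f is a coordinate map, and f itself is then the inverse of that
  chart.\<close>

lemma charts_of_locally_biholomorphic:
  fixes f :: "complex^'n \<Rightarrow> complex^'k"
  assumes "locally_biholomorphic f UNIV T" "f ` UNIV = T" "t \<in> T"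
  shows "\<exists>D \<phi>. (D, \<phi>) \<in> (submanifold_charts T :: (complex^'k, 'n) chart set) \<and> t \<in> D \<and> (\<forall>q\<in>D. f (\<phi> q) = q)"
proof -
  obtain p where p: "t = f p" using assms by auto
  obtain N where N: "openin (top_of_set UNIV) N" "p \<in> N" "inj_on f N" "openin (top_of_set T) (f ` N)"
    "hol_map N f" "hol_map (f ` N) (inv_into N f)"
    using assms(1) unfolding locally_biholomorphic_def by blast
  have img: "inv_into N f ` f ` N = N"
    using N(3) by (force simp: image_def inv_into_f_f)
  have inv: "inv_into (f ` N) (inv_into N f) q = f q" if "q \<in> N" for q
    using that N(3) by (metis image_eqI inj_on_inv_into inv_into_f_f subset_refl)
  have "(f ` N, inv_into N f) \<in> submanifold_charts T"
    unfolding submanifold_charts_def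
    using N img inj_on_inv_into[of "f ` N" f N] hol_map_cong[OF N(5), of "inv_into (f ` N) (inv_into N f)"] inv
    by auto
  then show ?thesis using p N(2) by (intro exI[of _ "f ` N"] exI[of _ "inv_into N f"]) (auto simp: f_inv_into_f)
qed

lemma hol_map_vector2:
  "hol_map S (\<lambda>p. vector [f p, g p] :: complex^2) \<longleftrightarrow> hol_fun S f \<and> hol_fun S g"
  by (simp add: hol_map_def forall_2)

lemma hol_map_vector3:
  "hol_map S (\<lambda>p. vector [f p, g p, h p] :: complex^3) \<longleftrightarrow> hol_fun S f \<and> hol_fun S g \<and> hol_fun S h"
  by (simp add: hol_map_def forall_3)

lemma hol_fun_UNIV: "(\<And>p. complex_diff_at f p) \<Longrightarrow> hol_fun S f"
  by (rule hol_fun_of_complex_diff[of UNIV]) auto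

subsection \<open>The surface and Painleve's coordinates\<close>

lemma M_iff: "q \<in> M z \<longleftrightarrow> (q $ 2)^2 = q $ 1 * (q $ 3)^4 + 2 * z * (q $ 3)^3 + 4 * q $ 3"
  by (simp add: M_def Let_def)

lemma invariants_nth [simp]:
  "invariants z q $ 1 = q $ 1 * (q $ 1 * (q $ 2)^6 - z * (q $ 2)^4 - 4) + (q $ 2)^2 * z^2 / 4"
  "invariants z q $ 2 = q $ 1 * (q $ 2)^7 - z * (q $ 2)^5 / 2 - 2 * q $ 2"
  "invariants z q $ 3 = (q $ 2)^2"
  by (simp_all add: invariants_def Let_def)

lemma painleve_coords_nth [simp]:
  "painleve_coords z q $ 1 = q $ 1 * (q $ 2)^3 - 2 / (q $ 2)^3 - z * q $ 2 / 2 - (q $ 2)^2 / 2"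
  "painleve_coords z q $ 2 = 1 / (q $ 2)^2"
  by (simp_all add: painleve_coords_def Let_def)

lemma Z2_act_nth [simp]:
  "Z2_act z q $ 1 = - q $ 1 + z / (q $ 2)^2 + 4 / (q $ 2)^6"
  "Z2_act z q $ 2 = - q $ 2"
  by (simp_all add: Z2_act_def Let_def)

lemma vec2_eq_iff: "(p :: 'a^2) = q \<longleftrightarrow> p $ 1 = q $ 1 \<and> p $ 2 = q $ 2"
  by (simp add: vec_eq_iff forall_2)

lemma vec3_eq_iff: "(p :: 'a^3) = q \<longleftrightarrow> p $ 1 = q $ 1 \<and> p $ 2 = q $ 2 \<and> p $ 3 = q $ 3"
  by (simp add: vec_eq_iff forall_3)

lemma vec4_eq_iff: "(p :: 'a^4) = q \<longleftrightarrow> p $ 1 = q $ 1 \<and> p $ 2 = q $ 2 \<and> p $ 3 = q $ 3 \<and> p $ 4 = q $ 4"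
  by (simp add: vec_eq_iff forall_4)

lemma Z2_act_involution: "q $ 2 \<noteq> 0 \<Longrightarrow> Z2_act z (Z2_act z q) = q"
  by (simp add: vec2_eq_iff)

lemma painleve_coords_Z2_act: "q $ 2 \<noteq> 0 \<Longrightarrow> painleve_coords z (Z2_act z q) = painleve_coords z q"
  by (simp add: vec2_eq_iff field_simps power_numeral_reduce)

text \<open>The value y determines w up to sign, and for fixed w the value x is affine in u with the
  nonzero slope \<open>w^3\<close>. A change of sign is undone by the action.\<close>

lemma painleve_coords_eq_iff:
  assumes q: "q $ 2 \<noteq> 0" "q' $ 2 \<noteq> 0"
  shows "painleve_coords z q = painleve_coords z q' \<longleftrightarrow> (q, q') \<in> Z2_rel z"
proof
  assume L: "painleve_coords z q = painleve_coords z q'"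
  then have "(q $ 2)^2 = (q' $ 2)^2" using q by (simp add: vec2_eq_iff field_simps)
  then consider "q' $ 2 = q $ 2" | "q' $ 2 = - q $ 2" by (metis power2_eq_iff)
  then show "(q, q') \<in> Z2_rel z"
  proof cases
    case 1
    then have "q' = q" using L q by (simp add: vec2_eq_iff)
    then show ?thesis by (simp add: Z2_rel_def)
  next
    case 2
    have "painleve_coords z (Z2_act z q) = painleve_coords z q'"
      using L painleve_coords_Z2_act[OF q(1)] by simp
    then have "q' = Z2_act z q" using 2 q by (simp only: vec2_eq_iff painleve_coords_nth Z2_act_nth) simp
    then show ?thesis using q by (simp add: Z2_rel_def)
  qed
next
  assume "(q, q') \<in> Z2_rel z"
  then show "painleve_coords z q = painleve_coords z q'"
    using painleve_coords_Z2_act q by (auto simp: Z2_rel_def)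
qed

lemma invariants_in_M: "invariants z q \<in> M z"
  by (simp add: M_iff field_simps power2_eq_square power_numeral_reduce)

text \<open>For \<open>W \<noteq> 0\<close> a square root w of W is chosen and u is solved from V;
  then U is right automatically, because the equation of \<open>M z\<close> determines it from V and
  W. On \<open>W = 0\<close> that equation gives \<open>V = 0\<close>, and there
  \<open>U = - 4 * u\<close>.\<close>

lemma invariants_surj:
  assumes "q \<in> M z" shows "\<exists>p. invariants z p = q"
proof (cases "q $ 3 = 0")
  case True
  then have "q $ 2 = 0" using assms by (simp add: M_iff)
  then show ?thesis using True
    by (intro exI[of _ "vector [- q $ 1 / 4, 0]"]) (simp add: vec3_eq_iff)
next
  case False
  define w where "w = csqrt (q $ 3)"
  have w: "w^2 = q $ 3" "w \<noteq> 0" using False by (auto simp: w_def)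
  define u where "u = (q $ 2 + z * w^5 / 2 + 2 * w) / w^7"
  have u: "u * w^7 = q $ 2 + z * w^5 / 2 + 2 * w" using w by (simp add: u_def)
  have "(q $ 2)^2 = (u * (u * w^6 - z * w^4 - 4) + w^2 * z^2 / 4) * w^8 + 2 * z * w^6 + 4 * w^2"
  proof -
    have "q $ 2 = u * w^7 - z * w^5 / 2 - 2 * w" using u by simp
    then show ?thesis by (simp only:) (simp add: field_simps power2_eq_square power_numeral_reduce)
  qed
  moreover have "(q $ 2)^2 = q $ 1 * w^8 + 2 * z * w^6 + 4 * w^2"
    using assms unfolding M_iff w(1)[symmetric] by algebra
  ultimately have "q $ 1 = u * (u * w^6 - z * w^4 - 4) + w^2 * z^2 / 4" using w by simp
  then show ?thesis using u w
    by (intro exI[of _ "vector [u, w]"]) (simp add: vec3_eq_iff)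
qed

lemma range_invariants: "range (invariants z) = M z"
  using invariants_in_M invariants_surj by (auto simp: image_iff) metis

lemma invariants_Z2_act: "q $ 2 \<noteq> 0 \<Longrightarrow> invariants z (Z2_act z q) = invariants z q"
  by (simp add: vec3_eq_iff field_simps power_numeral_reduce power2_eq_square)

text \<open>For \<open>w \<noteq> 0\<close> the coordinate u can be read off from V, where its
  coefficient is \<open>w^7\<close>. At \<open>w = 0\<close> only U sees it, as
  \<open>- 4 * u\<close>, so nothing is identified there, in agreement with
  \<open>Z2_rel\<close>.\<close>

lemma invariants_eq_iff: "invariants z q = invariants z q' \<longleftrightarrow> (q, q') \<in> Z2_rel z"
proof
  assume L: "invariants z q = invariants z q'"
  then have "(q $ 2)^2 = (q' $ 2)^2" by (simp add: vec3_eq_iff)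
  then consider "q' $ 2 = q $ 2" | "q' $ 2 = - q $ 2" "q $ 2 \<noteq> 0" by (metis power2_eq_iff neg_equal_0_iff_equal)
  then show "(q, q') \<in> Z2_rel z"
  proof cases
    case 1
    then have "q' $ 1 = q $ 1" using L by (cases "q $ 2 = 0") (auto simp: vec3_eq_iff)
    then have "q' = q" using 1 by (simp add: vec2_eq_iff)
    then show ?thesis by (simp add: Z2_rel_def)
  next
    case 2
    have "invariants z (Z2_act z q) = invariants z q'"
      using L invariants_Z2_act[OF 2(2)] by simp
    then have "q' = Z2_act z q" using 2 by (simp only: vec2_eq_iff vec3_eq_iff invariants_nth Z2_act_nth) simp
    then show ?thesis using 2 by (simp add: Z2_rel_def)
  qed
next
  assume "(q, q') \<in> Z2_rel z"
  then show "invariants z q = invariants z q'"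
    using invariants_Z2_act by (auto simp: Z2_rel_def)
qed

lemma equiv_Z2_rel: "equiv UNIV (Z2_rel z)"
  unfolding equiv_def refl_on_def sym_def trans_def
  by (auto simp: invariants_eq_iff[symmetric])

text \<open>Parametrizes the hypersurface \<open>total_M\<close> by (u, w, z), so that the total
  space of the bundle gets its charts in the same way as a single fibre.\<close>

definition total_invariants :: "complex^3 \<Rightarrow> complex^4" where
  "total_invariants r = (let i = invariants (r $ 3) (vector [r $ 1, r $ 2]) in vector [i $ 1, i $ 2, i $ 3, r $ 3])"

lemma total_M_iff: "q \<in> total_M \<longleftrightarrow> (q $ 2)^2 = q $ 1 * (q $ 3)^4 + 2 * q $ 4 * (q $ 3)^3 + 4 * q $ 3"
  by (simp add: total_M_def M_iff)

lemma total_invariants_nth [simp]: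
  "total_invariants r $ 1 = r $ 1 * (r $ 1 * (r $ 2)^6 - r $ 3 * (r $ 2)^4 - 4) + (r $ 2)^2 * (r $ 3)^2 / 4"
  "total_invariants r $ 2 = r $ 1 * (r $ 2)^7 - r $ 3 * (r $ 2)^5 / 2 - 2 * r $ 2"
  "total_invariants r $ 3 = (r $ 2)^2"
  "total_invariants r $ 4 = r $ 3"
  by (simp_all add: total_invariants_def Let_def)

lemma range_total_invariants: "range total_invariants = total_M"
proof
  show "range total_invariants \<subseteq> total_M"
    unfolding total_M_def total_invariants_def Let_def using invariants_in_M by (auto simp del: invariants_nth)
  show "total_M \<subseteq> range total_invariants"
  proof
    fix q assume "q \<in> total_M"
    then obtain p where p: "invariants (q $ 4) p = vector [q $ 1, q $ 2, q $ 3]"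
      unfolding total_M_def using invariants_surj by blast
    have "total_invariants (vector [p $ 1, p $ 2, q $ 4]) = q"
      unfolding total_invariants_def Let_def by (simp add: p del: invariants_nth)
    then show "q \<in> range total_invariants" by (metis rangeI)
  qed
qed

lemma hol_map_invariants: "hol_map S (invariants z)"
  unfolding hol_map_def forall_3 invariants_nth
  by (intro conjI hol_fun_UNIV complex_diff_at_intros) auto

lemma hol_map_total_invariants: "hol_map S total_invariants"
  unfolding hol_map_def forall_4 total_invariants_nth
  by (intro conjI hol_fun_UNIV complex_diff_at_intros) auto

text \<open>Near \<open>W = 0\<close> the equation of the surface has W-derivative close to 4, so
  (U, V) determine W. Dividing the difference of the two sides by \<open>W - W'\<close> leaves 4
  plus terms bounded by 4 R e and 6 R e; this is the origin of
  \<open>10 * R * e < 4\<close>.\<close>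

lemma M_root_unique:
  fixes U z W W' :: complex
  assumes eq: "U * W^4 + 2 * z * W^3 + 4 * W = U * W'^4 + 2 * z * W'^3 + 4 * W'"
    and U: "norm U \<le> R" and z: "norm z \<le> R" and W: "norm W \<le> e" "norm W' \<le> e" and e: "e \<le> 1" "10 * R * e < 4"
  shows "W = W'"
proof (rule ccontr)
  assume ne: "W \<noteq> W'"
  have R: "0 \<le> R" using U norm_ge_zero order.trans by blast
  have e0: "0 \<le> e" using W norm_ge_zero order.trans by blast
  have "(W - W') * (U * ((W + W') * (W^2 + W'^2)) + 2 * z * (W^2 + W * W' + W'^2) + 4) = 0"
    using eq by algebra
  then have 4: "U * ((W + W') * (W^2 + W'^2)) + 2 * z * (W^2 + W * W' + W'^2) = - 4"
    using ne by (simp add: add_eq_0_iff2)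
  have e2: "e^2 \<le> e" using e e0 by (simp add: power2_eq_square mult_left_le)
  have W2: "norm (W^2) \<le> e" "norm (W'^2) \<le> e" "norm (W * W') \<le> e"
    using W e0 e2 power_mono[OF W(1), of 2] power_mono[OF W(2), of 2] mult_mono[OF W(1) W(2)]
    by (auto simp: norm_power norm_mult power2_eq_square)
  have "norm ((W + W') * (W^2 + W'^2)) \<le> 2 * (2 * e)"
    unfolding norm_mult
    by (intro mult_mono norm_triangle_le) (use W W2 e e0 in auto)
  then have "norm (U * ((W + W') * (W^2 + W'^2))) \<le> R * (4 * e)"
    unfolding norm_mult[of U] using U R by (intro mult_mono) auto
  moreover have "norm (W^2 + W * W' + W'^2) \<le> 3 * e"
    using W2 norm_triangle_ineq[of "W^2 + W * W'" "W'^2"] norm_triangle_ineq[of "W^2" "W * W'"] by linarith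
  then have "norm (2 * z * (W^2 + W * W' + W'^2)) \<le> (2 * R) * (3 * e)"
    unfolding norm_mult[of "2 * z"] using z R by (intro mult_mono) (auto simp: norm_mult)
  ultimately have "norm (U * ((W + W') * (W^2 + W'^2)) + 2 * z * (W^2 + W * W' + W'^2)) < 4"
    using norm_triangle_ineq[of "U * ((W + W') * (W^2 + W'^2))" "2 * z * (W^2 + W * W' + W'^2)"] e(2) by linarith
  then show False unfolding 4 by simp
qed

lemma frechet_derivative_vec:
  fixes f :: "complex^'n \<Rightarrow> complex^'m"
  assumes "\<And>i. ((\<lambda>x. f x $ i) has_derivative (\<lambda>h. f' h $ i)) (at x)"
  shows "frechet_derivative f (at x) = f'"
  using frechet_derivative_at[OF has_derivative_vecI[OF assms]] by simp

lemma has_derivative_nth [derivative_intros]: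
  "(f has_derivative f') F \<Longrightarrow> ((\<lambda>x. f x $ i) has_derivative (\<lambda>h. f' h $ i)) F"
  by (rule has_derivative_vec_nth)

lemma invariants_derivative:
  "frechet_derivative (invariants z) (at p) v = vector
    [v $ 1 * (2 * p $ 1 * (p $ 2)^6 - z * (p $ 2)^4 - 4) +
       v $ 2 * (p $ 1 * (6 * p $ 1 * (p $ 2)^5 - 4 * z * (p $ 2)^3) + p $ 2 * z^2 / 2),
     v $ 1 * (p $ 2)^7 + v $ 2 * (7 * p $ 1 * (p $ 2)^6 - 5 * z * (p $ 2)^4 / 2 - 2),
     2 * p $ 2 * v $ 2]" (is "_ = ?d v")
proof -
  have "((\<lambda>x. invariants z x $ i) has_derivative (\<lambda>h. ?d h $ i)) (at p)" for i
  proof -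
    consider "i = 1" | "i = 2" | "i = 3" using exhaust_3 by blast
    then show ?thesis
      by cases (auto intro!: derivative_eq_intros simp: fun_eq_iff algebra_simps power_numeral_reduce)
  qed
  then show ?thesis by (subst frechet_derivative_vec[where f' = ?d]) auto
qed

lemma total_invariants_derivative:
  "frechet_derivative total_invariants (at p) v = vector
    [v $ 1 * (2 * p $ 1 * (p $ 2)^6 - p $ 3 * (p $ 2)^4 - 4) +
       v $ 2 * (p $ 1 * (6 * p $ 1 * (p $ 2)^5 - 4 * p $ 3 * (p $ 2)^3) + p $ 2 * (p $ 3)^2 / 2)
       + v $ 3 * ((p $ 2)^2 * p $ 3 / 2 - p $ 1 * (p $ 2)^4),
     v $ 1 * (p $ 2)^7 + v $ 2 * (7 * p $ 1 * (p $ 2)^6 - 5 * p $ 3 * (p $ 2)^4 / 2 - 2) - v $ 3 * (p $ 2)^5 / 2,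
     2 * p $ 2 * v $ 2, v $ 3]" (is "_ = ?d v")
proof -
  have "((\<lambda>x. total_invariants x $ i) has_derivative (\<lambda>h. ?d h $ i)) (at p)" for i
  proof -
    consider "i = 1" | "i = 2" | "i = 3" | "i = 4" using exhaust_4 by blast
    then show ?thesis
      by cases (auto intro!: derivative_eq_intros simp: fun_eq_iff algebra_simps power_numeral_reduce)
  qed
  then show ?thesis by (subst frechet_derivative_vec[where f' = ?d]) auto
qed

lemma frechet_derivative_proj2:
  fixes F :: "complex^'n \<Rightarrow> complex^'k"
  assumes "(F has_derivative F') (at p)"
  shows "frechet_derivative (\<lambda>q. vector [F q $ i, F q $ j] :: complex^2) (at p) v = vector [F' v $ i, F' v $ j]"
proof -
  have "((\<lambda>x. vector [F x $ i, F x $ j] $ l) has_derivative (\<lambda>h. (vector [F' h $ i, F' h $ j] :: complex^2) $ l)) (at p)" for l :: 2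
    using exhaust_2[of l] has_derivative_vec_nth[OF assms] by auto
  then show ?thesis
    by (subst frechet_derivative_vec[where f' = "\<lambda>v. vector [F' v $ i, F' v $ j]"]) auto
qed

lemma frechet_derivative_proj3:
  fixes F :: "complex^'n \<Rightarrow> complex^'k"
  assumes "(F has_derivative F') (at p)"
  shows "frechet_derivative (\<lambda>q. vector [F q $ i, F q $ j, F q $ k] :: complex^3) (at p) v =
    vector [F' v $ i, F' v $ j, F' v $ k]"
proof -
  have "((\<lambda>x. vector [F x $ i, F x $ j, F x $ k] $ l) has_derivative
      (\<lambda>h. (vector [F' h $ i, F' h $ j, F' h $ k] :: complex^3) $ l)) (at p)" for l :: 3
    using exhaust_3[of l] has_derivative_vec_nth[OF assms] by auto
  then show ?thesis
    by (subst frechet_derivative_vec[where f' = "\<lambda>v. vector [F' v $ i, F' v $ j, F' v $ k]"]) auto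
qed

lemma invariants_has_derivative:
  "(invariants z has_derivative frechet_derivative (invariants z) (at p)) (at p)"
  by (rule hol_map_derivative(1)[OF hol_map_invariants open_UNIV UNIV_I])

lemma total_invariants_has_derivative:
  "(total_invariants has_derivative frechet_derivative total_invariants (at p)) (at p)"
  by (rule hol_map_derivative(1)[OF hol_map_total_invariants open_UNIV UNIV_I])

text \<open>Away from \<open>w = 0\<close> the projection to (V, W) works: its Jacobian is
  \<open>2 * w^8\<close>, up to sign, and U is determined by V and W. At \<open>w = 0\<close> it
  degenerates and (U, V) takes over, with the derivative (-4 v1, -2 v2) up to an additional v2-term
  that vanishes there; \<open>M_root_unique\<close> recovers W.\<close>

lemma locally_biholomorphic_invariants: "locally_biholomorphic (invariants z) UNIV (M z)"
  unfolding locally_biholomorphic_def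
proof
  fix p :: "complex^2"
  have rng: "range (invariants z) \<subseteq> M z" using range_invariants by simp
  show "\<exists>N. openin (top_of_set UNIV) N \<and> p \<in> N \<and> inj_on (invariants z) N \<and>
      openin (top_of_set (M z)) (invariants z ` N) \<and> hol_map N (invariants z) \<and>
      hol_map (invariants z ` N) (inv_into N (invariants z))"
  proof (cases "p $ 2 = 0")
    case False
    let ?\<pi> = "\<lambda>q :: complex^3. vector [q $ 2, q $ 3] :: complex^2"
    let ?Q = "{q :: complex^3. q $ 3 \<noteq> 0}"
    show ?thesis
    proof (rule local_parametrization[OF hol_map_invariants rng, of ?\<pi> p ?Q])
      show "hol_map UNIV ?\<pi>"
        by (simp add: hol_map_vector2 hol_fun_UNIV complex_diff_at_nth)
      show "v = 0" if "frechet_derivative (\<lambda>q. ?\<pi> (invariants z q)) (at p) v = 0" for v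
      proof -
        from that have "v $ 2 = 0" "v $ 1 = 0"
          unfolding frechet_derivative_proj2[OF invariants_has_derivative] invariants_derivative
          using False by (auto simp: vec2_eq_iff)
        then show ?thesis by (simp add: vec2_eq_iff)
      qed
      show "open ?Q" by (intro open_Collect_neq continuous_intros)
      show "invariants z p \<in> ?Q" using False by simp
      show "inj_on ?\<pi> (M z \<inter> ?Q)"
        by (rule inj_onI) (auto simp: M_iff vec3_eq_iff)
    qed
  next
    case True
    let ?\<pi> = "\<lambda>q :: complex^3. vector [q $ 1, q $ 2] :: complex^2"
    \<comment> \<open>At \<open>w = 0\<close> the first invariant is \<open>- 4 * u\<close>, so R
      exceeds both |U| at this point and |z|. With this e the product 10 R e equals 2.\<close>
    define R where "R = norm (4 * p $ 1) + norm z + 1"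
    define e where "e = 1 / (5 * R)"
    have R: "R \<ge> 1" by (simp add: R_def)
    then have e: "0 < e" "e \<le> 1" "10 * R * e < 4" by (auto simp: e_def field_simps)
    let ?Q = "{q :: complex^3. norm (q $ 1) < R \<and> norm (q $ 3) < e}"
    show ?thesis
    proof (rule local_parametrization[OF hol_map_invariants rng, of ?\<pi> p ?Q])
      show "hol_map UNIV ?\<pi>"
        by (simp add: hol_map_vector2 hol_fun_UNIV complex_diff_at_nth)
      show "v = 0" if "frechet_derivative (\<lambda>q. ?\<pi> (invariants z q)) (at p) v = 0" for v
      proof -
        from that have "v $ 2 = 0" "v $ 1 = 0"
          unfolding frechet_derivative_proj2[OF invariants_has_derivative] invariants_derivative
          using True by (auto simp: vec2_eq_iff)
        then show ?thesis by (simp add: vec2_eq_iff)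
      qed
      show "open ?Q" by (intro open_Collect_conj open_Collect_less continuous_intros)
      show "invariants z p \<in> ?Q" using True e by (simp add: R_def norm_mult add_nonneg_pos)
      show "inj_on ?\<pi> (M z \<inter> ?Q)"
      proof (rule inj_onI)
        fix q q' assume q: "q \<in> M z \<inter> ?Q" "q' \<in> M z \<inter> ?Q" "?\<pi> q = ?\<pi> q'"
        have "q $ 3 = q' $ 3"
          using q e by (intro M_root_unique[of "q $ 1" "q $ 3" z "q' $ 3" R e])
            (auto simp: M_iff R_def)
        then show "q = q'" using q(3) by (simp add: vec3_eq_iff)
      qed
    qed
  qed
qed

text \<open>The fourth coordinate is z itself, so both projections of the fibre case are extended by
  it. At \<open>w = 0\<close> the z-derivatives of U and V vanish, and the differential splits into
  that of the fibre and the identity in z.\<close>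

lemma locally_biholomorphic_total_invariants: "locally_biholomorphic total_invariants UNIV total_M"
  unfolding locally_biholomorphic_def
proof
  fix p :: "complex^3"
  have rng: "range total_invariants \<subseteq> total_M" using range_total_invariants by simp
  show "\<exists>N. openin (top_of_set UNIV) N \<and> p \<in> N \<and> inj_on total_invariants N \<and>
      openin (top_of_set total_M) (total_invariants ` N) \<and> hol_map N total_invariants \<and>
      hol_map (total_invariants ` N) (inv_into N total_invariants)"
  proof (cases "p $ 2 = 0")
    case False
    let ?\<pi> = "\<lambda>q :: complex^4. vector [q $ 2, q $ 3, q $ 4] :: complex^3"
    let ?Q = "{q :: complex^4. q $ 3 \<noteq> 0}"
    show ?thesis
    proof (rule local_parametrization[OF hol_map_total_invariants rng, of ?\<pi> p ?Q])
      show "hol_map UNIV ?\<pi>"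
        by (simp add: hol_map_vector3 hol_fun_UNIV complex_diff_at_nth)
      show "v = 0" if "frechet_derivative (\<lambda>q. ?\<pi> (total_invariants q)) (at p) v = 0" for v
      proof -
        from that have "v $ 3 = 0" "v $ 2 = 0" "v $ 1 = 0"
          unfolding frechet_derivative_proj3[OF total_invariants_has_derivative] total_invariants_derivative
          using False by (auto simp: vec3_eq_iff)
        then show ?thesis by (simp add: vec3_eq_iff)
      qed
      show "open ?Q" by (intro open_Collect_neq continuous_intros)
      show "total_invariants p \<in> ?Q" using False by simp
      show "inj_on ?\<pi> (total_M \<inter> ?Q)"
        by (rule inj_onI) (auto simp: total_M_iff vec4_eq_iff)
    qed
  next
    case True
    let ?\<pi> = "\<lambda>q :: complex^4. vector [q $ 1, q $ 2, q $ 4] :: complex^3"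
    define R where "R = norm (4 * p $ 1) + norm (p $ 3) + 1"
    define e where "e = 1 / (5 * R)"
    have R: "R \<ge> 1" by (simp add: R_def)
    then have e: "0 < e" "e \<le> 1" "10 * R * e < 4" by (auto simp: e_def field_simps)
    let ?Q = "{q :: complex^4. norm (q $ 1) < R \<and> norm (q $ 3) < e \<and> norm (q $ 4) < R}"
    show ?thesis
    proof (rule local_parametrization[OF hol_map_total_invariants rng, of ?\<pi> p ?Q])
      show "hol_map UNIV ?\<pi>"
        by (simp add: hol_map_vector3 hol_fun_UNIV complex_diff_at_nth)
      show "v = 0" if "frechet_derivative (\<lambda>q. ?\<pi> (total_invariants q)) (at p) v = 0" for v
      proof -
        from that have "v $ 3 = 0" "v $ 2 = 0" "v $ 1 = 0"
          unfolding frechet_derivative_proj3[OF total_invariants_has_derivative] total_invariants_derivative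
          using True by (auto simp: vec3_eq_iff)
        then show ?thesis by (simp add: vec3_eq_iff)
      qed
      show "open ?Q" by (intro open_Collect_conj open_Collect_less continuous_intros)
      show "total_invariants p \<in> ?Q" using True e by (simp add: R_def norm_mult add_nonneg_pos)
      show "inj_on ?\<pi> (total_M \<inter> ?Q)"
      proof (rule inj_onI)
        fix q q' assume q: "q \<in> total_M \<inter> ?Q" "q' \<in> total_M \<inter> ?Q" "?\<pi> q = ?\<pi> q'"
        have "q $ 3 = q' $ 3"
          using q e by (intro M_root_unique[of "q $ 1" "q $ 3" "q $ 4" "q' $ 3" R e])
            (auto simp: total_M_iff)
        then show "q = q'" using q(3) by (simp add: vec4_eq_iff)
      qed
    qed
  qed
qed

lemma M_charts_cover:
  assumes "q \<in> M z"
  shows "\<exists>D \<phi>. (D, \<phi>) \<in> (submanifold_charts (M z) :: (complex^3, 2) chart set) \<and> q \<in> D"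
  using charts_of_locally_biholomorphic[OF locally_biholomorphic_invariants range_invariants assms] by blast

lemma total_M_charts_cover:
  assumes "q \<in> total_M"
  shows "\<exists>D \<phi>. (D, \<phi>) \<in> (submanifold_charts total_M :: (complex^4, 3) chart set) \<and> q \<in> D \<and>
    (\<forall>q\<in>D. \<phi> q $ 3 = q $ 4)"
proof -
  obtain D and \<phi> :: "complex^4 \<Rightarrow> complex^3" where
    D: "(D, \<phi>) \<in> submanifold_charts total_M" "q \<in> D" "\<And>q. q \<in> D \<Longrightarrow> total_invariants (\<phi> q) = q"
    using charts_of_locally_biholomorphic[OF locally_biholomorphic_total_invariants range_total_invariants assms]
    by blast
  have "\<phi> q $ 3 = q $ 4" if "q \<in> D" for q
    using D(3)[OF that] total_invariants_nth(4)[of "\<phi> q"] by simp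
  then show ?thesis using D by blast
qed

lemma UNIV_chart: "(UNIV, \<lambda>p. p) \<in> submanifold_charts (UNIV :: (complex^'n) set)"
proof -
  have "inv_into UNIV (\<lambda>p :: complex^'n. p) = (\<lambda>p. p)"
    by (rule ext) (simp add: inv_into_f_eq)
  then show ?thesis
    unfolding submanifold_charts_def using hol_map_id[of UNIV] by simp
qed

lemma quotient_surface_M: "quotient_surface (Z2_rel z) (invariants z) (M z)"
  unfolding quotient_surface_def
proof (intro conjI)
  show "equiv UNIV (Z2_rel z)" by (rule equiv_Z2_rel)
  have eq: "Z2_rel z `` {p} = Z2_rel z `` {q} \<longleftrightarrow> invariants z p = invariants z q" for p q
    using eq_equiv_class_iff[OF equiv_Z2_rel] invariants_eq_iff by simp
  define h where "h X = invariants z (SOME p. X = Z2_rel z `` {p})" for X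
  have h: "h (Z2_rel z `` {p}) = invariants z p" for p
  proof -
    have "Z2_rel z `` {p} = Z2_rel z `` {SOME q. Z2_rel z `` {p} = Z2_rel z `` {q}}"
      by (rule someI) (rule refl)
    then show ?thesis unfolding h_def eq by (rule sym)
  qed
  have "bij_betw h (UNIV // Z2_rel z) (M z)"
    unfolding bij_betw_def
  proof
    show "inj_on h (UNIV // Z2_rel z)"
    proof (rule inj_onI)
      fix X Y assume "X \<in> UNIV // Z2_rel z" "Y \<in> UNIV // Z2_rel z" and XY: "h X = h Y"
      then obtain p q where "X = Z2_rel z `` {p}" "Y = Z2_rel z `` {q}"
        by (elim quotientE) blast
      then show "X = Y" using XY h eq by simp
    qed
    show "h ` (UNIV // Z2_rel z) = M z"
    proof
      show "h ` (UNIV // Z2_rel z) \<subseteq> M z"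
      proof
        fix q assume "q \<in> h ` (UNIV // Z2_rel z)"
        then obtain p where "q = h (Z2_rel z `` {p})" by (auto elim!: quotientE)
        then show "q \<in> M z" using h invariants_in_M by simp
      qed
      show "M z \<subseteq> h ` (UNIV // Z2_rel z)"
      proof
        fix q assume "q \<in> M z"
        then obtain p where "invariants z p = q" using invariants_surj by blast
        then show "q \<in> h ` (UNIV // Z2_rel z)"
          by (intro image_eqI[of _ _ "Z2_rel z `` {p}"]) (auto simp: h intro: quotientI)
      qed
    qed
  qed
  then show "\<exists>h. bij_betw h (UNIV // Z2_rel z) (M z) \<and> (\<forall>p. h (Z2_rel z `` {p}) = invariants z p)"
    using h by blast
  show "locally_biholomorphic (invariants z) UNIV (M z)" by (rule locally_biholomorphic_invariants)
  \<comment> \<open>Local biholomorphisms are open maps, and a continuous open surjection is a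
    quotient map.\<close>
  have "open_map euclidean (top_of_set (M z)) (invariants z)"
    unfolding open_map_def
  proof (intro allI impI)
    fix U :: "(complex^2) set" assume U: "openin euclidean U"
    have "\<exists>T. openin (top_of_set (M z)) T \<and> t \<in> T \<and> T \<subseteq> invariants z ` U" if t: "t \<in> invariants z ` U" for t
    proof -
      obtain p where p: "p \<in> U" "t = invariants z p" using t by blast
      obtain N where N: "openin (top_of_set UNIV) N" "p \<in> N" "inj_on (invariants z) N"
        "openin (top_of_set (M z)) (invariants z ` N)" "hol_map (invariants z ` N) (inv_into N (invariants z))"
        using locally_biholomorphic_invariants unfolding locally_biholomorphic_def by blast
      let ?T = "invariants z ` N \<inter> inv_into N (invariants z) -` U"
      have "openin (top_of_set (invariants z ` N)) ?T"
        using continuous_openin_preimage_gen[OF hol_map_continuous_on[OF N(5)]] U by simp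
      then have "openin (top_of_set (M z)) ?T" using N(4) openin_trans by blast
      moreover have "t \<in> ?T" using p N by (simp add: inv_into_f_f)
      moreover have "?T \<subseteq> invariants z ` U" using N(3) by (auto simp: inv_into_f_f)
      ultimately show ?thesis by blast
    qed
    then show "openin (top_of_set (M z)) (invariants z ` U)"
      by (subst openin_subopen) blast
  qed
  moreover have "continuous_map euclidean (top_of_set (M z)) (invariants z)"
    using hol_map_continuous_on[OF hol_map_invariants, of UNIV z] invariants_in_M
    by (simp add: continuous_map_in_subtopology image_subset_iff_funcset[symmetric] image_subset_iff)
  ultimately show "quotient_map euclidean (top_of_set (M z)) (invariants z)"
    using range_invariants by (intro continuous_open_imp_quotient_map) auto
  show "complex_manifold (top_of_set (M z)) (submanifold_charts (M z) :: (complex^3, 2) chart set)"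
    using M_charts_cover by (intro complex_manifold_submanifold) fast
qed

subsection \<open>Gluing two manifolds\<close>

lemma glued_topology_commute: "glued_topology j S k T = glued_topology k T j S"
  by (auto simp: topology_eq openin_glued_topology)

lemma topspace_glued_topology: "topspace (glued_topology j S k T) = j ` S \<union> k ` T"
proof
  show "topspace (glued_topology j S k T) \<subseteq> j ` S \<union> k ` T"
    using openin_topspace[of "glued_topology j S k T"] unfolding openin_glued_topology by blast
  have "{a \<in> S. j a \<in> j ` S \<union> k ` T} = S" "{b \<in> T. k b \<in> j ` S \<union> k ` T} = T" by auto
  then have "openin (glued_topology j S k T) (j ` S \<union> k ` T)" by (simp add: openin_glued_topology)
  then show "j ` S \<union> k ` T \<subseteq> topspace (glued_topology j S k T)" by (rule openin_subset)
qed

lemma continuous_map_glued_topology: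
  assumes "continuous_map (top_of_set S) Y (\<lambda>a. f (j a))" "continuous_map (top_of_set T) Y (\<lambda>b. f (k b))"
  shows "continuous_map (glued_topology j S k T) Y f"
  unfolding continuous_map topspace_glued_topology openin_glued_topology
proof (intro conjI allI impI)
  show "f ` (j ` S \<union> k ` T) \<subseteq> topspace Y"
    using assms by (auto simp: continuous_map)
  fix U assume U: "openin Y U"
  show "{x \<in> j ` S \<union> k ` T. f x \<in> U} \<subseteq> j ` S \<union> k ` T" by auto
  have "{a \<in> S. j a \<in> {x \<in> j ` S \<union> k ` T. f x \<in> U}} = {a \<in> S. f (j a) \<in> U}" by auto
  then show "openin (top_of_set S) {a \<in> S. j a \<in> {x \<in> j ` S \<union> k ` T. f x \<in> U}}"
    using assms(1) U by (auto simp: continuous_map)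
  have "{a \<in> T. k a \<in> {x \<in> j ` S \<union> k ` T. f x \<in> U}} = {a \<in> T. f (k a) \<in> U}" by auto
  then show "openin (top_of_set T) {a \<in> T. k a \<in> {x \<in> j ` S \<union> k ` T. f x \<in> U}}"
    using assms(2) U by (auto simp: continuous_map)
qed

lemma continuous_map_into_glued: "continuous_map (top_of_set S) (glued_topology j S k T) j"
  unfolding continuous_map topspace_glued_topology openin_glued_topology by auto

text \<open>The functions \<alpha> and \<beta> cut out the overlap as the sets where they do not
  vanish, and are reciprocal to each other there; for the fibres they are y and W. The last
  assumption is what makes the glued space Hausdorff.\<close>

locale gluing_data =
  fixes j :: "complex^'k \<Rightarrow> 'c" and S :: "(complex^'k) set"
    and k :: "complex^'l \<Rightarrow> 'c" and T :: "(complex^'l) set"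
    and \<alpha> :: "complex^'k \<Rightarrow> complex" and \<beta> :: "complex^'l \<Rightarrow> complex"
    and t :: "complex^'k \<Rightarrow> complex^'l" and t' :: "complex^'l \<Rightarrow> complex^'k"
  assumes inj_j: "inj_on j S" and inj_k: "inj_on k T"
    and cont_\<alpha>: "continuous_on S \<alpha>" and cont_\<beta>: "continuous_on T \<beta>"
    and hol_t: "hol_map {a \<in> S. \<alpha> a \<noteq> 0} t" and hol_t': "hol_map {b \<in> T. \<beta> b \<noteq> 0} t'"
    and t: "\<And>a. a \<in> S \<Longrightarrow> \<alpha> a \<noteq> 0 \<Longrightarrow> t a \<in> T \<and> \<beta> (t a) \<noteq> 0 \<and> k (t a) = j a"
    and t': "\<And>b. b \<in> T \<Longrightarrow> \<beta> b \<noteq> 0 \<Longrightarrow> t' b \<in> S \<and> \<alpha> (t' b) \<noteq> 0 \<and> j (t' b) = k b"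
    and overlap: "\<And>a b. a \<in> S \<Longrightarrow> b \<in> T \<Longrightarrow> j a = k b \<Longrightarrow> \<alpha> a * \<beta> b = 1"
begin

lemma commute: "gluing_data k T j S \<beta> \<alpha> t' t"
  using gluing_data_axioms unfolding gluing_data_def by (auto simp: mult.commute)

abbreviation "X \<equiv> glued_topology j S k T"

lemma t_mem: "a \<in> S \<Longrightarrow> \<alpha> a \<noteq> 0 \<Longrightarrow> t a \<in> T" using t by blast

lemma t_eq: "a \<in> S \<Longrightarrow> \<alpha> a \<noteq> 0 \<Longrightarrow> k (t a) = j a" using t by blast

lemma t'_mem: "b \<in> T \<Longrightarrow> \<beta> b \<noteq> 0 \<Longrightarrow> t' b \<in> S" using t' by blast

lemma t'_eq: "b \<in> T \<Longrightarrow> \<beta> b \<noteq> 0 \<Longrightarrow> j (t' b) = k b" using t' by blast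

lemma overlap_nonzero: "a \<in> S \<Longrightarrow> b \<in> T \<Longrightarrow> j a = k b \<Longrightarrow> \<alpha> a \<noteq> 0 \<and> \<beta> b \<noteq> 0"
  using overlap by (metis mult_zero_left mult_zero_right zero_neq_one)

lemma j_eq_k_iff:
  assumes ab: "a \<in> S" "b \<in> T"
  shows "j a = k b \<longleftrightarrow> \<alpha> a \<noteq> 0 \<and> b = t a"
proof
  assume "j a = k b"
  note * = ab this
  have \<alpha>: "\<alpha> a \<noteq> 0" using overlap_nonzero[OF *] by simp
  have "k b = k (t a)" using *(3) t[OF ab(1) \<alpha>] by metis
  then have "b = t a" using inj_onD[OF inj_k] t[OF ab(1) \<alpha>] ab(2) by metis
  then show "\<alpha> a \<noteq> 0 \<and> b = t a" using \<alpha> by blast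
next
  assume *: "\<alpha> a \<noteq> 0 \<and> b = t a"
  show "j a = k b" using t[OF ab(1), OF conjunct1[OF *]] * by metis
qed

lemma openin_image_j:
  assumes "openin (top_of_set S) D"
  shows "openin X (j ` D)"
  unfolding openin_glued_topology
proof (intro conjI)
  have D: "D \<subseteq> S" using assms by (auto dest: openin_imp_subset)
  show "j ` D \<subseteq> j ` S \<union> k ` T" using D by auto
  have "{a \<in> S. j a \<in> j ` D} = D" using D inj_on_image_mem_iff[OF inj_j] by auto
  then show "openin (top_of_set S) {a \<in> S. j a \<in> j ` D}" using assms by simp
  let ?T = "{b \<in> T. \<beta> b \<noteq> 0}"
  have oT: "openin (top_of_set T) ?T"
    using continuous_openin_preimage_gen[OF cont_\<beta>, of "- {0}"]
    by (simp add: vimage_def Int_def open_Compl)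
  \<comment> \<open>Only points with \<open>\<beta> b \<noteq> 0\<close> can be identified with a
    point of D, and for those \<open>k b = j (t' b)\<close>.\<close>
  have e: "{b \<in> T. k b \<in> j ` D} = ?T \<inter> t' -` D"
  proof (intro equalityI subsetI)
    fix b assume "b \<in> {b \<in> T. k b \<in> j ` D}"
    then obtain a where a: "b \<in> T" "a \<in> D" "j a = k b" by auto
    then have "\<beta> b \<noteq> 0" using overlap_nonzero[of a b] D by blast
    moreover then have "t' b = a"
      using t'_mem[of b] t'_eq[of b] a D inj_onD[OF inj_j, of "t' b" a] by auto
    ultimately show "b \<in> ?T \<inter> t' -` D" using a by auto
  next
    fix b assume "b \<in> ?T \<inter> t' -` D"
    then have b: "b \<in> T" "\<beta> b \<noteq> 0" "t' b \<in> D" by blast+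
    then show "b \<in> {b \<in> T. k b \<in> j ` D}" using imageI[OF b(3), of j] t'_eq[OF b(1,2)] by simp
  qed
  have o: "openin (top_of_set ?T) (?T \<inter> t' -` D)"
  proof (rule continuous_openin_preimage[OF hol_map_continuous_on[OF hol_t'] _ assms])
    show "t' \<in> ?T \<rightarrow> S" using t'_mem by (intro Pi_I) blast
  qed
  show "openin (top_of_set T) {b \<in> T. k b \<in> j ` D}"
    unfolding e by (rule openin_trans[OF o oT])
qed

lemma homeomorphic_maps_j:
  assumes "openin (top_of_set S) D"
  shows "homeomorphic_maps (top_of_set D) (subtopology X (j ` D)) j (inv_into S j)"
proof -
  have D: "D \<subseteq> S" using assms by (auto dest: openin_imp_subset)
  have 1: "continuous_map (top_of_set D) X j"
    using continuous_map_into_glued D by (rule continuous_map_from_subtopology_mono)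
  have 2: "openin (subtopology X (j ` D)) {x \<in> j ` D. inv_into S j x \<in> U}" if "openin (top_of_set D) U" for U
  proof -
    have UD: "U \<subseteq> D" using that by (auto dest: openin_imp_subset)
    have "{x \<in> j ` D. inv_into S j x \<in> U} = j ` U"
      using UD D inj_j by (auto simp: inv_into_f_f subset_iff)
    moreover have "openin X (j ` U)" using openin_image_j openin_trans[OF that assms] by blast
    ultimately show ?thesis using UD unfolding openin_subtopology by (intro exI[of _ "j ` U"]) auto
  qed
  have 3: "topspace (subtopology X (j ` D)) = j ` D"
    using D by (auto simp: topspace_glued_topology)
  have 4: "inv_into S j (j x) = x" if "x \<in> D" for x using that D inj_j by (simp add: subset_iff inv_into_f_f)
  have "continuous_map (subtopology X (j ` D)) (top_of_set D) (inv_into S j)"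
    unfolding continuous_map 3 using 2 4 by auto
  then show ?thesis
    unfolding homeomorphic_maps_def 3 using 1 4 by (auto simp: continuous_map_in_subtopology)
qed

lemma inv_into_chart:
  assumes "(D, \<phi>) \<in> submanifold_charts S" "x \<in> \<phi> ` D"
  shows "inv_into (j ` D) (\<phi> \<circ> inv_into S j) x = j (inv_into D \<phi> x)"
proof -
  note c = submanifold_chartsD[OF assms(1)]
  obtain a where a: "a \<in> D" "x = \<phi> a" using assms(2) by auto
  have inv: "inv_into S j (j b) = b" if "b \<in> D" for b using that c inj_j by (simp add: subset_iff inv_into_f_f)
  have "inj_on (\<phi> \<circ> inv_into S j) (j ` D)"
    using c(3) inv by (auto simp: inj_on_def)
  then have "inv_into (j ` D) (\<phi> \<circ> inv_into S j) ((\<phi> \<circ> inv_into S j) (j a)) = j a"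
    using a by (intro inv_into_f_f) auto
  then show ?thesis using a inv c(3) by (simp add: inv_into_f_f)
qed

lemma chart_image:
  assumes "(D, \<phi>) \<in> submanifold_charts S" "Y \<subseteq> D"
  shows "(\<phi> \<circ> inv_into S j) ` j ` Y = \<phi> ` Y"
  using submanifold_chartsD(2)[OF assms(1)] assms(2) inj_j by (force simp: inv_into_f_f subset_iff image_iff)

lemma chart_homeo_j:
  assumes "(D, \<phi>) \<in> submanifold_charts S"
  shows "openin X (j ` D)" "open ((\<phi> \<circ> inv_into S j) ` j ` D)"
    "homeomorphic_map (subtopology X (j ` D)) (top_of_set ((\<phi> \<circ> inv_into S j) ` j ` D)) (\<phi> \<circ> inv_into S j)"
proof -
  note c = submanifold_chartsD[OF assms(1)]
  show "openin X (j ` D)" using openin_image_j c by blast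
  show "open ((\<phi> \<circ> inv_into S j) ` j ` D)" using chart_image[OF assms order_refl] c by simp
  have "homeomorphic_map (subtopology X (j ` D)) (top_of_set D) (inv_into S j)"
    using homeomorphic_maps_j[OF c(1)] by (meson homeomorphic_map_maps homeomorphic_maps_sym)
  moreover have "homeomorphic_map (top_of_set D) (top_of_set (\<phi> ` D)) \<phi>"
    using submanifold_chart_homeo[OF assms] by (meson homeomorphic_map_maps)
  ultimately show "homeomorphic_map (subtopology X (j ` D)) (top_of_set ((\<phi> \<circ> inv_into S j) ` j ` D)) (\<phi> \<circ> inv_into S j)"
    unfolding chart_image[OF assms order_refl] by (rule homeomorphic_map_compose)
qed

lemma transition_jj:
  assumes c: "(D, \<phi>) \<in> submanifold_charts S" and c': "(D', \<psi>) \<in> submanifold_charts S"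
  shows "hol_map ((\<phi> \<circ> inv_into S j) ` (j ` D \<inter> j ` D')) ((\<psi> \<circ> inv_into S j) \<circ> inv_into (j ` D) (\<phi> \<circ> inv_into S j))"
proof -
  note D = submanifold_chartsD[OF c] and D' = submanifold_chartsD[OF c']
  have "j ` D \<inter> j ` D' = j ` (D \<inter> D')"
    using inj_on_image_Int[OF inj_j D(2) D'(2)] by simp
  then have img: "(\<phi> \<circ> inv_into S j) ` (j ` D \<inter> j ` D') = \<phi> ` (D \<inter> D')"
    using chart_image[OF c, of "D \<inter> D'"] by simp
  show ?thesis unfolding img
  proof (rule hol_map_cong[OF submanifold_transition[OF c c']])
    fix x assume "x \<in> \<phi> ` (D \<inter> D')"
    then obtain a where a: "a \<in> D" "a \<in> D'" "x = \<phi> a" by auto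
    then show "\<psi> (inv_into D \<phi> x) = ((\<psi> \<circ> inv_into S j) \<circ> inv_into (j ` D) (\<phi> \<circ> inv_into S j)) x"
      using inv_into_chart[OF c, of x] inj_j D by (simp add: inv_into_f_f subset_iff)
  qed
qed

text \<open>Between charts of different pieces the transition is the holomorphic gluing map t read
  in both coordinates.\<close>

lemma transition_jk:
  assumes c: "(D, \<phi>) \<in> submanifold_charts S" and c': "(D', \<psi>) \<in> submanifold_charts T"
  shows "hol_map ((\<phi> \<circ> inv_into S j) ` (j ` D \<inter> k ` D')) ((\<psi> \<circ> inv_into T k) \<circ> inv_into (j ` D) (\<phi> \<circ> inv_into S j))"
proof -
  note D = submanifold_chartsD[OF c] and D' = submanifold_chartsD[OF c']
  let ?Y = "{a \<in> D. \<alpha> a \<noteq> 0 \<and> t a \<in> D'}"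
  have "j ` D \<inter> k ` D' = j ` ?Y"
  proof (intro equalityI subsetI)
    fix x assume "x \<in> j ` D \<inter> k ` D'"
    then obtain a b where "a \<in> D" "b \<in> D'" "x = j a" "j a = k b" by auto
    then show "x \<in> j ` ?Y" using j_eq_k_iff[of a b] D(2) D'(2) by blast
  next
    fix x assume "x \<in> j ` ?Y"
    then obtain a where a: "a \<in> D" "\<alpha> a \<noteq> 0" "t a \<in> D'" "x = j a" by auto
    then have "k (t a) = x" using t_eq[of a] D(2) by blast
    then have "x \<in> k ` D'" using a(3) by blast
    then show "x \<in> j ` D \<inter> k ` D'" using a by blast
  qed
  then have img: "(\<phi> \<circ> inv_into S j) ` (j ` D \<inter> k ` D') = \<phi> ` ?Y"
    using chart_image[OF c, of ?Y] by auto
  have i: "inv_into D \<phi> (\<phi> a) = a" if "a \<in> D" for a using D(3) that by (simp add: inv_into_f_f)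
  have 1: "hol_map (\<phi> ` ?Y) (\<lambda>x. t (inv_into D \<phi> x))"
    by (rule hol_map_compose[OF hol_map_subset[OF D(6)] hol_t]) (use i D(2) in auto)
  have 2: "hol_map (\<phi> ` ?Y) (\<lambda>x. \<psi> (t (inv_into D \<phi> x)))"
    by (rule hol_map_compose[OF 1 D'(5)]) (use i in auto)
  show ?thesis unfolding img
  proof (rule hol_map_cong[OF 2])
    fix x assume "x \<in> \<phi> ` ?Y"
    then obtain a where a: "a \<in> D" "\<alpha> a \<noteq> 0" "t a \<in> D'" "x = \<phi> a" by auto
    then have "k (t a) = j a" "t a \<in> T" using t_mem t_eq D(2) by blast+
    then have "inv_into T k (j a) = t a" using inv_into_f_f[OF inj_k] by metis
    then show "\<psi> (t (inv_into D \<phi> x)) = ((\<psi> \<circ> inv_into T k) \<circ> inv_into (j ` D) (\<phi> \<circ> inv_into S j)) x"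
      using inv_into_chart[OF c, of x] a i by simp
  qed
qed

lemma second_countable_pieces: "\<exists>\<B>. countable \<B> \<and> (\<forall>V\<in>\<B>. openin X V) \<and>
    (\<forall>U x. openin X U \<and> x \<in> U \<inter> j ` S \<longrightarrow> (\<exists>V\<in>\<B>. x \<in> V \<and> V \<subseteq> U))"
proof -
  have "second_countable (top_of_set S)"
    by (simp add: second_countable_subtopology second_countable_euclidean)
  then obtain B where B: "countable B" "\<And>V. V \<in> B \<Longrightarrow> openin (top_of_set S) V"
    "\<And>U x. openin (top_of_set S) U \<Longrightarrow> x \<in> U \<Longrightarrow> \<exists>V\<in>B. x \<in> V \<and> V \<subseteq> U"
    unfolding second_countable_def by metis
  have "\<exists>V\<in>(`) j ` B. x \<in> V \<and> V \<subseteq> U" if U: "openin X U" "x \<in> U" "x \<in> j ` S" for U x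
  proof -
    obtain a where a: "a \<in> S" "x = j a" using U by auto
    have "openin (top_of_set S) {a \<in> S. j a \<in> U}" using U(1) by (simp add: openin_glued_topology)
    then obtain V where "V \<in> B" "a \<in> V" "V \<subseteq> {a \<in> S. j a \<in> U}"
      using B(3)[of "{a \<in> S. j a \<in> U}" a] a U by auto
    then show ?thesis using a by (intro bexI[of _ "j ` V"]) auto
  qed
  then show ?thesis using B openin_image_j by (intro exI[of _ "(`) j ` B"]) auto
qed

lemma Hausdorff_pieces:
  assumes "a \<in> S" "b \<in> S" "j a \<noteq> j b"
  shows "\<exists>U V. openin X U \<and> openin X V \<and> j a \<in> U \<and> j b \<in> V \<and> disjnt U V"
proof -
  have "Hausdorff_space (top_of_set S)" by (simp add: Hausdorff_space_subtopology)
  then obtain U V where UV: "openin (top_of_set S) U" "openin (top_of_set S) V" "a \<in> U" "b \<in> V" "disjnt U V"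
    using assms unfolding Hausdorff_space_def by (metis topspace_euclidean_subtopology)
  then have "U \<subseteq> S" "V \<subseteq> S" by (auto dest: openin_imp_subset)
  then have "disjnt (j ` U) (j ` V)" using UV(5) inj_on_image_Int[OF inj_j, of U V] by (auto simp: disjnt_def)
  then show ?thesis using UV openin_image_j by (intro exI[of _ "j ` U"] exI[of _ "j ` V"]) auto
qed

end

context gluing_data
begin

interpretation comm: gluing_data k T j S \<beta> \<alpha> t' t by (rule commute)

lemma openin_image_k: "openin (top_of_set T) D \<Longrightarrow> openin X (k ` D)"
  using comm.openin_image_j unfolding glued_topology_commute[of k T j S] .

lemma homeomorphic_maps_k:
  "openin (top_of_set T) D \<Longrightarrow> homeomorphic_maps (top_of_set D) (subtopology X (k ` D)) k (inv_into T k)"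
  using comm.homeomorphic_maps_j unfolding glued_topology_commute[of k T j S] .

lemma second_countable_glued: "second_countable X"
proof -
  obtain B1 where B1: "countable B1" "\<forall>V\<in>B1. openin X V"
    "\<forall>U x. openin X U \<and> x \<in> U \<inter> j ` S \<longrightarrow> (\<exists>V\<in>B1. x \<in> V \<and> V \<subseteq> U)"
    using second_countable_pieces by blast
  obtain B2 where B2: "countable B2" "\<forall>V\<in>B2. openin X V"
    "\<forall>U x. openin X U \<and> x \<in> U \<inter> k ` T \<longrightarrow> (\<exists>V\<in>B2. x \<in> V \<and> V \<subseteq> U)"
    using comm.second_countable_pieces unfolding glued_topology_commute[of k T j S] by blast
  have "\<exists>V\<in>B1 \<union> B2. x \<in> V \<and> V \<subseteq> U" if U: "openin X U" "x \<in> U" for U x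
  proof -
    have "x \<in> j ` S \<or> x \<in> k ` T" using U by (auto simp: openin_glued_topology)
    then show ?thesis
    proof
      assume "x \<in> j ` S"
      then show ?thesis using B1(3)[rule_format, of U x] U by blast
    next
      assume "x \<in> k ` T"
      then show ?thesis using B2(3)[rule_format, of U x] U by blast
    qed
  qed
  moreover have "\<forall>V\<in>B1 \<union> B2. openin X V" using B1(2) B2(2) by blast
  moreover have "countable (B1 \<union> B2)" using B1(1) B2(1) by simp
  ultimately show ?thesis
    unfolding second_countable_def by (intro exI[of _ "B1 \<union> B2"]) simp
qed

lemma Hausdorff_glued: "Hausdorff_space X"
proof -
  have mixed: "\<exists>U V. openin X U \<and> openin X V \<and> j a \<in> U \<and> k b \<in> V \<and> disjnt U V"
    if a: "a \<in> S" and b: "b \<in> T" and ne: "j a \<noteq> k b" for a b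
  proof (cases "\<alpha> a = 0")
    case False
    then show ?thesis using comm.Hausdorff_pieces[of "t a" b] t_mem[OF a] t_eq[OF a] b ne
      unfolding glued_topology_commute[of k T j S] by simp
  next
    case \<alpha>: True
    show ?thesis
    proof (cases "\<beta> b = 0")
      case False
      then show ?thesis using Hausdorff_pieces[of a "t' b"] t'_mem[OF b] t'_eq[OF b] a ne by simp
    next
      case True
      \<comment> \<open>Both points lie outside the overlap. On these neighbourhoods the product of
        \<alpha> and \<beta> has modulus below 1, whereas identified points have product 1.\<close>
      let ?U = "{a \<in> S. norm (\<alpha> a) < 1}" and ?V = "{b \<in> T. norm (\<beta> b) < 1}"
      have "openin (top_of_set S) ?U"
        using continuous_openin_preimage_gen[OF cont_\<alpha>, of "ball 0 1"] by (simp add: vimage_def Int_def)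
      moreover have "openin (top_of_set T) ?V"
        using continuous_openin_preimage_gen[OF cont_\<beta>, of "ball 0 1"] by (simp add: vimage_def Int_def)
      moreover have "disjnt (j ` ?U) (k ` ?V)"
        unfolding disjnt_iff
      proof (intro allI notI; clarsimp)
        fix a b assume "a \<in> S" "b \<in> T" "j a = k b" and n: "norm (\<alpha> a) < 1" "norm (\<beta> b) < 1"
        then have "\<alpha> a * \<beta> b = 1" using overlap by blast
        then have "norm (\<alpha> a) * norm (\<beta> b) = 1" by (metis norm_mult norm_one)
        then show False using n mult_strict_mono[of "norm (\<alpha> a)" 1 "norm (\<beta> b)" 1] by simp
      qed
      ultimately show ?thesis
        using openin_image_j openin_image_k a b \<alpha> True
        by (intro exI[of _ "j ` ?U"] exI[of _ "k ` ?V"]) auto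
    qed
  qed
  show ?thesis
    unfolding Hausdorff_space_def topspace_glued_topology
  proof (intro allI impI)
    fix x y assume xy: "x \<in> j ` S \<union> k ` T \<and> y \<in> j ` S \<union> k ` T \<and> x \<noteq> y"
    then consider a b where "a \<in> S" "b \<in> S" "x = j a" "y = j b"
      | a b where "a \<in> S" "b \<in> T" "x = j a" "y = k b"
      | a b where "a \<in> S" "b \<in> T" "x = k b" "y = j a"
      | a b where "a \<in> T" "b \<in> T" "x = k a" "y = k b" by blast
    then show "\<exists>U V. openin X U \<and> openin X V \<and> x \<in> U \<and> y \<in> V \<and> disjnt U V"
    proof cases
      case 1
      then show ?thesis using Hausdorff_pieces[of a b] xy by simp
    next
      case 2
      then show ?thesis using mixed[of a b] xy by simp
    next
      case 3
      then have "j a \<noteq> k b" using xy by simp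
      then obtain U V where "openin X U" "openin X V" "j a \<in> U" "k b \<in> V" "disjnt U V"
        using mixed[OF 3(1,2)] by blast
      then show ?thesis unfolding 3(3,4) by (intro exI[of _ V] exI[of _ U]) (simp add: disjnt_sym)
    next
      case 4
      have "k a \<noteq> k b" using xy 4 by simp
      then show ?thesis using comm.Hausdorff_pieces[OF 4(1,2)]
        unfolding 4(3,4) glued_topology_commute[of k T j S] by blast
    qed
  qed
qed

lemma glued_charts_cases:
  assumes "(D, \<phi>) \<in> glued_charts j S k T"
  obtains D' \<psi> where "D = j ` D'" "\<phi> = \<psi> \<circ> inv_into S j" "(D', \<psi>) \<in> submanifold_charts S"
  | D' \<psi> where "D = k ` D'" "\<phi> = \<psi> \<circ> inv_into T k" "(D', \<psi>) \<in> submanifold_charts T"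
  using assms unfolding glued_charts_def by blast

lemma complex_manifold_glued:
  assumes S: "\<And>a. a \<in> S \<Longrightarrow> \<exists>D \<phi>. (D, \<phi>) \<in> (submanifold_charts S :: (complex^'k, 'n::finite) chart set) \<and> a \<in> D"
    and T: "\<And>b. b \<in> T \<Longrightarrow> \<exists>D \<phi>. (D, \<phi>) \<in> (submanifold_charts T :: (complex^'l, 'n::finite) chart set) \<and> b \<in> D"
  shows "complex_manifold X (glued_charts j S k T :: ('c, 'n) chart set)"
  unfolding complex_manifold_def complex_atlas_def
proof (intro conjI)
  let ?A = "glued_charts j S k T :: ('c, 'n) chart set"
  show "Hausdorff_space X" by (rule Hausdorff_glued)
  show "second_countable X" by (rule second_countable_glued)
  show "\<forall>(D, \<phi>)\<in>?A. openin X D \<and> open (\<phi> ` D) \<and>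
     homeomorphic_map (subtopology X D) (top_of_set (\<phi> ` D)) \<phi>"
  proof (intro ballI, clarify)
    fix D \<phi> assume "(D, \<phi>) \<in> ?A"
    then show "openin X D \<and> open (\<phi> ` D) \<and> homeomorphic_map (subtopology X D) (top_of_set (\<phi> ` D)) \<phi>"
    proof (cases rule: glued_charts_cases)
      case (1 D' \<psi>)
      show ?thesis unfolding 1(1,2) using chart_homeo_j[OF 1(3)] by blast
    next
      case (2 D' \<psi>)
      show ?thesis unfolding 2(1,2) using comm.chart_homeo_j[OF 2(3)]
        unfolding glued_topology_commute[of k T j S] by blast
    qed
  qed
  show "\<forall>(D, \<phi>)\<in>?A. \<forall>(D', \<psi>)\<in>?A. hol_map (\<phi> ` (D \<inter> D')) (\<psi> \<circ> inv_into D \<phi>)"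
  proof (intro ballI, clarify)
    fix D \<phi> D' \<psi> assume c: "(D, \<phi>) \<in> ?A" "(D', \<psi>) \<in> ?A"
    from c(1) show "hol_map (\<phi> ` (D \<inter> D')) (\<psi> \<circ> inv_into D \<phi>)"
    proof (cases rule: glued_charts_cases)
      case (1 D1 \<phi>1)
      note c1 = 1(3)
      from c(2) show ?thesis
      proof (cases rule: glued_charts_cases)
        case (1 E \<chi>)
        show ?thesis unfolding 1(1,2) \<open>D = _\<close> \<open>\<phi> = _\<close> by (rule transition_jj[OF c1 1(3)])
      next
        case (2 E \<chi>)
        show ?thesis unfolding 2(1,2) \<open>D = _\<close> \<open>\<phi> = _\<close> by (rule transition_jk[OF c1 2(3)])
      qed
    next
      case (2 D1 \<phi>1)
      note c2 = 2(3)
      from c(2) show ?thesis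
      proof (cases rule: glued_charts_cases)
        case (1 E \<chi>)
        show ?thesis unfolding 1(1,2) \<open>D = _\<close> \<open>\<phi> = _\<close> by (rule comm.transition_jk[OF c2 1(3)])
      next
        case (2 E \<chi>)
        show ?thesis unfolding 2(1,2) \<open>D = _\<close> \<open>\<phi> = _\<close> by (rule comm.transition_jj[OF c2 2(3)])
      qed
    qed
  qed
  show "(\<Union>(D, \<phi>)\<in>?A. D) = topspace X"
  proof
    show "(\<Union>(D, \<phi>)\<in>?A. D) \<subseteq> topspace X"
    proof clarify
      fix x D \<phi> assume "(D, \<phi>) \<in> ?A" "x \<in> D"
      then show "x \<in> topspace X" unfolding topspace_glued_topology
        by (cases rule: glued_charts_cases) (auto dest: submanifold_chartsD(2))
    qed
    show "topspace X \<subseteq> (\<Union>(D, \<phi>)\<in>?A. D)"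
      unfolding topspace_glued_topology
    proof (intro subsetI, elim UnE imageE; hypsubst)
      fix a assume "a \<in> S"
      then obtain D \<phi> where "(D, \<phi>) \<in> (submanifold_charts S :: (complex^'k, 'n) chart set)" "a \<in> D" using S by blast
      then show "j a \<in> (\<Union>(D, \<phi>)\<in>?A. D)"
        unfolding glued_charts_def by (intro UN_I[of "(j ` D, \<phi> \<circ> inv_into S j)"]) auto
    next
      fix b assume "b \<in> T"
      then obtain D \<phi> where "(D, \<phi>) \<in> (submanifold_charts T :: (complex^'l, 'n) chart set)" "b \<in> D" using T by blast
      then show "k b \<in> (\<Union>(D, \<phi>)\<in>?A. D)"
        unfolding glued_charts_def by (intro UN_I[of "(k ` D, \<phi> \<circ> inv_into T k)"]) auto
    qed
  qed
qed

end

subsection \<open>The fibres and the total space\<close>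

text \<open>The component U is forced by the equation of \<open>M z\<close>: it is (x + 1/(2y))^2 -
  4 y^3 - 2 z y, that is \<open>Hz\<close> with x shifted by 1/(2y).\<close>

definition xy_to_M :: "complex \<Rightarrow> complex^2 \<Rightarrow> complex^3" where
  "xy_to_M z p = (let x = p $ 1; y = p $ 2 in
     vector [x^2 + x / y - 4 * y^3 - 2 * z * y + 1 / (4 * y^2), x / y^2 + 1 / (2 * y^3), 1 / y])"

definition M_to_xy :: "complex^3 \<Rightarrow> complex^2" where
  "M_to_xy q = vector [q $ 2 / (q $ 3)^2 - q $ 3 / 2, 1 / q $ 3]"

lemma xy_to_M_nth [simp]:
  "xy_to_M z p $ 1 = (p $ 1)^2 + p $ 1 / p $ 2 - 4 * (p $ 2)^3 - 2 * z * p $ 2 + 1 / (4 * (p $ 2)^2)"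
  "xy_to_M z p $ 2 = p $ 1 / (p $ 2)^2 + 1 / (2 * (p $ 2)^3)"
  "xy_to_M z p $ 3 = 1 / p $ 2"
  by (simp_all add: xy_to_M_def Let_def)

lemma M_to_xy_nth [simp]:
  "M_to_xy q $ 1 = q $ 2 / (q $ 3)^2 - q $ 3 / 2" "M_to_xy q $ 2 = 1 / q $ 3"
  by (simp_all add: M_to_xy_def)

lemma xy_to_M_in_M: "p $ 2 \<noteq> 0 \<Longrightarrow> xy_to_M z p \<in> M z"
  by (simp add: M_iff field_simps power2_eq_square power_numeral_reduce)

lemma M_to_xy_to_M:
  assumes "p $ 2 \<noteq> 0" shows "M_to_xy (xy_to_M z p) = p"
  using assms by (simp add: vec2_eq_iff field_simps power2_eq_square power_numeral_reduce)

lemma M_eqI: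
  assumes "q \<in> M z" "q' \<in> M z" "q $ 3 \<noteq> 0" "q $ 2 = q' $ 2" "q $ 3 = q' $ 3"
  shows "q = q'"
  using assms by (simp add: M_iff vec3_eq_iff)

lemma xy_to_M_to_xy:
  assumes "q \<in> M z" "q $ 3 \<noteq> 0" shows "xy_to_M z (M_to_xy q) = q"
  using assms by (intro M_eqI[OF xy_to_M_in_M]) (auto simp: field_simps power2_eq_square power_numeral_reduce)

lemma gluing_iff: "(p, q) \<in> gluing z \<longleftrightarrow> p $ 2 \<noteq> 0 \<and> q = xy_to_M z p"
proof
  assume "(p, q) \<in> gluing z"
  then have *: "p $ 2 \<noteq> 0" "q \<in> M z" "q $ 3 \<noteq> 0" "p = M_to_xy q"
    by (auto simp: gluing_def Let_def vec2_eq_iff)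
  then show "p $ 2 \<noteq> 0 \<and> q = xy_to_M z p" using xy_to_M_to_xy by simp
next
  assume *: "p $ 2 \<noteq> 0 \<and> q = xy_to_M z p"
  then have "M_to_xy q = p" using M_to_xy_to_M by blast
  then have e: "p $ 1 = q $ 2 / (q $ 3)^2 - q $ 3 / 2" "p $ 2 = 1 / q $ 3"
    using M_to_xy_nth[of q] by auto
  have "q \<in> M z" "q $ 3 \<noteq> 0" using * xy_to_M_in_M[of p z] by auto
  then show "(p, q) \<in> gluing z"
    unfolding gluing_def Let_def mem_Collect_eq case_prod_conv using * e by blast
qed

lemma gluing_iff': "(p, q) \<in> gluing z \<longleftrightarrow> q \<in> M z \<and> q $ 3 \<noteq> 0 \<and> p = M_to_xy q"
  unfolding gluing_iff
proof
  assume "p $ 2 \<noteq> 0 \<and> q = xy_to_M z p"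
  then show "q \<in> M z \<and> q $ 3 \<noteq> 0 \<and> p = M_to_xy q"
    using xy_to_M_in_M M_to_xy_to_M by auto
next
  assume "q \<in> M z \<and> q $ 3 \<noteq> 0 \<and> p = M_to_xy q"
  then show "p $ 2 \<noteq> 0 \<and> q = xy_to_M z p" using xy_to_M_to_xy by auto
qed

lemma gluingD:
  assumes "(p, q) \<in> gluing z"
  shows "q \<in> M z" "q $ 3 \<noteq> 0" "p $ 2 \<noteq> 0" "q = xy_to_M z p" "p = M_to_xy q"
  using assms gluing_iff gluing_iff' by blast+

lemma gluing_eq_gluing_inverse: "gluing z = gluing_inverse z"
proof -
  have "(p, q) \<in> gluing z \<longleftrightarrow> (p, q) \<in> gluing_inverse z" for p q
  proof
    assume "(p, q) \<in> gluing z"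
    then show "(p, q) \<in> gluing_inverse z"
      unfolding gluing_iff using xy_to_M_in_M by (auto simp: gluing_inverse_def Let_def)
  next
    assume "(p, q) \<in> gluing_inverse z"
    then have *: "p $ 2 \<noteq> 0" "q \<in> M z" "q $ 3 \<noteq> 0" "q $ 2 = xy_to_M z p $ 2" "q $ 3 = xy_to_M z p $ 3"
      by (auto simp: gluing_inverse_def Let_def)
    then have "q = xy_to_M z p" using M_eqI[OF *(2) xy_to_M_in_M[OF *(1)] *(3-5)] by simp
    then show "(p, q) \<in> gluing z" using * by (simp add: gluing_iff)
  qed
  then show ?thesis by auto
qed

lemma E_rel_iff [simp]:
  "(Inl p, Inl p') \<in> E_rel z \<longleftrightarrow> p = p'"
  "(Inl p, Inr q) \<in> E_rel z \<longleftrightarrow> (p, q) \<in> gluing z"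
  "(Inr q, Inl p) \<in> E_rel z \<longleftrightarrow> (p, q) \<in> gluing z"
  "(Inr q, Inr q') \<in> E_rel z \<longleftrightarrow> q = q' \<and> q \<in> M z"
  by (auto simp: E_rel_def glue_rel_def Id_on_def)

lemma equiv_E_rel: "equiv (UNIV <+> M z) (E_rel z)"
proof (rule equivI)
  show "E_rel z \<subseteq> (UNIV <+> M z) \<times> (UNIV <+> M z)"
    by (auto simp: E_rel_def glue_rel_def gluing_def)
  show "refl_on (UNIV <+> M z) (E_rel z)"
    by (auto simp: refl_on_def)
  show "sym (E_rel z)"
  proof (rule symI)
    fix a b assume "(a, b) \<in> E_rel z"
    then show "(b, a) \<in> E_rel z" by (cases a; cases b) auto
  qed
  show "trans (E_rel z)"
  proof (rule transI)
    fix a b c assume "(a, b) \<in> E_rel z" "(b, c) \<in> E_rel z"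
    then show "(a, c) \<in> E_rel z"
      using gluingD(1,4,5) by (cases a; cases b; cases c) (simp_all, metis+)
  qed
qed

lemma E_xy_eq_iff [simp]: "E_xy z p = E_xy z p' \<longleftrightarrow> p = p'"
  unfolding E_xy_def by (subst eq_equiv_class_iff[OF equiv_E_rel]) auto

lemma E_xy_eq_E_M_iff: "q \<in> M z \<Longrightarrow> E_xy z p = E_M z q \<longleftrightarrow> (p, q) \<in> gluing z"
  unfolding E_xy_def E_M_def by (subst eq_equiv_class_iff[OF equiv_E_rel]) auto

lemma E_M_eq_iff: "q \<in> M z \<Longrightarrow> q' \<in> M z \<Longrightarrow> E_M z q = E_M z q' \<longleftrightarrow> q = q'"
  unfolding E_M_def by (subst eq_equiv_class_iff[OF equiv_E_rel]) auto

lemma E_set_eq: "E_set z = range (E_xy z) \<union> E_M z ` M z"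
  unfolding E_set_def E_xy_def E_M_def quotient_def by auto

lemma topspace_E_top: "topspace (E_top z) = E_set z"
  by (simp add: E_top_def topspace_glued_topology E_set_eq)

lemma E_M_xy_to_M: "p $ 2 \<noteq> 0 \<Longrightarrow> E_M z (xy_to_M z p) = E_xy z p"
  using E_xy_eq_E_M_iff[OF xy_to_M_in_M] gluing_iff by metis

lemma E_xy_M_to_xy: "q \<in> M z \<Longrightarrow> q $ 3 \<noteq> 0 \<Longrightarrow> E_xy z (M_to_xy q) = E_M z q"
  using E_xy_eq_E_M_iff gluing_iff' by metis

lemma hol_map_xy_to_M: "hol_map {p. p $ 2 \<noteq> 0} (xy_to_M z)"
  unfolding hol_map_def
proof
  fix i
  have "complex_diff_at (\<lambda>p. xy_to_M z p $ i) p" if "p $ 2 \<noteq> 0" for p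
    using exhaust_3[of i] that by (auto intro!: complex_diff_at_intros)
  then show "hol_fun {p. p $ 2 \<noteq> 0} (\<lambda>p. xy_to_M z p $ i)"
    by (intro hol_fun_of_complex_diff[of "{p. p $ 2 \<noteq> 0}"]) (auto intro!: open_Collect_neq continuous_intros)
qed

lemma hol_map_M_to_xy: "S \<subseteq> {q. q $ 3 \<noteq> 0} \<Longrightarrow> hol_map S M_to_xy"
  unfolding hol_map_def
proof
  fix i assume S: "S \<subseteq> {q :: complex^3. q $ 3 \<noteq> 0}"
  have "complex_diff_at (\<lambda>p. M_to_xy p $ i) p" if "p $ 3 \<noteq> 0" for p
    using exhaust_2[of i] that by (auto intro!: complex_diff_at_intros)
  then show "hol_fun S (\<lambda>p. M_to_xy p $ i)"
    using S by (intro hol_fun_of_complex_diff[of "{p. p $ 3 \<noteq> 0}"]) (auto intro!: open_Collect_neq continuous_intros)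
qed

lemma gluing_data_E: "gluing_data (E_xy z) UNIV (E_M z) (M z) (\<lambda>p. p $ 2) (\<lambda>q. q $ 3) (xy_to_M z) M_to_xy"
proof
  show "inj_on (E_xy z) UNIV" by (rule inj_onI) simp
  show "inj_on (E_M z) (M z)" by (rule inj_onI) (simp add: E_M_eq_iff)
  show "hol_map {a \<in> UNIV. a $ 2 \<noteq> 0} (xy_to_M z)" using hol_map_xy_to_M by simp
  show "hol_map {b \<in> M z. b $ 3 \<noteq> 0} M_to_xy" by (rule hol_map_M_to_xy) auto
  show "xy_to_M z a \<in> M z \<and> xy_to_M z a $ 3 \<noteq> 0 \<and> E_M z (xy_to_M z a) = E_xy z a" if "a $ 2 \<noteq> 0" for a
    using that xy_to_M_in_M E_M_xy_to_M by simp
  show "M_to_xy b \<in> UNIV \<and> M_to_xy b $ 2 \<noteq> 0 \<and> E_xy z (M_to_xy b) = E_M z b" if "b \<in> M z" "b $ 3 \<noteq> 0" for b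
    using that E_xy_M_to_xy by simp
  show "a $ 2 * b $ 3 = 1" if "b \<in> M z" "E_xy z a = E_M z b" for a b
    using that by (auto simp: E_xy_eq_E_M_iff gluing_iff)
qed (intro continuous_intros)+

lemma complex_manifold_E: "complex_manifold (E_top z) (E_charts z)"
  unfolding E_top_def E_charts_def
  by (rule gluing_data.complex_manifold_glued[OF gluing_data_E])
     (use UNIV_chart M_charts_cover in blast)+

section \<open>The total space over the z-plane\<close>

definition xyz_to_total :: "complex^3 \<Rightarrow> complex^4" where
  "xyz_to_total r = (let q = xy_to_M (r $ 3) (vector [r $ 1, r $ 2]) in vector [q $ 1, q $ 2, q $ 3, r $ 3])"

definition total_to_xyz :: "complex^4 \<Rightarrow> complex^3" where
  "total_to_xyz r = (let p = M_to_xy (vector [r $ 1, r $ 2, r $ 3]) in vector [p $ 1, p $ 2, r $ 4])"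

lemma P_xy_eq_iff: "P_xy r = P_xy r' \<longleftrightarrow> r = r'"
  by (auto simp: P_xy_def vec3_eq_iff)

lemma total_M_mem: "r \<in> total_M \<longleftrightarrow> vector [r $ 1, r $ 2, r $ 3] \<in> M (r $ 4)"
  by (simp add: total_M_def)

lemma P_M_eq_iff: "r \<in> total_M \<Longrightarrow> r' \<in> total_M \<Longrightarrow> P_M r = P_M r' \<longleftrightarrow> r = r'"
  by (auto simp: P_M_def vec4_eq_iff total_M_mem E_M_eq_iff)

lemma P_M_xyz_to_total:
  assumes "r $ 2 \<noteq> 0"
  shows "xyz_to_total r \<in> total_M" "xyz_to_total r $ 3 \<noteq> 0" "P_M (xyz_to_total r) = P_xy r"
proof -
  show "xyz_to_total r $ 3 \<noteq> 0" using assms by (simp add: xyz_to_total_def Let_def)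
  show "xyz_to_total r \<in> total_M"
    using assms xy_to_M_in_M[of "vector [r $ 1, r $ 2]" "r $ 3"]
    by (simp add: xyz_to_total_def Let_def total_M_mem del: xy_to_M_nth)
  show "P_M (xyz_to_total r) = P_xy r"
    using assms E_M_xy_to_M[of "vector [r $ 1, r $ 2]" "r $ 3"]
    by (simp add: xyz_to_total_def Let_def P_M_def P_xy_def del: xy_to_M_nth)
qed

lemma P_xy_total_to_xyz:
  assumes "r \<in> total_M" "r $ 3 \<noteq> 0"
  shows "total_to_xyz r $ 2 \<noteq> 0" "P_xy (total_to_xyz r) = P_M r"
proof -
  show "total_to_xyz r $ 2 \<noteq> 0" using assms by (simp add: total_to_xyz_def Let_def)
  show "P_xy (total_to_xyz r) = P_M r"
    using assms E_xy_M_to_xy[of "vector [r $ 1, r $ 2, r $ 3]" "r $ 4"]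
    by (simp add: total_to_xyz_def Let_def total_M_mem P_M_def P_xy_def del: M_to_xy_nth)
qed

lemma hol_map_xyz_to_total: "hol_map {r. r $ 2 \<noteq> 0} xyz_to_total"
  unfolding hol_map_def
proof
  fix i
  have "complex_diff_at (\<lambda>p. xyz_to_total p $ i) p" if "p $ 2 \<noteq> 0" for p
    using exhaust_4[of i] that by (auto simp: xyz_to_total_def Let_def intro!: complex_diff_at_intros)
  then show "hol_fun {p. p $ 2 \<noteq> 0} (\<lambda>p. xyz_to_total p $ i)"
    by (intro hol_fun_of_complex_diff[of "{p. p $ 2 \<noteq> 0}"]) (auto intro!: open_Collect_neq continuous_intros)
qed

lemma hol_map_total_to_xyz: "hol_map {r \<in> total_M. r $ 3 \<noteq> 0} total_to_xyz"
  unfolding hol_map_def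
proof
  fix i
  have "complex_diff_at (\<lambda>p. total_to_xyz p $ i) p" if "p $ 3 \<noteq> 0" for p
    using exhaust_3[of i] that by (auto simp: total_to_xyz_def Let_def intro!: complex_diff_at_intros)
  then show "hol_fun {r \<in> total_M. r $ 3 \<noteq> 0} (\<lambda>p. total_to_xyz p $ i)"
    by (intro hol_fun_of_complex_diff[of "{p. p $ 3 \<noteq> 0}"]) (auto intro!: open_Collect_neq continuous_intros)
qed

lemma gluing_data_P: "gluing_data P_xy UNIV P_M total_M (\<lambda>p. p $ 2) (\<lambda>q. q $ 3) xyz_to_total total_to_xyz"
proof
  show "inj_on P_xy UNIV" by (rule inj_onI) (simp add: P_xy_eq_iff)
  show "inj_on P_M total_M" by (rule inj_onI) (simp add: P_M_eq_iff)
  show "hol_map {a \<in> UNIV. a $ 2 \<noteq> 0} xyz_to_total" using hol_map_xyz_to_total by simp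
  show "hol_map {b \<in> total_M. b $ 3 \<noteq> 0} total_to_xyz" by (rule hol_map_total_to_xyz)
  show "xyz_to_total a \<in> total_M \<and> xyz_to_total a $ 3 \<noteq> 0 \<and> P_M (xyz_to_total a) = P_xy a" if "a $ 2 \<noteq> 0" for a
    using P_M_xyz_to_total[OF that] by blast
  show "total_to_xyz b \<in> UNIV \<and> total_to_xyz b $ 2 \<noteq> 0 \<and> P_xy (total_to_xyz b) = P_M b" if "b \<in> total_M" "b $ 3 \<noteq> 0" for b
    using P_xy_total_to_xyz[OF that] by blast
  show "a $ 2 * b $ 3 = 1" if b: "b \<in> total_M" and e: "P_xy a = P_M b" for a b
  proof -
    note e' = e[unfolded P_xy_def P_M_def prod.inject]
    have "E_xy (b $ 4) (vector [a $ 1, a $ 2]) = E_M (b $ 4) (vector [b $ 1, b $ 2, b $ 3])"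
      using conjunct1[OF e'] unfolding conjunct2[OF e'] .
    then show ?thesis using b by (auto simp: E_xy_eq_E_M_iff gluing_iff total_M_mem vec3_eq_iff)
  qed
qed (intro continuous_intros)+

lemma complex_manifold_P: "complex_manifold P_top P_charts"
  unfolding P_top_def P_charts_def
proof (rule gluing_data.complex_manifold_glued[OF gluing_data_P])
  show "\<exists>D \<phi>. (D, \<phi>) \<in> (submanifold_charts UNIV :: (complex^3, 3) chart set) \<and> a \<in> D" for a
    using UNIV_chart by blast
  show "\<exists>D \<phi>. (D, \<phi>) \<in> (submanifold_charts total_M :: (complex^4, 3) chart set) \<and> b \<in> D" if "b \<in> total_M" for b
    using total_M_charts_cover[OF that] by blast
qed

lemma topspace_P_top: "topspace P_top = bundle_set E_top"
proof -
  have "range P_xy \<union> P_M ` total_M = {(e, z). e \<in> range (E_xy z) \<union> E_M z ` M z}" (is "?L = ?R")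
  proof (intro equalityI subsetI)
    fix x assume "x \<in> ?L" then show "x \<in> ?R" by (auto simp: P_xy_def P_M_def total_M_mem)
  next
    fix x assume "x \<in> ?R"
    then obtain e z where x: "x = (e, z)" "e \<in> range (E_xy z) \<union> E_M z ` M z" by blast
    from x(2) show "x \<in> ?L"
    proof
      assume "e \<in> range (E_xy z)"
      then obtain p where "e = E_xy z p" by blast
      then have "x = P_xy (vector [p $ 1, p $ 2, z])" by (simp add: x P_xy_def)
      then show ?thesis by blast
    next
      assume "e \<in> E_M z ` M z"
      then obtain q where "q \<in> M z" "e = E_M z q" by blast
      then have "x = P_M (vector [q $ 1, q $ 2, q $ 3, z])" "vector [q $ 1, q $ 2, q $ 3, z] \<in> total_M"
        by (simp_all add: x P_M_def total_M_mem)
      then show ?thesis by blast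
    qed
  qed
  then show ?thesis
    by (simp add: P_top_def topspace_glued_topology bundle_set_def topspace_E_top E_set_eq)
qed

lemma P_submersion:
  assumes "p \<in> bundle_set E_top"
  shows "\<exists>(D,\<phi>)\<in>P_charts. p \<in> D \<and> (\<forall>q\<in>D. \<phi> q $ 3 = snd q)"
proof -
  have "p \<in> range P_xy \<union> P_M ` total_M"
    using assms topspace_P_top by (simp add: P_top_def topspace_glued_topology)
  then show ?thesis
  proof
    assume p: "p \<in> range P_xy"
    have "(P_xy ` UNIV, (\<lambda>r. r) \<circ> inv_into UNIV P_xy) \<in> P_charts"
      unfolding P_charts_def glued_charts_def using UNIV_chart by blast
    moreover have "inv_into UNIV P_xy q $ 3 = snd q" if "q \<in> range P_xy" for q
      using f_inv_into_f[OF that] by (metis P_xy_def snd_conv)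
    ultimately show ?thesis using p by (intro bexI[of _ "(P_xy ` UNIV, (\<lambda>r. r) \<circ> inv_into UNIV P_xy)"]) auto
  next
    assume "p \<in> P_M ` total_M"
    then obtain r where r: "r \<in> total_M" "p = P_M r" by blast
    obtain D \<phi> where D: "(D, \<phi>) \<in> (submanifold_charts total_M :: (complex^4, 3) chart set)" "r \<in> D"
      "\<forall>q\<in>D. \<phi> q $ 3 = q $ 4" using total_M_charts_cover[OF r(1)] by blast
    have "(P_M ` D, \<phi> \<circ> inv_into total_M P_M) \<in> P_charts"
      unfolding P_charts_def glued_charts_def using D(1) by blast
    moreover have "(\<phi> \<circ> inv_into total_M P_M) q $ 3 = snd q" if q: "q \<in> P_M ` D" for q
    proof -
      obtain r where "r \<in> D" "q = P_M r" using q by blast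
      moreover have "inv_into total_M P_M (P_M r) = r" if "r \<in> D" for r
        using submanifold_chartsD(2)[OF D(1)] that P_M_eq_iff
        by (intro inv_into_f_f inj_onI) auto
      ultimately show ?thesis using D(3) by (simp add: P_M_def)
    qed
    ultimately show ?thesis using r D(2) by (intro bexI[of _ "(P_M ` D, \<phi> \<circ> inv_into total_M P_M)"]) auto
  qed
qed

subsection \<open>Local triviality\<close>

text \<open>For \<open>d = z - z0\<close> the map \<open>(U, V, W) \<mapsto> (k\<^sup>2 U + e, k V, W)\<close> with \<open>k = 1 + d W\<^sup>2 / 4\<close> takes \<open>M z0\<close> to
  \<open>M z\<close> with \<open>e\<close> regular at \<open>W = 0\<close>, because \<open>k\<^sup>2 (4 + 2 z0 W\<^sup>2) = 4 + 2 z W\<^sup>2 + O(W\<^sup>4)\<close>. The factor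
  \<open>cut\<close> does not change this, and makes \<open>k\<close> zero-free with \<open>k - 1 = O(W\<^sup>-\<^sup>4)\<close>, so that the map
  extends to \<open>y = 0\<close> and is a homeomorphism from \<open>E z0\<close> to \<open>E z\<close> for all \<open>z0\<close> and \<open>z\<close>.\<close>

definition cut :: "complex \<Rightarrow> complex \<Rightarrow> complex" where
  "cut d W = 1 / of_real (1 + (1 + norm d ^ 3) * norm W ^ 6)"

text \<open>This is \<open>cut\<close> at W = 1/y with the factor |y|^6 taken out. The summand 1
  beside |d|^3 keeps the denominator positive at \<open>y = 0\<close> even when
  \<open>d = 0\<close>.\<close>

definition cut_y :: "complex \<Rightarrow> complex \<Rightarrow> complex" where
  "cut_y d y = 1 / of_real ((1 + norm d ^ 3) + norm y ^ 6)"

definition scale_W :: "complex \<Rightarrow> complex \<Rightarrow> complex" where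
  "scale_W d W = 1 + d * W^2 * cut d W / 4"

definition scale_y :: "complex \<Rightarrow> complex \<Rightarrow> complex" where
  "scale_y d y = 1 + d * y * cnj y ^ 3 * cut_y d y / 4"

text \<open>The quotient of k^2 (2 z0 W^2 + 4) - 2 z W^2 - 4 by W^3, where k is
  \<open>scale_W\<close>, with the division carried out. It comes out even because 1 -
  \<open>cut\<close> contains |W|^6, which is W^3 times the cube of \<open>cnj W\<close>.\<close>

definition shift_U :: "complex \<Rightarrow> complex \<Rightarrow> complex \<Rightarrow> complex" where
  "shift_U z0 d W = d * cut d W * (z0 * W - 2 * of_real (1 + norm d ^ 3) * (W * cnj W)^2 * cnj W)
     + d^2 * (cut d W)^2 * W * (2 + z0 * W^2) / 8"

text \<open>Since x = V/W^2 - W/2, replacing V by k V replaces x by k x + (k - 1)/(2y). The exponent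
  6 in \<open>cut\<close> leaves a factor y in k - 1, so the shift is regular at
  \<open>y = 0\<close>.\<close>

definition shift_x :: "complex \<Rightarrow> complex \<Rightarrow> complex" where
  "shift_x d y = d * cnj y ^ 3 * cut_y d y / 8"

definition triv_xy :: "complex \<Rightarrow> complex \<Rightarrow> complex^2 \<Rightarrow> complex^2" where
  "triv_xy z0 z p = vector [scale_y (z - z0) (p $ 2) * p $ 1 + shift_x (z - z0) (p $ 2), p $ 2]"

definition triv_M :: "complex \<Rightarrow> complex \<Rightarrow> complex^3 \<Rightarrow> complex^3" where
  "triv_M z0 z q = vector [(scale_W (z - z0) (q $ 3))^2 * q $ 1 + shift_U z0 (z - z0) (q $ 3),
     scale_W (z - z0) (q $ 3) * q $ 2, q $ 3]"

definition triv_xy_inv :: "complex \<Rightarrow> complex \<Rightarrow> complex^2 \<Rightarrow> complex^2" where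
  "triv_xy_inv z0 z p = vector [(p $ 1 - shift_x (z - z0) (p $ 2)) / scale_y (z - z0) (p $ 2), p $ 2]"

definition triv_M_inv :: "complex \<Rightarrow> complex \<Rightarrow> complex^3 \<Rightarrow> complex^3" where
  "triv_M_inv z0 z q = vector [(q $ 1 - shift_U z0 (z - z0) (q $ 3)) / (scale_W (z - z0) (q $ 3))^2,
     q $ 2 / scale_W (z - z0) (q $ 3), q $ 3]"

lemma cut_pos: "0 < 1 + (1 + norm d ^ 3) * norm W ^ 6"
  by (simp add: add_pos_nonneg)

lemma cut_y_pos: "0 < (1 + norm d ^ 3) + norm y ^ 6"
  by (simp add: add_pos_nonneg)

text \<open>With t = |d| |W|^2 the denominator of \<open>cut\<close> is at least 1 + t^3, which is
  at least t; this is why |d|^3 multiplies |W|^6. The factor 1/4 makes the bound strict, so that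
  \<open>scale_W\<close> has no zero.\<close>

lemma norm_cut: "norm (d * W^2 * cut d W / 4) < 1"
proof -
  define t where "t = norm d * norm W ^ 2"
  have t: "0 \<le> t" by (simp add: t_def)
  have "t \<le> 1 + t^3"
  proof (cases "t \<le> 1")
    case False
    then have "t * 1 \<le> t * t^2" by (intro mult_left_mono) auto
    then show ?thesis by (simp add: power3_eq_cube power2_eq_square)
  next
    case True
    then show ?thesis using zero_le_power[OF t, of 3] by linarith
  qed
  also have "\<dots> \<le> 1 + (1 + norm d ^ 3) * norm W ^ 6"
    by (simp add: t_def power_mult_distrib distrib_right power_mult[symmetric])
  finally have t1: "t / (1 + (1 + norm d ^ 3) * norm W ^ 6) \<le> 1"
    by (simp only: pos_divide_le_eq[OF cut_pos] mult_1)
  have "norm (d * W^2 * cut d W / 4) = t / (1 + (1 + norm d ^ 3) * norm W ^ 6) / 4"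
    using cut_pos[of d W] by (simp add: cut_def norm_mult norm_divide norm_power t_def del: of_real_add)
  also have "\<dots> \<le> 1 / 4" by (rule divide_right_mono[OF t1]) simp
  also have "\<dots> < 1" by simp
  finally show ?thesis .
qed

lemma scale_W_nonzero: "scale_W d W \<noteq> 0"
proof
  assume "scale_W d W = 0"
  then have "d * W^2 * cut d W / 4 = - 1" by (simp add: scale_W_def add_eq_0_iff)
  then show False using norm_cut[of d W] by (metis norm_minus_cancel norm_one less_irrefl)
qed

lemma norm_power6: "of_real (norm W ^ 6) = (W * cnj W) ^ 3"
proof -
  have "(W * cnj W)^3 = (of_real (norm W ^ 2))^3" by (simp add: complex_norm_square[symmetric])
  then show ?thesis by (simp add: power_mult[symmetric])
qed

lemma scale_W_inverse:
  assumes "y \<noteq> 0"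
  shows "scale_W d (1 / y) = scale_y d y"
proof -
  define c where "c = (of_real (1 + norm d ^ 3) :: complex)"
  have ne: "c + (y * cnj y)^3 \<noteq> 0"
    using cut_y_pos[of d y] unfolding c_def norm_power6[symmetric] of_real_add[symmetric] of_real_eq_0_iff by simp
  have "cut d (1 / y) = 1 / (1 + c * ((1 / y) * cnj (1 / y))^3)"
    unfolding cut_def c_def norm_power6[symmetric] by simp
  also have "\<dots> = (y * cnj y)^3 / ((y * cnj y)^3 + c)"
    using assms ne by (simp add: field_simps)
  finally have 1: "cut d (1 / y) = (y * cnj y)^3 / ((y * cnj y)^3 + c)" .
  have 2: "cut_y d y = 1 / ((y * cnj y)^3 + c)"
    unfolding cut_y_def c_def norm_power6[symmetric] by (simp add: add_ac)
  show ?thesis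
    unfolding scale_W_def scale_y_def 1 2
    using assms ne by (simp add: field_simps power2_eq_square power3_eq_cube add_ac)
qed

lemma scale_y_nonzero: "scale_y d y \<noteq> 0"
proof (cases "y = 0")
  case False
  then show ?thesis using scale_W_inverse scale_W_nonzero by metis
qed (simp add: scale_y_def)

lemma shift_x_eq: "y \<noteq> 0 \<Longrightarrow> shift_x d y = (scale_y d y - 1) / (2 * y)"
  by (simp add: shift_x_def scale_y_def field_simps)

lemma shift_U_eq:
  "shift_U z0 (z - z0) W * W^3 = (scale_W (z - z0) W)^2 * (2 * z0 * W^2 + 4) - 2 * z * W^2 - 4"
proof -
  define d where "d = z - z0"
  define c where "c = (of_real (1 + norm d ^ 3) :: complex)"
  define n where "n = cut d W"
  \<comment> \<open>From here \<open>cnj W\<close> is an independent symbol, tied to W only through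
    the relation for n; the claim becomes a polynomial identity.\<close>
  define v where "v = cnj W"
  define k where "k = scale_W d W"
  define e where "e = shift_U z0 d W"
  have "1 + c * (W * cnj W)^3 \<noteq> 0"
    using cut_pos[of d W] unfolding c_def norm_power6[symmetric]
    by (metis of_real_1 of_real_add of_real_eq_0_iff of_real_mult less_irrefl)
  moreover have "n = 1 / (1 + c * (W * cnj W)^3)"
    unfolding n_def cut_def c_def norm_power6[symmetric] by simp
  ultimately have n: "n * (1 + c * (W * v)^3) = 1" by (simp add: v_def)
  have k: "4 * k = 4 + d * W^2 * n" by (simp add: k_def scale_W_def n_def)
  have e: "8 * e = 8 * d * n * (z0 * W - 2 * c * (W * v)^2 * v) + d^2 * n^2 * W * (2 + z0 * W^2)"
    by (simp add: e_def shift_U_def n_def c_def v_def algebra_simps)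
  have z: "z = z0 + d" by (simp add: d_def)
  have "16 * (e * W^3) = 16 * (k^2 * (2 * z0 * W^2 + 4) - 2 * z * W^2 - 4)"
    using n k e z by algebra
  then have "e * W^3 = k^2 * (2 * z0 * W^2 + 4) - 2 * z * W^2 - 4"
    by (rule mult_left_cancel[THEN iffD1, rotated]) simp
  then show ?thesis by (simp add: d_def[symmetric] k_def e_def)
qed

lemma triv_M_in_M:
  assumes "q \<in> M z0" shows "triv_M z0 z q \<in> M z"
proof -
  define k where "k = scale_W (z - z0) (q $ 3)"
  define e where "e = shift_U z0 (z - z0) (q $ 3)"
  have e: "e * (q $ 3)^3 = k^2 * (2 * z0 * (q $ 3)^2 + 4) - 2 * z * (q $ 3)^2 - 4"
    unfolding e_def k_def by (rule shift_U_eq)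
  have "(q $ 2)^2 = q $ 1 * (q $ 3)^4 + 2 * z0 * (q $ 3)^3 + 4 * q $ 3" using assms by (simp add: M_iff)
  then have "(k * q $ 2)^2 = (k^2 * q $ 1 + e) * (q $ 3)^4 + 2 * z * (q $ 3)^3 + 4 * q $ 3"
    using e by algebra
  then show ?thesis by (simp add: M_iff triv_M_def k_def e_def)
qed

lemma triv_M_inv_in_M:
  assumes "q \<in> M z" shows "triv_M_inv z0 z q \<in> M z0"
proof -
  define k where "k = scale_W (z - z0) (q $ 3)"
  define e where "e = shift_U z0 (z - z0) (q $ 3)"
  define U where "U = (q $ 1 - e) / k^2"
  define V where "V = q $ 2 / k"
  have k: "k \<noteq> 0" using scale_W_nonzero by (simp add: k_def)
  have U: "q $ 1 = k^2 * U + e" and V: "q $ 2 = k * V" using k by (simp_all add: U_def V_def)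
  have e: "e * (q $ 3)^3 = k^2 * (2 * z0 * (q $ 3)^2 + 4) - 2 * z * (q $ 3)^2 - 4"
    unfolding e_def k_def by (rule shift_U_eq)
  have "(q $ 2)^2 = q $ 1 * (q $ 3)^4 + 2 * z * (q $ 3)^3 + 4 * q $ 3" using assms by (simp add: M_iff)
  then have "k^2 * V^2 = k^2 * (U * (q $ 3)^4 + 2 * z0 * (q $ 3)^3 + 4 * q $ 3)"
    unfolding U V using e by algebra
  then have "V^2 = U * (q $ 3)^4 + 2 * z0 * (q $ 3)^3 + 4 * q $ 3" using k by simp
  then show ?thesis by (simp add: M_iff triv_M_inv_def k_def e_def U_def V_def)
qed

lemma triv_inverses [simp]:
  "triv_xy_inv z0 z (triv_xy z0 z p) = p" "triv_xy z0 z (triv_xy_inv z0 z p) = p"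
  "triv_M_inv z0 z (triv_M z0 z q) = q" "triv_M z0 z (triv_M_inv z0 z q) = q"
  by (simp_all add: triv_xy_def triv_xy_inv_def triv_M_def triv_M_inv_def scale_y_nonzero scale_W_nonzero
      vec2_eq_iff vec3_eq_iff)

lemma gluing_triv:
  assumes "(p, q) \<in> gluing z0" shows "(triv_xy z0 z p, triv_M z0 z q) \<in> gluing z"
proof -
  note g = gluingD[OF assms]
  have y: "q $ 3 = 1 / p $ 2" and x: "p $ 1 = q $ 2 / (q $ 3)^2 - q $ 3 / 2"
    using g(4) g(5) M_to_xy_nth(1)[of q] by (metis xy_to_M_nth(3), metis)
  have k: "scale_W (z - z0) (q $ 3) = scale_y (z - z0) (p $ 2)"
    using scale_W_inverse[OF g(3)] y by simp
  have "triv_M z0 z q $ 3 \<noteq> 0" using g(2) by (simp add: triv_M_def)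
  moreover have "triv_xy z0 z p = M_to_xy (triv_M z0 z q)"
  proof -
    have "shift_x (z - z0) (p $ 2) = (scale_y (z - z0) (p $ 2) - 1) * q $ 3 / 2"
      using shift_x_eq[OF g(3)] y by simp
    then show ?thesis using k g(3) y
      by (simp add: triv_xy_def triv_M_def vec2_eq_iff x) (simp add: algebra_simps diff_divide_distrib)
  qed
  ultimately show ?thesis using triv_M_in_M[OF g(1)] gluing_iff' by blast
qed

lemma gluing_triv_inv:
  assumes "(p, q) \<in> gluing z" shows "(triv_xy_inv z0 z p, triv_M_inv z0 z q) \<in> gluing z0"
proof -
  note g = gluingD[OF assms]
  have q: "triv_M_inv z0 z q \<in> M z0" "triv_M_inv z0 z q $ 3 \<noteq> 0"
    using triv_M_inv_in_M[OF g(1)] g(2) by (simp_all add: triv_M_inv_def)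
  then have "(M_to_xy (triv_M_inv z0 z q), triv_M_inv z0 z q) \<in> gluing z0" by (simp add: gluing_iff')
  from gluing_triv[OF this, of z] have "(triv_xy z0 z (M_to_xy (triv_M_inv z0 z q)), q) \<in> gluing z" by simp
  then have "triv_xy z0 z (M_to_xy (triv_M_inv z0 z q)) = p" using g(5) gluingD(5) by metis
  then have "M_to_xy (triv_M_inv z0 z q) = triv_xy_inv z0 z p" by (metis triv_inverses(1))
  then show ?thesis using q gluing_iff' by metis
qed

definition triv :: "complex \<Rightarrow> complex \<times> E_point \<Rightarrow> E_point \<times> complex" where
  "triv z0 = (\<lambda>(z, e). (if e \<in> range (E_xy z0) then E_xy z (triv_xy z0 z (inv_into UNIV (E_xy z0) e))
     else E_M z (triv_M z0 z (inv_into (M z0) (E_M z0) e)), z))"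

definition triv_inv :: "complex \<Rightarrow> E_point \<times> complex \<Rightarrow> complex \<times> E_point" where
  "triv_inv z0 = (\<lambda>(e, z). (z, if e \<in> range (E_xy z) then E_xy z0 (triv_xy_inv z0 z (inv_into UNIV (E_xy z) e))
     else E_M z0 (triv_M_inv z0 z (inv_into (M z) (E_M z) e))))"

lemma inv_E_xy [simp]: "inv_into UNIV (E_xy z) (E_xy z p) = p"
  by (simp add: inv_into_f_f inj_on_def)

lemma inv_E_M [simp]: "q \<in> M z \<Longrightarrow> inv_into (M z) (E_M z) (E_M z q) = q"
  by (simp add: inv_into_f_f inj_on_def E_M_eq_iff)

lemma triv_E_xy [simp]: "triv z0 (z, E_xy z0 p) = (E_xy z (triv_xy z0 z p), z)"
  by (simp add: triv_def)

lemma triv_E_M [simp]: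
  assumes q: "q \<in> M z0" shows "triv z0 (z, E_M z0 q) = (E_M z (triv_M z0 z q), z)"
proof (cases "E_M z0 q \<in> range (E_xy z0)")
  case True
  then obtain p where p: "E_xy z0 p = E_M z0 q" by (metis rangeE)
  then have "(p, q) \<in> gluing z0" using E_xy_eq_E_M_iff[OF q] by simp
  then have "E_xy z (triv_xy z0 z p) = E_M z (triv_M z0 z q)"
    using gluing_triv E_xy_eq_E_M_iff[OF triv_M_in_M[OF q]] by simp
  then show ?thesis using triv_E_xy[of z0 z p] p by simp
qed (use q in \<open>simp add: triv_def\<close>)

lemma triv_inv_E_xy [simp]: "triv_inv z0 (E_xy z p, z) = (z, E_xy z0 (triv_xy_inv z0 z p))"
  by (simp add: triv_inv_def)

lemma triv_inv_E_M [simp]: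
  assumes q: "q \<in> M z" shows "triv_inv z0 (E_M z q, z) = (z, E_M z0 (triv_M_inv z0 z q))"
proof (cases "E_M z q \<in> range (E_xy z)")
  case True
  then obtain p where p: "E_xy z p = E_M z q" by (metis rangeE)
  then have "(p, q) \<in> gluing z" using E_xy_eq_E_M_iff[OF q] by simp
  then have "E_xy z0 (triv_xy_inv z0 z p) = E_M z0 (triv_M_inv z0 z q)"
    using gluing_triv_inv E_xy_eq_E_M_iff[OF triv_M_inv_in_M[OF q]] by simp
  then show ?thesis using triv_inv_E_xy[of z0 z p] p by simp
qed (use q in \<open>simp add: triv_inv_def\<close>)

lemma continuous_on_vector2 [continuous_intros]:
  fixes f g :: "'a::topological_space \<Rightarrow> complex"
  assumes "continuous_on S f" "continuous_on S g"
  shows "continuous_on S (\<lambda>x. vector [f x, g x] :: complex^2)"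
proof -
  have "continuous_on S (\<lambda>x. (vector [f x, g x] :: complex^2) $ i)" for i
    using exhaust_2[of i] assms by auto
  then show ?thesis
    using continuous_on_vec_lambda[of S "\<lambda>i x. (vector [f x, g x] :: complex^2) $ i"] by simp
qed

lemma continuous_on_vector3 [continuous_intros]:
  fixes f g h :: "'a::topological_space \<Rightarrow> complex"
  assumes "continuous_on S f" "continuous_on S g" "continuous_on S h"
  shows "continuous_on S (\<lambda>x. vector [f x, g x, h x] :: complex^3)"
proof -
  have "continuous_on S (\<lambda>x. (vector [f x, g x, h x] :: complex^3) $ i)" for i
    using exhaust_3[of i] assms by auto
  then show ?thesis
    using continuous_on_vec_lambda[of S "\<lambda>i x. (vector [f x, g x, h x] :: complex^3) $ i"] by simp
qed

lemma continuous_on_vector4 [continuous_intros]: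
  fixes f g h k :: "'a::topological_space \<Rightarrow> complex"
  assumes "continuous_on S f" "continuous_on S g" "continuous_on S h" "continuous_on S k"
  shows "continuous_on S (\<lambda>x. vector [f x, g x, h x, k x] :: complex^4)"
proof -
  have "continuous_on S (\<lambda>x. (vector [f x, g x, h x, k x] :: complex^4) $ i)" for i
    using exhaust_4[of i] assms by auto
  then show ?thesis
    using continuous_on_vec_lambda[of S "\<lambda>i x. (vector [f x, g x, h x, k x] :: complex^4) $ i"] by simp
qed

lemma continuous_on_cut [continuous_intros]:
  assumes "continuous_on S f" "continuous_on S g"
  shows "continuous_on S (\<lambda>x. cut (f x) (g x))" "continuous_on S (\<lambda>x. cut_y (f x) (g x))"
  unfolding cut_def cut_y_def
  by (intro continuous_intros assms; use cut_pos cut_y_pos in \<open>metis less_irrefl of_real_eq_0_iff\<close>)+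

lemma continuous_on_triv_coeffs [continuous_intros]:
  assumes "continuous_on S f" "continuous_on S g"
  shows "continuous_on S (\<lambda>x. scale_W (f x) (g x))" "continuous_on S (\<lambda>x. scale_y (f x) (g x))"
    "continuous_on S (\<lambda>x. shift_U z0 (f x) (g x))" "continuous_on S (\<lambda>x. shift_x (f x) (g x))"
  unfolding scale_W_def scale_y_def shift_U_def shift_x_def
  by (intro continuous_intros assms; simp)+

text \<open>The criterion \<open>continuous_map_glued_topology\<close> concerns the glued space
  alone, not its product with a parameter plane. Since the images of both pieces are open,
  continuity is pasted from the two open products instead.\<close>

lemma continuous_map_prod_glued:
  fixes f :: "complex \<times> 'c \<Rightarrow> 'y"
  assumes G: "gluing_data j S k T \<alpha> \<beta> t t'"
    and S: "continuous_map (prod_topology euclidean (top_of_set S)) Y (\<lambda>(z,a). f (z, j a))"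
    and T: "continuous_map (prod_topology euclidean (top_of_set T)) Y (\<lambda>(z,b). f (z, k b))"
  shows "continuous_map (prod_topology euclidean (glued_topology j S k T)) Y f"
proof -
  interpret gluing_data j S k T \<alpha> \<beta> t t' by (rule G)
  have sub: "subtopology (prod_topology euclidean X) (UNIV \<times> D) = prod_topology euclidean (subtopology X D)" for D
    using subtopology_Times[of euclidean X UNIV D] by simp
  have piece: "continuous_map (prod_topology euclidean (subtopology X (i ` R))) Y f"
    if h: "homeomorphic_maps (top_of_set R) (subtopology X (i ` R)) i i'"
      and c: "continuous_map (prod_topology euclidean (top_of_set R)) Y (\<lambda>(z,a). f (z, i a))"
      and sub: "i ` R \<subseteq> topspace X"
    for i :: "'q::topological_space \<Rightarrow> 'c" and R i'
  proof -
    have "continuous_map (prod_topology euclidean (subtopology X (i ` R))) (prod_topology euclidean (top_of_set R))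
      (\<lambda>(z,e). (z, i' e))"
      using h unfolding homeomorphic_maps_def case_prod_unfold
      by (intro continuous_map_pairedI continuous_map_fst continuous_map_compose[OF continuous_map_snd, unfolded o_def]) auto
    from continuous_map_compose[OF this c]
    show ?thesis
    proof (rule continuous_map_eq)
      fix x assume "x \<in> topspace (prod_topology (euclidean :: complex topology) (subtopology X (i ` R)))"
      then have "snd x \<in> i ` R" by auto
      then have "i (i' (snd x)) = snd x"
        using h sub unfolding homeomorphic_maps_def by auto
      then show "((\<lambda>(z, a). f (z, i a)) \<circ> (\<lambda>(z, e). (z, i' e))) x = f x"
        by (simp add: case_prod_unfold)
    qed
  qed
  show ?thesis
  proof (rule pasting_lemma[where I = UNIV and T = "\<lambda>b. UNIV \<times> (if b then j ` S else k ` T)" and f = "\<lambda>b. f"])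
    show "openin (prod_topology euclidean X) (UNIV \<times> (if b then j ` S else k ` T))" for b
      using openin_image_j[of S] openin_image_k[of T] by (simp add: openin_prod_Times_iff)
    show "continuous_map (subtopology (prod_topology euclidean X) (UNIV \<times> (if b then j ` S else k ` T))) Y f" for b
      using piece[OF homeomorphic_maps_j[of S] S] piece[OF homeomorphic_maps_k[of T] T]
      by (auto simp: sub topspace_glued_topology)
    show "\<exists>b. b \<in> UNIV \<and> x \<in> UNIV \<times> (if b then j ` S else k ` T) \<and> f x = f x"
      if "x \<in> topspace (prod_topology (euclidean :: complex topology) X)" for x
    proof -
      have "snd x \<in> j ` S \<or> snd x \<in> k ` T" using that by (auto simp: topspace_glued_topology)
      then show ?thesis by (cases x) (auto intro: exI[of _ True] exI[of _ False])
    qed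
  qed auto
qed

text \<open>The formulas make sense for all z0 and z, so a single map trivializes the bundle over
  the whole plane and no covering by small discs is needed. Only continuity is asked for, which
  leaves room for the non-holomorphic factor.\<close>

lemma homeomorphic_map_triv: "homeomorphic_map (prod_topology euclidean (E_top z0)) P_top (triv z0)"
  unfolding homeomorphic_map_maps
proof
  have xy: "P_xy (vector [triv_xy z0 z p $ 1, triv_xy z0 z p $ 2, z]) = triv z0 (z, E_xy z0 p)" for z p
    by (simp add: P_xy_def)
  have M: "P_M (vector [triv_M z0 z q $ 1, triv_M z0 z q $ 2, triv_M z0 z q $ 3, z]) = triv z0 (z, E_M z0 q)"
    if "q \<in> M z0" for z q using that by (simp add: P_M_def)
  have 1: "continuous_map (prod_topology euclidean (E_top z0)) P_top (triv z0)"
    unfolding E_top_def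
  proof (rule continuous_map_prod_glued[OF gluing_data_E])
    have "continuous_on UNIV (\<lambda>x::complex \<times> (complex^2). vector [triv_xy z0 (fst x) (snd x) $ 1, triv_xy z0 (fst x) (snd x) $ 2, fst x] :: complex^3)"
      unfolding triv_xy_def vector_2 by (intro continuous_intros)
    then have "continuous_map (prod_topology euclidean euclidean) euclidean
       (\<lambda>x::complex \<times> (complex^2). vector [triv_xy z0 (fst x) (snd x) $ 1, triv_xy z0 (fst x) (snd x) $ 2, fst x] :: complex^3)"
      by simp
    from continuous_map_compose[OF this, of P_top P_xy]
    show "continuous_map (prod_topology euclidean (top_of_set UNIV)) P_top (\<lambda>(z, a). triv z0 (z, E_xy z0 a))"
      using continuous_map_into_glued[of UNIV P_xy P_M total_M]
      by (simp add: P_top_def o_def xy case_prod_unfold)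
    have "continuous_on (UNIV \<times> M z0) (\<lambda>x::complex \<times> (complex^3). vector [triv_M z0 (fst x) (snd x) $ 1, triv_M z0 (fst x) (snd x) $ 2,
        triv_M z0 (fst x) (snd x) $ 3, fst x] :: complex^4)"
      unfolding triv_M_def vector_3 by (intro continuous_intros)
    then have c: "continuous_map (prod_topology euclidean (top_of_set (M z0))) (top_of_set total_M)
       (\<lambda>x::complex \<times> (complex^3). vector [triv_M z0 (fst x) (snd x) $ 1, triv_M z0 (fst x) (snd x) $ 2,
        triv_M z0 (fst x) (snd x) $ 3, fst x] :: complex^4)"
    proof -
      assume c: "continuous_on (UNIV \<times> M z0) (\<lambda>x::complex \<times> (complex^3). vector [triv_M z0 (fst x) (snd x) $ 1,
        triv_M z0 (fst x) (snd x) $ 2, triv_M z0 (fst x) (snd x) $ 3, fst x] :: complex^4)"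
      have e: "prod_topology euclidean (top_of_set (M z0)) = top_of_set ((UNIV :: complex set) \<times> M z0)"
        using subtopology_Times[of "euclidean :: complex topology" "euclidean :: (complex^3) topology" UNIV "M z0"] by simp
      show ?thesis
        unfolding e using c triv_M_in_M[of _ z0] by (auto simp: continuous_map_in_subtopology total_M_mem)
    qed
    have "continuous_map (top_of_set total_M) P_top P_M"
      unfolding P_top_def by (subst glued_topology_commute) (rule continuous_map_into_glued)
    from continuous_map_compose[OF c this]
    show "continuous_map (prod_topology euclidean (top_of_set (M z0))) P_top (\<lambda>(z, b). triv z0 (z, E_M z0 b))"
      by (rule continuous_map_eq) (auto simp: M)
  qed
  have 2: "continuous_map P_top (prod_topology euclidean (E_top z0)) (triv_inv z0)"
    unfolding P_top_def
  proof (rule continuous_map_glued_topology)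
    have "continuous_on UNIV (\<lambda>r. triv_xy_inv z0 (r $ 3) (vector [r $ 1, r $ 2]))"
      unfolding triv_xy_inv_def vector_2 by (intro continuous_intros) (simp add: scale_y_nonzero)
    then have "continuous_map euclidean (E_top z0) (\<lambda>r. E_xy z0 (triv_xy_inv z0 (r $ 3) (vector [r $ 1, r $ 2])))"
      using continuous_map_compose[of euclidean euclidean _ "E_top z0" "E_xy z0"]
        continuous_map_into_glued[of UNIV "E_xy z0" "E_M z0" "M z0"]
      by (fastforce simp: E_top_def o_def)
    then show "continuous_map (top_of_set UNIV) (prod_topology euclidean (E_top z0)) (\<lambda>a. triv_inv z0 (P_xy a))"
      by (auto simp: P_xy_def intro!: continuous_map_pairedI continuous_intros)
    have "continuous_on total_M (\<lambda>r. triv_M_inv z0 (r $ 4) (vector [r $ 1, r $ 2, r $ 3]))"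
      unfolding triv_M_inv_def vector_3 by (intro continuous_intros) (simp_all add: scale_W_nonzero)
    then have c: "continuous_map (top_of_set total_M) (top_of_set (M z0)) (\<lambda>r. triv_M_inv z0 (r $ 4) (vector [r $ 1, r $ 2, r $ 3]))"
      using triv_M_inv_in_M by (auto simp: continuous_map_in_subtopology total_M_mem)
    have "continuous_map (top_of_set (M z0)) (E_top z0) (E_M z0)"
      unfolding E_top_def by (subst glued_topology_commute) (rule continuous_map_into_glued)
    from continuous_map_compose[OF c this]
    have "continuous_map (top_of_set total_M) (E_top z0) (\<lambda>r. E_M z0 (triv_M_inv z0 (r $ 4) (vector [r $ 1, r $ 2, r $ 3])))"
      by (simp add: o_def)
    then have "continuous_map (top_of_set total_M) (prod_topology euclidean (E_top z0))
      (\<lambda>r. (r $ 4, E_M z0 (triv_M_inv z0 (r $ 4) (vector [r $ 1, r $ 2, r $ 3]))))"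
      by (intro continuous_map_pairedI) (auto intro!: continuous_intros)
    then show "continuous_map (top_of_set total_M) (prod_topology euclidean (E_top z0)) (\<lambda>b. triv_inv z0 (P_M b))"
      by (rule continuous_map_eq) (auto simp: P_M_def total_M_mem)
  qed
  have 3: "triv_inv z0 (triv z0 x) = x" if "x \<in> topspace (prod_topology (euclidean :: complex topology) (E_top z0))" for x
  proof -
    have "snd x \<in> range (E_xy z0) \<or> snd x \<in> E_M z0 ` M z0"
      using that by (auto simp: topspace_E_top E_set_eq)
    then show ?thesis using triv_M_in_M by (cases x) auto
  qed
  have 4: "triv z0 (triv_inv z0 x) = x" if "x \<in> topspace P_top" for x
  proof -
    have "fst x \<in> range (E_xy (snd x)) \<or> fst x \<in> E_M (snd x) ` M (snd x)"
      using that by (auto simp: topspace_P_top bundle_set_def topspace_E_top E_set_eq)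
    then show ?thesis using triv_M_inv_in_M by (cases x) auto
  qed
  show "homeomorphic_maps (prod_topology euclidean (E_top z0)) P_top (triv z0) (triv_inv z0)"
    unfolding homeomorphic_maps_def using 1 2 3 4 by blast
qed

lemma fibre_bundle_P: "fibre_bundle_over_plane E_top P_top P_charts"
  unfolding fibre_bundle_over_plane_def
proof (intro conjI ballI allI)
  show "topspace P_top = bundle_set E_top" by (rule topspace_P_top)
  show "complex_manifold P_top P_charts" by (rule complex_manifold_P)
  show "\<exists>(D,\<phi>)\<in>P_charts. p \<in> D \<and> (\<forall>q\<in>D. \<phi> q $ 3 = snd q)" if "p \<in> bundle_set E_top" for p
    using P_submersion[OF that] .
  fix z0
  have "subtopology P_top {p \<in> bundle_set E_top. snd p \<in> UNIV} = P_top"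
    by (simp add: topspace_P_top[symmetric])
  then have "homeomorphic_map (prod_topology (top_of_set UNIV) (E_top z0))
      (subtopology P_top {p \<in> bundle_set E_top. snd p \<in> UNIV}) (triv z0)"
    using homeomorphic_map_triv by simp
  moreover have "snd (triv z0 (z, e)) = z" for z e by (simp add: triv_def)
  ultimately show "\<exists>N h. open N \<and> z0 \<in> N \<and>
        homeomorphic_map (prod_topology (top_of_set N) (E_top z0))
          (subtopology P_top {p \<in> bundle_set E_top. snd p \<in> N}) h \<and>
        (\<forall>z\<in>N. \<forall>e\<in>topspace (E_top z0). snd (h (z, e)) = z)"
    by (intro exI[of _ UNIV] exI[of _ "triv z0"]) auto
qed

subsection \<open>Holomorphic ordinary differential equations\<close>

type_synonym 'n vector_field = "complex \<Rightarrow> complex^'n \<Rightarrow> complex^'n"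

text \<open>What Picard iteration requires of a right-hand side: a bound and a Lipschitz constant on
  bounded sets, and holomorphy along holomorphic curves. The class contains constants, time and
  coordinates and is closed under sums and products, hence contains all polynomial fields.\<close>

definition tame_fun :: "(complex \<Rightarrow> complex^'n \<Rightarrow> complex) \<Rightarrow> bool" where
  "tame_fun f \<longleftrightarrow>
     (\<forall>R. \<exists>B\<ge>0. \<forall>z p q. norm z \<le> R \<longrightarrow> norm p \<le> R \<longrightarrow> norm q \<le> R \<longrightarrow>
        norm (f z p) \<le> B \<and> norm (f z p - f z q) \<le> B * norm (p - q)) \<and>
     (\<forall>S s. (\<forall>i. (\<lambda>z. s z $ i) holomorphic_on S) \<longrightarrow> (\<lambda>z. f z (s z)) holomorphic_on S)"

lemma tame_fun_bound:
  assumes "tame_fun f"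
  obtains B where "B \<ge> 0" "\<And>z p q. norm z \<le> R \<Longrightarrow> norm p \<le> R \<Longrightarrow> norm q \<le> R \<Longrightarrow>
        norm (f z p) \<le> B \<and> norm (f z p - f z q) \<le> B * norm (p - q)"
proof -
  have "\<exists>B\<ge>0. \<forall>z p q. norm z \<le> R \<longrightarrow> norm p \<le> R \<longrightarrow> norm q \<le> R \<longrightarrow>
        norm (f z p) \<le> B \<and> norm (f z p - f z q) \<le> B * norm (p - q)"
    using assms unfolding tame_fun_def by simp
  then show ?thesis using that by auto
qed

lemma tame_fun_holomorphic:
  "tame_fun f \<Longrightarrow> (\<And>i. (\<lambda>z. s z $ i) holomorphic_on S) \<Longrightarrow> (\<lambda>z. f z (s z)) holomorphic_on S"
  unfolding tame_fun_def by simp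

lemma tame_fun_const: "tame_fun (\<lambda>z p. c)"
  unfolding tame_fun_def
proof (intro conjI allI impI)
  show "\<exists>B\<ge>0. \<forall>z p q. norm z \<le> R \<longrightarrow> norm p \<le> R \<longrightarrow> norm q \<le> R \<longrightarrow> norm c \<le> B \<and> norm (c - c) \<le> B * norm (p - q)" for R :: real
    by (rule exI[of _ "norm c"]) auto
qed auto

lemma tame_fun_time: "tame_fun (\<lambda>z p. z)"
  unfolding tame_fun_def
proof (intro conjI allI impI)
  show "\<exists>B\<ge>0. \<forall>z p q. norm z \<le> R \<longrightarrow> norm p \<le> R \<longrightarrow> norm q \<le> R \<longrightarrow> norm z \<le> B \<and> norm (z - z) \<le> B * norm (p - q)" for R :: real
    by (rule exI[of _ "\<bar>R\<bar>"]) auto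
qed auto

lemma tame_fun_nth: "tame_fun (\<lambda>z p. p $ i)"
  unfolding tame_fun_def
proof (intro conjI allI impI)
  have "norm (p $ i) \<le> \<bar>R\<bar> + 1" "norm (p $ i - q $ i) \<le> (\<bar>R\<bar> + 1) * norm (p - q)" if "norm p \<le> R" for R p q
  proof -
    have "norm (p $ i) \<le> norm p" by (rule Finite_Cartesian_Product.norm_nth_le)
    then show "norm (p $ i) \<le> \<bar>R\<bar> + 1" using that by linarith
    have "norm (p $ i - q $ i) \<le> 1 * norm (p - q)" using Finite_Cartesian_Product.norm_nth_le[of "p - q" i] by simp
    also have "\<dots> \<le> (\<bar>R\<bar> + 1) * norm (p - q)" by (intro mult_right_mono) auto
    finally show "norm (p $ i - q $ i) \<le> (\<bar>R\<bar> + 1) * norm (p - q)" .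
  qed
  then show "\<exists>B\<ge>0. \<forall>z p q. norm z \<le> R \<longrightarrow> norm p \<le> R \<longrightarrow> norm q \<le> R \<longrightarrow> norm (p $ i) \<le> B \<and> norm (p $ i - q $ i) \<le> B * norm (p - q)" for R
    by (intro exI[of _ "\<bar>R\<bar> + 1"]) auto
qed auto

lemma tame_fun_add:
  assumes "tame_fun f" "tame_fun g" shows "tame_fun (\<lambda>z p. f z p + g z p)"
  unfolding tame_fun_def
proof (intro conjI allI impI)
  fix R
  obtain B where B: "B \<ge> 0" "\<And>z p q. norm z \<le> R \<Longrightarrow> norm p \<le> R \<Longrightarrow> norm q \<le> R \<Longrightarrow>
        norm (f z p) \<le> B \<and> norm (f z p - f z q) \<le> B * norm (p - q)"
    using tame_fun_bound[OF assms(1)] by blast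
  obtain C where C: "C \<ge> 0" "\<And>z p q. norm z \<le> R \<Longrightarrow> norm p \<le> R \<Longrightarrow> norm q \<le> R \<Longrightarrow>
        norm (g z p) \<le> C \<and> norm (g z p - g z q) \<le> C * norm (p - q)"
    using tame_fun_bound[OF assms(2)] by blast
  have "norm (f z p + g z p) \<le> B + C \<and> norm (f z p + g z p - (f z q + g z q)) \<le> (B + C) * norm (p - q)"
    if "norm z \<le> R" "norm p \<le> R" "norm q \<le> R" for z p q
  proof
    show "norm (f z p + g z p) \<le> B + C" using B(2)[OF that] C(2)[OF that] norm_triangle_ineq[of "f z p" "g z p"] by linarith
    have e: "f z p + g z p - (f z q + g z q) = (f z p - f z q) + (g z p - g z q)" by simp
    show "norm (f z p + g z p - (f z q + g z q)) \<le> (B + C) * norm (p - q)"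
      unfolding e distrib_right
      using B(2)[OF that] C(2)[OF that] norm_triangle_ineq[of "f z p - f z q" "g z p - g z q"] by linarith
  qed
  then show "\<exists>B\<ge>0. \<forall>z p q. norm z \<le> R \<longrightarrow> norm p \<le> R \<longrightarrow> norm q \<le> R \<longrightarrow>
    norm (f z p + g z p) \<le> B \<and> norm (f z p + g z p - (f z q + g z q)) \<le> B * norm (p - q)"
    using B(1) C(1) by (intro exI[of _ "B + C"]) simp
next
  fix S and s :: "complex \<Rightarrow> complex^'a" assume "\<forall>i. (\<lambda>z. s z $ i) holomorphic_on S"
  then show "(\<lambda>z. f z (s z) + g z (s z)) holomorphic_on S"
    by (intro holomorphic_on_add tame_fun_holomorphic[OF assms(1)] tame_fun_holomorphic[OF assms(2)]) blast+
qed

lemma tame_fun_mult: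
  assumes "tame_fun f" "tame_fun g" shows "tame_fun (\<lambda>z p. f z p * g z p)"
  unfolding tame_fun_def
proof (intro conjI allI impI)
  fix R
  obtain B where B: "B \<ge> 0" "\<And>z p q. norm z \<le> R \<Longrightarrow> norm p \<le> R \<Longrightarrow> norm q \<le> R \<Longrightarrow>
        norm (f z p) \<le> B \<and> norm (f z p - f z q) \<le> B * norm (p - q)"
    using tame_fun_bound[OF assms(1)] by blast
  obtain C where C: "C \<ge> 0" "\<And>z p q. norm z \<le> R \<Longrightarrow> norm p \<le> R \<Longrightarrow> norm q \<le> R \<Longrightarrow>
        norm (g z p) \<le> C \<and> norm (g z p - g z q) \<le> C * norm (p - q)"
    using tame_fun_bound[OF assms(2)] by blast
  \<comment> \<open>One constant has to serve both estimates; the difference of products splits into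
    two terms, each contributing B C.\<close>
  have "norm (f z p * g z p) \<le> 2 * (B * C) \<and> norm (f z p * g z p - f z q * g z q) \<le> 2 * (B * C) * norm (p - q)"
    if n: "norm z \<le> R" "norm p \<le> R" "norm q \<le> R" for z p q
  proof
    have "norm (f z p * g z p) \<le> B * C"
      unfolding norm_mult using B(1) B(2)[OF n] C(2)[OF n] by (intro mult_mono) auto
    then show "norm (f z p * g z p) \<le> 2 * (B * C)" using B(1) C(1) mult_nonneg_nonneg[of B C] by linarith
    have e: "f z p * g z p - f z q * g z q = f z p * (g z p - g z q) + (f z p - f z q) * g z q" by (simp add: algebra_simps)
    have "norm (f z p * (g z p - g z q)) \<le> B * (C * norm (p - q))"
      unfolding norm_mult using B(1) B(2)[OF n] C(2)[OF n] by (intro mult_mono) auto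
    moreover have "norm ((f z p - f z q) * g z q) \<le> (B * norm (p - q)) * C"
      unfolding norm_mult using B(1) B(2)[OF n] C(2)[OF n(1,3,3)] by (intro mult_mono) auto
    moreover have "B * (C * norm (p - q)) = B * C * norm (p - q)" "(B * norm (p - q)) * C = B * C * norm (p - q)"
      by simp_all
    ultimately show "norm (f z p * g z p - f z q * g z q) \<le> 2 * (B * C) * norm (p - q)"
      unfolding e using norm_triangle_ineq[of "f z p * (g z p - g z q)" "(f z p - f z q) * g z q"] by linarith
  qed
  then show "\<exists>B\<ge>0. \<forall>z p q. norm z \<le> R \<longrightarrow> norm p \<le> R \<longrightarrow> norm q \<le> R \<longrightarrow>
    norm (f z p * g z p) \<le> B \<and> norm (f z p * g z p - f z q * g z q) \<le> B * norm (p - q)"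
    using B(1) C(1) by (intro exI[of _ "2 * (B * C)"]) simp
next
  fix S and s :: "complex \<Rightarrow> complex^'a" assume "\<forall>i. (\<lambda>z. s z $ i) holomorphic_on S"
  then show "(\<lambda>z. f z (s z) * g z (s z)) holomorphic_on S"
    by (intro holomorphic_on_mult tame_fun_holomorphic[OF assms(1)] tame_fun_holomorphic[OF assms(2)]) blast+
qed

lemma tame_fun_uminus: "tame_fun f \<Longrightarrow> tame_fun (\<lambda>z p. - f z p)"
  using tame_fun_mult[OF tame_fun_const[of "-1"], of f] by simp

lemma tame_fun_diff: "tame_fun f \<Longrightarrow> tame_fun g \<Longrightarrow> tame_fun (\<lambda>z p. f z p - g z p)"
  using tame_fun_add[OF _ tame_fun_uminus, of f g] by simp

lemma tame_fun_power: "tame_fun f \<Longrightarrow> tame_fun (\<lambda>z p. f z p ^ n)"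
  by (induction n) (auto intro: tame_fun_const tame_fun_mult)

lemma tame_fun_divide_const: "tame_fun f \<Longrightarrow> tame_fun (\<lambda>z p. f z p / c)"
  using tame_fun_mult[OF _ tame_fun_const[of "inverse c"], of f] by (simp add: divide_inverse)

lemmas tame_fun_intros = tame_fun_const tame_fun_time tame_fun_nth tame_fun_add tame_fun_mult
  tame_fun_uminus tame_fun_diff tame_fun_power tame_fun_divide_const

definition tame :: "'n::finite vector_field \<Rightarrow> bool" where
  "tame X \<longleftrightarrow> (\<forall>i. tame_fun (\<lambda>z p. X z p $ i))"

section \<open>Local existence and uniqueness in complex time\<close>

definition solves_field :: "'n vector_field \<Rightarrow> complex set \<Rightarrow> (complex \<Rightarrow> complex^'n) \<Rightarrow> bool" where
  "solves_field X S s \<longleftrightarrow> (\<forall>z\<in>S. \<forall>i. ((\<lambda>z. s z $ i) has_field_derivative X z (s z) $ i) (at z))"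

lemma norm_vec_le_sum: "norm (v :: complex^'n) \<le> (\<Sum>i\<in>UNIV. norm (v $ i))"
  unfolding norm_vec_def by (rule L2_set_le_sum) simp

lemma norm_vec_le_card:
  assumes "\<And>i. norm ((v :: complex^'n) $ i) \<le> c"
  shows "norm v \<le> real CARD('n) * c"
  using norm_vec_le_sum[of v] sum_bounded_above[of UNIV "\<lambda>i. norm (v $ i)" c] assms by fastforce

lemma tame_bounds:
  assumes "tame X"
  obtains B where "B \<ge> 0"
    "\<And>z p i. norm z \<le> R \<Longrightarrow> norm p \<le> R \<Longrightarrow> norm (X z p $ i) \<le> B"
    "\<And>z p q i. norm z \<le> R \<Longrightarrow> norm p \<le> R \<Longrightarrow> norm q \<le> R \<Longrightarrow> norm (X z p $ i - X z q $ i) \<le> B * norm (p - q)"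
proof -
  have "\<forall>i. \<exists>B\<ge>0. \<forall>z p q. norm z \<le> R \<longrightarrow> norm p \<le> R \<longrightarrow> norm q \<le> R \<longrightarrow>
        norm (X z p $ i) \<le> B \<and> norm (X z p $ i - X z q $ i) \<le> B * norm (p - q)"
    using assms unfolding tame_def tame_fun_def by simp
  then obtain B where B: "\<And>i. B i \<ge> 0" "\<And>i z p q. norm z \<le> R \<Longrightarrow> norm p \<le> R \<Longrightarrow> norm q \<le> R \<Longrightarrow>
        norm (X z p $ i) \<le> B i \<and> norm (X z p $ i - X z q $ i) \<le> B i * norm (p - q)" by metis
  have le: "B i \<le> (\<Sum>i\<in>UNIV. B i)" for i using B(1) by (intro member_le_sum) auto
  show ?thesis
  proof (rule that[of "\<Sum>i\<in>UNIV. B i"])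
    show "(\<Sum>i\<in>UNIV. B i) \<ge> 0" using B(1) by (simp add: sum_nonneg)
    show "norm (X z p $ i) \<le> (\<Sum>i\<in>UNIV. B i)" if "norm z \<le> R" "norm p \<le> R" for z p i
      using B(2)[of z p p i] le[of i] that by linarith
    show "norm (X z p $ i - X z q $ i) \<le> (\<Sum>i\<in>UNIV. B i) * norm (p - q)"
      if "norm z \<le> R" "norm p \<le> R" "norm q \<le> R" for z p q i
      using B(2)[of z p q i] that mult_right_mono[OF le[of i] norm_ge_zero[of "p - q"]] by linarith
  qed
qed

text \<open>Picard iteration with primitives on a disc in place of integrals. The factor
  \<open>CARD('n)\<close> is the price for estimating the components separately. The two smallness
  conditions keep the iterates within \<rho> of a and make consecutive differences shrink by the
  factor 1/2.\<close>

lemma Picard_existence: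
  fixes X :: "'n::finite vector_field"
  assumes X: "tame X"
    and \<delta>: "0 < \<delta>" "norm \<zeta> + \<delta> \<le> R" "norm a + \<rho> \<le> R" "0 \<le> \<rho>"
    and B: "0 \<le> B" "\<And>z p i. norm z \<le> R \<Longrightarrow> norm p \<le> R \<Longrightarrow> norm (X z p $ i) \<le> B"
    "\<And>z p q i. norm z \<le> R \<Longrightarrow> norm p \<le> R \<Longrightarrow> norm q \<le> R \<Longrightarrow> norm (X z p $ i - X z q $ i) \<le> B * norm (p - q)"
    and small: "real CARD('n) * (B * \<delta>) \<le> \<rho>" "real CARD('n) * (B * \<delta>) \<le> 1 / 2"
  shows "\<exists>s. s \<zeta> = a \<and> solves_field X (ball \<zeta> \<delta>) s"
proof -
  let ?b = "ball \<zeta> \<delta>"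
  have zR: "norm z \<le> R" if "z \<in> ?b" for z
    using that \<delta>(2) norm_triangle_sub[of z \<zeta>] by (simp add: dist_norm norm_minus_commute)
  have pR: "norm p \<le> R" if "norm (p - a) \<le> \<rho>" for p
    using that \<delta>(3) norm_triangle_sub[of p a] by simp
  \<comment> \<open>The primitive that vanishes at the centre, chosen as a function of g so that it
    can enter the recursion. For g without a primitive the value is arbitrary; the invariant below
    shows that the iteration meets only holomorphic g.\<close>
  define prim where "prim g = (SOME G. G \<zeta> = 0 \<and> (\<forall>z\<in>?b. (G has_field_derivative g z) (at z)))" for g :: "complex \<Rightarrow> complex"
  have prim: "prim g \<zeta> = 0" "\<And>z. z \<in> ?b \<Longrightarrow> (prim g has_field_derivative g z) (at z)" if g: "g holomorphic_on ?b" for g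
  proof -
    obtain G where G: "\<And>z. z \<in> ?b \<Longrightarrow> (G has_field_derivative g z) (at z within ?b)"
      using holomorphic_convex_primitive'[OF convex_ball open_ball g] by metis
    have "((\<lambda>z. G z - G \<zeta>) has_field_derivative g z) (at z)" if "z \<in> ?b" for z
      using G[OF that] that by (auto intro!: derivative_eq_intros simp: at_within_open[OF that open_ball])
    then have "\<exists>G. G \<zeta> = 0 \<and> (\<forall>z\<in>?b. (G has_field_derivative g z) (at z))"
      by (intro exI[of _ "\<lambda>z. G z - G \<zeta>"]) simp
    from someI_ex[OF this]
    show "prim g \<zeta> = 0" "\<And>z. z \<in> ?b \<Longrightarrow> (prim g has_field_derivative g z) (at z)"
      unfolding prim_def by auto
  qed
  have mv: "norm (G z) \<le> c * \<delta>"
    if "G \<zeta> = 0" "\<And>z. z \<in> ?b \<Longrightarrow> (G has_field_derivative g z) (at z)" "\<And>z. z \<in> ?b \<Longrightarrow> norm (g z) \<le> c" "z \<in> ?b" for G g c z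
  proof -
    have c: "0 \<le> c" using that(3)[OF that(4)] norm_ge_zero order.trans by blast
    have "norm (G z - G \<zeta>) \<le> c * norm (z - \<zeta>)"
      by (rule field_differentiable_bound[of ?b G g])
        (use that \<delta> in \<open>auto intro: has_field_derivative_at_within\<close>)
    also have "\<dots> \<le> c * \<delta>" using that(4) c by (intro mult_left_mono) (auto simp: dist_norm norm_minus_commute)
    finally show ?thesis using that(1) by simp
  qed
  define step where "step s = (\<lambda>z. \<chi> i. a $ i + prim (\<lambda>z. X z (s z) $ i) z)" for s
  define s where "s n = (step ^^ n) (\<lambda>_. a)" for n
  have s_Suc: "s (Suc n) z $ i = a $ i + prim (\<lambda>z. X z (s n z) $ i) z" for n z i
    by (simp add: s_def step_def)
  have inv: "(\<forall>i. (\<lambda>z. s n z $ i) holomorphic_on ?b) \<and> (\<forall>z\<in>?b. norm (s n z - a) \<le> \<rho>) \<and> s n \<zeta> = a" for n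
  proof (induction n)
    case 0
    then show ?case using \<delta> by (simp add: s_def)
  next
    case (Suc n)
    have h: "(\<lambda>z. X z (s n z) $ i) holomorphic_on ?b" for i
      using X Suc by (intro tame_fun_holomorphic[of "\<lambda>z p. X z p $ i"]) (auto simp: tame_def)
    have d: "((\<lambda>z. s (Suc n) z $ i) has_field_derivative X z (s n z) $ i) (at z)" if "z \<in> ?b" for z i
      unfolding s_Suc using prim(2)[of "\<lambda>z. X z (s n z) $ i", OF h that] by (auto intro!: derivative_eq_intros)
    have "norm (s (Suc n) z - a) \<le> \<rho>" if z: "z \<in> ?b" for z
    proof -
      have "norm (prim (\<lambda>z. X z (s n z) $ i) z) \<le> B * \<delta>" for i
      proof (rule mv[OF prim(1)[OF h] prim(2)[OF h] _ z])
        fix z assume z: "z \<in> ?b"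
        show "norm (X z (s n z) $ i) \<le> B" using B(2)[OF zR[OF z] pR] Suc z by blast
      qed
      then have "norm (s (Suc n) z - a) \<le> real CARD('n) * (B * \<delta>)"
        by (intro norm_vec_le_card) (simp add: s_Suc)
      then show ?thesis using small(1) by simp
    qed
    moreover have "(\<lambda>z. s (Suc n) z $ i) holomorphic_on ?b" for i
      unfolding holomorphic_on_open[OF open_ball] using d by blast
    moreover have "s (Suc n) \<zeta> = a"
      using prim(1)[OF h] by (simp add: vec_eq_iff s_Suc)
    ultimately show ?case by blast
  qed
  have h: "(\<lambda>z. X z (s n z) $ i) holomorphic_on ?b" for i n
    using X inv by (intro tame_fun_holomorphic[of "\<lambda>z p. X z p $ i"]) (auto simp: tame_def)
  have d: "((\<lambda>z. s (Suc n) z $ i) has_field_derivative X z (s n z) $ i) (at z)" if "z \<in> ?b" for z i n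
    unfolding s_Suc using prim(2)[of "\<lambda>z. X z (s n z) $ i", OF h that] by (auto intro!: derivative_eq_intros)
  have sR: "norm (s n z) \<le> R" if "z \<in> ?b" for n z
    using pR inv that by blast
  have diff: "norm (s (Suc n) z - s n z) \<le> \<rho> * (1/2)^n" if "z \<in> ?b" for n z
    using that
  proof (induction n arbitrary: z)
    case 0
    then show ?case using inv[of 1] by (simp add: s_def)
  next
    case (Suc n)
    have "norm (s (Suc (Suc n)) z $ i - s (Suc n) z $ i) \<le> B * (\<rho> * (1/2)^n) * \<delta>" for i
    proof (rule mv[where G = "\<lambda>z. s (Suc (Suc n)) z $ i - s (Suc n) z $ i" and
         g = "\<lambda>z. X z (s (Suc n) z) $ i - X z (s n z) $ i"])
      show "s (Suc (Suc n)) \<zeta> $ i - s (Suc n) \<zeta> $ i = 0" using inv by simp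
      show "((\<lambda>z. s (Suc (Suc n)) z $ i - s (Suc n) z $ i) has_field_derivative X z (s (Suc n) z) $ i - X z (s n z) $ i) (at z)"
        if "z \<in> ?b" for z using d[OF that] by (intro derivative_intros)
      show "norm (X z (s (Suc n) z) $ i - X z (s n z) $ i) \<le> B * (\<rho> * (1/2)^n)" if z: "z \<in> ?b" for z
        using B(3)[OF zR[OF z] sR[OF z, of "Suc n"] sR[OF z, of n], of i] mult_left_mono[OF Suc.IH[OF z] B(1)] by linarith
      show "z \<in> ?b" by (rule Suc.prems)
    qed
    then have "norm (s (Suc (Suc n)) z - s (Suc n) z) \<le> real CARD('n) * (B * (\<rho> * (1/2)^n) * \<delta>)"
      by (intro norm_vec_le_card) simp
    also have "\<dots> = (real CARD('n) * (B * \<delta>)) * (\<rho> * (1/2)^n)" by simp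
    also have "\<dots> \<le> (1/2) * (\<rho> * (1/2)^n)" using small(2) \<delta>(4) by (intro mult_right_mono) auto
    finally show ?case by simp
  qed
  have sum: "(\<Sum>k<n. s (Suc k) z - s k z) = s n z - a" for n z
    by (induction n) (auto simp: s_def)
  define l where "l z = (\<Sum>k. s (Suc k) z - s k z) + a" for z
  have "uniform_limit ?b (\<lambda>n z. \<Sum>k<n. s (Suc k) z - s k z) (\<lambda>z. \<Sum>k. s (Suc k) z - s k z) sequentially"
    by (rule Weierstrass_m_test[where M = "\<lambda>n. \<rho> * (1/2)^n"]) (use diff in \<open>auto intro!: summable_mult summable_geometric\<close>)
  then have "uniform_limit ?b (\<lambda>n z. (\<Sum>k<n. s (Suc k) z - s k z) + a) l sequentially"
    unfolding l_def by (intro uniform_limit_intros)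
  then have ul: "uniform_limit ?b s l sequentially"
    unfolding sum by simp
  have lim: "(\<lambda>n. s n z) \<longlonglongrightarrow> l z" if "z \<in> ?b" for z
    using tendsto_uniform_limitI[OF ul that] .
  have l\<rho>: "norm (l z - a) \<le> \<rho>" if "z \<in> ?b" for z
    by (rule Lim_norm_ubound[OF _ tendsto_diff[OF lim[OF that] tendsto_const]]) (use inv that in auto)
  have l\<zeta>: "l \<zeta> = a"
    using LIMSEQ_unique[OF lim[of \<zeta>], of a] \<delta>(1) inv by simp
  have "((\<lambda>z. l z $ i) has_field_derivative X z (l z) $ i) (at z)" if z: "z \<in> ?b" for z i
  proof -
    \<comment> \<open>Shifted by one because the derivative of iterate n + 1 is the field along
      iterate n, and both sequences must be indexed alike to pass to the limit.\<close>
    have uli: "uniform_limit ?b (\<lambda>n z. s (Suc n) z $ i) (\<lambda>z. l z $ i) sequentially"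
    proof -
      have "uniform_limit ?b (\<lambda>n z. s n z $ i) (\<lambda>z. l z $ i) sequentially"
        by (rule bounded_linear.uniform_limit[OF bounded_linear_vec_nth ul])
      then show ?thesis by (rule filterlim_compose[OF _ filterlim_Suc])
    qed
    have "\<exists>g'. \<forall>z\<in>?b. ((\<lambda>z. l z $ i) has_field_derivative g' z) (at z) \<and> (\<lambda>n. X z (s n z) $ i) \<longlonglongrightarrow> g' z"
    proof (rule has_complex_derivative_uniform_sequence[OF open_ball])
      fix x assume "x \<in> ?b"
      then obtain e where "0 < e" "cball x e \<subseteq> ?b" by (metis open_ball open_contains_cball)
      then show "\<exists>d>0. cball x d \<subseteq> ?b \<and> uniform_limit (cball x d) (\<lambda>n z. s (Suc n) z $ i) (\<lambda>z. l z $ i) sequentially"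
        using uniform_limit_on_subset[OF uli] by blast
    qed (use d in auto)
    then obtain g' where g': "((\<lambda>z. l z $ i) has_field_derivative g' z) (at z)" "(\<lambda>n. X z (s n z) $ i) \<longlonglongrightarrow> g' z"
      using z by blast
    have "(\<lambda>n. X z (s n z) $ i) \<longlonglongrightarrow> X z (l z) $ i"
    proof (rule LIM_zero_cancel, rule Lim_null_comparison)
      show "\<forall>\<^sub>F n in sequentially. norm (X z (s n z) $ i - X z (l z) $ i) \<le> B * norm (s n z - l z)"
        using B(3)[OF zR[OF z] sR[OF z] pR[OF l\<rho>[OF z]]] by simp
      show "(\<lambda>n. B * norm (s n z - l z)) \<longlonglongrightarrow> 0"
        using tendsto_mult[OF tendsto_const[of B] tendsto_norm_zero[OF LIM_zero[OF lim[OF z]]]] by simp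
    qed
    then show ?thesis using g' LIMSEQ_unique by metis
  qed
  then show ?thesis using l\<zeta> by (intro exI[of _ l]) (auto simp: solves_field_def)
qed

text \<open>The radius depends only on the bound R for time and initial value. Continuation in steps
  of fixed length rests on this uniformity.\<close>

lemma uniform_existence:
  fixes X :: "'n::finite vector_field"
  assumes X: "tame X"
  obtains \<delta> where "0 < \<delta>" "\<And>\<zeta> a. norm \<zeta> \<le> R \<Longrightarrow> norm a \<le> R \<Longrightarrow> \<exists>s. s \<zeta> = a \<and> solves_field X (ball \<zeta> \<delta>) s"
proof -
  obtain B where B: "B \<ge> 0"
    "\<And>z p i. norm z \<le> R + 1 \<Longrightarrow> norm p \<le> R + 1 \<Longrightarrow> norm (X z p $ i) \<le> B"
    "\<And>z p q i. norm z \<le> R + 1 \<Longrightarrow> norm p \<le> R + 1 \<Longrightarrow> norm q \<le> R + 1 \<Longrightarrow> norm (X z p $ i - X z q $ i) \<le> B * norm (p - q)"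
    using tame_bounds[OF X, of "R + 1"] by metis
  define N where "N = real CARD('n)"
  have N: "N > 0" by (simp add: N_def)
  \<comment> \<open>This choice gives \<delta> at most 1, so bounds on the ball of radius R + 1
    suffice with \<rho> = 1, and it gives the contraction factor 1/2.\<close>
  define \<delta> where "\<delta> = 1 / (2 * (1 + N * B))"
  have NB: "N * B \<ge> 0" using N B(1) by simp
  have \<delta>: "0 < \<delta>" "\<delta> \<le> 1" "N * (B * \<delta>) \<le> 1 / 2"
    using NB by (auto simp: \<delta>_def field_simps)
  show ?thesis
  proof (rule that[OF \<delta>(1)])
    fix \<zeta> :: complex and a :: "complex^'n" assume "norm \<zeta> \<le> R" "norm a \<le> R"
    then show "\<exists>s. s \<zeta> = a \<and> solves_field X (ball \<zeta> \<delta>) s"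
      using \<delta> B by (intro Picard_existence[OF X, of \<delta> \<zeta> "R + 1" a 1 B]) (auto simp: N_def)
  qed
qed

text \<open>The contraction estimate is iterated on the difference of two solutions: starting from
  the crude bound 2 it is at most 2 (1/2)^n for every n, hence zero.\<close>

lemma local_uniqueness:
  fixes X :: "'n::finite vector_field"
  assumes X: "tame X" and r: "0 < r"
    and s: "solves_field X (ball \<zeta> r) s" "solves_field X (ball \<zeta> r) s'" "s \<zeta> = s' \<zeta>"
  obtains e where "0 < e" "e \<le> r" "\<And>z. z \<in> ball \<zeta> e \<Longrightarrow> s z = s' z"
proof -
  define R where "R = norm \<zeta> + norm (s \<zeta>) + 1"
  obtain B where B: "B \<ge> 0"
    "\<And>z p q i. norm z \<le> R \<Longrightarrow> norm p \<le> R \<Longrightarrow> norm q \<le> R \<Longrightarrow> norm (X z p $ i - X z q $ i) \<le> B * norm (p - q)"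
    using tame_bounds[OF X, of R] by metis
  define N where "N = real CARD('n)"
  have N: "N > 0" by (simp add: N_def)
  define \<delta> where "\<delta> = 1 / (2 * (1 + N * B))"
  have NB: "N * B \<ge> 0" using N B(1) by simp
  have \<delta>: "0 < \<delta>" "\<delta> \<le> 1" "N * (B * \<delta>) \<le> 1 / 2"
    using NB by (auto simp: \<delta>_def field_simps)
  have cont: "isCont f \<zeta>" if "solves_field X (ball \<zeta> r) f" for f
  proof -
    have "isCont (\<lambda>z. f z $ i) \<zeta>" for i
    proof -
      have "((\<lambda>z. f z $ i) has_field_derivative X \<zeta> (f \<zeta>) $ i) (at \<zeta>)"
        using that r unfolding solves_field_def by simp
      then show ?thesis by (rule DERIV_isCont)
    qed
    then have "(f \<longlongrightarrow> f \<zeta>) (at \<zeta>)"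
      unfolding isCont_def by (rule vec_tendstoI)
    then show ?thesis by (simp add: isCont_def)
  qed
  have near: "\<exists>e>0. \<forall>z\<in>ball \<zeta> e. norm (f z - f \<zeta>) < 1" if sf: "solves_field X (ball \<zeta> r) f" for f
  proof -
    obtain e where "e > 0" "\<And>z. dist z \<zeta> < e \<Longrightarrow> dist (f z) (f \<zeta>) < 1"
      using cont[OF sf] unfolding continuous_at_eps_delta by (meson zero_less_one)
    then show ?thesis by (intro exI[of _ e]) (auto simp: dist_norm norm_minus_commute)
  qed
  obtain e1 e2 where e12: "0 < e1" "0 < e2" "\<And>z. z \<in> ball \<zeta> e1 \<Longrightarrow> norm (s z - s \<zeta>) < 1" "\<And>z. z \<in> ball \<zeta> e2 \<Longrightarrow> norm (s' z - s' \<zeta>) < 1"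
    using near[OF s(1)] near[OF s(2)] by metis
  define e where "e = min (min e1 e2) (min r \<delta>)"
  have e: "0 < e" "e \<le> r" "e \<le> \<delta>" "e \<le> e1" "e \<le> e2" using e12 \<delta> r by (auto simp: e_def)
  have zR: "norm z \<le> R" if "z \<in> ball \<zeta> e" for z
  proof -
    have "norm (z - \<zeta>) < 1" using that e(3) \<delta>(2) by (simp add: dist_norm norm_minus_commute)
    then show ?thesis
      unfolding R_def using norm_triangle_sub[of z \<zeta>] norm_ge_zero[of "s \<zeta>"] by linarith
  qed
  have sR: "norm (s z) \<le> R" "norm (s' z) \<le> R" "norm (s z - s' z) \<le> 2" if "z \<in> ball \<zeta> e" for z
  proof -
    have 1: "norm (s z - s \<zeta>) < 1" "norm (s' z - s \<zeta>) < 1" using that e e12(3)[of z] e12(4)[of z] s(3) by auto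
    show "norm (s z) \<le> R" "norm (s' z) \<le> R"
      using 1 norm_triangle_sub[of "s z" "s \<zeta>"] norm_triangle_sub[of "s' z" "s \<zeta>"] norm_ge_zero[of \<zeta>] unfolding R_def by linarith+
    show "norm (s z - s' z) \<le> 2"
      using 1 norm_triangle_ineq4[of "s z - s \<zeta>" "s' z - s \<zeta>"] by simp
  qed
  have bound: "norm (s z - s' z) \<le> 2 * (1/2)^n" if "z \<in> ball \<zeta> e" for z n
    using that
  proof (induction n arbitrary: z)
    case 0
    then show ?case using sR by simp
  next
    case (Suc n)
    have "norm ((s z - s' z) $ i) \<le> B * (2 * (1/2)^n) * \<delta>" for i
    proof -
      have "norm ((s z $ i - s' z $ i) - (s \<zeta> $ i - s' \<zeta> $ i)) \<le> B * (2 * (1/2)^n) * norm (z - \<zeta>)"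
      proof (rule field_differentiable_bound[of "ball \<zeta> e" "\<lambda>z. s z $ i - s' z $ i" "\<lambda>z. X z (s z) $ i - X z (s' z) $ i"])
        fix x assume x: "x \<in> ball \<zeta> e"
        then have "x \<in> ball \<zeta> r" using e by auto
        then have "((\<lambda>z. s z $ i) has_field_derivative X x (s x) $ i) (at x)"
          "((\<lambda>z. s' z $ i) has_field_derivative X x (s' x) $ i) (at x)"
          using s unfolding solves_field_def by blast+
        from DERIV_diff[OF this]
        show "((\<lambda>z. s z $ i - s' z $ i) has_field_derivative X x (s x) $ i - X x (s' x) $ i) (at x within ball \<zeta> e)"
          by (rule has_field_derivative_at_within)
        show "norm (X x (s x) $ i - X x (s' x) $ i) \<le> B * (2 * (1/2)^n)"
          using B(2)[OF zR[OF x] sR(1,2)[OF x], of i] mult_left_mono[OF Suc.IH[OF x] B(1)] by linarith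
      qed (use Suc.prems e in auto)
      also have "\<dots> \<le> B * (2 * (1/2)^n) * \<delta>"
        using Suc.prems e(3) B(1) by (intro mult_left_mono) (auto simp: dist_norm norm_minus_commute)
      finally show ?thesis using s(3) by simp
    qed
    then have "norm (s z - s' z) \<le> N * (B * (2 * (1/2)^n) * \<delta>)"
      unfolding N_def by (rule norm_vec_le_card)
    also have "\<dots> = (N * (B * \<delta>)) * (2 * (1/2)^n)" by simp
    also have "\<dots> \<le> (1/2) * (2 * (1/2)^n)" using \<delta>(3) by (intro mult_right_mono) auto
    finally show ?case by simp
  qed
  have "s z = s' z" if "z \<in> ball \<zeta> e" for z
  proof -
    have "(\<lambda>n. 2 * (1/2)^n :: real) \<longlonglongrightarrow> 2 * 0" by (intro tendsto_mult tendsto_const LIMSEQ_realpow_zero) auto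
    then have "norm (s z - s' z) \<le> 0"
      using LIMSEQ_le_const[of "\<lambda>n. 2 * (1/2)^n" "2 * 0" "norm (s z - s' z)"] bound[OF that] by auto
    then show ?thesis by simp
  qed
  then show ?thesis using that e by blast
qed

subsection \<open>The first Painleve equation as a polynomial system on the surface\<close>

text \<open>The equation transported by \<open>xy_to_M\<close> and written as a polynomial field on
  the whole ambient space; for instance the W-component is -x W^2. On the surface only its
  restriction matters, so such a representative is determined only modulo the equation of
  \<open>M z\<close>.\<close>

definition M_field :: "complex \<Rightarrow> complex^3 \<Rightarrow> complex^3" where
  "M_field z q = (let U = q $ 1; V = q $ 2; W = q $ 3 in
     vector [- U * W^2 - z * W + V * W / 2,
       - 2 - 3 * z * W^2 - 2 * U * W^3 + V * W^2 / 2 + W^5 / 4,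
       - V + W^3 / 2])"

lemma M_field_nth [simp]:
  "M_field z q $ 1 = - q $ 1 * (q $ 3)^2 - z * q $ 3 + q $ 2 * q $ 3 / 2"
  "M_field z q $ 2 = - 2 - 3 * z * (q $ 3)^2 - 2 * q $ 1 * (q $ 3)^3 + q $ 2 * (q $ 3)^2 / 2 + (q $ 3)^5 / 4"
  "M_field z q $ 3 = - q $ 2 + (q $ 3)^3 / 2"
  by (simp_all add: M_field_def Let_def)

lemma PI_system_nth [simp]: "PI_system z p $ 1 = 6 * (p $ 2)^2 + z" "PI_system z p $ 2 = p $ 1"
  by (simp_all add: PI_system_def)

lemma tame_PI_system: "tame PI_system"
  unfolding tame_def forall_2 PI_system_nth by (intro conjI tame_fun_intros)

lemma tame_M_field: "tame M_field"
  unfolding tame_def forall_3 M_field_nth by (intro conjI tame_fun_intros)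

lemma solves_fieldD:
  "solves_field X S s \<Longrightarrow> z \<in> S \<Longrightarrow> ((\<lambda>z. s z $ i) has_field_derivative X z (s z) $ i) (at z)"
  unfolding solves_field_def by blast

lemma solves_field_subset: "solves_field X S s \<Longrightarrow> T \<subseteq> S \<Longrightarrow> solves_field X T s"
  unfolding solves_field_def by blast

lemma solves_field_isCont:
  assumes "solves_field X S s" "z \<in> S" shows "isCont s z"
  using DERIV_isCont[OF solves_fieldD[OF assms]] vec_tendstoI[of s "s z" "at z"]
  unfolding isCont_def by blast

text \<open>The defect \<Phi> of the surface equation satisfies the linear equation \<Phi>' = W^2
  \<Phi>. With a primitive G of W^2 the product of \<Phi> and exp (-G) is constant, so \<Phi>
  remains 0.\<close>

lemma M_field_preserves_M:
  assumes m: "solves_field M_field (ball \<zeta> r) m" "m \<zeta> \<in> M \<zeta>" and z: "z \<in> ball \<zeta> r"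
  shows "m z \<in> M z"
proof -
  note d = solves_fieldD[OF m(1)]
  have \<zeta>: "\<zeta> \<in> ball \<zeta> r" using z by (metis centre_in_ball dist_not_less_zero linorder_not_less mem_ball order.strict_trans1)
  have "(\<lambda>z. m z $ 3) holomorphic_on ball \<zeta> r"
    unfolding holomorphic_on_open[OF open_ball] using d by blast
  then have "(\<lambda>z. (m z $ 3)^2) holomorphic_on ball \<zeta> r" by (intro holomorphic_intros)
  then obtain G where G: "\<And>z. z \<in> ball \<zeta> r \<Longrightarrow> (G has_field_derivative (m z $ 3)^2) (at z within ball \<zeta> r)"
    using holomorphic_convex_primitive'[OF convex_ball open_ball] by metis
  define \<Phi> where "\<Phi> z = (m z $ 2)^2 - m z $ 1 * (m z $ 3)^4 - 2 * z * (m z $ 3)^3 - 4 * m z $ 3" for z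
  have "((\<lambda>z. \<Phi> z * exp (- G z)) has_field_derivative 0) (at x within ball \<zeta> r)" if x: "x \<in> ball \<zeta> r" for x
  proof -
    have "(\<Phi> has_field_derivative
       2 * m x $ 2 * M_field x (m x) $ 2 - (M_field x (m x) $ 1 * (m x $ 3)^4 + m x $ 1 * (4 * (m x $ 3)^3 * M_field x (m x) $ 3))
       - (2 * (m x $ 3)^3 + 2 * x * (3 * (m x $ 3)^2 * M_field x (m x) $ 3)) - 4 * M_field x (m x) $ 3) (at x)"
      unfolding \<Phi>_def
      by (rule derivative_eq_intros d[OF x] refl)+ (simp add: algebra_simps)
    moreover have "2 * m x $ 2 * M_field x (m x) $ 2 - (M_field x (m x) $ 1 * (m x $ 3)^4 + m x $ 1 * (4 * (m x $ 3)^3 * M_field x (m x) $ 3))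
       - (2 * (m x $ 3)^3 + 2 * x * (3 * (m x $ 3)^2 * M_field x (m x) $ 3)) - 4 * M_field x (m x) $ 3 = (m x $ 3)^2 * \<Phi> x"
      by (simp add: \<Phi>_def field_simps power2_eq_square power_numeral_reduce)
    ultimately have "(\<Phi> has_field_derivative (m x $ 3)^2 * \<Phi> x) (at x within ball \<zeta> r)"
      using has_field_derivative_at_within by metis
    then show ?thesis
      by (auto intro!: derivative_eq_intros G[OF x])
  qed
  then obtain c where c: "\<And>x. x \<in> ball \<zeta> r \<Longrightarrow> \<Phi> x * exp (- G x) = c"
    using has_field_derivative_zero_constant[OF convex_ball, of \<zeta> r "\<lambda>z. \<Phi> z * exp (- G z)"] by blast
  have "\<Phi> \<zeta> = 0" using m(2) by (simp add: \<Phi>_def M_iff)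
  then have "\<Phi> z = 0" using c[OF \<zeta>] c[OF z] by simp
  then show ?thesis unfolding \<Phi>_def M_iff by algebra
qed

definition M_sol :: "complex set \<Rightarrow> (complex \<Rightarrow> complex^3) \<Rightarrow> bool" where
  "M_sol S m \<longleftrightarrow> solves_field M_field S m \<and> (\<forall>z\<in>S. m z \<in> M z)"

lemma xy_to_M_solution:
  assumes s: "solves_field PI_system S s" "\<And>z. z \<in> S \<Longrightarrow> s z $ 2 \<noteq> 0"
  shows "M_sol S (\<lambda>z. xy_to_M z (s z))"
  unfolding M_sol_def solves_field_def
proof (intro conjI ballI allI)
  fix z assume z: "z \<in> S"
  show "xy_to_M z (s z) \<in> M z" using xy_to_M_in_M s(2)[OF z] by blast
  note d = solves_fieldD[OF s(1) z]
  fix i :: 3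
  consider "i = 1" | "i = 2" | "i = 3" using exhaust_3 by blast
  then show "((\<lambda>z. xy_to_M z (s z) $ i) has_field_derivative M_field z (xy_to_M z (s z)) $ i) (at z)"
    using s(2)[OF z] d[of 1] d[of 2]
    by cases (auto intro!: derivative_eq_intros simp: field_simps power2_eq_square power_numeral_reduce)
qed

text \<open>The x-component comes out right only on the surface: eliminating V^2 by its equation
  turns the derivative, multiplied by W^3, into 6 W + z W^3.\<close>

lemma M_to_xy_solution:
  assumes m: "M_sol S m" "\<And>z. z \<in> S \<Longrightarrow> m z $ 3 \<noteq> 0"
  shows "solves_field PI_system S (\<lambda>z. M_to_xy (m z))"
  unfolding solves_field_def
proof (intro ballI allI)
  fix z assume z: "z \<in> S"
  have sol: "solves_field M_field S m" and M: "m z \<in> M z" using m(1) z by (auto simp: M_sol_def)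
  note d = solves_fieldD[OF sol z]
  define U V W where "U = m z $ 1" "V = m z $ 2" "W = m z $ 3"
  note defs = this
  have W: "W \<noteq> 0" using m(2)[OF z] by (simp add: defs)
  have V: "V^2 = U * W^4 + 2 * z * W^3 + 4 * W" using M by (simp add: M_iff defs)
  fix i :: 2
  consider "i = 1" | "i = 2" using exhaust_2 by blast
  then show "((\<lambda>z. M_to_xy (m z) $ i) has_field_derivative PI_system z (M_to_xy (m z)) $ i) (at z)"
  proof cases
    case 1
    define D where "D = M_field z (m z) $ 2 / W^2 - 2 * V * M_field z (m z) $ 3 / W^3 - M_field z (m z) $ 3 / 2"
    have deriv: "((\<lambda>z. M_to_xy (m z) $ i) has_field_derivative D) (at z)"
      unfolding 1 M_to_xy_nth D_def
      using d[of 2] d[of 3] W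
      by (auto intro!: derivative_eq_intros simp: field_simps power2_eq_square power_numeral_reduce defs)
    have "D * W^3 = 2 * V^2 - 2 * W - 3 * z * W^3 - 2 * U * W^4"
      using W unfolding D_def M_field_nth defs[symmetric]
      by (simp add: field_simps power2_eq_square power_numeral_reduce)
    then have "D * W^3 = 6 * W + z * W^3" by (simp add: V)
    also have "\<dots> = (6 * (1 / W)^2 + z) * W^3" using W by (simp add: field_simps power2_eq_square power_numeral_reduce)
    finally have "D = 6 * (1 / W)^2 + z" using W by simp
    with deriv show ?thesis by (simp add: 1 defs)
  next
    case 2
    show ?thesis unfolding 2 M_to_xy_nth PI_system_nth
      using d[of 3] m(2)[OF z]
      by (auto intro!: derivative_eq_intros simp: field_simps power2_eq_square power_numeral_reduce)
  qed
qed

text \<open>Solutions with values in the fibres, represented near each point in whichever piece is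
  available. Near a pole of the original solution it is the second piece, where the curve is an
  ordinary solution through \<open>W = 0\<close>.\<close>

definition sol :: "complex set \<Rightarrow> (complex \<Rightarrow> E_point) \<Rightarrow> bool" where
  "sol S \<sigma> \<longleftrightarrow> (\<forall>\<zeta>\<in>S. \<exists>r>0.
     (\<exists>s. solves_field PI_system (ball \<zeta> r) s \<and> (\<forall>z\<in>ball \<zeta> r. \<sigma> z = E_xy z (s z))) \<or>
     (\<exists>m. M_sol (ball \<zeta> r) m \<and> (\<forall>z\<in>ball \<zeta> r. \<sigma> z = E_M z (m z))))"

lemma M_sol_subset: "M_sol S m \<Longrightarrow> T \<subseteq> S \<Longrightarrow> M_sol T m"
  unfolding M_sol_def using solves_field_subset by blast

lemma sol_subset: "sol S \<sigma> \<Longrightarrow> T \<subseteq> S \<Longrightarrow> sol T \<sigma>"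
  unfolding sol_def by blast

lemma sol_cases:
  assumes "sol S \<sigma>" "\<zeta> \<in> S"
  obtains (xy) r s where "0 < r" "solves_field PI_system (ball \<zeta> r) s" "\<And>z. z \<in> ball \<zeta> r \<Longrightarrow> \<sigma> z = E_xy z (s z)"
  | (M) r m where "0 < r" "M_sol (ball \<zeta> r) m" "\<And>z. z \<in> ball \<zeta> r \<Longrightarrow> \<sigma> z = E_M z (m z)"
  using assms unfolding sol_def by blast

lemma sol_in_E:
  assumes "sol S \<sigma>" "\<zeta> \<in> S" shows "\<sigma> \<zeta> \<in> E_set \<zeta>"
  using assms
proof (cases rule: sol_cases)
  case (xy r s)
  then show ?thesis by (auto simp: E_set_eq)
next
  case (M r m)
  then show ?thesis by (auto simp: E_set_eq M_sol_def)
qed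

lemma isCont_nonzero_ball:
  fixes f :: "complex \<Rightarrow> complex^'n"
  assumes "isCont f \<zeta>" "f \<zeta> $ i \<noteq> 0" "0 < r"
  obtains e where "0 < e" "e \<le> r" "\<And>z. z \<in> ball \<zeta> e \<Longrightarrow> f z $ i \<noteq> 0"
proof -
  have "isCont (\<lambda>z. f z $ i) \<zeta>" using assms(1) by (intro continuous_intros)
  then obtain e where e: "0 < e" "\<And>z. dist \<zeta> z < e \<Longrightarrow> f z $ i \<noteq> 0"
    using continuous_at_avoid[of \<zeta> "\<lambda>z. f z $ i" 0] assms(2) by blast
  then show ?thesis using assms(3) by (intro that[of "min e r"]) auto
qed

text \<open>The representation supplied by \<open>sol\<close> may be in the other piece. The value
  then lies in the overlap, and by continuity so do nearby values, so the gluing map converts the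
  solution on a smaller disc.\<close>

lemma sol_xy_form:
  assumes \<sigma>: "sol S \<sigma>" "\<zeta> \<in> S" "\<sigma> \<zeta> = E_xy \<zeta> p"
  obtains r s where "0 < r" "solves_field PI_system (ball \<zeta> r) s" "\<And>z. z \<in> ball \<zeta> r \<Longrightarrow> \<sigma> z = E_xy z (s z)" "s \<zeta> = p"
  using \<sigma>(1,2)
proof (cases rule: sol_cases)
  case (xy r s)
  have "s \<zeta> = p" using \<sigma>(3) xy(1) xy(3)[of \<zeta>] by simp
  then show ?thesis using that xy by blast
next
  case (M r m)
  have \<zeta>: "\<zeta> \<in> ball \<zeta> r" using M by simp
  have mM: "m \<zeta> \<in> M \<zeta>" using M \<zeta> by (auto simp: M_sol_def)
  have "(p, m \<zeta>) \<in> gluing \<zeta>" using E_xy_eq_E_M_iff[OF mM, of p] \<sigma>(3) M(3)[OF \<zeta>] by simp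
  then have 1: "m \<zeta> $ 3 \<noteq> 0" "p = M_to_xy (m \<zeta>)" using gluingD by blast+
  have cm: "isCont m \<zeta>" using M(2) \<zeta> solves_field_isCont unfolding M_sol_def by blast
  obtain e where e: "0 < e" "e \<le> r" "\<And>z. z \<in> ball \<zeta> e \<Longrightarrow> m z $ 3 \<noteq> 0"
    using isCont_nonzero_ball[OF cm 1(1) M(1)] by blast
  have sub: "ball \<zeta> e \<subseteq> ball \<zeta> r" using e by auto
  show ?thesis
  proof (rule that[of e "\<lambda>z. M_to_xy (m z)"])
    show "solves_field PI_system (ball \<zeta> e) (\<lambda>z. M_to_xy (m z))"
      by (rule M_to_xy_solution[OF M_sol_subset[OF M(2) sub] e(3)])
    show "\<sigma> z = E_xy z (M_to_xy (m z))" if "z \<in> ball \<zeta> e" for z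
    proof -
      have "z \<in> ball \<zeta> r" using that sub by blast
      then have "m z \<in> M z" "\<sigma> z = E_M z (m z)" using M by (auto simp: M_sol_def)
      then show ?thesis using E_xy_M_to_xy e(3)[OF that] by simp
    qed
  qed (use e 1 in auto)
qed

lemma sol_M_form:
  assumes \<sigma>: "sol S \<sigma>" "\<zeta> \<in> S" "\<sigma> \<zeta> = E_M \<zeta> q" "q \<in> M \<zeta>"
  obtains r m where "0 < r" "M_sol (ball \<zeta> r) m" "\<And>z. z \<in> ball \<zeta> r \<Longrightarrow> \<sigma> z = E_M z (m z)" "m \<zeta> = q"
  using \<sigma>(1,2)
proof (cases rule: sol_cases)
  case (M r m)
  have \<zeta>: "\<zeta> \<in> ball \<zeta> r" using M by simp
  have mM: "m \<zeta> \<in> M \<zeta>" using M \<zeta> by (auto simp: M_sol_def)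
  have "m \<zeta> = q" using E_M_eq_iff[OF mM \<sigma>(4)] \<sigma>(3) M(3)[OF \<zeta>] by simp
  then show ?thesis using that M by blast
next
  case (xy r s)
  have \<zeta>: "\<zeta> \<in> ball \<zeta> r" using xy by simp
  have "(s \<zeta>, q) \<in> gluing \<zeta>" using E_xy_eq_E_M_iff[OF \<sigma>(4), of "s \<zeta>"] \<sigma>(3) xy(3)[OF \<zeta>] by simp
  then have 1: "s \<zeta> $ 2 \<noteq> 0" "q = xy_to_M \<zeta> (s \<zeta>)" using gluingD by blast+
  have cs: "isCont s \<zeta>" using xy(2) \<zeta> solves_field_isCont by blast
  obtain e where e: "0 < e" "e \<le> r" "\<And>z. z \<in> ball \<zeta> e \<Longrightarrow> s z $ 2 \<noteq> 0"
    using isCont_nonzero_ball[OF cs 1(1) xy(1)] by blast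
  have sub: "ball \<zeta> e \<subseteq> ball \<zeta> r" using e by auto
  show ?thesis
  proof (rule that[of e "\<lambda>z. xy_to_M z (s z)"])
    show "M_sol (ball \<zeta> e) (\<lambda>z. xy_to_M z (s z))"
      by (rule xy_to_M_solution[OF solves_field_subset[OF xy(2) sub] e(3)])
    show "\<sigma> z = E_M z (xy_to_M z (s z))" if "z \<in> ball \<zeta> e" for z
      using that sub xy(3)[of z] E_M_xy_to_M[OF e(3)[OF that]] by auto
  qed (use e 1 in auto)
qed

lemma sol_local_unique:
  assumes \<sigma>: "sol S \<sigma>" "\<zeta> \<in> S" and \<tau>: "sol S' \<tau>" "\<zeta> \<in> S'" and eq: "\<sigma> \<zeta> = \<tau> \<zeta>"
  obtains e where "0 < e" "\<And>z. z \<in> ball \<zeta> e \<Longrightarrow> \<sigma> z = \<tau> z"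
proof -
  from sol_in_E[OF \<sigma>] consider p where "\<sigma> \<zeta> = E_xy \<zeta> p" | q where "q \<in> M \<zeta>" "\<sigma> \<zeta> = E_M \<zeta> q"
    unfolding E_set_eq by blast
  then show ?thesis
  proof cases
    case 1
    obtain r s where rs: "0 < r" "solves_field PI_system (ball \<zeta> r) s" "\<And>z. z \<in> ball \<zeta> r \<Longrightarrow> \<sigma> z = E_xy z (s z)" "s \<zeta> = p"
      using sol_xy_form[OF \<sigma> 1] by blast
    obtain r' s' where rs': "0 < r'" "solves_field PI_system (ball \<zeta> r') s'" "\<And>z. z \<in> ball \<zeta> r' \<Longrightarrow> \<tau> z = E_xy z (s' z)" "s' \<zeta> = p"
      using sol_xy_form[OF \<tau>, of p] 1 eq by metis
    have sub: "ball \<zeta> (min r r') \<subseteq> ball \<zeta> r" "ball \<zeta> (min r r') \<subseteq> ball \<zeta> r'" by auto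
    obtain e where e: "0 < e" "e \<le> min r r'" "\<And>z. z \<in> ball \<zeta> e \<Longrightarrow> s z = s' z"
      using local_uniqueness[OF tame_PI_system _ solves_field_subset[OF rs(2) sub(1)] solves_field_subset[OF rs'(2) sub(2)]]
        rs(1,4) rs'(1,4) by auto
    then show ?thesis using rs(3) rs'(3) by (intro that[of e]) auto
  next
    case 2
    obtain r s where rs: "0 < r" "M_sol (ball \<zeta> r) s" "\<And>z. z \<in> ball \<zeta> r \<Longrightarrow> \<sigma> z = E_M z (s z)" "s \<zeta> = q"
      using sol_M_form[OF \<sigma> 2(2,1)] by blast
    obtain r' s' where rs': "0 < r'" "M_sol (ball \<zeta> r') s'" "\<And>z. z \<in> ball \<zeta> r' \<Longrightarrow> \<tau> z = E_M z (s' z)" "s' \<zeta> = q"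
      using sol_M_form[OF \<tau>, of q] 2 eq by metis
    have sub: "ball \<zeta> (min r r') \<subseteq> ball \<zeta> r" "ball \<zeta> (min r r') \<subseteq> ball \<zeta> r'" by auto
    have sf: "solves_field M_field (ball \<zeta> (min r r')) s" "solves_field M_field (ball \<zeta> (min r r')) s'"
      using M_sol_subset[OF rs(2) sub(1)] M_sol_subset[OF rs'(2) sub(2)] by (auto simp: M_sol_def)
    obtain e where e: "0 < e" "e \<le> min r r'" "\<And>z. z \<in> ball \<zeta> e \<Longrightarrow> s z = s' z"
      using local_uniqueness[OF tame_M_field _ sf] rs(1,4) rs'(1,4) by auto
    then show ?thesis using rs(3) rs'(3) by (intro that[of e]) auto
  qed
qed

lemma curve_in_open:
  fixes c :: "complex \<Rightarrow> 'a::topological_space"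
  assumes "continuous_on (ball \<zeta> r) c" "0 < r" "open T" "c \<zeta> \<in> T"
  obtains e where "0 < e" "e \<le> r" "\<And>z. z \<in> ball \<zeta> e \<Longrightarrow> c z \<in> T"
proof -
  have "open (ball \<zeta> r \<inter> c -` T)"
    by (rule continuous_open_preimage[OF assms(1) open_ball assms(3)])
  moreover have "\<zeta> \<in> ball \<zeta> r \<inter> c -` T" using assms by simp
  ultimately obtain e where "0 < e" "ball \<zeta> e \<subseteq> ball \<zeta> r \<inter> c -` T" by (rule openE)
  then show ?thesis using assms(2) by (intro that[of "min e r"]) auto
qed

lemma P_curve_preimage:
  assumes \<sigma>: "sol S \<sigma>" "\<zeta> \<in> S" and Q: "openin P_top Q" "(\<sigma> \<zeta>, \<zeta>) \<in> Q"
  obtains e where "0 < e" "\<And>z. z \<in> ball \<zeta> e \<Longrightarrow> (\<sigma> z, z) \<in> Q"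
  using \<sigma>
proof (cases rule: sol_cases)
  case (xy r s)
  define c where "c z = (vector [s z $ 1, s z $ 2, z] :: complex^3)" for z
  have c: "P_xy (c z) = (\<sigma> z, z)" if "z \<in> ball \<zeta> r" for z
    using xy(3)[OF that] by (simp add: P_xy_def c_def)
  have "continuous_on (ball \<zeta> r) s" using xy(2) solves_field_isCont by (blast intro: continuous_at_imp_continuous_on)
  then have cc: "continuous_on (ball \<zeta> r) c" unfolding c_def by (intro continuous_intros)
  have "open {a. P_xy a \<in> Q}" using Q(1) by (simp add: P_top_def openin_glued_topology)
  moreover have "c \<zeta> \<in> {a. P_xy a \<in> Q}" using c[of \<zeta>] Q(2) xy(1) by simp
  ultimately obtain e where e: "0 < e" "e \<le> r" "\<And>z. z \<in> ball \<zeta> e \<Longrightarrow> c z \<in> {a. P_xy a \<in> Q}"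
    using curve_in_open[OF cc xy(1)] by blast
  have "(\<sigma> z, z) \<in> Q" if z: "z \<in> ball \<zeta> e" for z
  proof -
    have "P_xy (c z) = (\<sigma> z, z)" using z e(2) by (intro c) simp
    then show ?thesis using e(3)[OF z] by simp
  qed
  then show ?thesis using e(1) that by blast
next
  case (M r m)
  define c where "c z = (vector [m z $ 1, m z $ 2, m z $ 3, z] :: complex^4)" for z
  have c: "P_M (c z) = (\<sigma> z, z)" "c z \<in> total_M" if "z \<in> ball \<zeta> r" for z
    using M(2,3) that by (auto simp: P_M_def total_M_mem M_sol_def c_def)
  have "continuous_on (ball \<zeta> r) m"
    using M(2) solves_field_isCont unfolding M_sol_def by (blast intro: continuous_at_imp_continuous_on)
  then have cc: "continuous_on (ball \<zeta> r) c" unfolding c_def by (intro continuous_intros)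
  have "openin (top_of_set total_M) {a \<in> total_M. P_M a \<in> Q}" using Q(1) by (simp add: P_top_def openin_glued_topology)
  then obtain T where T: "open T" "{a \<in> total_M. P_M a \<in> Q} = total_M \<inter> T" unfolding openin_open by blast
  have "c \<zeta> \<in> {a \<in> total_M. P_M a \<in> Q}" using c[of \<zeta>] Q(2) M(1) by simp
  then have "c \<zeta> \<in> T" unfolding T(2) by (rule IntD2)
  then obtain e where e: "0 < e" "e \<le> r" "\<And>z. z \<in> ball \<zeta> e \<Longrightarrow> c z \<in> T"
    using curve_in_open[OF cc M(1) T(1)] by blast
  have "(\<sigma> z, z) \<in> Q" if z: "z \<in> ball \<zeta> e" for z
  proof -
    have zr: "z \<in> ball \<zeta> r" using z e(2) by simp
    have "c z \<in> total_M \<inter> T" using c(2)[OF zr] e(3)[OF z] by (rule IntI)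
    then have "c z \<in> {a \<in> total_M. P_M a \<in> Q}" by (simp only: T(2))
    then show ?thesis using c(1)[OF zr] by simp
  qed
  then show ?thesis using e(1) that by blast
qed

lemma sol_continuous_map:
  assumes "sol S \<sigma>" "open S"
  shows "continuous_map (top_of_set S) P_top (\<lambda>z. (\<sigma> z, z))"
  unfolding continuous_map
proof (intro conjI allI impI)
  show "(\<lambda>z. (\<sigma> z, z)) ` topspace (top_of_set S) \<subseteq> topspace P_top"
    using sol_in_E[OF assms(1)] by (auto simp: topspace_P_top bundle_set_def topspace_E_top)
  fix Q assume Q: "openin P_top Q"
  have "open {z \<in> S. (\<sigma> z, z) \<in> Q}"
    unfolding open_contains_ball
  proof
    fix \<zeta> assume \<zeta>: "\<zeta> \<in> {z \<in> S. (\<sigma> z, z) \<in> Q}"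
    then obtain e where e: "0 < e" "\<And>z. z \<in> ball \<zeta> e \<Longrightarrow> (\<sigma> z, z) \<in> Q"
      using P_curve_preimage[OF assms(1) _ Q, of \<zeta>] by blast
    obtain e' where "0 < e'" "ball \<zeta> e' \<subseteq> S" using \<zeta> assms(2) open_contains_ball_eq by blast
    then show "\<exists>e>0. ball \<zeta> e \<subseteq> {z \<in> S. (\<sigma> z, z) \<in> Q}"
      using e by (intro exI[of _ "min e e'"]) auto
  qed
  then show "openin (top_of_set S) {z \<in> topspace (top_of_set S). (\<sigma> z, z) \<in> Q}"
    using assms(2) by (simp add: openin_open_eq)
qed

text \<open>The coincidence set is closed because the total space is Hausdorff, and open by
  uniqueness in a common piece.\<close>

lemma sol_identity:
  assumes S: "open S" "connected S" and \<sigma>: "sol S \<sigma>" and \<tau>: "sol S \<tau>"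
    and \<zeta>: "\<zeta> \<in> S" "\<sigma> \<zeta> = \<tau> \<zeta>" and z: "z \<in> S"
  shows "\<sigma> z = \<tau> z"
proof -
  let ?A = "{z \<in> S. \<sigma> z = \<tau> z}"
  have "Hausdorff_space P_top" using complex_manifold_P by (simp add: complex_manifold_def)
  from closedin_continuous_maps_eq[OF this sol_continuous_map[OF \<sigma> S(1)] sol_continuous_map[OF \<tau> S(1)]]
  have "closedin (top_of_set S) ?A" by simp
  moreover have "open ?A"
    unfolding open_contains_ball
  proof
    fix x assume x: "x \<in> ?A"
    then obtain e where e: "0 < e" "\<And>z. z \<in> ball x e \<Longrightarrow> \<sigma> z = \<tau> z"
      using sol_local_unique[OF \<sigma> _ \<tau>, of x] by blast
    obtain e' where "0 < e'" "ball x e' \<subseteq> S" using x S(1) open_contains_ball_eq by blast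
    then show "\<exists>e>0. ball x e \<subseteq> ?A" using e by (intro exI[of _ "min e e'"]) auto
  qed
  then have "openin (top_of_set S) ?A" using S(1) by (simp add: openin_open_eq)
  ultimately have "?A = {} \<or> ?A = S" using S(2)[unfolded connected_clopen] by blast
  then show ?thesis using \<zeta> z by blast
qed

text \<open>A bound in one of the two pieces is enough, because each piece has its own uniform
  radius of existence.\<close>

definition point_bound :: "real \<Rightarrow> complex \<Rightarrow> E_point \<Rightarrow> bool" where
  "point_bound C \<zeta> e \<longleftrightarrow> (\<exists>p. e = E_xy \<zeta> p \<and> norm p \<le> C) \<or> (\<exists>q\<in>M \<zeta>. e = E_M \<zeta> q \<and> norm q \<le> C)"

lemma sol_xyI: "open S \<Longrightarrow> solves_field PI_system S s \<Longrightarrow> sol S (\<lambda>z. E_xy z (s z))"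
  unfolding sol_def
proof
  fix \<zeta> assume "open S" "solves_field PI_system S s" "\<zeta> \<in> S"
  then obtain r where "0 < r" "solves_field PI_system (ball \<zeta> r) s"
    using open_contains_ball_eq solves_field_subset by metis
  then show "\<exists>r>0. (\<exists>s'. solves_field PI_system (ball \<zeta> r) s' \<and> (\<forall>z\<in>ball \<zeta> r. E_xy z (s z) = E_xy z (s' z))) \<or>
      (\<exists>m. M_sol (ball \<zeta> r) m \<and> (\<forall>z\<in>ball \<zeta> r. E_xy z (s z) = E_M z (m z)))"
    by (intro exI[of _ r] conjI disjI1 exI[of _ s]) auto
qed

lemma sol_MI: "open S \<Longrightarrow> M_sol S m \<Longrightarrow> sol S (\<lambda>z. E_M z (m z))"
  unfolding sol_def
proof
  fix \<zeta> assume "open S" "M_sol S m" "\<zeta> \<in> S"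
  then obtain r where "0 < r" "M_sol (ball \<zeta> r) m"
    using open_contains_ball_eq M_sol_subset by metis
  then show "\<exists>r>0. (\<exists>s. solves_field PI_system (ball \<zeta> r) s \<and> (\<forall>z\<in>ball \<zeta> r. E_M z (m z) = E_xy z (s z))) \<or>
      (\<exists>m'. M_sol (ball \<zeta> r) m' \<and> (\<forall>z\<in>ball \<zeta> r. E_M z (m z) = E_M z (m' z)))"
    by (intro exI[of _ r] conjI disjI2 exI[of _ m]) auto
qed

lemma sol_uniform_existence:
  obtains \<delta> where "0 < \<delta>" "\<And>\<zeta> e. norm \<zeta> \<le> R \<Longrightarrow> point_bound R \<zeta> e \<Longrightarrow> \<exists>\<tau>. sol (ball \<zeta> \<delta>) \<tau> \<and> \<tau> \<zeta> = e"
proof -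
  obtain d1 where d1: "0 < d1" "\<And>\<zeta> a. norm \<zeta> \<le> R \<Longrightarrow> norm a \<le> R \<Longrightarrow> \<exists>s. s \<zeta> = a \<and> solves_field PI_system (ball \<zeta> d1) s"
    using uniform_existence[OF tame_PI_system] by blast
  obtain d2 where d2: "0 < d2" "\<And>\<zeta> a. norm \<zeta> \<le> R \<Longrightarrow> norm a \<le> R \<Longrightarrow> \<exists>s. s \<zeta> = a \<and> solves_field M_field (ball \<zeta> d2) s"
    using uniform_existence[OF tame_M_field] by blast
  show ?thesis
  proof (rule that[of "min d1 d2"])
    show "0 < min d1 d2" using d1(1) d2(1) by simp
    fix \<zeta> e assume \<zeta>: "norm \<zeta> \<le> R" and "point_bound R \<zeta> e"
    then consider p where "e = E_xy \<zeta> p" "norm p \<le> R" | q where "q \<in> M \<zeta>" "e = E_M \<zeta> q" "norm q \<le> R"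
      unfolding point_bound_def by blast
    then show "\<exists>\<tau>. sol (ball \<zeta> (min d1 d2)) \<tau> \<and> \<tau> \<zeta> = e"
    proof cases
      case 1
      obtain s where s: "s \<zeta> = p" "solves_field PI_system (ball \<zeta> d1) s" using d1(2)[OF \<zeta> 1(2)] by blast
      have "sol (ball \<zeta> (min d1 d2)) (\<lambda>z. E_xy z (s z))"
        by (rule sol_subset[OF sol_xyI[OF open_ball s(2)]]) auto
      then show ?thesis using s(1) 1(1) by auto
    next
      case 2
      obtain m where m: "m \<zeta> = q" "solves_field M_field (ball \<zeta> d2) m" using d2(2)[OF \<zeta> 2(3)] by blast
      have "M_sol (ball \<zeta> d2) m"
        unfolding M_sol_def using m M_field_preserves_M[OF m(2)] 2(1) by simp
      then have "sol (ball \<zeta> (min d1 d2)) (\<lambda>z. E_M z (m z))"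
        by (rule sol_subset[OF sol_MI[OF open_ball]]) auto
      then show ?thesis using m(1) 2(2) by auto
    qed
  qed
qed

text \<open>The local solutions around all points of the ball are glued. Two of them with
  overlapping discs are compared at the midpoint of their centres: it lies in both discs and, by
  convexity, in the original ball, where both agree with \<sigma>.\<close>

lemma sol_extend:
  assumes \<sigma>: "sol (ball z0 \<rho>) \<sigma>" and \<rho>: "0 < \<rho>" and \<delta>: "0 < \<delta>"
    and ex: "\<And>\<zeta>. \<zeta> \<in> ball z0 \<rho> \<Longrightarrow> \<exists>\<tau>. sol (ball \<zeta> \<delta>) \<tau> \<and> \<tau> \<zeta> = \<sigma> \<zeta>"
  obtains \<sigma>' where "sol (ball z0 (\<rho> + \<delta>)) \<sigma>'" "\<And>z. z \<in> ball z0 \<rho> \<Longrightarrow> \<sigma>' z = \<sigma> z"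
proof -
  obtain \<tau> where \<tau>: "\<And>\<zeta>. \<zeta> \<in> ball z0 \<rho> \<Longrightarrow> sol (ball \<zeta> \<delta>) (\<tau> \<zeta>)" "\<And>\<zeta>. \<zeta> \<in> ball z0 \<rho> \<Longrightarrow> \<tau> \<zeta> \<zeta> = \<sigma> \<zeta>"
    using ex by metis
  have agree: "\<tau> \<zeta> z = \<sigma> z" if "\<zeta> \<in> ball z0 \<rho>" "z \<in> ball z0 \<rho>" "z \<in> ball \<zeta> \<delta>" for \<zeta> z
  proof (rule sol_identity[of "ball z0 \<rho> \<inter> ball \<zeta> \<delta>" "\<tau> \<zeta>" \<sigma> \<zeta>])
    show "connected (ball z0 \<rho> \<inter> ball \<zeta> \<delta>)" by (intro convex_connected convex_Int convex_ball)
  qed (use that \<tau> \<delta> sol_subset[OF \<tau>(1)] sol_subset[OF \<sigma>] in auto)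
  have consistent: "\<tau> \<zeta> z = \<tau> \<zeta>' z" if \<zeta>: "\<zeta> \<in> ball z0 \<rho>" "\<zeta>' \<in> ball z0 \<rho>" and z: "z \<in> ball \<zeta> \<delta>" "z \<in> ball \<zeta>' \<delta>" for \<zeta> \<zeta>' z
  proof -
    let ?m = "midpoint \<zeta> \<zeta>'"
    have "dist \<zeta> \<zeta>' < 2 * \<delta>" using z dist_triangle[of \<zeta> \<zeta>' z] by (simp add: dist_commute)
    then have m: "?m \<in> ball \<zeta> \<delta>" "?m \<in> ball \<zeta>' \<delta>" by (simp_all add: dist_midpoint)
    have m0: "?m \<in> ball z0 \<rho>"
      using \<zeta> convex_ball[of z0 \<rho>] unfolding convex_contains_segment by (metis midpoint_in_closed_segment subsetD)
    show ?thesis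
    proof (rule sol_identity[of "ball \<zeta> \<delta> \<inter> ball \<zeta>' \<delta>" "\<tau> \<zeta>" "\<tau> \<zeta>'" ?m])
      show "connected (ball \<zeta> \<delta> \<inter> ball \<zeta>' \<delta>)" by (intro convex_connected convex_Int convex_ball)
      show "\<tau> \<zeta> ?m = \<tau> \<zeta>' ?m" using agree[OF \<zeta>(1) m0 m(1)] agree[OF \<zeta>(2) m0 m(2)] by simp
    qed (use z m sol_subset[OF \<tau>(1)[OF \<zeta>(1)]] sol_subset[OF \<tau>(1)[OF \<zeta>(2)]] in auto)
  qed
  define pick where "pick z = (SOME \<zeta>. \<zeta> \<in> ball z0 \<rho> \<and> z \<in> ball \<zeta> \<delta>)" for z
  define \<sigma>' where "\<sigma>' z = \<tau> (pick z) z" for z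
  have \<sigma>': "\<sigma>' z = \<tau> \<zeta> z" if "\<zeta> \<in> ball z0 \<rho>" "z \<in> ball \<zeta> \<delta>" for \<zeta> z
  proof -
    have "pick z \<in> ball z0 \<rho> \<and> z \<in> ball (pick z) \<delta>"
      unfolding pick_def by (rule someI_ex) (use that in blast)
    then show ?thesis unfolding \<sigma>'_def using consistent that by blast
  qed
  have near: "\<exists>\<zeta>. \<zeta> \<in> ball z0 \<rho> \<and> z \<in> ball \<zeta> \<delta>" if z: "z \<in> ball z0 (\<rho> + \<delta>)" for z
  proof -
    \<comment> \<open>The centre \<open>?\<zeta>\<close> divides the segment from z0 to z in the
      ratio \<rho> : \<delta>, which puts it within \<rho> of z0 and within \<delta> of z.\<close>
    define l where "l = \<rho> / (\<rho> + \<delta>)"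
    have l: "0 < l" "l < 1" "l * (\<rho> + \<delta>) = \<rho>" "(1 - l) * (\<rho> + \<delta>) = \<delta>" using \<rho> \<delta> by (auto simp: l_def field_simps)
    let ?\<zeta> = "z0 + of_real l * (z - z0)"
    have n: "norm (z - z0) < \<rho> + \<delta>" using z by (simp add: dist_norm norm_minus_commute)
    have "norm (of_real l * (z - z0)) < \<rho>"
      using mult_strict_left_mono[OF n l(1)] l by (simp add: norm_mult)
    moreover have "?\<zeta> - z = - (of_real (1 - l) * (z - z0))" by (simp add: algebra_simps)
    then have "norm (?\<zeta> - z) = (1 - l) * norm (z - z0)" using l by (simp add: norm_mult del: of_real_diff)
    then have "norm (?\<zeta> - z) < \<delta>"
      using mult_strict_left_mono[OF n, of "1 - l"] l by simp
    ultimately show ?thesis by (intro exI[of _ ?\<zeta>]) (simp add: dist_norm)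
  qed
  show ?thesis
  proof (rule that[of \<sigma>'])
    show "sol (ball z0 (\<rho> + \<delta>)) \<sigma>'"
      unfolding sol_def
    proof
      fix z assume "z \<in> ball z0 (\<rho> + \<delta>)"
      then obtain \<zeta> where \<zeta>: "\<zeta> \<in> ball z0 \<rho>" "z \<in> ball \<zeta> \<delta>" using near by blast
      obtain e where e: "0 < e" "ball z e \<subseteq> ball \<zeta> \<delta>" using \<zeta>(2) open_ball open_contains_ball_eq by blast
      have eq: "\<sigma>' x = \<tau> \<zeta> x" if "x \<in> ball z (min r e)" for x r
        using \<sigma>'[OF \<zeta>(1), of x] e(2) that by auto
      from \<tau>(1)[OF \<zeta>(1)] \<zeta>(2) show "\<exists>r>0. (\<exists>s. solves_field PI_system (ball z r) s \<and> (\<forall>x\<in>ball z r. \<sigma>' x = E_xy x (s x))) \<or>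
           (\<exists>m. M_sol (ball z r) m \<and> (\<forall>x\<in>ball z r. \<sigma>' x = E_M x (m x)))"
      proof (cases rule: sol_cases)
        case (xy r s)
        have "solves_field PI_system (ball z (min r e)) s" by (rule solves_field_subset[OF xy(2)]) auto
        moreover have "\<forall>x\<in>ball z (min r e). \<sigma>' x = E_xy x (s x)" using eq xy(3) by auto
        ultimately show ?thesis using xy(1) e(1) by (intro exI[of _ "min r e"]) auto
      next
        case (M r m)
        have "M_sol (ball z (min r e)) m" by (rule M_sol_subset[OF M(2)]) auto
        moreover have "\<forall>x\<in>ball z (min r e). \<sigma>' x = E_M x (m x)" using eq M(3) by auto
        ultimately show ?thesis using M(1) e(1) by (intro exI[of _ "min r e"]) auto
      qed
    qed
    show "\<sigma>' z = \<sigma> z" if "z \<in> ball z0 \<rho>" for z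
      using \<sigma>'[OF that, of z] \<tau>(2)[OF that] \<delta> by simp
  qed
qed

subsection \<open>The Painleve property\<close>

text \<open>A solution cannot leave all compact subsets of the fibres along a path of finite length: the function
  \<open>lyap\<close>, which is \<open>(x + \<psi>/2)\<^sup>2 - 4 y\<^sup>3 - 2 z y\<close> with the non-holomorphic \<open>\<psi> = cnj y / (1 + |y|\<^sup>2)\<close> instead of
  the usual \<open>1/y\<close>, is a smooth function on all of \<open>E z\<close>, it is proper, and along solutions it
  satisfies \<open>|L'| \<le> K (1 + |L|)\<close>.\<close>

definition lyap_xy :: "complex \<Rightarrow> complex^2 \<Rightarrow> complex" where
  "lyap_xy z p = (let x = p $ 1; y = p $ 2 in
     (x + cnj y * inverse (1 + y * cnj y) / 2)^2 - 4 * y^3 - 2 * z * y)"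

text \<open>The same function in (U, V, W). With n = 1/(1 + |y|^2) one has \<psi> = (1 - n)/y, so x
  + \<psi>/2 equals V/W^2 - n W/2; expanding the square leaves U plus correction terms, and n = W
  \<open>cnj W\<close> N cancels the denominators.\<close>

definition lyap_M :: "complex^3 \<Rightarrow> complex" where
  "lyap_M q = (let U = q $ 1; V = q $ 2; W = q $ 3; N = inverse (1 + W * cnj W) in
     U - V * cnj W * N + (W^2 * cnj W * N)^2 / 4)"

definition lyap :: "complex \<Rightarrow> E_point \<Rightarrow> complex" where
  "lyap z e = (if e \<in> range (E_xy z) then lyap_xy z (inv_into UNIV (E_xy z) e)
     else lyap_M (inv_into (M z) (E_M z) e))"

lemma one_plus_norm_square: "1 + w * cnj w = complex_of_real (1 + (cmod w)^2)"
  by (simp only: of_real_add of_real_1 complex_norm_square)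

lemma one_plus_norm_nonzero: "1 + w * cnj w \<noteq> 0"
proof -
  have "0 < 1 + (cmod w)^2" by (simp add: add_pos_nonneg)
  then show ?thesis unfolding one_plus_norm_square of_real_eq_0_iff by simp
qed

lemma norm_inverse_one_plus: "norm (inverse (1 + w * cnj w)) \<le> 1"
proof -
  have "norm (1 + w * cnj w) = 1 + (cmod w)^2"
    unfolding one_plus_norm_square norm_of_real by simp
  then show ?thesis by (simp add: norm_inverse inverse_le_1_iff)
qed

text \<open>Here v stands for \<open>cnj y\<close>, and i, j, n for the inverses of y, v and 1 + y
  v. Conjugation is not algebraic, but treating v as an independent unknown makes the comparison a
  polynomial identity.\<close>

lemma lyap_gluing_identity:
  fixes i y j v n x z :: complex
  assumes i: "i * y = 1" and j: "j * v = 1" and n: "n * (1 + y * v) = 1"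
  shows "(x^2 + x * i - 4 * y^3 - 2 * z * y + i^2 / 4) - (x * i^2 + i^3 / 2) * j * (y * v * n) + (i^2 * j * (y * v * n))^2 / 4
    = (x + v * n / 2)^2 - 4 * y^3 - 2 * z * y"
proof -
  have B: "v * n = i - i * n" using i n by algebra
  have A: "i^2 * j * (y * v * n) = i * n" using i j by algebra
  have "(x * i^2 + i^3 / 2) * j * (y * v * n) = (x + i / 2) * (i^2 * j * (y * v * n))"
    by (simp add: power2_eq_square power3_eq_cube algebra_simps)
  then have C: "(x * i^2 + i^3 / 2) * j * (y * v * n) = (x + i / 2) * (i * n)" unfolding A .
  show ?thesis unfolding C A B by (simp add: power2_eq_square field_simps)
qed

lemma lyap_M_eq_xy:
  assumes "(p, q) \<in> gluing z" shows "lyap_M q = lyap_xy z p"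
proof -
  note g = gluingD[OF assms]
  have y: "p $ 2 \<noteq> 0" by (rule g(3))
  let ?y = "p $ 2"
  let ?i = "inverse ?y" and ?j = "inverse (cnj ?y)" and ?n = "inverse (1 + ?y * cnj ?y)"
  have i: "?i * ?y = 1" using y by (rule left_inverse)
  have j: "?j * cnj ?y = 1" using y by (intro left_inverse) simp
  have n: "?n * (1 + ?y * cnj ?y) = 1" by (rule left_inverse[OF one_plus_norm_nonzero])
  have q: "q $ 1 = (p $ 1)^2 + p $ 1 * ?i - 4 * ?y^3 - 2 * z * ?y + ?i^2 / 4" "q $ 2 = p $ 1 * ?i^2 + ?i^3 / 2"
    "q $ 3 = ?i"
    unfolding g(4) xy_to_M_nth using y by (simp_all add: field_simps power2_eq_square power_numeral_reduce)
  have cj: "cnj ?i = ?j" by (rule complex_cnj_inverse)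
  have e: "(1 + ?i * ?j) * (?y * cnj ?y * n) = n * (1 + ?y * cnj ?y)" for n
    using i j by algebra
  have N: "inverse (1 + ?i * ?j) = ?y * cnj ?y * ?n" by (intro inverse_unique) (rule trans[OF e n])
  show ?thesis
    unfolding lyap_M_def lyap_xy_def Let_def q cj N by (rule lyap_gluing_identity[OF i j n])
qed

lemma lyap_E_xy [simp]: "lyap z (E_xy z p) = lyap_xy z p"
  by (simp add: lyap_def)

lemma lyap_E_M:
  assumes q: "q \<in> M z" shows "lyap z (E_M z q) = lyap_M q"
proof (cases "E_M z q \<in> range (E_xy z)")
  case True
  then obtain p where p: "E_xy z p = E_M z q" by (metis rangeE)
  then have "(p, q) \<in> gluing z" using E_xy_eq_E_M_iff[OF q] by simp
  then show ?thesis using lyap_M_eq_xy lyap_E_xy[of z p] p by simp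
qed (use q in \<open>simp add: lyap_def\<close>)

lemma norm_mult_bound: "norm a \<le> A \<Longrightarrow> norm b \<le> B \<Longrightarrow> norm (a * b :: complex) \<le> A * B"
  unfolding norm_mult by (intro mult_mono) (auto intro: order.trans[OF norm_ge_zero])

lemma norm_add_bound: "norm a \<le> A \<Longrightarrow> norm b \<le> B \<Longrightarrow> norm (a + b :: complex) \<le> A + B"
  by (rule order.trans[OF norm_triangle_ineq add_mono])

lemma norm_diff_bound: "norm a \<le> A \<Longrightarrow> norm b \<le> B \<Longrightarrow> norm (a - b :: complex) \<le> A + B"
  by (rule order.trans[OF norm_triangle_ineq4 add_mono])

lemma norm_uminus_bound: "norm a \<le> A \<Longrightarrow> norm (- a :: complex) \<le> A"
  by simp

lemma norm_power_bound: "norm a \<le> 1 \<Longrightarrow> norm (a ^ n :: complex) \<le> 1"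
  by (simp add: norm_power power_le_one)

lemma has_vector_derivative_compose_complex:
  fixes \<gamma> :: "real \<Rightarrow> complex"
  assumes "(\<gamma> has_vector_derivative c) (at t)" "(f has_field_derivative f') (at (\<gamma> t))"
  shows "((\<lambda>t. f (\<gamma> t)) has_vector_derivative c * f') (at t)"
  using field_vector_diff_chain_at[OF assms] by (simp add: o_def)

lemma has_vector_derivative_cnj_complex:
  "(f has_vector_derivative f') F \<Longrightarrow> ((\<lambda>t. cnj (f t)) has_vector_derivative cnj f') F"
  by (rule bounded_linear.has_vector_derivative[OF bounded_linear_cnj])

lemma has_vector_derivative_inverse_complex:
  fixes f :: "real \<Rightarrow> complex"
  assumes "(f has_vector_derivative f') (at t)" "f t \<noteq> 0"
  shows "((\<lambda>t. inverse (f t)) has_vector_derivative - f' * (inverse (f t))^2) (at t)"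
  using has_vector_derivative_compose_complex[OF assms(1) DERIV_inverse[OF assms(2)]]
  by (simp add: power2_eq_square)

lemma has_vector_derivative_power2:
  fixes f :: "real \<Rightarrow> complex"
  assumes "(f has_vector_derivative f') (at t)"
  shows "((\<lambda>t. (f t)^2) has_vector_derivative 2 * f t * f') (at t)"
  using has_vector_derivative_mult[OF assms assms] by (simp add: power2_eq_square algebra_simps)

text \<open>The terms of 2 x x' cancel against the derivatives of y in 4 y^3 + 2 z y, as they do for
  the exact energy. Since \<psi>' is real-linear in x, the rest is at most quadratic in x, and |x|^2
  is bounded in terms of |L| because |y| is at most 1. The numbers 37 and 95 only have to dominate
  this estimate and the one on the surface.\<close>

lemma lyap_xy_derivative:
  fixes \<gamma> :: "real \<Rightarrow> complex"
  assumes s: "\<And>i. ((\<lambda>z. s z $ i) has_field_derivative PI_system (\<gamma> t) (s (\<gamma> t)) $ i) (at (\<gamma> t))"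
    and \<gamma>: "(\<gamma> has_vector_derivative c) (at t)"
    and b: "norm (s (\<gamma> t) $ 2) \<le> 1" "norm (\<gamma> t) \<le> Z" "norm c \<le> R"
  shows "\<exists>L'. ((\<lambda>t. lyap_xy (\<gamma> t) (s (\<gamma> t))) has_vector_derivative L') (at t) \<and>
     norm L' \<le> R * (37 * Z + 95) * (1 + norm (lyap_xy (\<gamma> t) (s (\<gamma> t))))"
    and "(norm (s (\<gamma> t) $ 1))^2 \<le> 2 * norm (lyap_xy (\<gamma> t) (s (\<gamma> t))) + 9 + 4 * Z"
proof -
  define z x y N where "z = \<gamma> t" "x = s z $ 1" "y = s z $ 2" "N = inverse (1 + y * cnj y)"
  note d = this
  have R: "0 \<le> R" and Z: "0 \<le> Z" using b norm_ge_zero order.trans by blast+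
  have dx: "((\<lambda>t. s (\<gamma> t) $ 1) has_vector_derivative c * (6 * y^2 + z)) (at t)"
    using has_vector_derivative_compose_complex[OF \<gamma> s[of 1]] by (simp add: d)
  have dy: "((\<lambda>t. s (\<gamma> t) $ 2) has_vector_derivative c * x) (at t)"
    using has_vector_derivative_compose_complex[OF \<gamma> s[of 2]] by (simp add: d)
  have dv: "((\<lambda>t. cnj (s (\<gamma> t) $ 2)) has_vector_derivative cnj (c * x)) (at t)"
    by (rule has_vector_derivative_cnj_complex[OF dy])
  define N' where "N' = - (y * cnj (c * x) + c * x * cnj y) * N^2"
  have dN: "((\<lambda>t. inverse (1 + s (\<gamma> t) $ 2 * cnj (s (\<gamma> t) $ 2))) has_vector_derivative N') (at t)"
    using has_vector_derivative_inverse_complex[OF has_vector_derivative_add[OF has_vector_derivative_const has_vector_derivative_mult[OF dy dv]],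
        of 1] one_plus_norm_nonzero
    by (simp add: N'_def d[symmetric])
  define P' where "P' = cnj y * N' + cnj (c * x) * N"
  have dP: "((\<lambda>t. cnj (s (\<gamma> t) $ 2) * inverse (1 + s (\<gamma> t) $ 2 * cnj (s (\<gamma> t) $ 2))) has_vector_derivative P') (at t)"
    using has_vector_derivative_mult[OF dv dN] by (simp add: P'_def d[symmetric])
  define L' where "L' = 2 * (x + cnj y * N / 2) * (c * (6 * y^2 + z) + P' / 2) - 12 * y^2 * (c * x) - 2 * (z * (c * x) + c * y)"
  have "((\<lambda>t. (s (\<gamma> t) $ 1 + cnj (s (\<gamma> t) $ 2) * inverse (1 + s (\<gamma> t) $ 2 * cnj (s (\<gamma> t) $ 2)) / 2)^2
      - 4 * (s (\<gamma> t) $ 2 * (s (\<gamma> t) $ 2)^2) - 2 * (\<gamma> t * s (\<gamma> t) $ 2)) has_vector_derivative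
     2 * (x + cnj y * N / 2) * (c * (6 * y^2 + z) + P' / 2) - 4 * (y * (2 * y * (c * x)) + c * x * y^2) - 2 * (z * (c * x) + c * y)) (at t)"
    using has_vector_derivative_diff[OF has_vector_derivative_diff[OF
        has_vector_derivative_power2[OF has_vector_derivative_add[OF dx has_vector_derivative_divide[OF dP, of 2]]]
        has_vector_derivative_mult_right[OF has_vector_derivative_mult[OF dy has_vector_derivative_power2[OF dy]], of 4]]
        has_vector_derivative_mult_right[OF has_vector_derivative_mult[OF \<gamma> dy], of 2]]
    by (simp add: d[symmetric])
  moreover have "4 * (y * (2 * y * (c * x)) + c * x * y^2) = 12 * y^2 * (c * x)" by (simp add: power2_eq_square algebra_simps)
  ultimately have D: "((\<lambda>t. lyap_xy (\<gamma> t) (s (\<gamma> t))) has_vector_derivative L') (at t)"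
    by (simp add: lyap_xy_def Let_def L'_def power3_eq_cube power2_eq_square mult_ac)
  define X l where "X = norm x" "l = norm (lyap_xy z (s z))"
  note X = this
  have X0: "0 \<le> X" "0 \<le> l" by (simp_all add: X)
  have ny: "norm y \<le> 1" "norm (cnj y) \<le> 1" using b by (simp_all add: d)
  have nN: "norm N \<le> 1" unfolding d by (rule norm_inverse_one_plus)
  have nz: "norm z \<le> Z" using b by (simp add: d)
  have ncx: "norm (c * x) \<le> R * X" "norm (cnj (c * x)) \<le> R * X"
    using norm_mult_bound[OF b(3), of x X] by (simp_all add: X del: complex_cnj_mult)
  have nN': "norm N' \<le> (1 * (R * X) + (R * X) * 1) * 1"
    unfolding N'_def by (intro norm_mult_bound norm_add_bound norm_uminus_bound norm_power_bound ny nN ncx)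
  have nP': "norm P' \<le> 1 * ((1 * (R * X) + (R * X) * 1) * 1) + (R * X) * 1"
    unfolding P'_def by (intro norm_mult_bound norm_add_bound norm_uminus_bound norm_power_bound ny nN ncx nN')
  have n1: "norm (1 :: complex) \<le> 1" "norm (2 :: complex) \<le> 2" "norm (6 :: complex) \<le> 6" "norm (4 :: complex) \<le> 4" "norm (1/2 :: complex) \<le> 1/2" by simp_all
  have L'_eq: "L' = x * P' + cnj y * N * (c * (6 * y^2 + z) + 1/2 * P') - 2 * (c * y)"
    unfolding L'_def by (simp add: algebra_simps power2_eq_square)
  have "norm L' \<le> X * (1 * ((1 * (R * X) + (R * X) * 1) * 1) + (R * X) * 1) +
      1 * 1 * (R * (6 * 1 + Z) + 1/2 * (1 * ((1 * (R * X) + (R * X) * 1) * 1) + (R * X) * 1)) + 2 * (R * 1)"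
    unfolding L'_eq
    by (intro norm_diff_bound norm_add_bound norm_mult_bound norm_power_bound ny nN nP' n1 nz b(3)) (simp add: X)
  also have "\<dots> = R * (3 * X^2 + 3/2 * X + 8 + Z)" by (simp add: algebra_simps power2_eq_square)
  finally have L'1: "norm L' \<le> R * (3 * X^2 + 3/2 * X + 8 + Z)" .
  have X2: "X \<le> (X^2 + 1) / 2" using zero_le_power2[of "X - 1"] by (simp add: power2_eq_square algebra_simps)
  have e: "(x + cnj y * N / 2)^2 = lyap_xy z (s z) + 4 * y^3 + 2 * z * y"
    by (simp add: lyap_xy_def Let_def d)
  have "norm ((x + cnj y * N / 2)^2) \<le> l + 4 * 1 + 2 * Z * 1"
    unfolding e by (intro norm_add_bound norm_mult_bound norm_power_bound ny n1 nz) (simp add: X)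
  then have A: "(norm (x + cnj y * N / 2))^2 \<le> l + 4 + 2 * Z" by (simp add: norm_power)
  have "norm (cnj y * N * (1/2)) \<le> 1 * 1 * (1/2)" by (intro norm_mult_bound ny nN n1)
  then have "X \<le> norm (x + cnj y * N / 2) + 1/2"
    unfolding X using norm_triangle_ineq4[of "x + cnj y * N / 2" "cnj y * N / 2"] by simp
  then have "X^2 \<le> (norm (x + cnj y * N / 2) + 1/2)^2" using X0 by (intro power_mono) auto
  also have "\<dots> \<le> 2 * (norm (x + cnj y * N / 2))^2 + 1/2"
    using zero_le_power2[of "norm (x + cnj y * N / 2) - 1/2"] by (simp add: power2_eq_square algebra_simps)
  finally have XX: "X^2 \<le> 2 * l + 9 + 4 * Z" using A by simp
  then show "(norm (s (\<gamma> t) $ 1))^2 \<le> 2 * norm (lyap_xy (\<gamma> t) (s (\<gamma> t))) + 9 + 4 * Z"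
    by (simp add: X d)
  \<comment> \<open>The square X^2 is abstracted to Y, so that only linear inequalities
    remain.\<close>
  have aux: "3 * Y + 3/2 * X + 8 + Z \<le> 8 * l + 44 + 17 * Z"
    if "X \<le> (Y + 1) / 2" "Y \<le> 2 * l + 9 + 4 * Z" for Y
    using that X0 Z by (simp add: field_simps)
  have "3 * X^2 + 3/2 * X + 8 + Z \<le> 8 * l + 44 + 17 * Z" by (rule aux[OF X2 XX])
  also have "\<dots> \<le> (37 * Z + 95) * (1 + l)" using X0 Z mult_nonneg_nonneg[OF Z X0(2)] by (simp add: algebra_simps)
  finally have "R * (3 * X^2 + 3/2 * X + 8 + Z) \<le> R * ((37 * Z + 95) * (1 + l))" using R by (rule mult_left_mono)
  then have "norm L' \<le> R * (37 * Z + 95) * (1 + l)" using L'1 by (simp only: mult.assoc)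
  then show "\<exists>L'. ((\<lambda>t. lyap_xy (\<gamma> t) (s (\<gamma> t))) has_vector_derivative L') (at t) \<and>
     norm L' \<le> R * (37 * Z + 95) * (1 + norm (lyap_xy (\<gamma> t) (s (\<gamma> t))))"
    using D by (auto simp: X d)
qed

text \<open>For |W| at most 1 the surface equation bounds |V|^2 by |U| + 2 Z + 4, and the formula
  for \<open>lyap_M\<close> bounds |U| by |L| + |V| + 1/4; with |V| at most (|V|^2 + 1)/2 these two
  inequalities close up. The derivative of L is at most linear in U and quadratic in V, hence
  controlled.\<close>

lemma lyap_M_derivative:
  fixes \<gamma> :: "real \<Rightarrow> complex"
  assumes m: "\<And>i. ((\<lambda>z. m z $ i) has_field_derivative M_field (\<gamma> t) (m (\<gamma> t)) $ i) (at (\<gamma> t))"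
    and M: "m (\<gamma> t) \<in> M (\<gamma> t)"
    and \<gamma>: "(\<gamma> has_vector_derivative c) (at t)"
    and b: "norm (m (\<gamma> t) $ 3) \<le> 1" "norm (\<gamma> t) \<le> Z" "norm c \<le> R"
  shows "\<exists>L'. ((\<lambda>t. lyap_M (m (\<gamma> t))) has_vector_derivative L') (at t) \<and>
     norm L' \<le> R * (37 * Z + 95) * (1 + norm (lyap_M (m (\<gamma> t))))"
    and "norm (m (\<gamma> t) $ 1) \<le> 2 * norm (lyap_M (m (\<gamma> t))) + 2 * Z + 6"
    and "(norm (m (\<gamma> t) $ 2))^2 \<le> 2 * norm (lyap_M (m (\<gamma> t))) + 4 * Z + 10"
proof -
  define z U V W N where "z = \<gamma> t" "U = m z $ 1" "V = m z $ 2" "W = m z $ 3" "N = inverse (1 + W * cnj W)"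
  note d = this
  define u1 v1 w1 where "u1 = - U * W^2 - z * W + V * W * (1/2)"
    "v1 = - 2 - 3 * z * W^2 - 2 * U * W^3 + V * W^2 * (1/2) + W^5 * (1/4)" "w1 = - V + W^3 * (1/2)"
  note f = this
  have R: "0 \<le> R" and Z: "0 \<le> Z" using b norm_ge_zero order.trans by blast+
  have dU: "((\<lambda>t. m (\<gamma> t) $ 1) has_vector_derivative c * u1) (at t)"
    using has_vector_derivative_compose_complex[OF \<gamma> m[of 1]] by (simp add: d f)
  have dV: "((\<lambda>t. m (\<gamma> t) $ 2) has_vector_derivative c * v1) (at t)"
    using has_vector_derivative_compose_complex[OF \<gamma> m[of 2]] by (simp add: d f)
  have dW: "((\<lambda>t. m (\<gamma> t) $ 3) has_vector_derivative c * w1) (at t)"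
    using has_vector_derivative_compose_complex[OF \<gamma> m[of 3]] by (simp add: d f)
  have dC: "((\<lambda>t. cnj (m (\<gamma> t) $ 3)) has_vector_derivative cnj (c * w1)) (at t)"
    by (rule has_vector_derivative_cnj_complex[OF dW])
  define N' where "N' = - (W * cnj (c * w1) + c * w1 * cnj W) * N^2"
  have dN: "((\<lambda>t. inverse (1 + m (\<gamma> t) $ 3 * cnj (m (\<gamma> t) $ 3))) has_vector_derivative N') (at t)"
    using has_vector_derivative_inverse_complex[OF has_vector_derivative_add[OF has_vector_derivative_const has_vector_derivative_mult[OF dW dC]],
        of 1] one_plus_norm_nonzero
    by (simp add: N'_def d[symmetric])
  define P' where "P' = cnj W * N' + cnj (c * w1) * N"
  have dP: "((\<lambda>t. cnj (m (\<gamma> t) $ 3) * inverse (1 + m (\<gamma> t) $ 3 * cnj (m (\<gamma> t) $ 3))) has_vector_derivative P') (at t)"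
    using has_vector_derivative_mult[OF dC dN] by (simp add: P'_def d[symmetric])
  define Q' where "Q' = W^2 * P' + 2 * W * (c * w1) * (cnj W * N)"
  have dQ: "((\<lambda>t. (m (\<gamma> t) $ 3)^2 * (cnj (m (\<gamma> t) $ 3) * inverse (1 + m (\<gamma> t) $ 3 * cnj (m (\<gamma> t) $ 3)))) has_vector_derivative Q') (at t)"
    using has_vector_derivative_mult[OF has_vector_derivative_power2[OF dW] dP] by (simp add: Q'_def d[symmetric])
  define L' where "L' = c * u1 - (V * P' + c * v1 * (cnj W * N)) + 1/2 * (W^2 * (cnj W * N)) * Q'"
  have "((\<lambda>t. m (\<gamma> t) $ 1 - m (\<gamma> t) $ 2 * (cnj (m (\<gamma> t) $ 3) * inverse (1 + m (\<gamma> t) $ 3 * cnj (m (\<gamma> t) $ 3)))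
     + ((m (\<gamma> t) $ 3)^2 * (cnj (m (\<gamma> t) $ 3) * inverse (1 + m (\<gamma> t) $ 3 * cnj (m (\<gamma> t) $ 3))))^2 / 4) has_vector_derivative
     c * u1 - (V * P' + c * v1 * (cnj W * N)) + 2 * (W^2 * (cnj W * N)) * Q' / 4) (at t)"
    using has_vector_derivative_add[OF has_vector_derivative_diff[OF dU has_vector_derivative_mult[OF dV dP]]
       has_vector_derivative_divide[OF has_vector_derivative_power2[OF dQ], of 4]]
    by (simp add: d[symmetric])
  then have D: "((\<lambda>t. lyap_M (m (\<gamma> t))) has_vector_derivative L') (at t)"
    by (simp add: lyap_M_def Let_def L'_def mult_ac)
  define a b' l where "a = norm U" "b' = norm V" "l = norm (lyap_M (m z))"
  note X = this
  have X0: "0 \<le> a" "0 \<le> b'" "0 \<le> l" by (simp_all add: X)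
  have nW: "norm W \<le> 1" "norm (cnj W) \<le> 1" using b by (simp_all add: d)
  have nN: "norm N \<le> 1" unfolding d by (rule norm_inverse_one_plus)
  have nz: "norm z \<le> Z" using b by (simp add: d)
  have nU: "norm U \<le> a" and nV: "norm V \<le> b'" by (simp_all add: X)
  have n1: "norm (2 :: complex) \<le> 2" "norm (3 :: complex) \<le> 3" "norm (4 :: complex) \<le> 4" "norm (1/2 :: complex) \<le> 1/2" "norm (1/4 :: complex) \<le> 1/4" by simp_all
  note ni = norm_diff_bound norm_add_bound norm_mult_bound norm_uminus_bound norm_power_bound
  have u1: "norm u1 \<le> a * 1 + Z * 1 + b' * 1 * (1/2)"
    unfolding f by (intro ni nW nz nU nV n1)
  have v1: "norm v1 \<le> 2 + 3 * Z * 1 + 2 * a * 1 + b' * 1 * (1/2) + 1 * (1/4)"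
    unfolding f by (intro ni nW nz nU nV n1)
  have w1: "norm w1 \<le> b' + 1 * (1/2)"
    unfolding f by (intro ni nW nz nU nV n1)
  define w' where "w' = R * (b' + 1/2)"
  have cw: "norm (c * w1) \<le> w'" "norm (cnj (c * w1)) \<le> w'"
    using norm_mult_bound[OF b(3) w1] by (simp_all add: w'_def del: complex_cnj_mult)
  have nN': "norm N' \<le> (1 * w' + w' * 1) * 1"
    unfolding N'_def by (intro ni nW nN cw)
  have nP': "norm P' \<le> 1 * ((1 * w' + w' * 1) * 1) + w' * 1"
    unfolding P'_def by (intro ni nW nN cw nN')
  have nQ': "norm Q' \<le> 1 * (1 * ((1 * w' + w' * 1) * 1) + w' * 1) + 2 * 1 * w' * (1 * 1)"
    unfolding Q'_def by (intro ni nW nN cw nP' n1)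
  have "norm L' \<le> R * (a * 1 + Z * 1 + b' * 1 * (1/2)) +
     (b' * (1 * ((1 * w' + w' * 1) * 1) + w' * 1) + R * (2 + 3 * Z * 1 + 2 * a * 1 + b' * 1 * (1/2) + 1 * (1/4)) * (1 * 1))
     + 1/2 * (1 * (1 * 1)) * (1 * (1 * ((1 * w' + w' * 1) * 1) + w' * 1) + 2 * 1 * w' * (1 * 1))"
    unfolding L'_def by (intro ni nW nN nP' nQ' n1 u1 v1 b(3) nV)
  also have "\<dots> = R * (3 * a + 4 * Z + 7/2 + 5 * b' + 3 * b'^2)"
    unfolding w'_def by (simp add: algebra_simps power2_eq_square)
  finally have L'1: "norm L' \<le> R * (3 * a + 4 * Z + 7/2 + 5 * b' + 3 * b'^2)" .
  have b2: "b' \<le> (b'^2 + 1) / 2" using zero_le_power2[of "b' - 1"] by (simp add: power2_eq_square algebra_simps)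
  have "V^2 = U * W^4 + 2 * z * W^3 + 4 * W" using M by (simp add: M_iff d)
  moreover have "norm (U * W^4 + 2 * z * W^3 + 4 * W) \<le> a * 1 + 2 * Z * 1 + 4 * 1"
    by (intro ni nW nU nz n1)
  ultimately have bb: "b'^2 \<le> a + 2 * Z + 4" by (simp add: X norm_power[symmetric])
  have "norm U \<le> l + b' * (1 * 1) + (1 * (1 * 1)) * (1 * (1 * 1)) * (1/4)"
  proof -
    have "U = lyap_M (m z) + V * (cnj W * N) - (W^2 * (cnj W * N)) * (W^2 * (cnj W * N)) * (1/4)"
      by (simp add: lyap_M_def Let_def d power2_eq_square mult.assoc)
    moreover have "norm (lyap_M (m z) + V * (cnj W * N) - (W^2 * (cnj W * N)) * (W^2 * (cnj W * N)) * (1/4)) \<le>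
      l + b' * (1 * 1) + (1 * (1 * 1)) * (1 * (1 * 1)) * (1/4)"
      by (intro ni nW nN nV n1) (simp add: X)
    ultimately show ?thesis by simp
  qed
  then have aa: "a \<le> 2 * l + 2 * Z + 6" using b2 bb by (simp add: X(1))
  then show "norm (m (\<gamma> t) $ 1) \<le> 2 * norm (lyap_M (m (\<gamma> t))) + 2 * Z + 6" by (simp add: X d)
  show "(norm (m (\<gamma> t) $ 2))^2 \<le> 2 * norm (lyap_M (m (\<gamma> t))) + 4 * Z + 10" using aa bb by (simp add: X d)
  have aux: "3 * a + 4 * Z + 7/2 + 5 * b' + 3 * Y \<le> 17 * l + 32 * Z + 79"
    if "b' \<le> (Y + 1) / 2" "Y \<le> a + 2 * Z + 4" for Y
    using that aa X0 Z by (simp add: field_simps)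
  have "3 * a + 4 * Z + 7/2 + 5 * b' + 3 * b'^2 \<le> 17 * l + 32 * Z + 79" by (rule aux[OF b2 bb])
  also have "\<dots> \<le> (37 * Z + 95) * (1 + l)" using X0 Z mult_nonneg_nonneg[OF Z X0(3)] by (simp add: algebra_simps)
  finally have "R * (3 * a + 4 * Z + 7/2 + 5 * b' + 3 * b'^2) \<le> R * ((37 * Z + 95) * (1 + l))" using R by (rule mult_left_mono)
  then have "norm L' \<le> R * (37 * Z + 95) * (1 + l)" using L'1 by (simp only: mult.assoc)
  then show "\<exists>L'. ((\<lambda>t. lyap_M (m (\<gamma> t))) has_vector_derivative L') (at t) \<and>
     norm L' \<le> R * (37 * Z + 95) * (1 + norm (lyap_M (m (\<gamma> t))))"
    using D by (auto simp: X d)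
qed

section \<open>A priori bounds and continuation to the whole plane\<close>

lemma point_bound_mono:
  assumes "point_bound C z e" "C \<le> B" shows "point_bound B z e"
proof -
  from assms(1) consider p where "e = E_xy z p" "norm p \<le> C" | q where "q \<in> M z" "e = E_M z q" "norm q \<le> C"
    unfolding point_bound_def by blast
  then show ?thesis
  proof cases
    case 1
    then show ?thesis unfolding point_bound_def using assms(2) order.trans by metis
  next
    case 2
    then show ?thesis unfolding point_bound_def using assms(2) order.trans by metis
  qed
qed

text \<open>Since y W = 1 on the overlap, every point of a fibre has a representative with |y| at
  most 1 or with |W| at most 1, so the two local estimates cover everything. The resulting bound is
  doubled because the norm is estimated by the sum of the coordinates.\<close>

lemma sol_lyap_derivative:
  assumes \<sigma>: "sol S \<sigma>" "\<gamma> t \<in> S" and \<gamma>: "(\<gamma> has_vector_derivative c) (at t)" "isCont \<gamma> t"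
    and b: "norm (\<gamma> t) \<le> Z" "norm c \<le> R"
  shows "\<exists>L'. ((\<lambda>t. lyap (\<gamma> t) (\<sigma> (\<gamma> t))) has_vector_derivative L') (at t) \<and>
     norm L' \<le> R * (37 * Z + 95) * (1 + norm (lyap (\<gamma> t) (\<sigma> (\<gamma> t))))"
    and "point_bound (2 * norm (lyap (\<gamma> t) (\<sigma> (\<gamma> t))) + 4 * Z + 20 + (2 * norm (lyap (\<gamma> t) (\<sigma> (\<gamma> t))) + 4 * Z + 20)) (\<gamma> t) (\<sigma> (\<gamma> t))"
proof -
  define z l where "z = \<gamma> t" "l = norm (lyap z (\<sigma> z))"
  note zl = this
  have Z: "0 \<le> Z" using b(1) norm_ge_zero order.trans by blast
  have l0: "0 \<le> l" by (simp add: zl)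
  have sqb: "x \<le> B" if "x^2 \<le> B" "1 \<le> B" "0 \<le> x" for x B :: real
  proof (rule ccontr)
    assume "\<not> x \<le> B"
    then have "B * 1 < x * x" using that by (intro mult_strict_mono) auto
    then show False using that by (simp add: power2_eq_square)
  qed
  have cont: "\<exists>d>0. \<forall>t'\<in>ball t d. \<gamma> t' \<in> ball z r" if r: "0 < r" for r
  proof -
    obtain d where "0 < d" "\<And>x'. dist x' t < d \<Longrightarrow> dist (\<gamma> x') (\<gamma> t) < r"
      using \<gamma>(2)[unfolded continuous_at_eps_delta, rule_format, OF r] by auto
    then show ?thesis by (intro exI[of _ d]) (auto simp: zl dist_commute)
  qed
  have "\<sigma> z \<in> E_set z" using sol_in_E \<sigma> zl by blast
  then consider p where "\<sigma> z = E_xy z p" "norm (p $ 2) \<le> 1" | q where "q \<in> M z" "\<sigma> z = E_M z q" "norm (q $ 3) \<le> 1"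
  proof -
    have inv: "norm (1 / w) \<le> 1" if "\<not> norm w \<le> 1" for w :: complex
      using that by (simp add: norm_divide divide_le_eq_1)
    assume a: "\<sigma> z \<in> E_set z" and 1: "\<And>p. \<sigma> z = E_xy z p \<Longrightarrow> norm (p $ 2) \<le> 1 \<Longrightarrow> thesis"
      and 2: "\<And>q. q \<in> M z \<Longrightarrow> \<sigma> z = E_M z q \<Longrightarrow> norm (q $ 3) \<le> 1 \<Longrightarrow> thesis"
    from a consider p where "\<sigma> z = E_xy z p" | q where "q \<in> M z" "\<sigma> z = E_M z q"
      unfolding E_set_eq by blast
    then show thesis
    proof cases
      case p: (1 p)
      show thesis
      proof (cases "norm (p $ 2) \<le> 1")
        case False
        then have "p $ 2 \<noteq> 0" by auto
        then show thesis using 2[of "xy_to_M z p"] xy_to_M_in_M E_M_xy_to_M p inv[OF False] by simp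
      qed (use 1 p in blast)
    next
      case q: (2 q)
      show thesis
      proof (cases "norm (q $ 3) \<le> 1")
        case False
        then have "q $ 3 \<noteq> 0" by auto
        then show thesis using 1[of "M_to_xy q"] E_xy_M_to_xy q inv[OF False] by simp
      qed (use 2 q in blast)
    qed
  qed
  then have "(\<exists>L'. ((\<lambda>t. lyap (\<gamma> t) (\<sigma> (\<gamma> t))) has_vector_derivative L') (at t) \<and> norm L' \<le> R * (37 * Z + 95) * (1 + l)) \<and>
    point_bound (2 * l + 4 * Z + 20 + (2 * l + 4 * Z + 20)) z (\<sigma> z)"
  proof cases
    case (1 p)
    obtain r s where s: "0 < r" "solves_field PI_system (ball z r) s" "\<And>x. x \<in> ball z r \<Longrightarrow> \<sigma> x = E_xy x (s x)" "s z = p"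
      using sol_xy_form[OF \<sigma>(1) _ 1(1)] \<sigma>(2) zl by metis
    have zr: "z \<in> ball z r" using s(1) by simp
    have l: "l = norm (lyap_xy z (s z))" using s(3)[OF zr] by (simp add: zl)
    have y1: "norm (s (\<gamma> t) $ 2) \<le> 1" using 1 s(4) zl by simp
    note d = solves_fieldD[OF s(2) zr, unfolded zl]
    obtain L' where L': "((\<lambda>t. lyap_xy (\<gamma> t) (s (\<gamma> t))) has_vector_derivative L') (at t)"
      "norm L' \<le> R * (37 * Z + 95) * (1 + l)"
      using lyap_xy_derivative(1)[OF d \<gamma>(1) y1 b] unfolding l zl by blast
    obtain e where e: "0 < e" "\<forall>t'\<in>ball t e. \<gamma> t' \<in> ball z r" using cont[OF s(1)] by blast
    have "((\<lambda>t. lyap (\<gamma> t) (\<sigma> (\<gamma> t))) has_vector_derivative L') (at t)"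
      by (rule has_vector_derivative_transform_within_open[OF L'(1), of "ball t e"]) (use e s(3) in auto)
    moreover have "(norm (p $ 1))^2 \<le> 2 * l + 9 + 4 * Z"
      using lyap_xy_derivative(2)[OF d \<gamma>(1) y1 b] unfolding l using s(4) by (simp add: zl)
    then have "norm (p $ 1) \<le> 2 * l + 4 * Z + 20" using l0 Z by - (rule sqb; simp)
    then have "norm p \<le> 2 * l + 4 * Z + 20 + (2 * l + 4 * Z + 20)"
      using norm_vec_le_sum[of p] 1(2) l0 Z by (simp add: sum_2)
    ultimately show ?thesis using L'(2) 1(1) unfolding point_bound_def
      by - (intro conjI exI[of _ L'] disjI1 exI[of _ p])
  next
    case (2 q)
    obtain r m where m: "0 < r" "M_sol (ball z r) m" "\<And>x. x \<in> ball z r \<Longrightarrow> \<sigma> x = E_M x (m x)" "m z = q"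
      using sol_M_form[OF \<sigma>(1) _ 2(2,1)] \<sigma>(2) zl by metis
    have zr: "z \<in> ball z r" using m(1) by simp
    have mM: "m x \<in> M x" if "x \<in> ball z r" for x using m(2) that by (simp add: M_sol_def)
    have l: "l = norm (lyap_M (m z))" using m(3)[OF zr] lyap_E_M[OF mM[OF zr]] by (simp add: zl)
    have W1: "norm (m (\<gamma> t) $ 3) \<le> 1" using 2 m(4) zl by simp
    have sf: "solves_field M_field (ball z r) m" using m(2) by (simp add: M_sol_def)
    note d = solves_fieldD[OF sf zr, unfolded zl] and mM' = mM[OF zr, unfolded zl]
    obtain L' where L': "((\<lambda>t. lyap_M (m (\<gamma> t))) has_vector_derivative L') (at t)"
      "norm L' \<le> R * (37 * Z + 95) * (1 + l)"
      using lyap_M_derivative(1)[OF d mM' \<gamma>(1) W1 b] unfolding l zl by blast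
    obtain e where e: "0 < e" "\<forall>t'\<in>ball t e. \<gamma> t' \<in> ball z r" using cont[OF m(1)] by blast
    have "((\<lambda>t. lyap (\<gamma> t) (\<sigma> (\<gamma> t))) has_vector_derivative L') (at t)"
      by (rule has_vector_derivative_transform_within_open[OF L'(1), of "ball t e"]) (use e m(3) mM lyap_E_M in auto)
    moreover have "norm (q $ 1) \<le> 2 * l + 2 * Z + 6" "(norm (q $ 2))^2 \<le> 2 * l + 4 * Z + 10"
      using lyap_M_derivative(2,3)[OF d mM' \<gamma>(1) W1 b] unfolding l using m(4) by (simp_all add: zl)
    moreover then have "norm (q $ 2) \<le> 2 * l + 4 * Z + 10" using l0 Z by - (rule sqb; simp)
    ultimately have "norm q \<le> 2 * l + 4 * Z + 20 + (2 * l + 4 * Z + 20)"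
      "((\<lambda>t. lyap (\<gamma> t) (\<sigma> (\<gamma> t))) has_vector_derivative L') (at t)"
      using norm_vec_le_sum[of q] 2(3) l0 Z by (simp_all add: sum_3)
    then show ?thesis using L'(2) 2(1,2) unfolding point_bound_def
      by - (intro conjI exI[of _ L'] disjI2 bexI[of _ q])
  qed
  then show "\<exists>L'. ((\<lambda>t. lyap (\<gamma> t) (\<sigma> (\<gamma> t))) has_vector_derivative L') (at t) \<and>
     norm L' \<le> R * (37 * Z + 95) * (1 + norm (lyap (\<gamma> t) (\<sigma> (\<gamma> t))))"
    and "point_bound (2 * norm (lyap (\<gamma> t) (\<sigma> (\<gamma> t))) + 4 * Z + 20 + (2 * norm (lyap (\<gamma> t) (\<sigma> (\<gamma> t))) + 4 * Z + 20)) (\<gamma> t) (\<sigma> (\<gamma> t))"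
    unfolding zl by blast+
qed

text \<open>The quantity 1 + |f|^2 replaces |f|, which need not be differentiable at zeros of f. Its
  derivative is at most 4 K (1 + |f|^2), because n (1 + n) is at most 2 (1 + n^2).\<close>

lemma Gronwall_norm:
  fixes f :: "real \<Rightarrow> complex"
  assumes K: "0 \<le> K" and d: "\<And>t. 0 \<le> t \<Longrightarrow> t \<le> 1 \<Longrightarrow> \<exists>f'. (f has_vector_derivative f') (at t) \<and> norm f' \<le> K * (1 + norm (f t))"
  shows "(norm (f 1))^2 \<le> (1 + (norm (f 0))^2) * exp (4 * K)"
proof -
  define g where "g t = (1 + f t \<bullet> f t) * exp (- 4 * K * t)" for t
  have "g 1 \<le> g 0"
  proof (rule DERIV_nonpos_imp_nonincreasing[of 0 1 g])
    fix t :: real assume t: "0 \<le> t" "t \<le> 1"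
    obtain f' where f': "(f has_vector_derivative f') (at t)" "norm f' \<le> K * (1 + norm (f t))"
      using d[OF t] by blast
    have ip: "((\<lambda>t. f t \<bullet> f t) has_real_derivative 2 * (f t \<bullet> f')) (at t)"
      using has_derivative_inner[OF f'(1)[unfolded has_vector_derivative_def] f'(1)[unfolded has_vector_derivative_def]]
      unfolding has_field_derivative_def by (simp add: inner_commute algebra_simps mult_commute_abs)
    have "(g has_real_derivative 2 * (f t \<bullet> f') * exp (- 4 * K * t) + (1 + f t \<bullet> f t) * (exp (- 4 * K * t) * (- 4 * K))) (at t)"
      unfolding g_def by (auto intro!: derivative_eq_intros ip)
    moreover have "2 * (f t \<bullet> f') * exp (- 4 * K * t) + (1 + f t \<bullet> f t) * (exp (- 4 * K * t) * (- 4 * K)) \<le> 0"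
    proof -
      define n where "n = norm (f t)"
      have n: "0 \<le> n" by (simp add: n_def)
      have "f t \<bullet> f' \<le> n * (K * (1 + n))"
        using order.trans[OF norm_cauchy_schwarz mult_left_mono[OF f'(2) norm_ge_zero]] by (simp add: n_def)
      moreover have "n * (K * (1 + n)) \<le> K * (2 * (1 + n^2))"
      proof -
        have "n * (1 + n) \<le> 2 * (1 + n^2)"
          using zero_le_power2[of "n - 1"] zero_le_power2[of n] n by (simp add: power2_eq_square algebra_simps)
        then have "K * (n * (1 + n)) \<le> K * (2 * (1 + n^2))" using K by (rule mult_left_mono)
        then show ?thesis by (simp add: algebra_simps)
      qed
      moreover have "f t \<bullet> f t = n^2" by (simp add: n_def power2_norm_eq_inner)
      ultimately have "2 * (f t \<bullet> f') + (1 + f t \<bullet> f t) * (- 4 * K) \<le> 0" by (simp add: algebra_simps)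
      then have "(2 * (f t \<bullet> f') + (1 + f t \<bullet> f t) * (- 4 * K)) * exp (- 4 * K * t) \<le> 0"
        by (simp add: mult_le_0_iff)
      then show ?thesis by (simp add: algebra_simps)
    qed
    ultimately show "\<exists>y. (g has_real_derivative y) (at t) \<and> y \<le> 0" by blast
  qed simp
  then have "(1 + (norm (f 1))^2) * exp (- 4 * K) \<le> 1 + (norm (f 0))^2"
    by (simp add: g_def power2_norm_eq_inner)
  then have "(1 + (norm (f 1))^2) * exp (- 4 * K) * exp (4 * K) \<le> (1 + (norm (f 0))^2) * exp (4 * K)"
    by (intro mult_right_mono) auto
  then have "1 + (norm (f 1))^2 \<le> (1 + (norm (f 0))^2) * exp (4 * K)"
    by (simp add: mult.assoc exp_add[symmetric])
  then show ?thesis by simp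
qed

text \<open>Gronwall along the segment from z0 to \<zeta>, parametrized over the unit interval, so
  that its velocity is bounded by R. The order of quantifiers matters: C is chosen before the
  solution and its radius, hence cannot deteriorate during continuation.\<close>

lemma sol_point_bound:
  assumes "0 \<le> R"
  obtains C where "\<And>\<sigma> \<rho> \<zeta>. \<rho> \<le> R \<Longrightarrow> sol (ball z0 \<rho>) \<sigma> \<Longrightarrow> \<sigma> z0 = e0 \<Longrightarrow> \<zeta> \<in> ball z0 \<rho> \<Longrightarrow> point_bound C \<zeta> (\<sigma> \<zeta>)"
proof -
  define Z where "Z = norm z0 + R"
  define K where "K = R * (37 * Z + 95)"
  have Z: "0 \<le> Z" and K: "0 \<le> K" using assms by (simp_all add: Z_def K_def)
  \<comment> \<open>The leading 1 serves to remove the square: |L|^2 at most B - 1 implies |L| at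
    most B.\<close>
  define B where "B = 1 + (1 + (norm (lyap z0 e0))^2) * exp (4 * K)"
  define C where "C = 2 * B + 4 * Z + 20 + (2 * B + 4 * Z + 20)"
  show ?thesis
  proof (rule that[of C])
    fix \<sigma> \<rho> \<zeta> assume \<rho>: "\<rho> \<le> R" and \<sigma>: "sol (ball z0 \<rho>) \<sigma>" "\<sigma> z0 = e0" and \<zeta>: "\<zeta> \<in> ball z0 \<rho>"
    define c where "c = \<zeta> - z0"
    define \<gamma> where "\<gamma> t = z0 + of_real t * c" for t
    have nc: "norm c < \<rho>" using \<zeta> by (simp add: c_def dist_norm norm_minus_commute)
    have nt: "norm (of_real t * c) \<le> norm c" if "0 \<le> t" "t \<le> 1" for t
      using that by (simp add: norm_mult mult_left_le_one_le)
    have \<gamma>S: "\<gamma> t \<in> ball z0 \<rho>" if "0 \<le> t" "t \<le> 1" for t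
      using nt[OF that] nc by (simp add: \<gamma>_def dist_norm)
    have \<gamma>Z: "norm (\<gamma> t) \<le> Z" if "0 \<le> t" "t \<le> 1" for t
      unfolding \<gamma>_def Z_def using nt[OF that] nc \<rho> by (intro order.trans[OF norm_triangle_ineq]) auto
    have \<gamma>d: "(\<gamma> has_vector_derivative c) (at t)" for t
    proof -
      have "((\<lambda>t. z0 + t *\<^sub>R c) has_vector_derivative c) (at t)"
        by (auto intro!: derivative_eq_intros)
      then show ?thesis by (simp add: \<gamma>_def[abs_def] scaleR_conv_of_real)
    qed
    have \<gamma>c: "isCont \<gamma> t" for t using has_vector_derivative_continuous[OF \<gamma>d] .
    have cR: "norm c \<le> R" using nc \<rho> by simp
    have "(norm (lyap (\<gamma> 1) (\<sigma> (\<gamma> 1))))^2 \<le> (1 + (norm (lyap (\<gamma> 0) (\<sigma> (\<gamma> 0))))^2) * exp (4 * K)"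
    proof (rule Gronwall_norm[OF K])
      fix t :: real assume t: "0 \<le> t" "t \<le> 1"
      show "\<exists>f'. ((\<lambda>t. lyap (\<gamma> t) (\<sigma> (\<gamma> t))) has_vector_derivative f') (at t) \<and> norm f' \<le> K * (1 + norm (lyap (\<gamma> t) (\<sigma> (\<gamma> t))))"
        using sol_lyap_derivative(1)[OF \<sigma>(1) \<gamma>S[OF t] \<gamma>d \<gamma>c \<gamma>Z[OF t] cR] by (simp add: K_def)
    qed
    moreover have \<gamma>1: "\<gamma> 1 = \<zeta>" and "\<gamma> 0 = z0" by (simp_all add: \<gamma>_def c_def)
    ultimately have l2: "(norm (lyap \<zeta> (\<sigma> \<zeta>)))^2 \<le> B - 1" using \<sigma>(2) by (simp add: B_def)
    have "norm (lyap \<zeta> (\<sigma> \<zeta>)) \<le> B"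
      using l2 zero_le_power2[of "norm (lyap \<zeta> (\<sigma> \<zeta>)) - 1"] zero_le_power2[of "norm (lyap \<zeta> (\<sigma> \<zeta>))"]
      unfolding power2_diff one_power2 mult_1_right by linarith
    then have le: "2 * norm (lyap \<zeta> (\<sigma> \<zeta>)) + 4 * Z + 20 + (2 * norm (lyap \<zeta> (\<sigma> \<zeta>)) + 4 * Z + 20) \<le> C"
      by (simp add: C_def)
    have "point_bound (2 * norm (lyap \<zeta> (\<sigma> \<zeta>)) + 4 * Z + 20 + (2 * norm (lyap \<zeta> (\<sigma> \<zeta>)) + 4 * Z + 20)) \<zeta> (\<sigma> \<zeta>)"
      using sol_lyap_derivative(2)[OF \<sigma>(1) \<gamma>S[of 1] \<gamma>d \<gamma>c \<gamma>Z[of 1] cR] by (simp add: \<gamma>1)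
    then show "point_bound C \<zeta> (\<sigma> \<zeta>)"
      using le by (rule point_bound_mono)
  qed
qed

text \<open>The a priori bound yields one \<delta> for all points that any solution on a smaller
  disc can reach, so each step enlarges the radius by \<delta> until R is attained.\<close>

lemma sol_on_ball:
  assumes e0: "e0 \<in> E_set z0" and R: "0 < R"
  shows "\<exists>\<sigma>. sol (ball z0 R) \<sigma> \<and> \<sigma> z0 = e0"
proof -
  obtain C where C: "\<And>\<sigma> \<rho> \<zeta>. \<rho> \<le> R \<Longrightarrow> sol (ball z0 \<rho>) \<sigma> \<Longrightarrow> \<sigma> z0 = e0 \<Longrightarrow> \<zeta> \<in> ball z0 \<rho> \<Longrightarrow> point_bound C \<zeta> (\<sigma> \<zeta>)"
    using sol_point_bound[of R z0 e0] R by (metis less_imp_le)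
  have "\<exists>D. point_bound D z0 e0" using e0 unfolding E_set_eq point_bound_def by blast
  then obtain D where D: "point_bound D z0 e0" by blast
  \<comment> \<open>One bound for all uses of local existence: C for points on solutions, D for the
    initial point, and the last entry for the times in the disc.\<close>
  define Q where "Q = max (max C D) (norm z0 + R)"
  have Q: "D \<le> Q" "norm z0 \<le> Q" using R by (auto simp: Q_def)
  have mono: "point_bound Q z e" if "point_bound x z e" "x \<le> Q" for x z e
    by (rule point_bound_mono[OF that])
  obtain \<delta> where \<delta>: "0 < \<delta>" "\<And>\<zeta> e. norm \<zeta> \<le> Q \<Longrightarrow> point_bound Q \<zeta> e \<Longrightarrow> \<exists>\<tau>. sol (ball \<zeta> \<delta>) \<tau> \<and> \<tau> \<zeta> = e"
    using sol_uniform_existence[of Q] by metis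
  have step: "\<exists>\<sigma>. sol (ball z0 (min R (real (Suc n) * \<delta>))) \<sigma> \<and> \<sigma> z0 = e0" for n
  proof (induction n)
    case 0
    obtain \<tau> where "sol (ball z0 \<delta>) \<tau>" "\<tau> z0 = e0"
      using \<delta>(2)[of z0 e0] mono[OF D] Q(1,2) by blast
    then show ?case by (intro exI[of _ \<tau>]) (auto intro: sol_subset)
  next
    case (Suc n)
    define \<rho> where "\<rho> = min R (real (Suc n) * \<delta>)"
    have \<rho>: "0 < \<rho>" "\<rho> \<le> R" using R \<delta>(1) by (auto simp: \<rho>_def)
    obtain \<sigma> where \<sigma>: "sol (ball z0 \<rho>) \<sigma>" "\<sigma> z0 = e0" using Suc \<rho>_def by auto
    have "\<exists>\<tau>. sol (ball \<zeta> \<delta>) \<tau> \<and> \<tau> \<zeta> = \<sigma> \<zeta>" if \<zeta>: "\<zeta> \<in> ball z0 \<rho>" for \<zeta>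
    proof (rule \<delta>(2))
      have "norm \<zeta> \<le> norm z0 + dist z0 \<zeta>" by (metis dist_norm norm_minus_commute norm_triangle_sub)
      then show "norm \<zeta> \<le> Q" using \<zeta> \<rho>(2) by (simp add: Q_def)
      show "point_bound Q \<zeta> (\<sigma> \<zeta>)" by (rule mono[OF C[OF \<rho>(2) \<sigma> \<zeta>]]) (simp add: Q_def)
    qed
    then obtain \<sigma>' where \<sigma>': "sol (ball z0 (\<rho> + \<delta>)) \<sigma>'" "\<And>z. z \<in> ball z0 \<rho> \<Longrightarrow> \<sigma>' z = \<sigma> z"
      using sol_extend[OF \<sigma>(1) \<rho>(1) \<delta>(1)] by metis
    have "ball z0 (min R (real (Suc (Suc n)) * \<delta>)) \<subseteq> ball z0 (\<rho> + \<delta>)"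
      using \<delta>(1) by (intro subset_ball) (auto simp: \<rho>_def min_def algebra_simps)
    then have "sol (ball z0 (min R (real (Suc (Suc n)) * \<delta>))) \<sigma>'" using \<sigma>'(1) sol_subset by blast
    moreover have "\<sigma>' z0 = e0" using \<sigma>'(2)[of z0] \<rho>(1) \<sigma>(2) by simp
    ultimately show ?case by blast
  qed
  obtain n where "R < real n * \<delta>" using reals_Archimedean3[OF \<delta>(1)] by blast
  then have "R \<le> real (Suc n) * \<delta>" using \<delta>(1) by (simp add: algebra_simps)
  then show ?thesis using step[of n] by (simp add: min_absorb1)
qed

lemma sol_global:
  assumes e0: "e0 \<in> E_set z0"
  shows "\<exists>\<sigma>. sol UNIV \<sigma> \<and> \<sigma> z0 = e0"
proof -
  have "\<forall>n. \<exists>\<sigma>. sol (ball z0 (real (Suc n))) \<sigma> \<and> \<sigma> z0 = e0"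
    using sol_on_ball[OF e0] by simp
  then obtain s where s: "\<And>n. sol (ball z0 (real (Suc n))) (s n)" "\<And>n. s n z0 = e0" by metis
  have agree: "s n z = s k z" if "z \<in> ball z0 (real (Suc n))" "n \<le> k" for n k z
  proof (rule sol_identity[of "ball z0 (real (Suc n))" "s n" "s k" z0])
    show "sol (ball z0 (real (Suc n))) (s k)"
      using that by (intro sol_subset[OF s(1)[of k]] subset_ball) simp
  qed (use s that in \<open>auto intro: convex_connected\<close>)
  define N where "N z = nat \<lceil>dist z0 z\<rceil>" for z
  have N: "z \<in> ball z0 (real (Suc (N z)))" for z
    unfolding N_def mem_ball by linarith
  define \<sigma> where "\<sigma> z = s (N z) z" for z
  have \<sigma>: "\<sigma> z = s n z" if "z \<in> ball z0 (real (Suc n))" for n z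
    unfolding \<sigma>_def by (rule linorder_le_cases[of n "N z"]) (rule agree[OF that, symmetric] agree[OF N]; assumption)+
  have "sol UNIV \<sigma>"
    unfolding sol_def
  proof
    fix z
    define n where "n = Suc (N z)"
    have "z \<in> ball z0 (real (Suc n))" using N[of z] by (simp add: n_def)
    from openE[OF open_ball this] obtain e where e: "0 < e" "ball z e \<subseteq> ball z0 (real (Suc n))" by metis
    have eq: "\<sigma> x = s n x" if "x \<in> ball z (min r e)" for x r
      using \<sigma>[of x n] e(2) that by auto
    have "z \<in> ball z0 (real (Suc n))" using N[of z] by (simp add: n_def)
    from s(1)[of n] this show "\<exists>r>0. (\<exists>s. solves_field PI_system (ball z r) s \<and> (\<forall>x\<in>ball z r. \<sigma> x = E_xy x (s x))) \<or>
         (\<exists>m. M_sol (ball z r) m \<and> (\<forall>x\<in>ball z r. \<sigma> x = E_M x (m x)))"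
    proof (cases rule: sol_cases)
      case (xy r s')
      have "solves_field PI_system (ball z (min r e)) s'" by (rule solves_field_subset[OF xy(2)]) auto
      moreover have "\<forall>x\<in>ball z (min r e). \<sigma> x = E_xy x (s' x)" using eq xy(3) by auto
      ultimately show ?thesis using xy(1) e(1) by (intro exI[of _ "min r e"]) auto
    next
      case (M r m)
      have "M_sol (ball z (min r e)) m" by (rule M_sol_subset[OF M(2)]) auto
      moreover have "\<forall>x\<in>ball z (min r e). \<sigma> x = E_M x (m x)" using eq M(3) by auto
      ultimately show ?thesis using M(1) e(1) by (intro exI[of _ "min r e"]) auto
    qed
  qed
  moreover have "\<sigma> z0 = e0" using \<sigma>[of z0 0] s(2)[of 0] by simp
  ultimately show ?thesis by blast
qed

section \<open>Global solutions as holomorphic sections\<close>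

lemma hol_map_curve_differentiable:
  fixes c :: "complex \<Rightarrow> complex^'n" and \<phi> :: "complex^'n \<Rightarrow> complex^'m"
  assumes \<phi>: "hol_map D \<phi>" and c: "\<And>i. (\<lambda>z. c z $ i) field_differentiable at \<zeta>"
    and e: "0 < e" "\<And>z. z \<in> ball \<zeta> e \<Longrightarrow> c z \<in> D"
    and f: "\<And>z. z \<in> ball \<zeta> e \<Longrightarrow> f z = \<phi> (c z) $ i"
  shows "f field_differentiable at \<zeta>"
proof -
  have c\<zeta>: "c \<zeta> \<in> D" using e by simp
  have "hol_fun D (\<lambda>p. \<phi> p $ i)" using \<phi> by (simp add: hol_map_def)
  from hol_funE[OF this c\<zeta>] obtain N F where N: "open N" "c \<zeta> \<in> N" "\<And>q. q \<in> N \<Longrightarrow> complex_diff_at F q"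
    "\<And>q. q \<in> N \<Longrightarrow> q \<in> D \<Longrightarrow> F q = \<phi> q $ i" by metis
  have d: "(\<lambda>z. F (c z)) field_differentiable at \<zeta>"
    by (rule complex_diff_at_along_curve[OF c N(3)[OF N(2)]])
  have "isCont c \<zeta>"
    unfolding isCont_def
    using vec_tendstoI[of c "c \<zeta>" "at \<zeta>"] field_differentiable_imp_continuous_at[OF c]
    by (simp add: isCont_def)
  then obtain e' where e': "0 < e'" "\<And>z. z \<in> ball \<zeta> e' \<Longrightarrow> c z \<in> N"
    using N(1,2) unfolding continuous_at_open by (metis open_contains_ball_eq subsetD)
  have "f z = F (c z)" if "z \<in> ball \<zeta> (min e e')" for z
    using that e e' f N(4) by simp
  moreover obtain d' where "((\<lambda>z. F (c z)) has_field_derivative d') (at \<zeta>)"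
    using d unfolding field_differentiable_def by blast
  ultimately have "(f has_field_derivative d') (at \<zeta>)"
    using e(1) e'(1) by (intro has_field_derivative_transform_within_open[of "\<lambda>z. F (c z)" d' \<zeta> "ball \<zeta> (min e e')" f]) auto
  then show ?thesis by (auto simp: field_differentiable_def)
qed

lemma sol_imp_section:
  assumes \<sigma>: "sol UNIV \<sigma>"
  shows "global_holomorphic_section E_top P_top P_charts \<sigma>"
  unfolding global_holomorphic_section_def
proof (intro conjI allI)
  show "\<sigma> z \<in> topspace (E_top z)" for z using sol_in_E[OF \<sigma>] by (simp add: topspace_E_top)
  show "continuous_map euclidean P_top (\<lambda>z. (\<sigma> z, z))" using sol_continuous_map[OF \<sigma>] by simp
  interpret P: gluing_data P_xy UNIV P_M total_M "\<lambda>p. p $ 2" "\<lambda>q. q $ 3" xyz_to_total total_to_xyz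
    by (rule gluing_data_P)
  show "\<forall>(D, \<phi>)\<in>P_charts. \<forall>i. (\<lambda>z. \<phi> (\<sigma> z, z) $ i) holomorphic_on {z. (\<sigma> z, z) \<in> D}"
  proof (intro ballI, clarify)
    fix D \<phi> i assume c: "(D, \<phi>) \<in> P_charts"
    show "(\<lambda>z. \<phi> (\<sigma> z, z) $ i) holomorphic_on {z. (\<sigma> z, z) \<in> D}"
      unfolding holomorphic_on_def
    proof
      fix \<zeta> assume "\<zeta> \<in> {z. (\<sigma> z, z) \<in> D}"
      then have \<zeta>: "(\<sigma> \<zeta>, \<zeta>) \<in> D" by simp
      have oD: "openin P_top D" using complex_manifold_P c unfolding complex_manifold_def complex_atlas_def by blast
      obtain e where e: "0 < e" "\<And>z. z \<in> ball \<zeta> e \<Longrightarrow> (\<sigma> z, z) \<in> D"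
        using P_curve_preimage[OF \<sigma> _ oD \<zeta>] by blast
      have "(\<lambda>z. \<phi> (\<sigma> z, z) $ i) field_differentiable at \<zeta>"
        using c unfolding P_charts_def
      proof (cases rule: P.glued_charts_cases)
        case (1 D' \<psi>)
        note ch = submanifold_chartsD[OF 1(3)]
        obtain a where a: "a \<in> D'" "P_xy a = (\<sigma> \<zeta>, \<zeta>)" using \<zeta> 1(1) by auto
        then have "\<sigma> \<zeta> = E_xy \<zeta> (vector [a $ 1, a $ 2])" by (auto simp: P_xy_def)
        then obtain r s where s: "0 < r" "solves_field PI_system (ball \<zeta> r) s" "\<And>z. z \<in> ball \<zeta> r \<Longrightarrow> \<sigma> z = E_xy z (s z)"
          using sol_xy_form[OF \<sigma>] by (metis UNIV_I)
        define k where "k z = (vector [s z $ 1, s z $ 2, z] :: complex^3)" for z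
        have k: "P_xy (k z) = (\<sigma> z, z)" if "z \<in> ball \<zeta> r" for z using s(3)[OF that] by (simp add: P_xy_def k_def)
        have inv: "inv_into UNIV P_xy (P_xy x) = x" for x by (simp add: inv_into_f_f P.inj_j)
        have kD: "k z \<in> D'" if "z \<in> ball \<zeta> (min e r)" for z
        proof -
          have "P_xy (k z) \<in> P_xy ` D'" using k[of z] e(2)[of z] that 1(1) by simp
          then show ?thesis by (auto simp: P_xy_eq_iff)
        qed
        show ?thesis
        proof (rule hol_map_curve_differentiable[OF ch(5), of k \<zeta> "min e r"])
          fix l :: 3
          have "(\<lambda>z. s z $ l') field_differentiable at \<zeta>" for l'
            using solves_fieldD[OF s(2), of \<zeta> l'] s(1) by (auto simp: field_differentiable_def)
          then show "(\<lambda>z. k z $ l) field_differentiable at \<zeta>"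
            using exhaust_3[of l] by (auto simp: k_def field_differentiable_ident)
          show "\<phi> (\<sigma> z, z) $ i = \<psi> (k z) $ i" if "z \<in> ball \<zeta> (min e r)" for z
            using k[of z, symmetric] that by (simp add: 1(2) inv)
        qed (use e(1) s(1) kD in auto)
      next
        case (2 D' \<psi>)
        note ch = submanifold_chartsD[OF 2(3)]
        obtain a where a: "a \<in> D'" "P_M a = (\<sigma> \<zeta>, \<zeta>)" using \<zeta> 2(1) by auto
        then have "\<sigma> \<zeta> = E_M \<zeta> (vector [a $ 1, a $ 2, a $ 3])" "vector [a $ 1, a $ 2, a $ 3] \<in> M \<zeta>"
          using ch(2) by (auto simp: P_M_def total_M_mem)
        then obtain r m where m: "0 < r" "M_sol (ball \<zeta> r) m" "\<And>z. z \<in> ball \<zeta> r \<Longrightarrow> \<sigma> z = E_M z (m z)"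
          using sol_M_form[OF \<sigma>] by (metis UNIV_I)
        define k where "k z = (vector [m z $ 1, m z $ 2, m z $ 3, z] :: complex^4)" for z
        have k: "P_M (k z) = (\<sigma> z, z)" "k z \<in> total_M" if "z \<in> ball \<zeta> r" for z
          using m(2,3) that by (auto simp: P_M_def k_def total_M_mem M_sol_def)
        have inv: "inv_into total_M P_M (P_M x) = x" if "x \<in> total_M" for x
          using that by (simp add: inv_into_f_f P.inj_k)
        have kD: "k z \<in> D'" if "z \<in> ball \<zeta> (min e r)" for z
        proof -
          have "P_M (k z) \<in> P_M ` D'" using k(1)[of z] e(2)[of z] that 2(1) by simp
          then obtain d where "d \<in> D'" "P_M (k z) = P_M d" by auto
          then show ?thesis using P_M_eq_iff[of "k z" d] k(2)[of z] that ch(2) by auto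
        qed
        show ?thesis
        proof (rule hol_map_curve_differentiable[OF ch(5), of k \<zeta> "min e r"])
          fix l :: 4
          have "(\<lambda>z. m z $ l') field_differentiable at \<zeta>" for l'
            using m(1,2) solves_fieldD[of M_field "ball \<zeta> r" m \<zeta> l'] by (auto simp: field_differentiable_def M_sol_def)
          then show "(\<lambda>z. k z $ l) field_differentiable at \<zeta>"
            using exhaust_4[of l] by (auto simp: k_def field_differentiable_ident)
          show "\<phi> (\<sigma> z, z) $ i = \<psi> (k z) $ i" if "z \<in> ball \<zeta> (min e r)" for z
            using k(1)[of z, symmetric] k(2)[of z] that by (simp add: 2(2) inv)
        qed (use e(1) m(1) kD in auto)
      qed
      then show "(\<lambda>z. \<phi> (\<sigma> z, z) $ i) field_differentiable at \<zeta> within {z. (\<sigma> z, z) \<in> D}"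
        by (rule field_differentiable_at_within)
    qed
  qed
qed

lemma space_of_initial_conditions_E:
  "space_of_initial_conditions PI_system E_top E_charts P_top P_charts E_xy"
  unfolding space_of_initial_conditions_def
proof (intro conjI allI impI)
  show "complex_manifold (E_top z) (E_charts z)" for z by (rule complex_manifold_E)
  show "fibre_bundle_over_plane E_top P_top P_charts" by (rule fibre_bundle_P)
  fix \<Omega> s assume *: "open \<Omega> \<and> connected \<Omega> \<and> \<Omega> \<noteq> {} \<and> solves PI_system \<Omega> s"
  then obtain z0 where z0: "z0 \<in> \<Omega>" by blast
  have "solves_field PI_system \<Omega> s" using * unfolding solves_def solves_field_def by blast
  then have s: "sol \<Omega> (\<lambda>z. E_xy z (s z))" using * sol_xyI by blast
  obtain \<sigma> where \<sigma>: "sol UNIV \<sigma>" "\<sigma> z0 = E_xy z0 (s z0)"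
    using sol_global[of "E_xy z0 (s z0)" z0] by (auto simp: E_set_eq)
  have "\<sigma> z = E_xy z (s z)" if "z \<in> \<Omega>" for z
    using sol_identity[OF _ _ sol_subset[OF \<sigma>(1)] s z0 \<sigma>(2) that] * by blast
  then show "\<exists>\<sigma>. global_holomorphic_section E_top P_top P_charts \<sigma> \<and> (\<forall>z\<in>\<Omega>. \<sigma> z = E_xy z (s z))"
    using sol_imp_section[OF \<sigma>(1)] by blast
qed

subsection \<open>Polynomials in two variables\<close>

lemma eval2_0 [simp]: "eval2 0 x y = 0"
  and eval2_pCons [simp]: "eval2 (pCons a p) x y = poly a y + x * eval2 p x y"
  and eval2_add [simp]: "eval2 (p + q) x y = eval2 p x y + eval2 q x y"
  and eval2_diff [simp]: "eval2 (p - q) x y = eval2 p x y - eval2 q x y"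
  and eval2_uminus [simp]: "eval2 (- p) x y = - eval2 p x y"
  and eval2_mult [simp]: "eval2 (p * q) x y = eval2 p x y * eval2 q x y"
  and eval2_smult [simp]: "eval2 (smult a p) x y = poly a y * eval2 p x y"
  by (simp_all add: eval2_def)

definition deriv_y :: "complex poly poly \<Rightarrow> complex poly poly" where
  "deriv_y p = map_poly pderiv p"

lemma deriv_y_simps [simp]: "deriv_y 0 = 0" "deriv_y (pCons a p) = pCons (pderiv a) (deriv_y p)"
  by (simp_all add: deriv_y_def map_poly_pCons)

lemma eval2_has_derivative_x: "((\<lambda>x. eval2 p x y) has_field_derivative eval2 (pderiv p) x y) (at x)"
  by (induction p) (auto intro!: derivative_eq_intros simp: pderiv_pCons)

lemma eval2_has_derivative_y: "((\<lambda>y. eval2 p x y) has_field_derivative eval2 (deriv_y p) x y) (at y)"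
  by (induction p) (auto intro!: derivative_eq_intros)

lemma eval2_has_field_derivative:
  assumes "(f has_field_derivative f') (at t)" "(g has_field_derivative g') (at t)"
  shows "((\<lambda>t. eval2 p (f t) (g t)) has_field_derivative
    eval2 (pderiv p) (f t) (g t) * f' + eval2 (deriv_y p) (f t) (g t) * g') (at t)"
proof (induction p)
  case (pCons a p)
  then show ?case
    by (auto intro!: derivative_eq_intros assms simp: pderiv_pCons algebra_simps)
qed simp

lemma eval2_eq_0D:
  assumes "\<And>x y. y \<noteq> 0 \<Longrightarrow> eval2 p x y = 0" shows "p = 0"
proof -
  have "poly p [:x:] = 0" for x
  proof (rule ccontr)
    assume "poly p [:x:] \<noteq> 0"
    then have "finite {y. poly (poly p [:x:]) y = 0}" by (rule poly_roots_finite)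
    moreover have "- {0} \<subseteq> {y. poly (poly p [:x:]) y = 0}" using assms by (auto simp: eval2_def)
    ultimately have "finite (- {0 :: complex})" by (rule finite_subset[rotated])
    then show False by (simp add: infinite_UNIV_char_0 Compl_eq_Diff_UNIV)
  qed
  then have "range (\<lambda>x. [:x:]) \<subseteq> {a. poly p a = 0}" by auto
  moreover have "infinite (range (\<lambda>x :: complex. [:x:]))"
    using finite_imageD[of "\<lambda>x :: complex. [:x:]" UNIV] by (auto simp: inj_on_def infinite_UNIV_char_0)
  ultimately show ?thesis using poly_roots_finite finite_subset by blast
qed

lemma pderiv_sum_poly: "pderiv (sum f A) = (\<Sum>i\<in>A. pderiv (f i))"
  by (induction A rule: infinite_finite_induct) (simp_all add: pderiv_add)

lemma poly_antiderivative: "\<exists>q. pderiv q = (p :: 'a::field_char_0 poly)"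
proof -
  let ?q = "\<Sum>i\<le>degree p. monom (coeff p i / of_nat (Suc i)) (Suc i)"
  have "pderiv ?q = (\<Sum>i\<le>degree p. monom (coeff p i) i)"
    by (simp add: pderiv_sum_poly pderiv_monom del: of_nat_Suc)
  then have "pderiv ?q = p" by (simp only: poly_as_sum_of_monoms)
  then show ?thesis by (rule exI)
qed

lemma poly2_antiderivative: "\<exists>q. pderiv q = (p :: complex poly poly)"
proof -
  let ?q = "\<Sum>i\<le>degree p. monom (smult (1 / of_nat (Suc i)) (coeff p i)) (Suc i)"
  have "of_nat (Suc i) * smult (1 / of_nat (Suc i)) c = c" for c :: "complex poly" and i
    by (simp add: of_nat_poly del: of_nat_Suc)
  then have "pderiv ?q = (\<Sum>i\<le>degree p. monom (coeff p i) i)"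
    by (simp add: pderiv_sum_poly pderiv_monom del: of_nat_Suc)
  then have "pderiv ?q = p" by (simp only: poly_as_sum_of_monoms)
  then show ?thesis by (rule exI)
qed

lemma pderiv_deriv_y: "pderiv (deriv_y p) = deriv_y (pderiv p)"
proof (induction p)
  case (pCons a p)
  have "deriv_y (p + q) = deriv_y p + deriv_y q" for p q :: "complex poly poly"
    by (rule poly_eqI) (simp add: deriv_y_def coeff_map_poly pderiv_add)
  then show ?case using pCons by (simp add: pderiv_pCons)
qed simp

text \<open>Poincare's lemma for polynomials: f is integrated in the first variable, and closedness
  shows that the remaining error depends on the second variable alone.\<close>

lemma potential_exists:
  fixes f g :: "complex poly poly"
  assumes "deriv_y f = pderiv g"
  shows "\<exists>K. pderiv K = f \<and> deriv_y K = g"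
proof -
  obtain K0 where K0: "pderiv K0 = f" using poly2_antiderivative by blast
  have "pderiv (g - deriv_y K0) = 0" using assms K0 by (simp add: pderiv_diff pderiv_deriv_y)
  then have "degree (g - deriv_y K0) = 0" by (simp add: pderiv_eq_0_iff)
  then obtain r where r: "g - deriv_y K0 = [:r:]" by (metis degree_0_id)
  obtain q where q: "pderiv q = r" using poly_antiderivative by blast
  have "deriv_y (K0 + [:q:]) = deriv_y K0 + deriv_y [:q:]"
    by (rule poly_eqI) (simp add: deriv_y_def coeff_map_poly pderiv_add)
  then have "deriv_y (K0 + [:q:]) = g" using r q by (simp add: algebra_simps)
  moreover have "pderiv (K0 + [:q:]) = f" using K0 by (simp add: pderiv_add pderiv_pCons)
  ultimately show ?thesis by blast
qed

subsection \<open>Regular functions on the fibres are constant\<close>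

abbreviation "xw z u w \<equiv> painleve_coords z (vector [u, w]) $ 1"

text \<open>This is -2 times the Hamiltonian of the equation. Although x^2 and y^3 both have poles
  of order 6 at \<open>w = 0\<close>, for fixed u their combination has only a simple pole.\<close>

definition Hz :: "complex \<Rightarrow> complex \<Rightarrow> complex \<Rightarrow> complex" where
  "Hz z x y = x^2 - 4 * y^3 - 2 * z * y"

text \<open>Powers of x are reduced by x^2 = H + 4 y^3 + 2 z y. Only x^0 and x^1 survive, so that
  the pole order together with the exponent of H determines a monomial.\<close>

lemma H_decomposition: "\<exists>A B :: complex poly poly. \<forall>x y. eval2 p x y = eval2 A (Hz z x y) y + x * eval2 B (Hz z x y) y"
proof (induction p)
  case 0
  show ?case by (intro exI[of _ 0]) simp
next
  case (pCons a p)
  then obtain A B where AB: "\<And>x y. eval2 p x y = eval2 A (Hz z x y) y + x * eval2 B (Hz z x y) y" by blast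
  \<comment> \<open>As a polynomial in the outer variable H the factor in front of B is H + 2 z y +
    4 y^3, that is x^2. Multiplication by x exchanges the roles of A and B.\<close>
  have "eval2 (pCons a p) x y = eval2 ([:a:] + pCons [:0, 2 * z, 0, 4:] 1 * B) (Hz z x y) y + x * eval2 A (Hz z x y) y" for x y
  proof -
    have "x * x = Hz z x y + 4 * y^3 + 2 * z * y" by (simp add: Hz_def power2_eq_square)
    then have "x * (x * eval2 B (Hz z x y) y) = (Hz z x y + 4 * y^3 + 2 * z * y) * eval2 B (Hz z x y) y"
      by (simp add: mult.assoc[symmetric])
    then show ?thesis by (simp add: AB algebra_simps power3_eq_cube)
  qed
  then show ?case by blast
qed

lemma poly_sum_le:
  fixes p :: "'a::comm_semiring_1 poly"
  shows "degree p \<le> d \<Longrightarrow> poly p x = (\<Sum>i\<le>d. coeff p i * x ^ i)"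
  unfolding poly_altdef by (intro sum.mono_neutral_left) (auto simp: coeff_eq_0)

lemma eval2_sum:
  assumes "degree A \<le> d" "\<And>n. degree (coeff A n) \<le> d"
  shows "eval2 A h y = (\<Sum>n\<le>d. \<Sum>b\<le>d. coeff (coeff A n) b * h^n * y^b)"
  unfolding eval2_def poly_sum_le[OF assms(1)] poly_sum
  by (simp add: poly_sum_le[OF assms(2)] sum_distrib_left sum_distrib_right mult_ac)

lemma degree_coeff_bound: "\<exists>d. degree A \<le> d \<and> (\<forall>n. degree (coeff A n) \<le> d)" for A :: "complex poly poly"
proof (intro exI conjI allI)
  let ?d = "degree A + (\<Sum>n\<le>degree A. degree (coeff A n))"
  show "degree A \<le> ?d" by simp
  show "degree (coeff A n) \<le> ?d" for n
  proof (cases "n \<le> degree A")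
    case True
    then have "degree (coeff A n) \<le> (\<Sum>n\<le>degree A. degree (coeff A n))" by (intro member_le_sum) auto
    then show ?thesis by simp
  qed (simp add: coeff_eq_0)
qed

text \<open>Existence of the limit forces the coefficients below m to vanish, so each induction step
  may divide by w.\<close>

lemma coeff_eq_limit:
  assumes "((\<lambda>w. poly q w / w^m) \<longlongrightarrow> (L :: complex)) (at 0)"
  shows "coeff q m = L"
  using assms
proof (induction m arbitrary: q)
  case 0
  have "(poly q \<longlongrightarrow> poly q 0) (at 0)" using poly_isCont isCont_def by blast
  then show ?case using 0 by (simp add: poly_0_coeff_0) (metis at_neq_bot tendsto_unique)
next
  case (Suc m)
  obtain a q' where q: "q = pCons a q'" by (cases q)
  have "((\<lambda>w. w ^ Suc m * (poly q w / w ^ Suc m)) \<longlongrightarrow> 0 ^ Suc m * L) (at 0)"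
    by (intro tendsto_mult tendsto_power tendsto_ident_at Suc.prems)
  then have "(poly q \<longlongrightarrow> 0) (at 0)"
    by (rule Lim_transform_eventually[THEN tendsto_eq_rhs]) (auto simp: eventually_at_filter)
  moreover have "(poly q \<longlongrightarrow> poly q 0) (at 0)" using poly_isCont isCont_def by blast
  ultimately have "poly q 0 = 0" by (metis at_neq_bot tendsto_unique)
  then have a: "a = 0" by (simp add: q)
  have "((\<lambda>w. poly q' w / w ^ m) \<longlongrightarrow> L) (at 0)"
    using Suc.prems by (rule Lim_transform_eventually) (auto simp: eventually_at_filter q a)
  then show ?case using Suc.IH by (simp add: q)
qed

text \<open>The leading part of H at \<open>w = 0\<close> is 2/w - 4u. The substitution u = v/w
  brings both terms to the same order, so that the leading coefficient 2 - 4v still varies.\<close>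

lemma xw_scaled:
  assumes "w \<noteq> 0"
  shows "w^3 * xw z (v / w) w = v * w^5 - 2 - z * w^4 / 2 - w^5 / 2"
    and "w * Hz z (xw z (v / w) w) (1 / w^2) =
      (2 - 4 * v) + z^2 * w^3 / 4 + z * w^4 * (2 - 4 * v) / 4 + w^5 * (2 - 4 * v)^2 / 16"
  using assms by (simp_all add: Hz_def field_simps power2_eq_square power_numeral_reduce)

text \<open>Here N is the order of the pole that p would have along u = v/w. The leading coefficient
  is computed twice, as \<open>Q\<close> from (x, y) and as \<open>L\<close> from (u, w), and the
  two shapes are incompatible for positive N. If all weights vanish, only a constant is
  left.\<close>

lemma regular_function_const:
  assumes reg: "\<And>u w. w \<noteq> 0 \<Longrightarrow> eval2 p (xw z u w) (1 / w^2) = eval2 P u w"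
  shows "\<exists>c. \<forall>x y. eval2 p x y = c"
proof -
  obtain A B where AB: "\<And>x y. eval2 p x y = eval2 A (Hz z x y) y + x * eval2 B (Hz z x y) y"
    using H_decomposition[of p z] by blast
  obtain dA dB where "degree A \<le> dA \<and> (\<forall>n. degree (coeff A n) \<le> dA)" "degree B \<le> dB \<and> (\<forall>n. degree (coeff B n) \<le> dB)"
    using degree_coeff_bound by blast
  then obtain d where d: "degree A \<le> d" "\<And>n. degree (coeff A n) \<le> d" "degree B \<le> d" "\<And>n. degree (coeff B n) \<le> d"
    by (meson max.cobounded1 max.cobounded2 order.trans)
  define c where "c = (\<lambda>(n, b, e::nat). if e = 0 then coeff (coeff A n) b else coeff (coeff B n) b)"
  \<comment> \<open>The orders of the poles along u = v/w: 1 for H, 2 for y and 3 for x.\<close>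
  define wt where "wt = (\<lambda>(n, b, e). n + 2 * b + 3 * e :: nat)"
  define I where "I = {..d} \<times> {..d} \<times> {0, 1::nat}"
  define tm where "tm = (\<lambda>H y x (n, b, e). H ^ n * y ^ b * x ^ e :: complex)"
  have finI: "finite I" by (simp add: I_def)
  have p_eq: "eval2 p x y = (\<Sum>t\<in>I. c t * tm (Hz z x y) y x t)" for x y
  proof -
    have "(\<Sum>t\<in>I. c t * tm (Hz z x y) y x t) =
      (\<Sum>n\<le>d. \<Sum>b\<le>d. \<Sum>e\<in>{0, 1}. c (n, b, e) * tm (Hz z x y) y x (n, b, e))"
      unfolding I_def by (simp only: sum.cartesian_product' case_prod_unfold fst_conv snd_conv)
    also have "\<dots> = eval2 p x y"
      unfolding AB eval2_sum[OF d(1,2)] eval2_sum[OF d(3,4)]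
      by (simp add: c_def tm_def sum.distrib sum_distrib_left mult_ac)
    finally show ?thesis by simp
  qed
  define T where "T = {t \<in> I. c t \<noteq> 0}"
  show ?thesis
  proof (cases "\<forall>t\<in>T. wt t = 0")
    case True
    have "eval2 p x y = (\<Sum>t\<in>I. c t)" for x y
      unfolding p_eq
    proof (rule sum.cong[OF refl])
      fix t assume t: "t \<in> I"
      show "c t * tm (Hz z x y) y x t = c t"
      proof (cases "c t = 0")
        case False
        then have "wt t = 0" using t True unfolding T_def by blast
        then show ?thesis by (cases t) (simp add: wt_def tm_def)
      qed simp
    qed
    then show ?thesis by blast
  next
    case False
    define N where "N = Max (wt ` T)"
    have finT: "finite T" using finI by (simp add: T_def)
    have Tne: "T \<noteq> {}" using False by blast
    have wtN: "wt t \<le> N" if "t \<in> T" for t using finT that by (simp add: N_def)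
    have N0: "N > 0" using False wtN by fastforce
    obtain t0 where t0: "t0 \<in> T" "wt t0 = N"
    proof -
      have "N \<in> wt ` T" unfolding N_def using finT Tne by (intro Max_in) auto
      then show ?thesis using that by blast
    qed
    define J where "J = {t \<in> I. wt t = N}"
    have finJ: "finite J" using finI by (simp add: J_def)
    define cc where "cc = (\<lambda>(n, b, e). c (n, b, e) * (-2) ^ e)"
    \<comment> \<open>The leading coefficient as a polynomial in s = 2 - 4v, the limit of w H. The
      factors y and x contribute their limits 1 and -2, the latter through
      \<open>cc\<close>.\<close>
    define Q where "Q = (\<Sum>t\<in>J. monom (cc t) (fst t))"
    have coeffQ: "coeff Q k = (\<Sum>t\<in>J. if fst t = k then cc t else 0)" for k
      by (simp add: Q_def coeff_sum)
    have "coeff Q (fst t0) = cc t0"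
    proof -
      \<comment> \<open>Weight and n fix 2b + 3e, and for e at most 1 its parity fixes e. Hence
        distinct terms of weight N have distinct powers of s and cannot cancel.\<close>
      have "t = t0" if "t \<in> J" "fst t = fst t0" for t
      proof -
        obtain n b e n0 b0 e0 where t: "t = (n, b, e)" "t0 = (n0, b0, e0)" by (metis prod_cases3)
        have "e \<in> {0, 1}" "e0 \<in> {0, 1}" "n + 2 * b + 3 * e = n0 + 2 * b0 + 3 * e0" "n = n0"
          using that t t0 by (auto simp: J_def T_def I_def wt_def)
        then have "e = e0 \<and> b = b0" by (elim insertE; simp; presburger)
        then show ?thesis using t \<open>n = n0\<close> by simp
      qed
      then have "coeff Q (fst t0) = (\<Sum>t\<in>J. if t = t0 then cc t0 else 0)"
        unfolding coeffQ by (intro sum.cong refl) auto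
      also have "\<dots> = cc t0" using t0 finJ by (simp add: J_def T_def)
      finally show ?thesis .
    qed
    moreover have "cc t0 \<noteq> 0" using t0 by (cases t0) (simp add: cc_def T_def)
    ultimately have Q0: "Q \<noteq> 0" by auto
    \<comment> \<open>The gap: n = N - 1 would require 2b + 3e = 1.\<close>
    have "fst t \<noteq> N - 1" if "t \<in> J" for t
    proof -
      obtain n b e where t: "t = (n, b, e)" by (metis prod_cases3)
      have "n + 2 * b + 3 * e = N" using that t by (simp add: J_def wt_def)
      then show ?thesis using N0 t by simp presburger
    qed
    then have QN1: "coeff Q (N - 1) = 0"
      unfolding coeffQ by (intro sum.neutral) auto
    have degQ: "degree Q \<le> N"
    proof (rule degree_le, intro allI impI)
      fix k assume k: "N < k"
      have "fst t \<noteq> k" if "t \<in> J" for t using that k by (cases t) (auto simp: J_def wt_def)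
      then show "coeff Q k = 0" unfolding coeffQ by (intro sum.neutral) auto
    qed
    have lim: "((\<lambda>w. w^N * eval2 p (xw z (v / w) w) (1 / w^2)) \<longlongrightarrow> poly Q (2 - 4 * v)) (at 0)" for v
    proof -
      define s where "s = 2 - 4 * v"
      let ?x = "\<lambda>w. xw z (v / w) w" and ?y = "\<lambda>w :: complex. 1 / w^2"
      let ?H = "\<lambda>w. Hz z (?x w) (?y w)"
      have "((\<lambda>w. v * w^5 - 2 - z * w^4 / 2 - w^5 / 2) \<longlongrightarrow> v * 0^5 - 2 - z * 0^4 / 2 - 0^5 / 2) (at 0)"
        by (intro tendsto_intros) auto
      then have lx: "((\<lambda>w. w^3 * ?x w) \<longlongrightarrow> -2) (at 0)"
        by (rule Lim_transform_eventually[THEN tendsto_eq_rhs]) (auto simp: eventually_at_filter xw_scaled(1) simp del: painleve_coords_nth)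
      have "((\<lambda>w. s + z^2 * w^3 / 4 + z * w^4 * s / 4 + w^5 * s^2 / 16) \<longlongrightarrow> s + z^2 * 0^3 / 4 + z * 0^4 * s / 4 + 0^5 * s^2 / 16) (at 0)"
        by (intro tendsto_intros) auto
      then have lH: "((\<lambda>w. w * ?H w) \<longlongrightarrow> s) (at 0)"
        by (rule Lim_transform_eventually[THEN tendsto_eq_rhs]) (auto simp: eventually_at_filter xw_scaled(2) s_def simp del: painleve_coords_nth)
      have ly: "((\<lambda>w. w^2 * ?y w) \<longlongrightarrow> 1) (at 0)"
        by (rule tendsto_eventually) (auto simp: eventually_at_filter)
      have trm: "((\<lambda>w. w^N * (c t * tm (?H w) (?y w) (?x w) t)) \<longlongrightarrow> (if wt t = N then cc t * s ^ fst t else 0)) (at 0)" if t: "t \<in> I" for t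
      proof (cases "c t = 0")
        case True
        then show ?thesis by (cases t) (simp add: cc_def)
      next
        case False
        obtain n b e where te: "t = (n, b, e)" by (metis prod_cases3)
        have le: "n + 2 * b + 3 * e \<le> N" using wtN[of t] t False te by (simp add: T_def wt_def)
        have A: "((\<lambda>w. c t * (w ^ (N - wt t) * ((w * ?H w)^n * (w^2 * ?y w)^b * (w^3 * ?x w)^e))) \<longlongrightarrow>
           c t * (0 ^ (N - wt t) * (s^n * 1^b * (-2)^e))) (at 0)"
          by (intro tendsto_mult tendsto_const tendsto_power tendsto_ident_at lx lH ly)
        have B: "c t * (0 ^ (N - wt t) * (s^n * 1^b * (-2)^e)) = (if wt t = N then cc t * s ^ fst t else 0)"
          using le te by (auto simp: wt_def cc_def)
        have C: "c t * (w ^ (N - wt t) * ((w * h)^n * (w^2 * y)^b * (w^3 * x)^e)) = w^N * (c t * tm h y x t)" for w h y x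
        proof -
          have "N = (N - wt t) + (n + 2 * b + 3 * e)" using le te by (simp add: wt_def)
          then have "w ^ N = w ^ (N - wt t) * (w ^ n * (w^2)^b * (w^3)^e)"
            by (metis power_add power_mult)
          then show ?thesis using te by (simp add: tm_def power_mult_distrib mult_ac)
        qed
        show ?thesis using A unfolding B C .
      qed
      have "((\<lambda>w. \<Sum>t\<in>I. w^N * (c t * tm (?H w) (?y w) (?x w) t)) \<longlongrightarrow> (\<Sum>t\<in>I. if wt t = N then cc t * s ^ fst t else 0)) (at 0)"
        by (intro tendsto_sum trm)
      moreover have "(\<Sum>t\<in>I. if wt t = N then cc t * s ^ fst t else 0) = poly Q s"
        unfolding Q_def poly_sum poly_monom J_def using finI by (simp add: sum.inter_filter)
      ultimately show ?thesis unfolding p_eq sum_distrib_left s_def[symmetric] by simp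
    qed
    obtain d' where d': "degree P \<le> d'" "\<And>n. degree (coeff P n) \<le> d'" using degree_coeff_bound by blast
    \<comment> \<open>After multiplication by w^N the monomial u^i w^j becomes v^i w^(N + j - i).
      The part constant in w has i = N + j, so only powers v^i with i at least N occur.\<close>
    define L where "L = (\<Sum>i\<le>d'. \<Sum>j\<le>d'. if i = N + j then monom (coeff (coeff P i) j) i else 0)"
    have QLv: "poly Q (2 - 4 * v) = poly L v" for v
    proof -
      \<comment> \<open>Multiplication by a further w^d' clears the denominators, since i is at most
        d'; the limit is then a coefficient of a polynomial in w.\<close>
      define q where "q = (\<Sum>i\<le>d'. \<Sum>j\<le>d'. monom (coeff (coeff P i) j * v^i) (N + j + (d' - i)))"
      have "poly q w / w^d' = w^N * eval2 p (xw z (v / w) w) (1 / w^2)" if "w \<noteq> 0" for w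
      proof -
        have "poly q w = (\<Sum>i\<le>d'. \<Sum>j\<le>d'. w^d' * (w^N * (coeff (coeff P i) j * (v / w)^i * w^j)))"
          unfolding q_def poly_sum poly_monom
        proof (intro sum.cong refl)
          fix i j assume "i \<in> {..d'}"
          then have "w ^ d' = w ^ (d' - i) * w ^ i" by (simp flip: power_add)
          then show "coeff (coeff P i) j * v ^ i * w ^ (N + j + (d' - i)) = w^d' * (w^N * (coeff (coeff P i) j * (v / w)^i * w^j))"
            using that by (simp add: power_add power_divide)
        qed
        then have "poly q w = w^d' * (w^N * (\<Sum>i\<le>d'. \<Sum>j\<le>d'. coeff (coeff P i) j * (v / w)^i * w^j))"
          by (simp only: sum_distrib_left)
        then show ?thesis
          unfolding reg[OF that] eval2_sum[OF d'] using that by simp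
      qed
      then have "((\<lambda>w. poly q w / w^d') \<longlongrightarrow> poly Q (2 - 4 * v)) (at 0)"
        using lim[of v] by (auto intro: Lim_transform_eventually simp: eventually_at_filter)
      then have "poly Q (2 - 4 * v) = coeff q d'" using coeff_eq_limit by metis
      also have "\<dots> = (\<Sum>i\<le>d'. \<Sum>j\<le>d'. if i = N + j then coeff (coeff P i) j * v^i else 0)"
        unfolding q_def coeff_sum by (intro sum.cong refl) auto
      also have "\<dots> = poly L v"
        unfolding L_def poly_sum by (intro sum.cong refl) (simp add: poly_monom)
      finally show ?thesis .
    qed
    have QL: "pcompose Q [:2, -4:] = L"
    proof (intro poly_eq_poly_eq_iff[THEN iffD1] ext)
      fix v :: complex
      have "poly [:2, -4:] v = 2 - 4 * v" by simp
      then show "poly (pcompose Q [:2, -4:]) v = poly L v" using QLv[of v] by (simp only: poly_pcompose)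
    qed
    have "coeff L k = 0" if "k \<noteq> N" for k
    proof (cases "k < N")
      case True
      then show ?thesis unfolding L_def coeff_sum by (intro sum.neutral ballI) auto
    next
      case False
      have "degree L \<le> N" using degQ degree_pcompose_le[of Q "[:2, -4:]"] by (simp add: QL)
      then show ?thesis using False that by (intro coeff_eq_0) auto
    qed
    then have Lm: "L = monom (coeff L N) N" by (intro poly_eqI) simp
    \<comment> \<open>Powers below N are absent from \<open>L\<close> and its degree is at most N,
      so it is a multiple of v^N with v = (2 - s)/4. A nonzero multiple has a nonzero coefficient at
      s^(N - 1), contrary to the gap.\<close>
    have Qeq: "Q = smult (coeff L N / 4 ^ N) ([:2, -1:] ^ N)"
    proof (rule poly_eq_poly_eq_iff[THEN iffD1], rule ext)
      fix s :: complex
      have "2 - 4 * ((2 - s) / 4) = s" by (simp add: field_simps)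
      then have "poly Q s = poly L ((2 - s) / 4)" using QLv[of "(2 - s) / 4"] by metis
      also have "\<dots> = coeff L N * ((2 - s) / 4) ^ N" by (subst Lm) (simp add: poly_monom)
      finally show "poly Q s = poly (smult (coeff L N / 4 ^ N) ([:2, -1:] ^ N)) s"
        by (simp add: power_divide)
    qed
    have "coeff ([:2, -1:] ^ N :: complex poly) (N - 1) \<noteq> 0"
      using N0 by (subst coeff_linear_poly_power) auto
    moreover have "coeff Q (N - 1) = coeff L N / 4 ^ N * coeff ([:2, -1:] ^ N) (N - 1)"
      by (subst Qeq) simp
    ultimately have "coeff L N = 0" using QN1 by simp
    then have "Q = 0" using Qeq by simp
    then show ?thesis using Q0 by simp
  qed
qed

subsection \<open>Polynomial vector fields regular in both coordinate systems\<close>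

text \<open>Such a vector field \<open>X\<close> vanishes: its divergence is a regular function, hence a constant \<open>\<delta>\<close>.
  Contracting \<open>X\<close> with the symplectic form gives \<open>\<delta> x dy + dK\<close> in \<open>(x, y)\<close> and \<open>- 2 \<delta> u dw + dL\<close> in
  \<open>(u, w)\<close>, and \<open>x dy + 2 u dw\<close> has the residue 1 at \<open>w = 0\<close>; so \<open>\<delta> = 0\<close>, and \<open>K\<close> is a regular function.\<close>

lemma xw_has_derivative_u: "((\<lambda>u. xw z u w) has_field_derivative w^3) (at u)"
  by (auto intro!: derivative_eq_intros)

lemma xw_has_derivative_w:
  assumes "w \<noteq> 0"
  shows "((\<lambda>w. xw z u w) has_field_derivative 3 * u * w^2 + 6 / w^4 - z / 2 - w) (at w)"
  using assms by (auto intro!: derivative_eq_intros simp: field_simps power_numeral_reduce)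

lemma inv_square_has_derivative:
  assumes "w \<noteq> (0 :: complex)"
  shows "((\<lambda>w. 1 / w^2) has_field_derivative - 2 / w^3) (at w)"
  using assms by (auto intro!: derivative_eq_intros simp: field_simps power_numeral_reduce)

lemma deriv_y_uminus: "deriv_y (- p) = - deriv_y p"
  by (rule poly_eqI) (simp add: deriv_y_def coeff_map_poly pderiv_minus)

lemma deriv_y_smult_const: "deriv_y (smult [:c:] p) = smult [:c:] (deriv_y p)"
  by (rule poly_eqI) (simp add: deriv_y_def coeff_map_poly pderiv_smult)

lemma regular_vector_field_zero:
  assumes g: "\<And>u w. w \<noteq> 0 \<Longrightarrow> eval2 g (xw z u w) (1 / w^2) = - 2 / w^3 * eval2 G u w"
    and f: "\<And>u w. w \<noteq> 0 \<Longrightarrow> eval2 f (xw z u w) (1 / w^2) =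
       w^3 * eval2 F u w + (3 * u * w^2 + 6 / w^4 - z / 2 - w) * eval2 G u w"
  shows "eval2 f x y = 0 \<and> eval2 g x y = 0"
proof -
  let ?xw = "\<lambda>u w. 3 * u * w^2 + 6 / w^4 - z / 2 - w"
  note [simp del] = painleve_coords_nth
  \<comment> \<open>The map from (u, w) to (x, y) has the constant Jacobian -2, so the divergence is
    the same function in both coordinate systems. The u-derivatives of both transformation rules and
    the w-derivative of the one for g suffice to check this.\<close>
  have div: "eval2 (pderiv f + deriv_y g) (xw z u w) (1 / w^2) = eval2 (pderiv F + deriv_y G) u w"
    if w: "w \<noteq> 0" for u w
  proof -
    let ?X = "xw z u w" and ?Y = "1 / w^2"
    have d1: "eval2 (pderiv g) ?X ?Y * w^3 + eval2 (deriv_y g) ?X ?Y * 0 = - 2 / w^3 * eval2 (pderiv G) u w"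
    proof (rule DERIV_unique)
      show "((\<lambda>u. eval2 g (xw z u w) ?Y) has_field_derivative eval2 (pderiv g) ?X ?Y * w^3 + eval2 (deriv_y g) ?X ?Y * 0) (at u)"
        by (intro eval2_has_field_derivative xw_has_derivative_u DERIV_const)
      show "((\<lambda>u. eval2 g (xw z u w) ?Y) has_field_derivative - 2 / w^3 * eval2 (pderiv G) u w) (at u)"
        unfolding g[OF w] by (rule DERIV_cmult[OF eval2_has_derivative_x])
    qed
    have d2: "eval2 (pderiv f) ?X ?Y * w^3 + eval2 (deriv_y f) ?X ?Y * 0 =
        w^3 * eval2 (pderiv F) u w + (?xw u w * eval2 (pderiv G) u w + 3 * w^2 * eval2 G u w)"
    proof (rule DERIV_unique)
      show "((\<lambda>u. eval2 f (xw z u w) ?Y) has_field_derivative eval2 (pderiv f) ?X ?Y * w^3 + eval2 (deriv_y f) ?X ?Y * 0) (at u)"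
        by (intro eval2_has_field_derivative xw_has_derivative_u DERIV_const)
      have "((\<lambda>u. ?xw u w) has_field_derivative 3 * w^2) (at u)"
        by (auto intro!: derivative_eq_intros)
      then show "((\<lambda>u. eval2 f (xw z u w) ?Y) has_field_derivative
         w^3 * eval2 (pderiv F) u w + (?xw u w * eval2 (pderiv G) u w + 3 * w^2 * eval2 G u w)) (at u)"
        unfolding f[OF w] by (intro DERIV_add DERIV_cmult DERIV_mult'[OF _ eval2_has_derivative_x] eval2_has_derivative_x)
    qed
    have d3: "eval2 (pderiv g) ?X ?Y * ?xw u w + eval2 (deriv_y g) ?X ?Y * (- 2 / w^3) =
        - 2 / w^3 * eval2 (deriv_y G) u w + 6 / w^4 * eval2 G u w"
    proof (rule DERIV_unique)
      show "((\<lambda>w. eval2 g (xw z u w) (1 / w^2)) has_field_derivative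
        eval2 (pderiv g) ?X ?Y * ?xw u w + eval2 (deriv_y g) ?X ?Y * (- 2 / w^3)) (at w)"
        by (intro eval2_has_field_derivative xw_has_derivative_w inv_square_has_derivative w)
      have "((\<lambda>w. - 2 / w^3) has_field_derivative 6 / w^4) (at w)"
        using w by (auto intro!: derivative_eq_intros simp: field_simps power_numeral_reduce)
      from DERIV_mult'[OF this eval2_has_derivative_y]
      have "((\<lambda>w. - 2 / w^3 * eval2 G u w) has_field_derivative - 2 / w^3 * eval2 (deriv_y G) u w + 6 / w^4 * eval2 G u w) (at w)" .
      then show "((\<lambda>w. eval2 g (xw z u w) (1 / w^2)) has_field_derivative - 2 / w^3 * eval2 (deriv_y G) u w + 6 / w^4 * eval2 G u w) (at w)"
        by (rule has_field_derivative_transform_within_open[of _ _ _ "- {0}"]) (use w g in \<open>auto simp: open_Compl\<close>)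
    qed
    define i where "i = inverse w"
    have i: "i * w = 1" using w by (simp add: i_def)
    define gx gy fx Fu Gu Gw G0 X' where "gx = eval2 (pderiv g) ?X ?Y" "gy = eval2 (deriv_y g) ?X ?Y"
      "fx = eval2 (pderiv f) ?X ?Y" "Fu = eval2 (pderiv F) u w" "Gu = eval2 (pderiv G) u w"
      "Gw = eval2 (deriv_y G) u w" "G0 = eval2 G u w" "X' = ?xw u w"
    note defs = this
    have "gx * w^3 = - 2 * i^3 * Gu" using d1 by (simp add: defs i_def divide_inverse power_inverse)
    moreover have "fx * w^3 = w^3 * Fu + (X' * Gu + 3 * w^2 * G0)" using d2 by (simp add: defs)
    moreover have "gx * X' + gy * (- 2 * i^3) = - 2 * i^3 * Gw + 6 * i^4 * G0"
      using d3 unfolding defs[symmetric] by (simp add: i_def divide_inverse power_inverse)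
    ultimately have "2 * (fx + gy) = 2 * (Fu + Gw)" using i by algebra
    then have "fx + gy = Fu + Gw" by (rule mult_left_cancel[THEN iffD1, rotated]) simp
    then show ?thesis by (simp add: defs)
  qed
  from regular_function_const[OF div] obtain \<delta> where \<delta>: "\<And>x y. eval2 (pderiv f + deriv_y g) x y = \<delta>" by blast
  have \<delta>': "eval2 (pderiv F + deriv_y G) u w = \<delta>" if "w \<noteq> 0" for u w
    using div[OF that, of u] \<delta> by simp
  have div1: "pderiv f + deriv_y g = [:[:\<delta>:]:]"
    using eval2_eq_0D[of "pderiv f + deriv_y g - [:[:\<delta>:]:]"] \<delta> by simp
  have div2: "pderiv F + deriv_y G = [:[:\<delta>:]:]"
    using eval2_eq_0D[of "pderiv F + deriv_y G - [:[:\<delta>:]:]"] \<delta>' by simp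
  \<comment> \<open>K is a potential of f dy - g dx - \<delta> x dy, and L below of -2 (F dw - G du)
    + 2 \<delta> u dw. Both forms are closed because both divergences equal \<delta>.\<close>
  have "deriv_y (- g) = pderiv (f - pCons 0 [:[:\<delta>:]:])"
    using div1 by (simp add: deriv_y_uminus pderiv_diff pderiv_pCons algebra_simps)
  then obtain K where K: "pderiv K = - g" "deriv_y K = f - pCons 0 [:[:\<delta>:]:]"
    using potential_exists by blast
  have "deriv_y G = pderiv (pCons 0 [:[:\<delta>:]:] - F)"
    using div2 by (simp add: pderiv_diff pderiv_pCons algebra_simps)
  then have "deriv_y (smult [:2:] G) = pderiv (smult [:2:] (pCons 0 [:[:\<delta>:]:] - F))"
    by (simp only: deriv_y_smult_const pderiv_smult)
  then obtain L where L: "pderiv L = smult [:2:] G" "deriv_y L = smult [:2:] (pCons 0 [:[:\<delta>:]:] - F)"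
    using potential_exists by blast
  define D where "D u w = eval2 K (xw z u w) (1 / w^2) - eval2 L u w" for u w
  have Du: "((\<lambda>u. D u w) has_field_derivative 0) (at u)" if w: "w \<noteq> 0" for u w
  proof -
    have "((\<lambda>u. D u w) has_field_derivative
       (eval2 (pderiv K) (xw z u w) (1 / w^2) * w^3 + eval2 (deriv_y K) (xw z u w) (1 / w^2) * 0) - eval2 (pderiv L) u w) (at u)"
      unfolding D_def
      by (intro DERIV_diff eval2_has_field_derivative xw_has_derivative_u DERIV_const eval2_has_derivative_x)
    moreover have "(eval2 (pderiv K) (xw z u w) (1 / w^2) * w^3 + eval2 (deriv_y K) (xw z u w) (1 / w^2) * 0) - eval2 (pderiv L) u w = 0"
      using w by (simp add: K L g)
    ultimately show ?thesis by simp
  qed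
  have Dw: "((\<lambda>w. D u w) has_field_derivative - \<delta> * (4 / w^6 + z / w^2 + 1 / w)) (at w)" if w: "w \<noteq> 0" for u w
  proof -
    have "((\<lambda>w. D u w) has_field_derivative
       (eval2 (pderiv K) (xw z u w) (1 / w^2) * ?xw u w + eval2 (deriv_y K) (xw z u w) (1 / w^2) * (- 2 / w^3)) - eval2 (deriv_y L) u w) (at w)"
      unfolding D_def
      by (intro DERIV_diff eval2_has_field_derivative xw_has_derivative_w inv_square_has_derivative w eval2_has_derivative_y)
    moreover have "(eval2 (pderiv K) (xw z u w) (1 / w^2) * ?xw u w + eval2 (deriv_y K) (xw z u w) (1 / w^2) * (- 2 / w^3)) - eval2 (deriv_y L) u w
       = - \<delta> * (4 / w^6 + z / w^2 + 1 / w)"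
    proof -
      have "eval2 (pderiv K) (xw z u w) (1 / w^2) * ?xw u w = 2 / w^3 * eval2 G u w * ?xw u w"
        using w by (simp add: K g)
      moreover have "eval2 (deriv_y K) (xw z u w) (1 / w^2) = w^3 * eval2 F u w + ?xw u w * eval2 G u w - xw z u w * \<delta>"
        using w by (simp add: K f)
      moreover have "eval2 (deriv_y L) u w = 2 * (u * \<delta> - eval2 F u w)" by (simp add: L)
      moreover have "2 / w^3 * g0 * x' + (w^3 * f0 + x' * g0 - x0 * \<delta>) * (- 2 / w^3) - 2 * (u * \<delta> - f0) = \<delta> * (2 * x0 / w^3 - 2 * u)" for g0 x' f0 x0
        using w by (simp add: field_simps)
      moreover have "2 * xw z u w / w^3 - 2 * u = - (4 / w^6 + z / w^2 + 1 / w)"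
        using w by (simp add: painleve_coords_nth field_simps power_numeral_reduce)
      ultimately show ?thesis by simp (simp add: algebra_simps)
    qed
    ultimately show ?thesis by simp
  qed
  have "\<delta> = 0"
  proof -
    \<comment> \<open>The terms with w^-6 and w^-2 have single-valued primitives, which are split
      off. What remains is a primitive of -\<delta>/w on the punctured plane, and integration over
      the unit circle forces \<delta> to vanish.\<close>
    define D2 where "D2 w = D 0 w - \<delta> * (4 / (5 * w^5) + z / w)" for w
    have "(D2 has_field_derivative - \<delta> / w) (at w)" if w: "w \<noteq> 0" for w
    proof -
      have "((\<lambda>w. 4 / (5 * w^5) + z / w) has_field_derivative - (4 / w^6 + z / w^2)) (at w)"
        using w by (auto intro!: derivative_eq_intros simp: field_simps power_numeral_reduce)
      from DERIV_diff[OF Dw[OF w, of 0] DERIV_cmult[OF this, of \<delta>]]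
      have "(D2 has_field_derivative - \<delta> * (4 / w^6 + z / w^2 + 1 / w) - \<delta> * - (4 / w^6 + z / w^2)) (at w)"
        unfolding D2_def by simp
      moreover have "- \<delta> * (4 / w^6 + z / w^2 + 1 / w) - \<delta> * - (4 / w^6 + z / w^2) = - \<delta> / w"
        by (simp add: algebra_simps)
      ultimately show ?thesis by simp
    qed
    then have "((\<lambda>w. - \<delta> / w) has_contour_integral 0) (circlepath 0 1)"
      by (intro Cauchy_theorem_primitive[of "- {0}" D2]) (auto intro: has_field_derivative_at_within)
    moreover have "((\<lambda>w. - \<delta> / (w - 0)) has_contour_integral 2 * of_real pi * \<i> * (- \<delta>)) (circlepath 0 1)"
      by (rule Cauchy_integral_circlepath_simple[of "\<lambda>_. - \<delta>"]) auto
    ultimately show ?thesis using has_contour_integral_unique by fastforce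
  qed
  have D0: "D u w = D 0 1" if w: "w \<noteq> 0" for u w
  proof -
    have "D u w = D 0 w"
      using has_field_derivative_zero_constant[of UNIV "\<lambda>u. D u w"] Du[OF w] by auto
    also have "D 0 w = D 0 1"
    proof (rule DERIV_zero_connected_constant[of "- {0}" "{}" "D 0"])
      show "connected (- {0 :: complex})" by (rule connected_punctured_universe) simp
      show "continuous_on (- {0}) (D 0)"
        using Dw by (intro continuous_at_imp_continuous_on ballI DERIV_isCont) auto
    qed (use Dw[of _ 0] w \<open>\<delta> = 0\<close> in \<open>auto simp: open_Compl\<close>)
    finally show ?thesis .
  qed
  \<comment> \<open>With \<delta> = 0 the potentials differ by a constant, so K is polynomial in
    both coordinate systems.\<close>
  have "eval2 K (xw z u w) (1 / w^2) = eval2 (L + [:[:D 0 1:]:]) u w" if "w \<noteq> 0" for u w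
    using D0[OF that, of u] by (simp add: D_def algebra_simps)
  from regular_function_const[OF this] obtain c where c: "\<And>x y. eval2 K x y = c" by blast
  have "eval2 (pderiv K) x y = 0" "eval2 (deriv_y K) x y = 0"
    using eval2_has_derivative_x[of K y x] eval2_has_derivative_y[of K x y] unfolding c
    by (auto intro: DERIV_unique)
  then show ?thesis using \<open>\<delta> = 0\<close> by (simp add: K)
qed

subsection \<open>Two-forms in dimension two\<close>

lemma frechet_derivative_eq_on:
  assumes "open N" "x \<in> N" "\<And>y. y \<in> N \<Longrightarrow> f y = g y" "(g has_derivative g') (at x)"
  shows "frechet_derivative f (at x) = g'"
  using has_derivative_transform_within_open[OF assms(4,1,2)] assms(3) frechet_derivative_at by metis

lemma complex_atlasD:
  assumes "complex_atlas X A" "(D,\<phi>) \<in> A"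
  shows "openin X D" "D \<subseteq> topspace X" "open (\<phi> ` D)" "inj_on \<phi> D"
    "homeomorphic_map (subtopology X D) (top_of_set (\<phi> ` D)) \<phi>"
proof -
  show o: "openin X D" and "open (\<phi> ` D)" and h: "homeomorphic_map (subtopology X D) (top_of_set (\<phi> ` D)) \<phi>"
    using assms unfolding complex_atlas_def by auto
  show D: "D \<subseteq> topspace X" by (rule openin_subset[OF o])
  have "inj_on \<phi> (topspace (subtopology X D))" using homeomorphic_imp_injective_map[OF h] .
  then show "inj_on \<phi> D" using D by (simp add: Int_absorb1)
qed

lemma complex_atlas_transition:
  assumes A: "complex_atlas X A" and c: "(D,\<phi>) \<in> A" "(D',\<psi>) \<in> A"
  shows "open (\<phi> ` (D \<inter> D'))" "hol_map (\<phi> ` (D \<inter> D')) (\<psi> \<circ> inv_into D \<phi>)"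
proof -
  note d = complex_atlasD[OF A c(1)]
  show "hol_map (\<phi> ` (D \<inter> D')) (\<psi> \<circ> inv_into D \<phi>)" using A c unfolding complex_atlas_def by blast
  have "openin (subtopology X D) (D \<inter> D')"
    using complex_atlasD(1)[OF A c(2)] by (metis inf_commute openin_subtopology_Int)
  then have "openin (top_of_set (\<phi> ` D)) (\<phi> ` (D \<inter> D'))"
    using homeomorphic_map_openness_eq[OF d(5)] by blast
  then show "open (\<phi> ` (D \<inter> D'))" using d(3) openin_open_trans by blast
qed

text \<open>The minor of rows i and j of a complex linear L: the factor with which
  \<open>wedge i j\<close> pulls back to a multiple of \<open>wedge 1 2\<close>.\<close>

definition minor :: "'k \<Rightarrow> 'k \<Rightarrow> (complex^2 \<Rightarrow> complex^'k) \<Rightarrow> complex" where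
  "minor i j L = wedge i j (L (axis 1 1)) (L (axis 2 1))"

lemma wedge_minor:
  assumes "linear L" "\<And>c v. L (c *s v) = c *s L v"
  shows "wedge i j (L v) (L w) = minor i j L * wedge 1 2 v w"
proof -
  have "L v = v $ 1 *s L (axis 1 1) + v $ 2 *s L (axis 2 1)" for v
  proof -
    have "v = v $ 1 *s axis 1 1 + v $ 2 *s axis 2 1"
      by (simp add: vec2_eq_iff axis_def)
    then show ?thesis using linear_add[OF assms(1)] assms(2) by metis
  qed
  note l = this[of v] this[of w]
  show ?thesis unfolding l by (simp add: minor_def wedge_def algebra_simps)
qed

lemma minor_compose:
  assumes "linear L" "\<And>c v. L (c *s v) = c *s L v"
  shows "minor i j (L \<circ> K) = minor i j L * minor 1 2 K"
  unfolding minor_def[of i j "L \<circ> K"] o_apply wedge_minor[OF assms] minor_def[of 1 2 K] ..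

lemma minor_id: "minor 1 2 (\<lambda>v. v) = 1" "minor 1 2 id = 1"
  by (simp_all add: minor_def wedge_def axis_def)

text \<open>The coefficient in the chart c of \<rho> times the wedge of the coordinate differentials
  i and j, pulled back along \<gamma>. In dimension two this one function is the whole form.\<close>

definition density ::
  "(complex^'k \<Rightarrow> complex) \<Rightarrow> 'k \<Rightarrow> 'k \<Rightarrow> ('a \<Rightarrow> complex^'k) \<Rightarrow> ('a, 2) chart \<Rightarrow> 'a \<Rightarrow> complex" where
  "density \<rho> i j \<gamma> c p = \<rho> (\<gamma> p) * minor i j (frechet_derivative (\<gamma> \<circ> inv_into (fst c) (snd c)) (at (snd c p)))"

definition jacobian :: "('a, 2) chart \<Rightarrow> ('a, 2) chart \<Rightarrow> 'a \<Rightarrow> complex" where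
  "jacobian c c' p = minor 1 2 (frechet_derivative (snd c' \<circ> inv_into (fst c) (snd c)) (at (snd c p)))"

text \<open>Around \<open>p\<close> the form presented by \<open>\<gamma>\<close> and \<open>\<rho>\<close> has constant coefficient \<open>b\<close> in the chart \<open>c\<close>.\<close>

definition darboux_at ::
  "('a, 2) chart set \<Rightarrow> (complex^'k \<Rightarrow> complex) \<Rightarrow> 'k::finite \<Rightarrow> 'k \<Rightarrow> ('a \<Rightarrow> complex^'k) \<Rightarrow> 'a \<Rightarrow> ('a, 2) chart \<Rightarrow> complex \<Rightarrow> bool" where
  "darboux_at A \<rho> i j \<gamma> p c b \<longleftrightarrow> c \<in> A \<and> p \<in> fst c \<and> b \<noteq> 0 \<and>
     (\<exists>N. open N \<and> snd c p \<in> N \<and> N \<subseteq> snd c ` fst c \<and> hol_map N (\<gamma> \<circ> inv_into (fst c) (snd c)) \<and>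
        (\<forall>s\<in>N. density \<rho> i j \<gamma> c (inv_into (fst c) (snd c) s) = b))"

context
  fixes X :: "'a topology" and A :: "('a, 2) chart set"
  assumes A: "complex_atlas X A"
begin

text \<open>Transition maps in opposite directions are mutually inverse, and the minor is
  multiplicative under composition.\<close>

lemma jacobian_nonzero:
  assumes c: "(D,\<psi>) \<in> A" "(D',\<phi>) \<in> A" and p: "p \<in> D" "p \<in> D'"
  shows "jacobian (D,\<psi>) (D',\<phi>) p \<noteq> 0"
proof -
  let ?\<tau> = "\<phi> \<circ> inv_into D \<psi>" and ?\<sigma> = "\<psi> \<circ> inv_into D' \<phi>"
  note t = complex_atlas_transition[OF A c] and s = complex_atlas_transition[OF A c(2,1)]
  note i = complex_atlasD(4)[OF A c(1)] complex_atlasD(4)[OF A c(2)]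
  have x: "\<psi> p \<in> \<psi> ` (D \<inter> D')" and y: "?\<tau> (\<psi> p) \<in> \<phi> ` (D' \<inter> D)"
    using p i by (auto simp: inv_into_f_f)
  note dt = hol_map_derivative(1)[OF t(2,1) x] and ds = hol_map_derivative[OF s(2,1) y]
  have "frechet_derivative (\<lambda>y. y) (at (\<psi> p)) = (\<lambda>v. v)"
    by (rule frechet_derivative_at[symmetric]) (rule has_derivative_ident)
  moreover have "frechet_derivative (\<lambda>y. y) (at (\<psi> p)) =
      frechet_derivative ?\<sigma> (at (?\<tau> (\<psi> p))) \<circ> frechet_derivative ?\<tau> (at (\<psi> p))"
    by (rule frechet_derivative_eq_on[OF t(1) x _ diff_chain_at[OF dt ds(1)]]) (use i in \<open>auto simp: inv_into_f_f\<close>)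
  ultimately have "minor 1 2 (frechet_derivative ?\<sigma> (at (?\<tau> (\<psi> p)))) * minor 1 2 (frechet_derivative ?\<tau> (at (\<psi> p))) = 1"
    using minor_compose[OF has_derivative_linear[OF ds(1)] ds(2)] minor_id(1) by metis
  then show ?thesis unfolding jacobian_def by auto
qed

lemma darboux_change:
  assumes d: "darboux_at A \<rho> i j \<gamma> p (D',\<phi>) b" and c: "(D,\<psi>) \<in> A" "p \<in> D"
  obtains N where "open N" "\<psi> p \<in> N" "N \<subseteq> \<psi> ` (D \<inter> D')" "hol_map N (\<gamma> \<circ> inv_into D \<psi>)"
    "\<And>s. s \<in> N \<Longrightarrow> density \<rho> i j \<gamma> (D,\<psi>) (inv_into D \<psi> s) = b * jacobian (D,\<psi>) (D',\<phi>) (inv_into D \<psi> s)"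
proof -
  obtain N' where N': "open N'" "\<phi> p \<in> N'" "N' \<subseteq> \<phi> ` D'" "hol_map N' (\<gamma> \<circ> inv_into D' \<phi>)"
    "\<And>s. s \<in> N' \<Longrightarrow> density \<rho> i j \<gamma> (D',\<phi>) (inv_into D' \<phi> s) = b"
    using d unfolding darboux_at_def by auto
  have c': "(D',\<phi>) \<in> A" "p \<in> D'" using d by (auto simp: darboux_at_def)
  let ?\<tau> = "\<phi> \<circ> inv_into D \<psi>"
  note t = complex_atlas_transition[OF A c(1) c'(1)]
  note i = complex_atlasD(4)[OF A c(1)] complex_atlasD(4)[OF A c'(1)]
  define N where "N = \<psi> ` (D \<inter> D') \<inter> ?\<tau> -` N'"
  have N: "open N" unfolding N_def
    by (rule continuous_open_preimage[OF hol_map_continuous_on[OF t(2)] t(1) N'(1)])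
  have h\<tau>: "hol_map N ?\<tau>" by (rule hol_map_subset[OF t(2)]) (simp add: N_def)
  have \<tau>N: "?\<tau> s \<in> N'" if "s \<in> N" for s using that by (simp add: N_def)
  have eq: "(\<gamma> \<circ> inv_into D \<psi>) s = (\<gamma> \<circ> inv_into D' \<phi>) (?\<tau> s)" and bk: "inv_into D' \<phi> (?\<tau> s) = inv_into D \<psi> s"
    if "s \<in> N" for s using that i by (auto simp: N_def inv_into_f_f)
  have "hol_map N (\<lambda>s. (\<gamma> \<circ> inv_into D' \<phi>) (?\<tau> s))"
    by (rule hol_map_compose[OF h\<tau> N'(4)]) (use \<tau>N in blast)
  then have h: "hol_map N (\<gamma> \<circ> inv_into D \<psi>)" using eq hol_map_cong by metis
  show ?thesis
  proof (rule that[OF N _ _ h])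
    show "\<psi> p \<in> N" using c(2) c'(2) N'(2) i by (auto simp: N_def inv_into_f_f)
    show "N \<subseteq> \<psi> ` (D \<inter> D')" by (auto simp: N_def)
    fix s assume s: "s \<in> N"
    note dt = hol_map_derivative[OF h\<tau> N s] and dg = hol_map_derivative[OF N'(4,1) \<tau>N[OF s]]
    have "frechet_derivative (\<gamma> \<circ> inv_into D \<psi>) (at s) =
      frechet_derivative (\<gamma> \<circ> inv_into D' \<phi>) (at (?\<tau> s)) \<circ> frechet_derivative ?\<tau> (at s)"
      by (rule frechet_derivative_eq_on[OF N s _ diff_chain_at[OF dt(1) dg(1)]]) (use eq in auto)
    then have m: "minor i j (frechet_derivative (\<gamma> \<circ> inv_into D \<psi>) (at s)) =
      minor i j (frechet_derivative (\<gamma> \<circ> inv_into D' \<phi>) (at (?\<tau> s))) * minor 1 2 (frechet_derivative ?\<tau> (at s))"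
      by (simp only: minor_compose[OF has_derivative_linear[OF dg(1)] dg(2)])
    have "s \<in> \<psi> ` D" "?\<tau> s \<in> \<phi> ` D'" using s \<tau>N[OF s] N'(3) by (auto simp: N_def)
    then have r: "\<psi> (inv_into D \<psi> s) = s" "\<phi> (inv_into D' \<phi> (?\<tau> s)) = ?\<tau> s" by (auto intro: f_inv_into_f)
    have "density \<rho> i j \<gamma> (D',\<phi>) (inv_into D' \<phi> (?\<tau> s)) = b" by (rule N'(5)[OF \<tau>N[OF s]])
    then have "b = \<rho> (\<gamma> (inv_into D \<psi> s)) * minor i j (frechet_derivative (\<gamma> \<circ> inv_into D' \<phi>) (at (?\<tau> s)))"
      unfolding density_def fst_conv snd_conv r(2) bk[OF s] by simp
    then show "density \<rho> i j \<gamma> (D,\<psi>) (inv_into D \<psi> s) = b * jacobian (D,\<psi>) (D',\<phi>) (inv_into D \<psi> s)"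
      unfolding density_def jacobian_def fst_conv snd_conv r(1) m by simp
  qed
qed

lemma darboux_density:
  assumes d: "darboux_at A \<rho> i j \<gamma> p (D',\<phi>) b" and c: "(D,\<psi>) \<in> A" "p \<in> D"
  shows "density \<rho> i j \<gamma> (D,\<psi>) p = b * jacobian (D,\<psi>) (D',\<phi>) p"
proof -
  obtain N where "\<psi> p \<in> N"
    "\<And>s. s \<in> N \<Longrightarrow> density \<rho> i j \<gamma> (D,\<psi>) (inv_into D \<psi> s) = b * jacobian (D,\<psi>) (D',\<phi>) (inv_into D \<psi> s)"
    using darboux_change[OF assms] by metis
  then show ?thesis using complex_atlasD(4)[OF A c(1)] c(2) by (metis inv_into_f_f)
qed

lemma darboux_agree:
  assumes "darboux_at A \<rho> i j \<gamma> p (D',\<phi>) b" "darboux_at A \<rho>' i' j' \<gamma>' p (D',\<phi>) b" "(D,\<psi>) \<in> A" "p \<in> D"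
  shows "density \<rho> i j \<gamma> (D,\<psi>) p = density \<rho>' i' j' \<gamma>' (D,\<psi>) p"
  using darboux_density assms by metis

lemma jacobian_cocycle:
  assumes c: "(D,\<psi>) \<in> A" "(D',\<phi>) \<in> A" "(D'',\<eta>) \<in> A" and p: "p \<in> D" "p \<in> D'" "p \<in> D''"
  shows "jacobian (D,\<psi>) (D'',\<eta>) p = jacobian (D',\<phi>) (D'',\<eta>) p * jacobian (D,\<psi>) (D',\<phi>) p"
proof -
  let ?\<tau> = "\<phi> \<circ> inv_into D \<psi>" and ?\<sigma> = "\<eta> \<circ> inv_into D' \<phi>"
  note t = complex_atlas_transition[OF A c(1,2)] and s = complex_atlas_transition[OF A c(2,3)]
  note i = complex_atlasD(4)[OF A c(1)] complex_atlasD(4)[OF A c(2)]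
  have y: "?\<tau> (\<psi> p) \<in> \<phi> ` (D' \<inter> D'')" and x: "\<psi> p \<in> \<psi> ` (D \<inter> D')" and \<tau>p: "?\<tau> (\<psi> p) = \<phi> p"
    using p i by (auto simp: inv_into_f_f)
  note dt = hol_map_derivative(1)[OF t(2,1) x] and ds = hol_map_derivative[OF s(2,1) y]
  have "frechet_derivative (\<eta> \<circ> inv_into D \<psi>) (at (\<psi> p)) =
      frechet_derivative ?\<sigma> (at (?\<tau> (\<psi> p))) \<circ> frechet_derivative ?\<tau> (at (\<psi> p))"
    by (rule frechet_derivative_eq_on[OF t(1) x _ diff_chain_at[OF dt ds(1)]]) (use i in \<open>auto simp: inv_into_f_f\<close>)
  then show ?thesis unfolding jacobian_def fst_conv snd_conv
    using minor_compose[OF has_derivative_linear[OF ds(1)] ds(2)] \<tau>p by metis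
qed

text \<open>Everything is reduced to Jacobians of transitions to a Darboux chart: they are
  holomorphic as derivatives of holomorphic maps, satisfy the cocycle rule, and have no zeros.
  Closedness is automatic, since three vectors in dimension two are dependent.\<close>

lemma symplectic_of_darboux:
  assumes d: "\<And>p. p \<in> topspace X \<Longrightarrow> \<exists>D' \<phi> b N. (D',\<phi>) \<in> A \<and> p \<in> D' \<and> b \<noteq> 0 \<and> openin X N \<and> p \<in> N \<and>
      (\<forall>D \<psi>. (D,\<psi>) \<in> A \<longrightarrow> (\<forall>p'\<in>D \<inter> D' \<inter> N. d (D,\<psi>) p' = b * jacobian (D,\<psi>) (D',\<phi>) p'))"
  shows "holomorphic_symplectic_form A (\<lambda>c p v w. d c p * wedge 1 2 v w)"
proof -
  have main: "\<exists>N. open N \<and> \<psi> p \<in> N \<and> N \<subseteq> \<psi> ` D \<and> hol_fun N (\<lambda>t. d (D,\<psi>) (inv_into D \<psi> t))" and nz: "d (D,\<psi>) p \<noteq> 0"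
    if c: "(D,\<psi>) \<in> A" "p \<in> D" for D \<psi> p
  proof -
    note cd = complex_atlasD[OF A c(1)]
    have "p \<in> topspace X" using cd(2) c(2) by blast
    from d[OF this] obtain D' \<phi> b N where *: "(D',\<phi>) \<in> A" "p \<in> D'" "b \<noteq> 0" "openin X N" "p \<in> N"
      "\<And>p'. p' \<in> D \<inter> D' \<inter> N \<Longrightarrow> d (D,\<psi>) p' = b * jacobian (D,\<psi>) (D',\<phi>) p'"
      using c(1) by metis
    show "d (D,\<psi>) p \<noteq> 0" using *(6)[of p] *(2,3,5) c jacobian_nonzero[OF c(1) *(1) c(2) *(2)] by simp
    note t = complex_atlas_transition[OF A c(1) *(1)]
    let ?K = "\<psi> ` (D \<inter> D' \<inter> N)"
    have "openin (subtopology X D) (D \<inter> (D' \<inter> N))"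
      using complex_atlasD(1)[OF A *(1)] *(4) openin_Int openin_subtopology_Int2 by blast
    then have "openin (top_of_set (\<psi> ` D)) ?K"
      using homeomorphic_map_openness_eq[OF cd(5)] by (simp add: Int_assoc)
    then have K: "open ?K" using cd(3) openin_open_trans by blast
    have h: "hol_map ?K (\<phi> \<circ> inv_into D \<psi>)" by (rule hol_map_subset[OF t(2)]) auto
    have J: "hol_fun ?K (\<lambda>s. frechet_derivative (\<phi> \<circ> inv_into D \<psi>) (at s) v $ l)" for v l
    proof -
      have "hol_fun ?K (\<lambda>x. (\<phi> \<circ> inv_into D \<psi>) x $ l)" using h by (simp add: hol_map_def)
      then have "hol_fun ?K (\<lambda>s. frechet_derivative (\<lambda>x. (\<phi> \<circ> inv_into D \<psi>) x $ l) (at s) v)"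
        by (rule hol_fun_frechet_derivative[OF K])
      then show ?thesis by (rule hol_fun_cong) (simp add: hol_map_derivative(3)[OF h K])
    qed
    have "hol_fun ?K (\<lambda>s. b * minor 1 2 (frechet_derivative (\<phi> \<circ> inv_into D \<psi>) (at s)))"
      using J[unfolded hol_fun_open[OF K]] unfolding hol_fun_open[OF K] minor_def wedge_def
      by (intro ballI complex_diff_at_intros) auto
    moreover have "b * minor 1 2 (frechet_derivative (\<phi> \<circ> inv_into D \<psi>) (at s)) = d (D,\<psi>) (inv_into D \<psi> s)"
      if s: "s \<in> ?K" for s
    proof -
      from s obtain p' where p': "p' \<in> D \<inter> D' \<inter> N" "s = \<psi> p'" by blast
      then show ?thesis using *(6)[OF p'(1)] cd(4) by (simp add: jacobian_def inv_into_f_f)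
    qed
    ultimately have "hol_fun ?K (\<lambda>t. d (D,\<psi>) (inv_into D \<psi> t))" by (rule hol_fun_cong)
    then show "\<exists>N. open N \<and> \<psi> p \<in> N \<and> N \<subseteq> \<psi> ` D \<and> hol_fun N (\<lambda>t. d (D,\<psi>) (inv_into D \<psi> t))"
      using K c(2) *(2,5) by (intro exI[of _ ?K]) auto
  qed
  have hol: "hol_fun (\<psi> ` D) (\<lambda>t. d (D,\<psi>) (inv_into D \<psi> t))" if c: "(D,\<psi>) \<in> A" for D \<psi>
  proof (rule hol_funI)
    fix t assume "t \<in> \<psi> ` D"
    then obtain p where "p \<in> D" "t = \<psi> p" by blast
    from main[OF c this(1)] this(2) obtain N where N: "open N" "t \<in> N" "N \<subseteq> \<psi> ` D" "hol_fun N (\<lambda>t. d (D,\<psi>) (inv_into D \<psi> t))" by blast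
    show "\<exists>N F. open N \<and> t \<in> N \<and> (\<forall>q\<in>N. complex_diff_at F q) \<and> (\<forall>q\<in>N \<inter> \<psi> ` D. F q = d (D,\<psi>) (inv_into D \<psi> q))"
      using N(1,2) N(4)[unfolded hol_fun_open[OF N(1)]] by blast
  qed
  have cocycle: "d (D,\<psi>) p = d (D2,\<eta>) p * jacobian (D,\<psi>) (D2,\<eta>) p"
    if c: "(D,\<psi>) \<in> A" "(D2,\<eta>) \<in> A" and p: "p \<in> D" "p \<in> D2" for D \<psi> D2 \<eta> p
  proof -
    have "p \<in> topspace X" using complex_atlasD(2)[OF A c(1)] p(1) by blast
    from d[OF this] obtain D' \<phi> b N where *: "(D',\<phi>) \<in> A" "p \<in> D'" "p \<in> N"
      "\<And>D \<psi> p'. (D,\<psi>) \<in> A \<Longrightarrow> p' \<in> D \<inter> D' \<inter> N \<Longrightarrow> d (D,\<psi>) p' = b * jacobian (D,\<psi>) (D',\<phi>) p'"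
      by metis
    show ?thesis using *(4)[OF c(1), of p] *(4)[OF c(2), of p] *(2,3) p jacobian_cocycle[OF c *(1) p *(2)] by simp
  qed
  show ?thesis
    unfolding holomorphic_symplectic_form_def
  proof (intro conjI)
    show "holomorphic_two_form A (\<lambda>c p v w. d c p * wedge 1 2 v w)"
      unfolding holomorphic_two_form_def Let_def
    proof (intro conjI ballI, clarify, intro conjI ballI allI)
      fix D \<psi> p show "alternating_bilinear (\<lambda>v w. d (D,\<psi>) p * wedge 1 2 v w)"
        by (simp add: alternating_bilinear_def wedge_def algebra_simps)
    next
      fix D \<psi> v w assume c: "(D,\<psi>) \<in> A"
      show "hol_fun (\<psi> ` D) (\<lambda>t. d (D,\<psi>) (inv_into D \<psi> t) * wedge 1 2 v w)"
        using hol[OF c] unfolding hol_fun_open[OF complex_atlasD(3)[OF A c]]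
        by (intro ballI complex_diff_at_intros) auto
    next
      fix c :: "('a,2) chart" assume "c \<in> A"
      then show "case c of (D,\<phi>) \<Rightarrow> \<forall>(D',\<psi>)\<in>A. \<forall>p\<in>D \<inter> D'. \<forall>v w. d (D,\<phi>) p * wedge 1 2 v w =
          d (D',\<psi>) p * wedge 1 2 (frechet_derivative (\<psi> \<circ> inv_into D \<phi>) (at (\<phi> p)) v)
            (frechet_derivative (\<psi> \<circ> inv_into D \<phi>) (at (\<phi> p)) w)"
      proof (clarify)
        fix D \<phi> D' \<psi> p v w assume c: "(D,\<phi>) \<in> A" "(D',\<psi>) \<in> A" and p: "p \<in> D" "p \<in> D'"
        have x: "\<phi> p \<in> \<phi> ` (D \<inter> D')" using p by blast
        note t = hol_map_derivative[OF complex_atlas_transition(2,1)[OF A c] x]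
        show "d (D,\<phi>) p * wedge 1 2 v w = d (D',\<psi>) p * wedge 1 2 (frechet_derivative (\<psi> \<circ> inv_into D \<phi>) (at (\<phi> p)) v)
            (frechet_derivative (\<psi> \<circ> inv_into D \<phi>) (at (\<phi> p)) w)"
          unfolding wedge_minor[OF has_derivative_linear[OF t(1)] t(2)] cocycle[OF c p]
          by (simp add: jacobian_def)
      qed
    qed
    show "closed_two_form A (\<lambda>c p v w. d c p * wedge 1 2 v w)"
      unfolding closed_two_form_def Let_def
    proof clarify
      fix D \<psi> p u v w assume c: "(D,\<psi>) \<in> A" and p: "p \<in> D"
      let ?h = "\<lambda>t. d (D,\<psi>) (inv_into D \<psi> t)"
      have "complex_diff_at ?h (\<psi> p)"
        using hol[OF c] p unfolding hol_fun_open[OF complex_atlasD(3)[OF A c]] by blast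
      note h = complex_diff_at_derivative[OF this]
      let ?h' = "frechet_derivative ?h (at (\<psi> p))"
      have e: "frechet_derivative (\<lambda>t. ?h t * k) (at (\<psi> p)) = (\<lambda>a. ?h' a * k)" for k
        by (rule frechet_derivative_at[symmetric]) (rule has_derivative_mult_left[OF h(1)])
      have h': "?h' a = a $ 1 * ?h' (axis 1 1) + a $ 2 * ?h' (axis 2 1)" for a
      proof -
        have "a = a $ 1 *s axis 1 1 + a $ 2 *s axis 2 1" by (simp add: vec2_eq_iff axis_def)
        then show ?thesis using linear_add[OF has_derivative_linear[OF h(1)]] h(2) by metis
      qed
      show "frechet_derivative (\<lambda>t. ?h t * wedge 1 2 v w) (at (\<psi> p)) u +
        frechet_derivative (\<lambda>t. ?h t * wedge 1 2 w u) (at (\<psi> p)) v +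
        frechet_derivative (\<lambda>t. ?h t * wedge 1 2 u v) (at (\<psi> p)) w = 0"
        unfolding e h'[of u] h'[of v] h'[of w] by (simp add: wedge_def algebra_simps)
    qed
    show "nondegenerate_two_form A (\<lambda>c p v w. d c p * wedge 1 2 v w)"
      unfolding nondegenerate_two_form_def
    proof clarify
      fix D \<psi> p and v :: "complex^2" assume c: "(D,\<psi>) \<in> A" "p \<in> D" and v: "v \<noteq> 0"
      have "wedge 1 2 v (axis 2 1) = v $ 1" "wedge 1 2 v (axis 1 1) = - v $ 2" by (simp_all add: wedge_def axis_def)
      moreover have "v $ 1 \<noteq> 0 \<or> v $ 2 \<noteq> 0" using v by (simp add: vec2_eq_iff)
      ultimately have "\<exists>w. wedge 1 2 v w \<noteq> 0" by (metis neg_equal_0_iff_equal)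
      then show "\<exists>w. d (D,\<psi>) p * wedge 1 2 v w \<noteq> 0" using nz[OF c] by auto
    qed
  qed
qed

text \<open>Two partial expressions define one form as soon as, at each common point, some chart
  shows both with the same constant coefficient; equality in all other charts follows by multiplying
  with the Jacobian.\<close>

lemma symplectic_of_two_densities:
  fixes \<gamma>1 :: "'a \<Rightarrow> complex^'k1" and \<gamma>2 :: "'a \<Rightarrow> complex^'k2"
  assumes O: "openin X O1" "openin X O2" "topspace X \<subseteq> O1 \<union> O2"
    and d1: "\<And>p. p \<in> O1 \<Longrightarrow> \<exists>D' \<phi> b. (D',\<phi>) \<in> A \<and> p \<in> D' \<and> (\<forall>p'\<in>D' \<inter> O1. darboux_at A \<rho>1 i1 j1 \<gamma>1 p' (D',\<phi>) b)"
    and d2: "\<And>p. p \<in> O2 \<Longrightarrow> \<exists>D' \<phi> b. (D',\<phi>) \<in> A \<and> p \<in> D' \<and> (\<forall>p'\<in>D' \<inter> O2. darboux_at A \<rho>2 i2 j2 \<gamma>2 p' (D',\<phi>) b)"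
    and d12: "\<And>p. p \<in> O1 \<inter> O2 \<Longrightarrow> \<exists>D' \<phi> b. darboux_at A \<rho>1 i1 j1 \<gamma>1 p (D',\<phi>) b \<and> darboux_at A \<rho>2 i2 j2 \<gamma>2 p (D',\<phi>) b"
  defines "d \<equiv> \<lambda>c p. if p \<in> O1 then density \<rho>1 i1 j1 \<gamma>1 c p else density \<rho>2 i2 j2 \<gamma>2 c p"
  shows "holomorphic_symplectic_form A (\<lambda>c p v w. d c p * wedge 1 2 v w)"
    and "\<And>D \<psi> p. (D,\<psi>) \<in> A \<Longrightarrow> p \<in> D \<Longrightarrow> p \<in> O2 \<Longrightarrow> d (D,\<psi>) p = density \<rho>2 i2 j2 \<gamma>2 (D,\<psi>) p"
proof -
  show agree: "d (D,\<psi>) p = density \<rho>2 i2 j2 \<gamma>2 (D,\<psi>) p" if "(D,\<psi>) \<in> A" "p \<in> D" "p \<in> O2" for D \<psi> p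
  proof (cases "p \<in> O1")
    case True
    then obtain D' \<phi> b where "darboux_at A \<rho>1 i1 j1 \<gamma>1 p (D',\<phi>) b" "darboux_at A \<rho>2 i2 j2 \<gamma>2 p (D',\<phi>) b"
      using d12[of p] \<open>p \<in> O2\<close> by blast
    from darboux_agree[OF this that(1,2)] show ?thesis by (simp add: d_def True)
  qed (simp add: d_def)
  show "holomorphic_symplectic_form A (\<lambda>c p v w. d c p * wedge 1 2 v w)"
  proof (rule symplectic_of_darboux)
    fix p assume "p \<in> topspace X"
    then consider "p \<in> O1" | "p \<in> O2" using O(3) by blast
    then show "\<exists>D' \<phi> b N. (D',\<phi>) \<in> A \<and> p \<in> D' \<and> b \<noteq> 0 \<and> openin X N \<and> p \<in> N \<and>
      (\<forall>D \<psi>. (D,\<psi>) \<in> A \<longrightarrow> (\<forall>p'\<in>D \<inter> D' \<inter> N. d (D,\<psi>) p' = b * jacobian (D,\<psi>) (D',\<phi>) p'))"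
    proof cases
      case 1
      obtain D' \<phi> b where *: "(D',\<phi>) \<in> A" "p \<in> D'"
        "\<And>p'. p' \<in> D' \<inter> O1 \<Longrightarrow> darboux_at A \<rho>1 i1 j1 \<gamma>1 p' (D',\<phi>) b" using d1[OF 1] by blast
      have "b \<noteq> 0" using *(3)[of p] *(2) 1 by (simp add: darboux_at_def)
      moreover have "d (D,\<psi>) p' = b * jacobian (D,\<psi>) (D',\<phi>) p'" if "(D,\<psi>) \<in> A" "p' \<in> D \<inter> D' \<inter> O1" for D \<psi> p'
        using darboux_density[OF *(3) that(1)] that(2) by (simp add: d_def)
      ultimately show ?thesis using *(1,2) O(1) 1
        by (intro exI[of _ D'] exI[of _ \<phi>] exI[of _ b] exI[of _ O1]) blast
    next
      case 2
      obtain D' \<phi> b where *: "(D',\<phi>) \<in> A" "p \<in> D'"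
        "\<And>p'. p' \<in> D' \<inter> O2 \<Longrightarrow> darboux_at A \<rho>2 i2 j2 \<gamma>2 p' (D',\<phi>) b" using d2[OF 2] by blast
      have "b \<noteq> 0" using *(3)[of p] *(2) 2 by (simp add: darboux_at_def)
      moreover have "d (D,\<psi>) p' = b * jacobian (D,\<psi>) (D',\<phi>) p'" if "(D,\<psi>) \<in> A" "p' \<in> D \<inter> D' \<inter> O2" for D \<psi> p'
        using darboux_density[OF *(3) that(1)] agree[OF that(1)] that(2) by simp
      ultimately show ?thesis using *(1,2) O(2) 2
        by (intro exI[of _ D'] exI[of _ \<phi>] exI[of _ b] exI[of _ O2]) blast
    qed
  qed
qed

lemma form_given_by_darboux:
  assumes d: "\<And>p. p \<in> j ` S \<Longrightarrow> \<exists>D' \<phi> b. darboux_at A \<rho> i k (inv_into S j) p (D',\<phi>) b"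
    and \<omega>: "\<And>D \<psi> p. (D,\<psi>) \<in> A \<Longrightarrow> p \<in> D \<Longrightarrow> p \<in> j ` S \<Longrightarrow> d (D,\<psi>) p = density \<rho> i k (inv_into S j) (D,\<psi>) p"
    and \<beta>: "\<And>q a b. \<beta> q a b = \<rho> q * wedge i k a b"
  shows "form_given_by A (\<lambda>c p v w. d c p * wedge 1 2 v w) j S \<beta>"
  unfolding form_given_by_def Let_def
proof (intro ballI, clarify)
  fix D \<psi> a v w assume c: "(D,\<psi>) \<in> A" "j a \<in> D" and a: "a \<in> S"
  let ?\<gamma> = "inv_into S j \<circ> inv_into D \<psi>"
  obtain D' \<phi> b where "darboux_at A \<rho> i k (inv_into S j) (j a) (D',\<phi>) b" using d a by blast
  from darboux_change[OF this c] obtain N where N: "open N" "\<psi> (j a) \<in> N" "hol_map N ?\<gamma>" by metis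
  note t = hol_map_derivative[OF N(3,1,2)]
  show "d (D,\<psi>) (j a) * wedge 1 2 v w = \<beta> (inv_into S j (j a)) (frechet_derivative ?\<gamma> (at (\<psi> (j a))) v)
      (frechet_derivative ?\<gamma> (at (\<psi> (j a))) w)"
    unfolding \<beta> wedge_minor[OF has_derivative_linear[OF t(1)] t(2)] using \<omega>[OF c] a
    by (simp add: density_def)
qed

end

subsection \<open>The symplectic forms on the surface and on the fibres\<close>

text \<open>A point of the surface may have two preimages. The local inverse is taken on the branch
  through the prescribed q, so that in this chart (u, w) are the coordinates near q.\<close>

lemma invariants_chart:
  "\<exists>D \<phi>. (D,\<phi>) \<in> M_charts z \<and> invariants z q \<in> D \<and> \<phi> (invariants z q) = q \<and>
     (\<forall>s\<in>\<phi> ` D. inv_into D \<phi> s = invariants z s)"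
proof -
  let ?f = "invariants z"
  obtain N where N: "openin (top_of_set UNIV) N" "q \<in> N" "inj_on ?f N" "openin (top_of_set (M z)) (?f ` N)"
    "hol_map N ?f" "hol_map (?f ` N) (inv_into N ?f)"
    using locally_biholomorphic_invariants[of z] unfolding locally_biholomorphic_def by blast
  let ?\<phi> = "inv_into N ?f"
  have im: "?\<phi> ` ?f ` N = N" using N(3) by simp
  have inj: "inj_on ?\<phi> (?f ` N)" by (rule inj_on_inv_into) simp
  have inv: "inv_into (?f ` N) ?\<phi> s = ?f s" if "s \<in> N" for s
    by (rule inv_into_f_eq[OF inj]) (use that N(3) in \<open>auto simp: inv_into_f_f\<close>)
  have "hol_map (?\<phi> ` ?f ` N) (inv_into (?f ` N) ?\<phi>)"
    unfolding im by (rule hol_map_cong[OF N(5)]) (simp add: inv)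
  then have "(?f ` N, ?\<phi>) \<in> M_charts z"
    unfolding M_charts_def submanifold_charts_def using N inj by (simp add: im)
  then show ?thesis using N(2,3) inv by (intro exI[of _ "?f ` N"] exI[of _ ?\<phi>]) (simp add: im inv_into_f_f)
qed

lemma painleve_coords_has_derivative:
  assumes "q $ 2 \<noteq> 0"
  shows "(painleve_coords z has_derivative (\<lambda>v. vector
    [v $ 1 * (q $ 2)^3 + v $ 2 * (3 * q $ 1 * (q $ 2)^2 + 6 / (q $ 2)^4 - z / 2 - q $ 2), - 2 * v $ 2 / (q $ 2)^3])) (at q)"
proof (rule has_derivative_vecI)
  fix i :: 2
  have 1: "((\<lambda>q. painleve_coords z q $ 1) has_derivative
    (\<lambda>v. v $ 1 * (q $ 2)^3 + v $ 2 * (3 * q $ 1 * (q $ 2)^2 + 6 / (q $ 2)^4 - z / 2 - q $ 2))) (at q)"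
    unfolding painleve_coords_nth using assms
    by (auto intro!: derivative_eq_intros ext simp: field_simps power_numeral_reduce power2_eq_square)
  have 2: "((\<lambda>q. painleve_coords z q $ 2) has_derivative (\<lambda>v. - 2 * v $ 2 / (q $ 2)^3)) (at q)"
    unfolding painleve_coords_nth using assms
    by (auto intro!: derivative_eq_intros ext simp: field_simps power_numeral_reduce power2_eq_square)
  show "((\<lambda>q. painleve_coords z q $ i) has_derivative (\<lambda>v. (vector
    [v $ 1 * (q $ 2)^3 + v $ 2 * (3 * q $ 1 * (q $ 2)^2 + 6 / (q $ 2)^4 - z / 2 - q $ 2), - 2 * v $ 2 / (q $ 2)^3] :: complex^2) $ i)) (at q)"
    using exhaust_2[of i] 1 2 by auto
qed

lemma minor_painleve_coords:
  assumes "q $ 2 \<noteq> 0"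
  shows "minor 1 2 (frechet_derivative (painleve_coords z) (at q)) = -2"
  unfolding frechet_derivative_at[OF painleve_coords_has_derivative[OF assms], symmetric]
  using assms by (simp add: minor_def wedge_def axis_def)

lemma hol_map_painleve_coords:
  assumes "S \<subseteq> {q. q $ 2 \<noteq> 0}" shows "hol_map S (painleve_coords z)"
proof -
  have o: "open {q :: complex^2. q $ 2 \<noteq> 0}" by (intro open_Collect_neq continuous_intros)
  have "hol_fun {q. q $ 2 \<noteq> 0} (\<lambda>q. painleve_coords z q $ i)" for i
    using exhaust_2[of i] unfolding hol_fun_open[OF o]
    by (elim disjE) (auto intro!: complex_diff_at_intros)
  then show ?thesis using assms hol_fun_subset unfolding hol_map_def by blast
qed

text \<open>As W = w^2, the weight -1/W^4 turns this minor into -2. The expression in (V, U) and the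
  form on the (x, y)-plane give the same constant, and this agreement identifies the three
  expressions.\<close>

lemma minor_invariants_VW:
  "minor 2 3 (frechet_derivative (invariants z) (at s)) = 2 * (s $ 2)^8"
  by (simp add: minor_def wedge_def invariants_derivative axis_def power_numeral_reduce)

lemma minor_invariants_VU:
  "minor 2 1 (frechet_derivative (invariants z) (at s)) = - 2 * denom z (invariants z s)"
  by (simp add: minor_def wedge_def invariants_derivative axis_def denom_def field_simps power_numeral_reduce power2_eq_square)

text \<open>The map k places the surface in the manifold at hand: the identity for
  \<open>M z\<close> itself, \<open>E_M z\<close> for the fibre. In this way the same computation
  with (u, w) serves both.\<close>

lemma darboux_at_invariants_chart:
  assumes c: "(D,\<phi>) \<in> A" and inv: "\<And>s. s \<in> \<phi> ` D \<Longrightarrow> inv_into D \<phi> s = k (invariants z s)"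
    and op: "open (\<phi> ` D)" and p: "p \<in> D"
    and N: "open N" "\<phi> p \<in> N" and g: "\<And>s. s \<in> N \<Longrightarrow> \<gamma> (k (invariants z s)) = g s"
    and hol: "hol_map N g"
    and m: "\<And>s. s \<in> N \<Longrightarrow> \<rho> (g s) * minor i j (frechet_derivative g (at s)) = -2"
  shows "darboux_at A \<rho> i j \<gamma> p (D,\<phi>) (-2)"
proof -
  let ?N = "\<phi> ` D \<inter> N"
  have oN: "open ?N" using op N(1) by blast
  have hN: "hol_map ?N g" by (rule hol_map_subset[OF hol]) blast
  have eq: "(\<gamma> \<circ> inv_into D \<phi>) s = g s" if "s \<in> ?N" for s using that inv g by simp
  have "hol_map ?N (\<gamma> \<circ> inv_into D \<phi>)" using hol_map_cong[OF hN] eq by metis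
  moreover have "density \<rho> i j \<gamma> (D,\<phi>) (inv_into D \<phi> s) = -2" if s: "s \<in> ?N" for s
  proof -
    have "\<phi> (inv_into D \<phi> s) = s" using s by (auto intro: f_inv_into_f)
    moreover have "frechet_derivative (\<gamma> \<circ> inv_into D \<phi>) (at s) = frechet_derivative g (at s)"
      by (rule frechet_derivative_eq_on[OF oN s eq hol_map_derivative(1)[OF hN oN s]])
    ultimately show ?thesis using m[of s] s eq[OF s] by (simp add: density_def)
  qed
  ultimately show ?thesis unfolding darboux_at_def fst_conv snd_conv using c p oN N(2)
    by (intro conjI exI[of _ ?N]) auto
qed

lemma invariants_mem_of_image:
  assumes "inj_on k (M z)" "S \<subseteq> M z" "k (invariants z s) = p" "p \<in> k ` S"
  shows "invariants z s \<in> S"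
  using inj_on_image_mem_iff[OF assms(1) invariants_in_M assms(2)] assms(3,4) by metis

lemma M_W_subset: "M_W z \<subseteq> M z" and M_UV_subset: "M_UV z \<subseteq> M z"
  by (auto simp: M_W_def M_UV_def)

lemma open_denom: "open {s. denom z (invariants z s) \<noteq> 0}"
  unfolding denom_def by (intro open_Collect_neq continuous_intros hol_map_continuous_on hol_map_invariants)

lemma darboux_at_VW:
  assumes "(D,\<phi>) \<in> A" "\<And>s. s \<in> \<phi> ` D \<Longrightarrow> inv_into D \<phi> s = k (invariants z s)" "open (\<phi> ` D)"
    and k: "inj_on k (M z)" and p: "p \<in> D" "inj_on \<phi> D" "p \<in> k ` M_W z"
  shows "darboux_at A (\<lambda>q. - 1 / (q $ 3)^4) 2 3 (inv_into (M_W z) k) p (D,\<phi>) (-2)"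
proof (rule darboux_at_invariants_chart[OF assms(1-3) p(1), where N = "{s. s $ 2 \<noteq> 0}" and g = "invariants z"])
  show "open {s :: complex^2. s $ 2 \<noteq> 0}" by (intro open_Collect_neq continuous_intros)
  have kW: "inj_on k (M_W z)" by (rule inj_on_subset[OF k]) (auto simp: M_W_def)
  have "inv_into D \<phi> (\<phi> p) = p" using p by (simp add: inv_into_f_f)
  then have "k (invariants z (\<phi> p)) = p" using assms(2) p(1) by simp
  then have "invariants z (\<phi> p) \<in> M_W z"
    by (rule invariants_mem_of_image[OF k M_W_subset _ p(3)])
  then show "\<phi> p \<in> {s. s $ 2 \<noteq> 0}" by (simp add: M_W_def)
  show "inv_into (M_W z) k (k (invariants z s)) = invariants z s" if "s \<in> {s. s $ 2 \<noteq> 0}" for s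
    using that by (intro inv_into_f_f[OF kW]) (simp add: M_W_def invariants_in_M)
qed (auto simp: hol_map_invariants minor_invariants_VW simp flip: power_mult)

lemma darboux_at_VU:
  assumes "(D,\<phi>) \<in> A" "\<And>s. s \<in> \<phi> ` D \<Longrightarrow> inv_into D \<phi> s = k (invariants z s)" "open (\<phi> ` D)"
    and k: "inj_on k (M z)" and p: "p \<in> D" "inj_on \<phi> D" "p \<in> k ` M_UV z"
  shows "darboux_at A (\<lambda>q. 1 / denom z q) 2 1 (inv_into (M_UV z) k) p (D,\<phi>) (-2)"
proof (rule darboux_at_invariants_chart[OF assms(1-3) p(1), where N = "{s. denom z (invariants z s) \<noteq> 0}" and g = "invariants z"])
  show "open {s. denom z (invariants z s) \<noteq> 0}" by (rule open_denom)
  have kW: "inj_on k (M_UV z)" by (rule inj_on_subset[OF k]) (auto simp: M_UV_def)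
  have "inv_into D \<phi> (\<phi> p) = p" using p by (simp add: inv_into_f_f)
  then have "k (invariants z (\<phi> p)) = p" using assms(2) p(1) by simp
  then have "invariants z (\<phi> p) \<in> M_UV z"
    by (rule invariants_mem_of_image[OF k M_UV_subset _ p(3)])
  then show "\<phi> p \<in> {s. denom z (invariants z s) \<noteq> 0}" by (simp add: M_UV_def)
  show "inv_into (M_UV z) k (k (invariants z s)) = invariants z s" if "s \<in> {s. denom z (invariants z s) \<noteq> 0}" for s
    using that by (intro inv_into_f_f[OF kW]) (simp add: M_UV_def invariants_in_M)
qed (auto simp: hol_map_invariants minor_invariants_VU)

lemma M_eq_M_W_Un_M_UV: "M z = M_W z \<union> M_UV z"
  by (auto simp: M_W_def M_UV_def denom_def)

lemma openin_M_pieces: "openin (top_of_set (M z)) (M_W z)" "openin (top_of_set (M z)) (M_UV z)"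
proof -
  have "open {q :: complex^3. q $ 3 \<noteq> 0}" "open {q. denom z q \<noteq> 0}"
    unfolding denom_def by (intro open_Collect_neq continuous_intros)+
  then show "openin (top_of_set (M z)) (M_W z)" "openin (top_of_set (M z)) (M_UV z)"
    unfolding M_W_def M_UV_def Collect_conj_eq Collect_mem_eq by (auto intro: openin_open_Int)
qed

lemma complex_atlas_M: "complex_atlas (top_of_set (M z)) (M_charts z)"
  using quotient_surface_M[of z] by (simp add: quotient_surface_def complex_manifold_def M_charts_def)

lemma complex_atlas_E: "complex_atlas (E_top z) (E_charts z)"
  using complex_manifold_E[of z] by (simp add: complex_manifold_def)

lemma form_VW_eq: "form_VW q a b = - 1 / (q $ 3)^4 * wedge 2 3 a b"
  by (simp add: form_VW_def)

lemma form_VU_eq: "form_VU z q a b = 1 / denom z q * wedge 2 1 a b"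
  by (simp add: form_VU_def)

definition M_form :: "complex \<Rightarrow> (complex^3, 2) two_form" where
  "M_form z c p v w = (if p \<in> M_W z then density (\<lambda>q. - 1 / (q $ 3)^4) 2 3 (inv_into (M_W z) id) c p
     else density (\<lambda>q. 1 / denom z q) 2 1 (inv_into (M_UV z) id) c p) * wedge 1 2 v w"

lemma M_form:
  shows "holomorphic_symplectic_form (M_charts z) (M_form z)"
    and "form_given_by (M_charts z) (M_form z) id (M_W z) form_VW"
    and "form_given_by (M_charts z) (M_form z) id (M_UV z) (form_VU z)"
proof -
  note A = complex_atlas_M[of z]
  have nice: "\<exists>D \<phi>. (D,\<phi>) \<in> M_charts z \<and> p \<in> D \<and>
    (\<forall>p'\<in>D \<inter> M_W z. darboux_at (M_charts z) (\<lambda>q. - 1 / (q $ 3)^4) 2 3 (inv_into (M_W z) id) p' (D,\<phi>) (-2)) \<and>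
    (\<forall>p'\<in>D \<inter> M_UV z. darboux_at (M_charts z) (\<lambda>q. 1 / denom z q) 2 1 (inv_into (M_UV z) id) p' (D,\<phi>) (-2))"
    if p: "p \<in> M z" for p
  proof -
    obtain q where q: "invariants z q = p" using invariants_surj[OF p] by blast
    obtain D \<phi> where c: "(D,\<phi>) \<in> M_charts z" "p \<in> D" "\<And>s. s \<in> \<phi> ` D \<Longrightarrow> inv_into D \<phi> s = id (invariants z s)"
      using invariants_chart[of z q] q by auto
    note d = complex_atlasD[OF A c(1)]
    have "darboux_at (M_charts z) (\<lambda>q. - 1 / (q $ 3)^4) 2 3 (inv_into (M_W z) id) p' (D,\<phi>) (-2)" if "p' \<in> D \<inter> M_W z" for p'
      by (rule darboux_at_VW[OF c(1,3) d(3) inj_on_id _ d(4)]) (use that in auto)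
    moreover have "darboux_at (M_charts z) (\<lambda>q. 1 / denom z q) 2 1 (inv_into (M_UV z) id) p' (D,\<phi>) (-2)" if "p' \<in> D \<inter> M_UV z" for p'
      by (rule darboux_at_VU[OF c(1,3) d(3) inj_on_id _ d(4)]) (use that in auto)
    ultimately show ?thesis using c(1,2) by (intro exI[of _ D] exI[of _ \<phi>] conjI ballI)
  qed
  note W = M_W_subset M_UV_subset
  have top: "topspace (top_of_set (M z)) \<subseteq> M_W z \<union> M_UV z" using M_eq_M_W_Un_M_UV by auto
  note two = symplectic_of_two_densities[OF A openin_M_pieces top,
      of "\<lambda>q. - 1 / (q $ 3)^4" 2 3 "inv_into (M_W z) id" "\<lambda>q. 1 / denom z q" 2 1 "inv_into (M_UV z) id"]
  have d: "\<exists>D \<phi> b. (D,\<phi>) \<in> M_charts z \<and> p \<in> D \<and> (\<forall>p'\<in>D \<inter> M_W z. darboux_at (M_charts z) (\<lambda>q. - 1 / (q $ 3)^4) 2 3 (inv_into (M_W z) id) p' (D,\<phi>) b)"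
    "\<exists>D \<phi> b. (D,\<phi>) \<in> M_charts z \<and> p \<in> D \<and> (\<forall>p'\<in>D \<inter> M_UV z. darboux_at (M_charts z) (\<lambda>q. 1 / denom z q) 2 1 (inv_into (M_UV z) id) p' (D,\<phi>) b)"
    if "p \<in> M z" for p
    using nice[OF that] by blast+
  have d12: "\<exists>D \<phi> b. darboux_at (M_charts z) (\<lambda>q. - 1 / (q $ 3)^4) 2 3 (inv_into (M_W z) id) p (D,\<phi>) b \<and>
      darboux_at (M_charts z) (\<lambda>q. 1 / denom z q) 2 1 (inv_into (M_UV z) id) p (D,\<phi>) b" if "p \<in> M_W z \<inter> M_UV z" for p
    using nice[of p] that W by blast
  have dW: "p \<in> M_W z \<Longrightarrow> p \<in> M z" and dUV: "p \<in> M_UV z \<Longrightarrow> p \<in> M z" for p using W by blast+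
  note two = two[OF d(1)[OF dW] d(2)[OF dUV] d12]
  show "holomorphic_symplectic_form (M_charts z) (M_form z)"
    using two(1) by (simp add: M_form_def[abs_def])
  show "form_given_by (M_charts z) (M_form z) id (M_W z) form_VW"
    unfolding M_form_def[abs_def]
  proof (rule form_given_by_darboux[OF A _ _ form_VW_eq])
    show "\<exists>D \<phi> b. darboux_at (M_charts z) (\<lambda>q. - 1 / (q $ 3)^4) 2 3 (inv_into (M_W z) id) p (D,\<phi>) b" if "p \<in> id ` M_W z" for p
    proof -
      have p: "p \<in> M_W z" using that by simp
      show ?thesis using nice[OF dW[OF p]] p by blast
    qed
  qed simp
  show "form_given_by (M_charts z) (M_form z) id (M_UV z) (form_VU z)"
    unfolding M_form_def[abs_def]
  proof (rule form_given_by_darboux[OF A _ _ form_VU_eq])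
    show "\<exists>D \<phi> b. darboux_at (M_charts z) (\<lambda>q. 1 / denom z q) 2 1 (inv_into (M_UV z) id) p (D,\<phi>) b" if "p \<in> id ` M_UV z" for p
    proof -
      have p: "p \<in> M_UV z" using that by simp
      show ?thesis using nice[OF dUV[OF p]] p by blast
    qed
  qed (use two(2) in simp)
qed

lemma symplectic_form_chart_change:
  assumes "holomorphic_symplectic_form A \<omega>" "(D,\<phi>) \<in> A" "(D',\<psi>) \<in> A" "p \<in> D" "p \<in> D'"
  shows "\<omega> (D,\<phi>) p v w = \<omega> (D',\<psi>) p (frechet_derivative (\<psi> \<circ> inv_into D \<phi>) (at (\<phi> p)) v)
      (frechet_derivative (\<psi> \<circ> inv_into D \<phi>) (at (\<phi> p)) w)"
proof -
  have 1: "\<forall>(D,\<phi>)\<in>A. \<forall>(D',\<psi>)\<in>A. \<forall>p\<in>D \<inter> D'. \<forall>v w.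
      (let \<tau>' = frechet_derivative (\<psi> \<circ> inv_into D \<phi>) (at (\<phi> p))
         in \<omega> (D,\<phi>) p v w = \<omega> (D',\<psi>) p (\<tau>' v) (\<tau>' w))"
    using assms(1) unfolding holomorphic_symplectic_form_def holomorphic_two_form_def by (elim conjE)
  note 2 = bspec[OF bspec[OF 1 assms(2), unfolded prod.case] assms(3), unfolded prod.case]
  show ?thesis using bspec[OF 2, of p] assms(4,5) by (simp add: Let_def)
qed

text \<open>In the chart inverse to \<open>invariants z\<close> near q the coefficient is -2 by the
  choice of the densities; every other chart follows from the transformation rule of the
  form.\<close>

lemma M_form_pullback:
  "pullback_equals (M_charts z) (M_form z) (invariants z) UNIV (\<lambda>_ a b. - 2 * wedge 1 2 a b)"
  unfolding pullback_equals_def Let_def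
proof (clarify)
  fix D \<psi> q v w assume c: "(D,\<psi>) \<in> M_charts z" "invariants z q \<in> D"
  note A = complex_atlas_M[of z]
  let ?p = "invariants z q"
  obtain D' \<phi> where c': "(D',\<phi>) \<in> M_charts z" "?p \<in> D'" "\<phi> ?p = q" "\<And>s. s \<in> \<phi> ` D' \<Longrightarrow> inv_into D' \<phi> s = id (invariants z s)"
    using invariants_chart[of z q] by auto
  note d' = complex_atlasD[OF A c'(1)]
  have one: "density \<rho> i j \<gamma> (D',\<phi>) ?p = -2" if "darboux_at (M_charts z) \<rho> i j \<gamma> ?p (D',\<phi>) (-2)" for \<rho> i j and \<gamma> :: "complex^3 \<Rightarrow> complex^3"
    using that d'(4) c'(2) unfolding darboux_at_def fst_conv snd_conv by (metis inv_into_f_f)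
  have "M_form z (D',\<phi>) ?p v w = - 2 * wedge 1 2 v w"
  proof (cases "?p \<in> M_W z")
    case True
    then show ?thesis unfolding M_form_def
      using one[OF darboux_at_VW[OF c'(1,4) d'(3) inj_on_id c'(2) d'(4)]] by simp
  next
    case False
    then have "?p \<in> M_UV z" using invariants_in_M[of z q] M_eq_M_W_Un_M_UV by blast
    then show ?thesis unfolding M_form_def
      using one[OF darboux_at_VU[OF c'(1,4) d'(3) inj_on_id c'(2) d'(4)]] False by simp
  qed
  moreover have "M_form z (D',\<phi>) ?p v w = M_form z (D,\<psi>) ?p
      (frechet_derivative (\<psi> \<circ> inv_into D' \<phi>) (at (\<phi> ?p)) v) (frechet_derivative (\<psi> \<circ> inv_into D' \<phi>) (at (\<phi> ?p)) w)"
    by (rule symplectic_form_chart_change[OF M_form(1) c'(1) c(1) c'(2) c(2)])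
  moreover have "frechet_derivative (\<psi> \<circ> invariants z) (at q) = frechet_derivative (\<psi> \<circ> inv_into D' \<phi>) (at q)"
  proof (rule frechet_derivative_eq_on)
    note t = complex_atlas_transition[OF A c'(1) c(1)]
    show "open (\<phi> ` (D' \<inter> D))" by (rule t(1))
    show q: "q \<in> \<phi> ` (D' \<inter> D)" using c' c by (metis IntI imageI)
    show "(\<psi> \<circ> inv_into D' \<phi> has_derivative frechet_derivative (\<psi> \<circ> inv_into D' \<phi>) (at q)) (at q)"
      by (rule hol_map_derivative(1)[OF t(2,1) q])
    show "(\<psi> \<circ> invariants z) y = (\<psi> \<circ> inv_into D' \<phi>) y" if "y \<in> \<phi> ` (D' \<inter> D)" for y
      using c'(4)[of y] that by auto
  qed
  ultimately show "- 2 * wedge 1 2 v w = M_form z (D,\<psi>) ?p (frechet_derivative (\<psi> \<circ> invariants z) (at q) v)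
      (frechet_derivative (\<psi> \<circ> invariants z) (at q) w)"
    using c'(3) by simp
qed

lemma inj_E_M: "inj_on (E_M z) (M z)"
  by (rule inj_onI) (simp add: E_M_eq_iff)

lemma E_xy_painleve_coords:
  assumes "q $ 2 \<noteq> 0" shows "E_xy z (painleve_coords z q) = E_M z (invariants z q)"
proof -
  have "painleve_coords z q = M_to_xy (invariants z q)"
    using assms by (simp add: vec2_eq_iff field_simps power_numeral_reduce power2_eq_square)
  then show ?thesis using E_xy_M_to_xy[OF invariants_in_M] assms by simp
qed

lemma E_invariants_chart:
  "\<exists>D \<phi>. (D,\<phi>) \<in> E_charts z \<and> E_M z (invariants z q) \<in> D \<and> \<phi> (E_M z (invariants z q)) = q \<and>
     (\<forall>s\<in>\<phi> ` D. inv_into D \<phi> s = E_M z (invariants z s))"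
proof -
  obtain D \<phi> where c: "(D,\<phi>) \<in> M_charts z" "invariants z q \<in> D" "\<phi> (invariants z q) = q"
    "\<And>s. s \<in> \<phi> ` D \<Longrightarrow> inv_into D \<phi> s = invariants z s" using invariants_chart[of z q] by blast
  have c': "(D,\<phi>) \<in> submanifold_charts (M z)" using c(1) by (simp add: M_charts_def)
  interpret G: gluing_data "E_M z" "M z" "E_xy z" UNIV "\<lambda>q. q $ 3" "\<lambda>p. p $ 2" M_to_xy "xy_to_M z"
    by (rule gluing_data.commute[OF gluing_data_E])
  let ?\<phi> = "\<phi> \<circ> inv_into (M z) (E_M z)"
  have im: "?\<phi> ` E_M z ` D = \<phi> ` D" by (rule G.chart_image[OF c' order_refl])
  have "(E_M z ` D, ?\<phi>) \<in> E_charts z" unfolding E_charts_def glued_charts_def using c' by blast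
  moreover have "?\<phi> (E_M z (invariants z q)) = q"
    using c(3) by (simp add: inv_into_f_f[OF inj_E_M invariants_in_M])
  moreover have "\<forall>s\<in>?\<phi> ` E_M z ` D. inv_into (E_M z ` D) ?\<phi> s = E_M z (invariants z s)"
    unfolding im by (simp add: G.inv_into_chart[OF c'] c(4))
  ultimately show ?thesis using c(2) by (intro exI[of _ "E_M z ` D"] exI[of _ ?\<phi>]) blast
qed

lemma darboux_at_xy:
  assumes "(D,\<phi>) \<in> E_charts z" "\<And>s. s \<in> \<phi> ` D \<Longrightarrow> inv_into D \<phi> s = E_M z (invariants z s)" "open (\<phi> ` D)"
    and p: "p \<in> D" "inj_on \<phi> D" "p \<in> E_M z ` M_W z"
  shows "darboux_at (E_charts z) (\<lambda>_. 1) 1 2 (inv_into UNIV (E_xy z)) p (D,\<phi>) (-2)"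
proof (rule darboux_at_invariants_chart[OF assms(1-3) p(1), where N = "{s. s $ 2 \<noteq> 0}" and g = "painleve_coords z"])
  show "open {s :: complex^2. s $ 2 \<noteq> 0}" by (intro open_Collect_neq continuous_intros)
  have "inv_into D \<phi> (\<phi> p) = p" using p by (simp add: inv_into_f_f)
  then have "E_M z (invariants z (\<phi> p)) = p" using assms(2) p(1) by simp
  then have "invariants z (\<phi> p) \<in> M_W z"
    by (rule invariants_mem_of_image[OF inj_E_M M_W_subset _ p(3)])
  then show "\<phi> p \<in> {s. s $ 2 \<noteq> 0}" by (simp add: M_W_def)
  show "inv_into UNIV (E_xy z) (E_M z (invariants z s)) = painleve_coords z s" if "s \<in> {s. s $ 2 \<noteq> 0}" for s
    using that E_xy_painleve_coords[of s z, symmetric] by (simp add: inv_into_f_f inj_on_def)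
qed (auto simp: hol_map_painleve_coords minor_painleve_coords)

lemma E_xy_chart: "(range (E_xy z), inv_into UNIV (E_xy z)) \<in> E_charts z"
proof -
  have "(E_xy z ` UNIV, (\<lambda>p. p) \<circ> inv_into UNIV (E_xy z)) \<in> E_charts z"
    unfolding E_charts_def glued_charts_def using UNIV_chart by blast
  then show ?thesis by (simp add: comp_def)
qed

lemma darboux_at_xy_chart:
  "darboux_at (E_charts z) (\<lambda>_. 1) 1 2 (inv_into UNIV (E_xy z)) (E_xy z p) (range (E_xy z), inv_into UNIV (E_xy z)) 1"
proof -
  let ?j = "E_xy z" and ?\<gamma> = "inv_into UNIV (E_xy z)"
  have j: "?\<gamma> (?j p) = p" for p by (simp add: inv_into_f_f inj_on_def)
  have inv: "inv_into (range ?j) ?\<gamma> s = ?j s" for s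
    by (rule inv_into_f_eq) (auto simp: j inj_on_def)
  have id: "?\<gamma> \<circ> inv_into (range ?j) ?\<gamma> = (\<lambda>s. s)" by (simp add: fun_eq_iff inv j)
  have im: "?\<gamma> ` range ?j = UNIV" by (auto simp: image_image j)
  have "minor 1 2 (frechet_derivative (\<lambda>s :: complex^2. s) (at s)) = 1" for s
    unfolding frechet_derivative_at[OF has_derivative_ident, symmetric] by (rule minor_id)
  then show ?thesis unfolding darboux_at_def fst_conv snd_conv id im density_def
    using E_xy_chart hol_map_id by (intro conjI exI[of _ UNIV]) auto
qed

text \<open>The image of the (x, y)-plane contains the part \<open>W \<noteq> 0\<close> of the
  surface. On the fibre the second branch is therefore reached only on \<open>W = 0\<close>, where
  \<open>denom\<close> equals 4.\<close>

definition E_form :: "complex \<Rightarrow> (E_point, 2) two_form" where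
  "E_form z c p v w = (if p \<in> range (E_xy z) then density (\<lambda>_. 1) 1 2 (inv_into UNIV (E_xy z)) c p
     else density (\<lambda>q. 1 / denom z q) 2 1 (inv_into (M_UV z) (E_M z)) c p) * wedge 1 2 v w"

lemma E_form:
  shows "holomorphic_symplectic_form (E_charts z) (E_form z)"
    and "form_given_by (E_charts z) (E_form z) (E_M z) (M_W z) form_VW"
    and "form_given_by (E_charts z) (E_form z) (E_M z) (M_UV z) (form_VU z)"
    and "form_given_by (E_charts z) (E_form z) (E_xy z) UNIV (\<lambda>_. wedge 1 2)"
proof -
  note A = complex_atlas_E[of z]
  let ?dxy = "darboux_at (E_charts z) (\<lambda>_. 1) 1 2 (inv_into UNIV (E_xy z))"
  let ?dW = "darboux_at (E_charts z) (\<lambda>q. - 1 / (q $ 3)^4) 2 3 (inv_into (M_W z) (E_M z))"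
  let ?dUV = "darboux_at (E_charts z) (\<lambda>q. 1 / denom z q) 2 1 (inv_into (M_UV z) (E_M z))"
  have nice: "\<exists>D \<phi>. (D,\<phi>) \<in> E_charts z \<and> p \<in> D \<and> (\<forall>p'\<in>D \<inter> E_M z ` M_W z. ?dxy p' (D,\<phi>) (-2) \<and> ?dW p' (D,\<phi>) (-2)) \<and>
    (\<forall>p'\<in>D \<inter> E_M z ` M_UV z. ?dUV p' (D,\<phi>) (-2))"
    if p: "p \<in> E_M z ` M z" for p
  proof -
    obtain q where q: "E_M z (invariants z q) = p" using p invariants_surj by blast
    obtain D \<phi> where c: "(D,\<phi>) \<in> E_charts z" "p \<in> D" "\<And>s. s \<in> \<phi> ` D \<Longrightarrow> inv_into D \<phi> s = E_M z (invariants z s)"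
      using E_invariants_chart[of z q] q by auto
    note d = complex_atlasD[OF A c(1)]
    have "?dW p' (D,\<phi>) (-2)" "?dxy p' (D,\<phi>) (-2)" if "p' \<in> D \<inter> E_M z ` M_W z" for p'
      by (rule darboux_at_VW[OF c(1,3) d(3) inj_E_M _ d(4)] darboux_at_xy[OF c(1,3) d(3) _ d(4)]; use that in blast)+
    moreover have "?dUV p' (D,\<phi>) (-2)" if "p' \<in> D \<inter> E_M z ` M_UV z" for p'
      by (rule darboux_at_VU[OF c(1,3) d(3) inj_E_M _ d(4)]; use that in blast)
    ultimately show ?thesis using c(1,2) by (intro exI[of _ D] exI[of _ \<phi>] conjI ballI)
  qed
  note W = M_W_subset M_UV_subset
  have WU: "p \<in> E_M z ` M_W z \<Longrightarrow> p \<in> E_M z ` M z" "p \<in> E_M z ` M_UV z \<Longrightarrow> p \<in> E_M z ` M z" for p using W by blast+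
  interpret G: gluing_data "E_xy z" UNIV "E_M z" "M z" "\<lambda>p. p $ 2" "\<lambda>q. q $ 3" "xy_to_M z" M_to_xy
    by (rule gluing_data_E)
  have O: "openin (E_top z) (range (E_xy z))" "openin (E_top z) (E_M z ` M_UV z)"
    unfolding E_top_def by (auto intro: G.openin_image_j G.openin_image_k openin_M_pieces)
  have W_xy: "p \<in> range (E_xy z)" if "p \<in> E_M z ` M_W z" for p
    using that E_xy_M_to_xy unfolding M_W_def by blast
  have xy_W: "p \<in> E_M z ` M_W z" if "p \<in> E_M z ` M z" "p \<in> range (E_xy z)" for p
  proof -
    obtain a q where "p = E_xy z a" "q \<in> M z" "p = E_M z q" using \<open>p \<in> E_M z ` M z\<close> \<open>p \<in> range (E_xy z)\<close> by blast
    moreover then have "(a, q) \<in> gluing z" using E_xy_eq_E_M_iff by metis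
    ultimately show ?thesis using gluingD(2) unfolding M_W_def by blast
  qed
  have "E_set z \<subseteq> range (E_xy z) \<union> E_M z ` M_UV z"
    unfolding E_set_eq M_eq_M_W_Un_M_UV[of z] using W_xy by blast
  then have top: "topspace (E_top z) \<subseteq> range (E_xy z) \<union> E_M z ` M_UV z" by (simp add: topspace_E_top)
  note two = symplectic_of_two_densities[OF A O top,
      of "\<lambda>_. 1" 1 2 "inv_into UNIV (E_xy z)" "\<lambda>q. 1 / denom z q" 2 1 "inv_into (M_UV z) (E_M z)"]
  have d1: "\<exists>D \<phi> b. (D,\<phi>) \<in> E_charts z \<and> p \<in> D \<and> (\<forall>p'\<in>D \<inter> range (E_xy z). ?dxy p' (D,\<phi>) b)" if "p \<in> range (E_xy z)" for p
    using E_xy_chart darboux_at_xy_chart that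
    by (intro exI[of _ "range (E_xy z)"] exI[of _ "inv_into UNIV (E_xy z)"] exI[of _ 1]) auto
  have d2: "\<exists>D \<phi> b. (D,\<phi>) \<in> E_charts z \<and> p \<in> D \<and> (\<forall>p'\<in>D \<inter> E_M z ` M_UV z. ?dUV p' (D,\<phi>) b)" if "p \<in> E_M z ` M_UV z" for p
    using nice[OF WU(2)[OF that]] by blast
  have d12: "\<exists>D \<phi> b. ?dxy p (D,\<phi>) b \<and> ?dUV p (D,\<phi>) b" if p: "p \<in> range (E_xy z) \<inter> E_M z ` M_UV z" for p
  proof -
    have "p \<in> E_M z ` M z" "p \<in> E_M z ` M_W z" using p WU(2) xy_W by blast+
    then show ?thesis using nice[of p] p by blast
  qed
  note two = two[OF d1 d2 d12]
  show "holomorphic_symplectic_form (E_charts z) (E_form z)"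
    using two(1) by (simp add: E_form_def[abs_def])
  show "form_given_by (E_charts z) (E_form z) (E_M z) (M_W z) form_VW"
    unfolding E_form_def[abs_def]
  proof (rule form_given_by_darboux[OF A _ _ form_VW_eq])
    show "\<exists>D \<phi> b. ?dW p (D,\<phi>) b" if "p \<in> E_M z ` M_W z" for p
      using nice[OF WU(1)[OF that]] that by blast
    fix D \<psi> p assume c: "(D,\<psi>) \<in> E_charts z" "p \<in> D" and p: "p \<in> E_M z ` M_W z"
    obtain D' \<phi> where "?dxy p (D',\<phi>) (-2)" "?dW p (D',\<phi>) (-2)" using nice[OF WU(1)[OF p]] p by blast
    from darboux_agree[OF A this c] W_xy[OF p]
    show "(if p \<in> range (E_xy z) then density (\<lambda>_. 1) 1 2 (inv_into UNIV (E_xy z)) (D,\<psi>) p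
       else density (\<lambda>q. 1 / denom z q) 2 1 (inv_into (M_UV z) (E_M z)) (D,\<psi>) p) =
       density (\<lambda>q. - 1 / (q $ 3)^4) 2 3 (inv_into (M_W z) (E_M z)) (D,\<psi>) p" by simp
  qed
  show "form_given_by (E_charts z) (E_form z) (E_M z) (M_UV z) (form_VU z)"
    unfolding E_form_def[abs_def]
  proof (rule form_given_by_darboux[OF A _ _ form_VU_eq])
    show "\<exists>D \<phi> b. ?dUV p (D,\<phi>) b" if "p \<in> E_M z ` M_UV z" for p
      using nice[OF WU(2)[OF that]] that by blast
  qed (rule two(2))
  show "form_given_by (E_charts z) (E_form z) (E_xy z) UNIV (\<lambda>_. wedge 1 2)"
    unfolding E_form_def[abs_def]
  proof (rule form_given_by_darboux[OF A, where \<rho> = "\<lambda>_. 1"])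
    show "\<exists>D \<phi> b. ?dxy p (D,\<phi>) b" if "p \<in> range (E_xy z)" for p
      using darboux_at_xy_chart that by blast
  qed simp_all
qed

subsection \<open>Painleve's system in both coordinate systems\<close>

definition PI_hamiltonian :: "complex^3 \<Rightarrow> complex" where
  "PI_hamiltonian r = 2 * (r $ 2)^3 + r $ 3 * r $ 2 - (r $ 1)^2 / 2"

lemma hamiltonian_PI_system: "hamiltonian_system PI_system (wedge 1 2)"
  unfolding hamiltonian_system_def
proof (intro exI[of _ PI_hamiltonian] conjI allI)
  show "hol_fun UNIV PI_hamiltonian"
    unfolding PI_hamiltonian_def[abs_def] by (intro hol_fun_UNIV complex_diff_at_intros) simp
  fix z and p v :: "complex^2"
  have "((\<lambda>p. PI_hamiltonian (vector [p $ 1, p $ 2, z])) has_derivative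
    (\<lambda>v. (6 * (p $ 2)^2 + z) * v $ 2 - p $ 1 * v $ 1)) (at p)"
    unfolding PI_hamiltonian_def vector_3
    by (auto intro!: derivative_eq_intros ext simp: field_simps power2_eq_square)
  from frechet_derivative_at[OF this, symmetric]
  show "wedge 1 2 (PI_system z p) v = frechet_derivative (\<lambda>p. PI_hamiltonian (vector [p $ 1, p $ 2, z])) (at p) v"
    by (simp add: PI_system_def wedge_def)
qed

text \<open>Found by solving the transformation rule in
  \<open>expressed_as_painleve_coords_iff\<close> for the velocities of u and w; all negative powers
  of w cancel.\<close>

definition painleve_system :: plane_system where
  "painleve_system z q = (let u = q $ 1; w = q $ 2 in vector
     [z^2 * w / 8 + 3 * z * w^2 / 8 + w^3 / 4 - z * u * w^3 - 5 / 4 * u * w^4 + 3 / 2 * u^2 * w^5,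
      1 + z * w^4 / 4 + w^5 / 4 - u * w^6 / 2])"

lemma painleve_system_nth [simp]:
  "painleve_system z q $ 1 = z^2 * q $ 2 / 8 + 3 * z * (q $ 2)^2 / 8 + (q $ 2)^3 / 4 - z * q $ 1 * (q $ 2)^3
     - 5 / 4 * q $ 1 * (q $ 2)^4 + 3 / 2 * (q $ 1)^2 * (q $ 2)^5"
  "painleve_system z q $ 2 = 1 + z * (q $ 2)^4 / 4 + (q $ 2)^5 / 4 - q $ 1 * (q $ 2)^6 / 2"
  by (simp_all add: painleve_system_def Let_def)

text \<open>This is \<open>PI_hamiltonian\<close> in the coordinates (u, w) plus 1/w. The extra term
  comes from the explicit z-dependence of x, which contributes -(w/2) dy = d(-1/w), and it removes
  the pole.\<close>

definition painleve_hamiltonian :: "complex^3 \<Rightarrow> complex" where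
  "painleve_hamiltonian r = 2 * r $ 1 + r $ 1 * r $ 3 * (r $ 2)^4 / 2 + r $ 1 * (r $ 2)^5 / 2
     - (r $ 1)^2 * (r $ 2)^6 / 2 - (r $ 3)^2 * (r $ 2)^2 / 8 - r $ 3 * (r $ 2)^3 / 4 - (r $ 2)^4 / 8"

lemma hamiltonian_painleve_system: "hamiltonian_system painleve_system (\<lambda>a b. - 2 * wedge 1 2 a b)"
  unfolding hamiltonian_system_def
proof (intro exI[of _ painleve_hamiltonian] conjI allI)
  show "hol_fun UNIV painleve_hamiltonian"
    unfolding painleve_hamiltonian_def[abs_def] by (intro hol_fun_UNIV complex_diff_at_intros) simp_all
  fix z and p v :: "complex^2"
  have "((\<lambda>p. painleve_hamiltonian (vector [p $ 1, p $ 2, z])) has_derivative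
    (\<lambda>v. - 2 * (painleve_system z p $ 1 * v $ 2 - painleve_system z p $ 2 * v $ 1))) (at p)"
    unfolding painleve_hamiltonian_def vector_3 painleve_system_nth
    by (auto intro!: derivative_eq_intros ext simp: field_simps power_numeral_reduce power2_eq_square)
  from frechet_derivative_at[OF this, symmetric]
  show "- 2 * wedge 1 2 (painleve_system z p) v =
      frechet_derivative (\<lambda>p. painleve_hamiltonian (vector [p $ 1, p $ 2, z])) (at p) v"
    by (simp add: wedge_def)
qed

lemma painleve_coords_along:
  fixes z :: complex and q Y :: "complex^2"
  assumes "q $ 2 \<noteq> 0"
  shows "((\<lambda>t. painleve_coords (z + t) (q + t *s Y) $ 1) has_field_derivative
      (q $ 2)^3 * Y $ 1 + (3 * q $ 1 * (q $ 2)^2 + 6 / (q $ 2)^4 - z / 2 - q $ 2) * Y $ 2 - q $ 2 / 2) (at 0)"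
    and "((\<lambda>t. painleve_coords (z + t) (q + t *s Y) $ 2) has_field_derivative - 2 / (q $ 2)^3 * Y $ 2) (at 0)"
  unfolding painleve_coords_nth vector_add_component vector_smult_component using assms
  by (auto intro!: derivative_eq_intros simp: field_simps power_numeral_reduce power2_eq_square)

text \<open>The summand -w/2 is the explicit z-derivative of x. It is the only inhomogeneous term,
  so it cancels when two systems are subtracted.\<close>

lemma expressed_as_painleve_coords_iff:
  "expressed_as painleve_coords {q. q $ 2 \<noteq> 0} \<Omega> X Y \<longleftrightarrow>
     (\<forall>z\<in>\<Omega>. \<forall>q. q $ 2 \<noteq> 0 \<longrightarrow>
        X z (painleve_coords z q) $ 1 = (q $ 2)^3 * Y z q $ 1 +
          (3 * q $ 1 * (q $ 2)^2 + 6 / (q $ 2)^4 - z / 2 - q $ 2) * Y z q $ 2 - q $ 2 / 2 \<and>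
        X z (painleve_coords z q) $ 2 = - 2 / (q $ 2)^3 * Y z q $ 2)"
  (is "?L \<longleftrightarrow> ?R")
proof
  assume L: ?L
  show ?R
  proof (intro ballI allI impI)
    fix z and q :: "complex^2" assume z: "z \<in> \<Omega>" and q: "q $ 2 \<noteq> 0"
    have "((\<lambda>t. painleve_coords (z + t) (q + t *s Y z q) $ i) has_field_derivative X z (painleve_coords z q) $ i) (at 0)" for i
      using L z q unfolding expressed_as_def by blast
    from DERIV_unique[OF this painleve_coords_along(1)[OF q]] DERIV_unique[OF this painleve_coords_along(2)[OF q]]
    show "X z (painleve_coords z q) $ 1 = (q $ 2)^3 * Y z q $ 1 +
          (3 * q $ 1 * (q $ 2)^2 + 6 / (q $ 2)^4 - z / 2 - q $ 2) * Y z q $ 2 - q $ 2 / 2 \<and>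
        X z (painleve_coords z q) $ 2 = - 2 / (q $ 2)^3 * Y z q $ 2" ..
  qed
next
  assume R: ?R
  show ?L
    unfolding expressed_as_def
  proof (intro ballI allI)
    fix z q and i :: 2 assume *: "z \<in> \<Omega>" "q \<in> {q :: complex^2. q $ 2 \<noteq> 0}"
    then have q: "q $ 2 \<noteq> 0" by simp
    note r = R[rule_format, OF *(1) q]
    show "((\<lambda>t. painleve_coords (z + t) (q + t *s Y z q) $ i) has_field_derivative X z (painleve_coords z q) $ i) (at 0)"
      using exhaust_2[of i] painleve_coords_along[OF q, of z "Y z q"] unfolding r[THEN conjunct1, symmetric] r[THEN conjunct2, symmetric]
      by auto
  qed
qed

lemma expressed_as_painleve_system:
  "expressed_as painleve_coords {q. q $ 2 \<noteq> 0} \<Omega> PI_system painleve_system"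
proof -
  have "w \<noteq> 0 \<Longrightarrow> 6 * (1 / w^2)^2 + z = w^3 * (z^2 * w / 8 + 3 * z * w^2 / 8 + w^3 / 4 - z * u * w^3 - 5 / 4 * u * w^4 + 3 / 2 * u^2 * w^5) +
      (3 * u * w^2 + 6 / w^4 - z / 2 - w) * (1 + z * w^4 / 4 + w^5 / 4 - u * w^6 / 2) - w / 2" for u w z :: complex
    by (simp add: field_simps power_numeral_reduce power2_eq_square)
  moreover have "w \<noteq> 0 \<Longrightarrow> u * w^3 - 2 / w^3 - z * w / 2 - w^2 / 2 = - 2 / w^3 * (1 + z * w^4 / 4 + w^5 / 4 - u * w^6 / 2)" for u w z :: complex
    by (simp add: field_simps power_numeral_reduce power2_eq_square)
  ultimately show ?thesis
    unfolding expressed_as_painleve_coords_iff PI_system_nth painleve_system_nth painleve_coords_nth by blast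
qed

lemma regular_system_is_PI:
  assumes e: "expressed_as painleve_coords {q. q $ 2 \<noteq> 0} \<Omega> (poly_system f g) (poly_system F G)" and z: "z \<in> \<Omega>"
  shows "eval2 (f z) x y = 6 * y^2 + z \<and> eval2 (g z) x y = x"
proof -
  \<comment> \<open>The first Painleve equation itself at the fixed z, in (x, y) and in (u, w). In
    the lists the outer position is the power of x or u, the inner one that of y or w.\<close>
  define f0 g0 F0 G0 :: "complex poly poly"
    where "f0 = [:[:z, 0, 6:]:]" and "g0 = [:0, 1:]"
      and "F0 = [:[:0, z^2 / 8, 3 * z / 8, 1 / 4:], [:0, 0, 0, - z, - 5 / 4:], [:0, 0, 0, 0, 0, 3 / 2:]:]"
      and "G0 = [:[:1, 0, 0, 0, z / 4, 1 / 4:], [:0, 0, 0, 0, 0, 0, - 1 / 2:]:]"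
  have f0: "eval2 f0 x y = 6 * y^2 + z" and g0: "eval2 g0 x y = x" for x y
    by (simp_all add: f0_def g0_def power2_eq_square algebra_simps)
  have F0: "eval2 F0 u w = painleve_system z (vector [u, w]) $ 1" and G0: "eval2 G0 u w = painleve_system z (vector [u, w]) $ 2" for u w
    by (simp_all add: F0_def G0_def field_simps power_numeral_reduce power2_eq_square)
  have p: "painleve_coords z (vector [u, w]) $ 2 = 1 / w^2" for u w by simp
  note E = e[unfolded expressed_as_painleve_coords_iff, rule_format, OF z]
    expressed_as_painleve_system[of UNIV, unfolded expressed_as_painleve_coords_iff, rule_format, OF UNIV_I]
  have "eval2 (f z - f0) x y = 0 \<and> eval2 (g z - g0) x y = 0"
  proof (rule regular_vector_field_zero)
    fix u w :: complex assume w: "w \<noteq> 0"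
    have q: "(vector [u, w] :: complex^2) $ 2 \<noteq> 0" using w by simp
    have 1: "eval2 (f z) (xw z u w) (1 / w^2) = w^3 * eval2 (F z) u w + (3 * u * w^2 + 6 / w^4 - z / 2 - w) * eval2 (G z) u w - w / 2"
      "eval2 (g z) (xw z u w) (1 / w^2) = - 2 / w^3 * eval2 (G z) u w"
      using E(1)[OF q] unfolding poly_system_def vector_2 p by blast+
    have 2: "eval2 f0 (xw z u w) (1 / w^2) = w^3 * eval2 F0 u w + (3 * u * w^2 + 6 / w^4 - z / 2 - w) * eval2 G0 u w - w / 2"
      "eval2 g0 (xw z u w) (1 / w^2) = - 2 / w^3 * eval2 G0 u w"
      using E(2)[OF q, of z] unfolding f0 g0 F0 G0 PI_system_nth vector_2 p by blast+
    show "eval2 (g z - g0) (xw z u w) (1 / w^2) = - 2 / w^3 * eval2 (G z - G0) u w"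
      unfolding eval2_diff 1 2 by (simp add: right_diff_distrib)
    show "eval2 (f z - f0) (xw z u w) (1 / w^2) =
        w^3 * eval2 (F z - F0) u w + (3 * u * w^2 + 6 / w^4 - z / 2 - w) * eval2 (G z - G0) u w"
      unfolding eval2_diff 1 2 by (simp add: right_diff_distrib)
  qed
  then show ?thesis by (simp add: f0 g0)
qed

subsection \<open>The weighted projective space\<close>

lemma wps_rel_iff: "(p, q) \<in> wps_rel \<longleftrightarrow> p \<noteq> 0 \<and>
    (\<exists>c. c \<noteq> 0 \<and> q $ 1 = c^3 * p $ 1 \<and> q $ 2 = c^2 * p $ 2 \<and> q $ 3 = c^4 * p $ 3 \<and> q $ 4 = c^5 * p $ 4)"
  by (simp add: wps_rel_def vec4_eq_iff)

lemma equiv_wps_rel: "equiv (UNIV - {0}) wps_rel"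
proof (rule equivI)
  have nz: "q \<noteq> 0" if "(p, q) \<in> wps_rel" for p q
    using that by (auto simp: wps_rel_iff vec4_eq_iff)
  show "wps_rel \<subseteq> (UNIV - {0}) \<times> (UNIV - {0})"
  proof (rule subrelI)
    fix p q assume pq: "(p, q) \<in> wps_rel"
    then show "(p, q) \<in> (UNIV - {0}) \<times> (UNIV - {0})" using nz[OF pq] by (simp add: wps_rel_iff)
  qed
  show "refl_on (UNIV - {0}) wps_rel"
    by (rule refl_onI) (auto simp: wps_rel_iff intro!: exI[of _ 1])
  show "sym wps_rel"
  proof (rule symI)
    fix p q assume pq: "(p, q) \<in> wps_rel"
    then obtain c where c: "c \<noteq> 0" "q $ 1 = c^3 * p $ 1" "q $ 2 = c^2 * p $ 2" "q $ 3 = c^4 * p $ 3" "q $ 4 = c^5 * p $ 4"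
      unfolding wps_rel_iff by blast
    then show "(q, p) \<in> wps_rel" using nz[OF pq] unfolding wps_rel_iff
      by (intro conjI exI[of _ "1 / c"]) (simp_all add: power_divide)
  qed
  show "trans wps_rel"
  proof (rule transI)
    fix p q r assume pq: "(p, q) \<in> wps_rel" and qr: "(q, r) \<in> wps_rel"
    obtain c where c: "c \<noteq> 0" "q $ 1 = c^3 * p $ 1" "q $ 2 = c^2 * p $ 2" "q $ 3 = c^4 * p $ 3" "q $ 4 = c^5 * p $ 4"
      using pq unfolding wps_rel_iff by blast
    obtain d where d: "d \<noteq> 0" "r $ 1 = d^3 * q $ 1" "r $ 2 = d^2 * q $ 2" "r $ 3 = d^4 * q $ 3" "r $ 4 = d^5 * q $ 4"
      using qr unfolding wps_rel_iff by blast
    show "(p, r) \<in> wps_rel" using pq c(1) d(1) unfolding wps_rel_iff d(2-) c(2-)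
      by (intro conjI exI[of _ "d * c"]) (auto simp: power_mult_distrib)
  qed
qed

lemma wps_class_eq_iff:
  assumes "p \<noteq> 0" "q \<noteq> 0" shows "wps_rel `` {p} = wps_rel `` {q} \<longleftrightarrow> (p, q) \<in> wps_rel"
  using eq_equiv_class_iff[OF equiv_wps_rel] assms by simp

text \<open>Keeping the second coordinate equal to 1 forces c^2 = 1, and c = -1 acts on the other
  coordinates by the parities of the weights 3, 4 and 5.\<close>

lemma wps_chart2_eq_iff: "wps_chart2 r = wps_chart2 r' \<longleftrightarrow> r' = r \<or> r' = orbifold_act r"
proof -
  have nz: "vector [a, 1, b, c] \<noteq> (0 :: complex^4)" for a b c by (simp add: vec4_eq_iff)
  have "wps_chart2 r = wps_chart2 r' \<longleftrightarrow> (\<exists>c. c \<noteq> 0 \<and> r' $ 1 = c^3 * r $ 1 \<and> 1 = c^2 \<and> r' $ 2 = c^4 * r $ 2 \<and> r' $ 3 = c^5 * r $ 3)"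
    unfolding wps_chart2_def wps_class_eq_iff[OF nz nz] by (simp add: wps_rel_iff nz)
  also have "\<dots> \<longleftrightarrow> (\<exists>c \<in> {1, -1}. r' $ 1 = c^3 * r $ 1 \<and> r' $ 2 = c^4 * r $ 2 \<and> r' $ 3 = c^5 * r $ 3)"
  proof -
    have "c \<in> {1, -1} \<longleftrightarrow> c \<noteq> 0 \<and> 1 = c^2" for c :: complex
      using power2_eq_1_iff[of c] by auto
    then show ?thesis by blast
  qed
  also have "\<dots> \<longleftrightarrow> r' = r \<or> r' = orbifold_act r"
    by (auto simp: vec3_eq_iff orbifold_act_def)
  finally show ?thesis .
qed

lemma induced_from_orbifold: induced_from_orbifold
  unfolding induced_from_orbifold_def
proof (intro conjI allI impI)
  have nz: "vector [a, 1, b, c] \<noteq> (0 :: complex^4)" for a b c by (simp add: vec4_eq_iff)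
  then show "range wps_chart2 \<subseteq> wps"
    unfolding wps_def wps_chart2_def by (auto intro: quotientI)
  show "wps_chart2 r = wps_chart2 r' \<longleftrightarrow> r' = r \<or> r' = orbifold_act r" for r r'
    by (rule wps_chart2_eq_iff)
  fix z and q :: "complex^2" assume q: "q $ 2 \<noteq> 0"
  have nz': "vector [a, b, c, 1] \<noteq> (0 :: complex^4)" for a b c by (simp add: vec4_eq_iff)
  \<comment> \<open>The scaling by c = w brings y = w^-2, of weight 2, to the value 1.\<close>
  have "(vector [painleve_coords z q $ 1, painleve_coords z q $ 2, z, 1],
      vector [blow_up z q $ 1, 1, blow_up z q $ 2, blow_up z q $ 3]) \<in> wps_rel"
    unfolding wps_rel_iff using q
    by (intro conjI nz' exI[of _ "q $ 2"])
      (simp_all add: blow_up_def Let_def field_simps power_numeral_reduce power2_eq_square)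
  then show "wps_chart2 (blow_up z q) = wps_affine z (painleve_coords z q)"
    unfolding wps_chart2_def wps_affine_def using wps_class_eq_iff[OF nz' nz] by metis
  show "blow_up z (Z2_act z q) = orbifold_act (blow_up z q)"
    using q by (simp add: blow_up_def orbifold_act_def Let_def field_simps power_numeral_reduce power2_eq_square)
qed

theorem theorem4p1:
  shows
    "(\<forall>z q. q $ 2 \<noteq> 0 \<longrightarrow> Z2_act z (Z2_act z q) = q \<and>
        painleve_coords z (Z2_act z q) = painleve_coords z q) \<and>
     (\<forall>z q q'. q $ 2 \<noteq> 0 \<and> q' $ 2 \<noteq> 0 \<longrightarrow>
        (painleve_coords z q = painleve_coords z q' \<longleftrightarrow> (q,q') \<in> Z2_rel z)) \<and>
     induced_from_orbifold \<and>
     (\<forall>z. quotient_surface (Z2_rel z) (invariants z) (M z)) \<and>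
     (\<forall>z. gluing z = gluing_inverse z \<and> equiv (UNIV <+> M z) (E_rel z) \<and>
        (\<forall>p. p $ 2 \<noteq> 0 \<longrightarrow> (\<exists>!q. (p,q) \<in> gluing z)) \<and>
        (\<forall>q\<in>M z. q $ 3 \<noteq> 0 \<longrightarrow> (\<exists>!p. (p,q) \<in> gluing z)) \<and>
        (\<forall>q. q $ 2 \<noteq> 0 \<longrightarrow> E_xy z (painleve_coords z q) = E_M z (invariants z q)) \<and>
        topspace (E_top z) = E_set z) \<and>
     space_of_initial_conditions PI_system E_top E_charts P_top P_charts E_xy \<and>
     (\<exists>\<omega>M \<omega>E.
        (\<forall>z. holomorphic_symplectic_form (M_charts z) (\<omega>M z) \<and>
           form_given_by (M_charts z) (\<omega>M z) id (M_W z) form_VW \<and>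
           form_given_by (M_charts z) (\<omega>M z) id (M_UV z) (form_VU z) \<and>
           M z = M_W z \<union> M_UV z \<and>
           holomorphic_symplectic_form (E_charts z) (\<omega>E z) \<and>
           form_given_by (E_charts z) (\<omega>E z) (E_M z) (M_W z) form_VW \<and>
           form_given_by (E_charts z) (\<omega>E z) (E_M z) (M_UV z) (form_VU z) \<and>
           form_given_by (E_charts z) (\<omega>E z) (E_xy z) UNIV (\<lambda>_. wedge 1 2)) \<and>
        hamiltonian_system PI_system (wedge 1 2) \<and>
        (\<exists>c. c \<noteq> 0 \<and>
           (\<forall>z. pullback_equals (M_charts z) (\<omega>M z) (invariants z) UNIV
                  (\<lambda>_ a b. c * wedge 1 2 a b)) \<and>
           (\<exists>Y. expressed_as painleve_coords {q. q $ 2 \<noteq> 0} UNIV PI_system Y \<and>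
              hamiltonian_system Y (\<lambda>a b. c * wedge 1 2 a b)))) \<and>
     (\<forall>\<Omega> f g F G.
        expressed_as painleve_coords {q. q $ 2 \<noteq> 0} \<Omega> (poly_system f g) (poly_system F G) \<longrightarrow>
        (\<forall>z\<in>\<Omega>. \<forall>x y. eval2 (f z) x y = 6 * y^2 + z \<and> eval2 (g z) x y = x))"
proof (intro conjI[OF _ conjI[OF _ conjI[OF _ conjI[OF _ conjI[OF _ conjI[OF _ conjI]]]]]])
  show "\<forall>z q. q $ 2 \<noteq> 0 \<longrightarrow> Z2_act z (Z2_act z q) = q \<and> painleve_coords z (Z2_act z q) = painleve_coords z q"
    by (intro allI impI conjI Z2_act_involution painleve_coords_Z2_act)
  show "\<forall>z q q'. q $ 2 \<noteq> 0 \<and> q' $ 2 \<noteq> 0 \<longrightarrow>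
      (painleve_coords z q = painleve_coords z q' \<longleftrightarrow> (q,q') \<in> Z2_rel z)"
    by (intro allI impI painleve_coords_eq_iff; elim conjE; assumption)
  show induced_from_orbifold by (rule induced_from_orbifold)
  show "\<forall>z. quotient_surface (Z2_rel z) (invariants z) (M z)" by (intro allI quotient_surface_M)
  show "\<forall>z. gluing z = gluing_inverse z \<and> equiv (UNIV <+> M z) (E_rel z) \<and>
        (\<forall>p. p $ 2 \<noteq> 0 \<longrightarrow> (\<exists>!q. (p,q) \<in> gluing z)) \<and>
        (\<forall>q\<in>M z. q $ 3 \<noteq> 0 \<longrightarrow> (\<exists>!p. (p,q) \<in> gluing z)) \<and>
        (\<forall>q. q $ 2 \<noteq> 0 \<longrightarrow> E_xy z (painleve_coords z q) = E_M z (invariants z q)) \<and>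
        topspace (E_top z) = E_set z"
  proof (intro allI conjI gluing_eq_gluing_inverse equiv_E_rel topspace_E_top ballI impI E_xy_painleve_coords)
    show "\<exists>!q. (p,q) \<in> gluing z" if "p $ 2 \<noteq> 0" for p z unfolding gluing_iff using that by simp
    show "\<exists>!p. (p,q) \<in> gluing z" if "q \<in> M z" "q $ 3 \<noteq> 0" for q z unfolding gluing_iff' using that by simp
  qed
  show "space_of_initial_conditions PI_system E_top E_charts P_top P_charts E_xy"
    by (rule space_of_initial_conditions_E)
  show "\<forall>\<Omega> f g F G. expressed_as painleve_coords {q. q $ 2 \<noteq> 0} \<Omega> (poly_system f g) (poly_system F G) \<longrightarrow>
        (\<forall>z\<in>\<Omega>. \<forall>x y. eval2 (f z) x y = 6 * y^2 + z \<and> eval2 (g z) x y = x)"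
    by (intro allI impI ballI) (rule regular_system_is_PI)
qed (intro exI[of _ M_form] exI[of _ E_form] exI[of _ "- 2"] exI[of _ painleve_system] conjI allI
    M_form E_form M_form_pullback hamiltonian_PI_system hamiltonian_painleve_system
    expressed_as_painleve_system M_eq_M_W_Un_M_UV, simp)

end
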